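(* Let $\mathfrak R$ be a nc rational function of $x_1,\dots,x_d$ over a field $\mathbb K$. Then for every $s\in\mathbb N$ and every $\underline Y=(Y_1,\dots,Y_d)\in dom_s(\mathfrak R)$ there exists a unique (up to unique similarity) minimal (observable and controllable) nc Fornasini--Marchesini realization $$\mathcal R(X_1,\dots,X_d)=D+C\Big(I_L-\sum_{k=1}^d\mathbf A_k(X_k-Y_k)\Big)^{-1}\sum_{k=1}^d\mathbf B_k(X_k-Y_k)$$ centred at $\underline Y$, such that (i) for every $m\in\mathbb N$ and $(X_1,\dots,X_d)\in dom_{sm}(\mathfrak R)$ one has $(X_1,\dots,X_d)\in DOM_{sm}(\mathcal R)$ and $$\mathfrak R(X_1,\dots,X_d)=I_m\otimes D+(I_m\otimes C)\Big(I_{Lm}-\sum_{k=1}^d(X_k-I_m\otimes Y_k)\mathbf A_k\Big)^{-1}\sum_{k=1}^d(X_k-I_m\otimes Y_k)\mathbf B_k .$$ Moreover, using the realization $\mathcal R$ one can evaluate $\mathfrak R$ on every matrix point in its domain of regularity as well as w.r.t. any unital stably finite $\mathbb K$-algebra: (ii) for every $n\in\mathbb N$ and $\underline Z\in dom_n(\mathfrak R)$: $I_s\otimes\underline Z\in DOM_{sn}(\mathcal R)$ and $I_s\otimes\mathfrak R(\underline Z)=\mathcal R(I_s\otimes\underline Z)$; (iii) for every unital stably finite $\mathbb K$-algebra $\mathcal A$ and $\underline{\mathfrak a}\in dom^{\mathcal A}(\mathfrak R)$: $I_s\otimes\underline{\mathfrak a}\in DOM^{\mathcal A}(\mathcal R)$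 and $I_s\otimes\mathfrak R^{\mathcal A}(\underline{\mathfrak a})=\mathcal R^{\mathcal A}(I_s\otimes\underline{\mathfrak a})$.
   Context: $\mathbb K$ is a field, $\mathbb N=\{1,2,\dots\}$, $d\in\mathbb N$; underlined letters denote tuples, and operations such as $I_s\otimes\underline Z=(I_s\otimes Z_1,\dots,I_s\otimes Z_d)$ act componentwise ($\otimes$ is the Kronecker product). NC rational expressions. A nc rational expression $R$ in $x_1,\dots,x_d$ over $\mathbb K$ is a formal expression obtained from nc polynomials in $\mathbb K\langle x_1,\dots,x_d\rangle$ by successive additions, multiplications and inversions. For a unital $\mathbb K$-algebra $\mathcal A$, its domain $dom^{\mathcal A}(R)\subseteq\mathcal A^d$ and evaluation $R^{\mathcal A}(\underline{\mathfrak a})\in\mathcal A$ are defined recursively: for a nc polynomial the domain is $\mathcal A^d$ and evaluation is substitution; for $R=R_1+R_2$ or $R=R_1R_2$ the domain is $dom^{\mathcal A}(R_1)\cap dom^{\mathcal A}(R_2)$ and the value is the sum, resp. product, of the values; for $R=R_1^{-1}$ the domain is $\{\underline{\mathfrak a}\in dom^{\mathcal A}(R_1): R_1^{\mathcal A}(\underline{\mathfrak a})\text{ invertible in }\mathcal A\}$ and $R^{\mathcal A}(\underline{\mathfrak a})=R_1^{\mathcal A}(\underline{\mathfrak a})^{-1}$. For $\mathcal A=\mathbb K^{n\times n}$ write $dom_n(R)$ and $R(\underline X)$; $dom(R)=\coprod_{n\ge1}dom_n(R)$; $R$ is non-degenerate if $dom(R)\neq\emptyset$. Two expressions $R_1,R_2$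 are $(\mathbb K^d)_{nc}$-evaluation equivalent if $R_1(\underline X)=R_2(\underline X)$ for all $\underline X\in dom(R_1)\cap dom(R_2)$. NC rational functions. A nc rational function $\mathfrak R$ is an equivalence class of non-degenerate nc rational expressions under $(\mathbb K^d)_{nc}$-evaluation equivalence. $dom_n(\mathfrak R)=\bigcup_{R\in\mathfrak R}dom_n(R)$, and $\mathfrak R(\underline X)=R(\underline X)$ for any $R\in\mathfrak R$ with $\underline X\in dom_n(R)$. Likewise $dom^{\mathcal A}(\mathfrak R)=\bigcup_{R\in\mathfrak R}dom^{\mathcal A}(R)$ and $\mathfrak R^{\mathcal A}(\underline{\mathfrak a})=R^{\mathcal A}(\underline{\mathfrak a})$ for any $R\in\mathfrak R$ with $\underline{\mathfrak a}\in dom^{\mathcal A}(R)$ (independent of the choice of $R$ when $\mathcal A$ is stably finite). A unital $\mathbb K$-algebra $\mathcal A$ is stably finite if for all $m\in\mathbb N$ and $\mathfrak A,\mathfrak B\in\mathcal A^{m\times m}$: $\mathfrak A\mathfrak B=I_m\otimes 1_{\mathcal A}$ iff $\mathfrak B\mathfrak A=I_m\otimes1_{\mathcal A}$. Realizations. Let $\underline Y\in(\mathbb K^{s\times s})^d$. A nc Fornasini--Marchesini realization $\mathcal R$ centred at $\underline Y$, described by $(L,D,C,\underline{\mathbf A},\underline{\mathbf B})$, consists of a dimension $L\in\mathbb N$, linear mappings $\mathbf A_1,\dots,\mathbf A_d:\mathbb K^{s\times s}\to\mathbb K^{L\times L}$, $\mathbf B_1,\dots,\mathbf B_d:\mathbb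 K^{s\times s}\to\mathbb K^{L\times s}$ and matrices $C\in\mathbb K^{s\times L}$, $D\in\mathbb K^{s\times s}$. A linear mapping $\mathbf T$ on $s\times s$ matrices is extended to $X=[X_{ij}]_{i,j=1}^m\in\mathbb K^{sm\times sm}$ ($X_{ij}\in\mathbb K^{s\times s}$) by $(X)\mathbf T=[\mathbf T(X_{ij})]_{i,j=1}^m$. Put $DOM_{sm}(\mathcal R)=\{\underline X\in(\mathbb K^{sm\times sm})^d:\det(I_{Lm}-\sum_k(X_k-I_m\otimes Y_k)\mathbf A_k)\ne0\}$ and for such $\underline X$ $$\mathcal R(\underline X)=I_m\otimes D+(I_m\otimes C)\Big(I_{Lm}-\sum_k(X_k-I_m\otimes Y_k)\mathbf A_k\Big)^{-1}\sum_k(X_k-I_m\otimes Y_k)\mathbf B_k.$$ For a unital $\mathbb K$-algebra $\mathcal A$, identify $\mathcal A^{p\times q}=\mathbb K^{p\times q}\otimes\mathcal A$ and extend $\mathbf T$ by $(\mathfrak A)\mathbf T^{\mathcal A}=\sum_{i,j}\mathbf T(E_{ij})\otimes\mathfrak a_{ij}$ for $\mathfrak A=\sum_{i,j} E_{ij}\otimes\mathfrak a_{ij}$ ($E_{ij}$ the matrix units). $DOM^{\mathcal A}(\mathcal R)$ is the set of $\underline{\mathfrak A}\in(\mathcal A^{s\times s})^d$ for which $I_L\otimes1_{\mathcal A}-\sum_k(\mathfrak A_k-Y_k\otimes1_{\mathcal A})\mathbf A_k^{\mathcal A}$ is invertible in $\mathcal A^{L\times L}$, and then $$\mathcal R^{\mathcal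 A}(\underline{\mathfrak A})=D\otimes1_{\mathcal A}+(C\otimes1_{\mathcal A})\Big(I_L\otimes1_{\mathcal A}-\sum_k(\mathfrak A_k-Y_k\otimes1_{\mathcal A})\mathbf A_k^{\mathcal A}\Big)^{-1}\sum_k(\mathfrak A_k-Y_k\otimes1_{\mathcal A})\mathbf B_k^{\mathcal A}.$$ Controllability, observability, minimality, similarity. The realization is controllable if the vectors $\mathbf A_{i_1}(X_1)\cdots\mathbf A_{i_\ell}(X_\ell)\mathbf B_k(X_{\ell+1})u$ ($\ell\ge0$, $1\le i_1,\dots,i_\ell,k\le d$, $X_j\in\mathbb K^{s\times s}$, $u\in\mathbb K^s$) span $\mathbb K^L$; observable if the only $v\in\mathbb K^L$ with $C\mathbf A_{i_1}(X_1)\cdots\mathbf A_{i_\ell}(X_\ell)v=0$ for all $\ell\ge0$, $1\le i_j\le d$, $X_j\in\mathbb K^{s\times s}$ is $v=0$. It is minimal if its dimension $L$ is the smallest among all nc Fornasini--Marchesini realizations centred at $\underline Y$ satisfying (i). Uniqueness up to unique similarity means: if $(L',D',C',\underline{\mathbf A}',\underline{\mathbf B}')$ describes another minimal (observable and controllable) realization centred at $\underline Y$ satisfying (i), then $L'=L$, $D'=D$ and there is a unique invertible $T\in\mathbb K^{L\times L}$ with $C'=CT^{-1}$, $\mathbf B_k'(X)=T\mathbf B_k(X)$ and $\mathbf A'_k(X)=T\mathbf A_k(X)T^{-1}$ for all $1\le k\le d$ and $X\in\mathbb K^{s\times s}$.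
   Formalization: The dimension L of a realization may be 0 (not only L ≥ 1): for a constant nc rational function no realization with L ≥ 1 is both controllable and observable, so the claim with L ≥ 1 fails there; for all other functions L ≥ 1 holds automatically. *)

theory Defs
  imports
    "HOL-Library.Poly_Mapping"
    "Jordan_Normal_Form.Matrix"
    "Jordan_Normal_Form.Determinant"
    "Jordan_Normal_Form.VS_Connect"
begin

text \<open>Conventions. The \<open>d\<close> variables are indexed by a finite (nonempty) type \<open>'d\<close>, so a
  \<open>d\<close>-tuple is a function on \<open>'d\<close>. All matrices are indexed from \<open>0\<close>.
  The sort \<open>{ring, monoid_mult}\<close> describes unital rings in which \<open>0 = 1\<close> is permitted, so
  the zero algebra is included.\<close>

section \<open>Unital algebras over a field\<close>

locale unital_algebra = vector_space sc
  for sc :: "'k::field \<Rightarrow> 'a::{ring,monoid_mult} \<Rightarrow> 'a" +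
  assumes sc_mult_left: "sc c (a * b) = sc c a * b"
    and sc_mult_right: "sc c (a * b) = a * sc c b"

definition stably_finite :: "'a::{ring,monoid_mult} itself \<Rightarrow> bool" where
  "stably_finite _ \<longleftrightarrow> (\<forall>m\<ge>1. \<forall>M \<in> carrier_mat m m. \<forall>N \<in> carrier_mat m m.
     M * N = (1\<^sub>m m :: 'a mat) \<longleftrightarrow> N * M = 1\<^sub>m m)"

text \<open>Expressions are evaluated in algebras given as records with explicit carrier, so that
  an algebra \<open>'a\<close> and all the matrix algebras over it are treated uniformly.
  In particular \<open>mat_alg (*) n\<close> is the algebra of \<open>n \<times> n\<close> matrices over the ground field.\<close>

definition type_alg :: "('k \<Rightarrow> 'a \<Rightarrow> 'a) \<Rightarrow> ('k, 'a::{ring,monoid_mult}) module" where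
  "type_alg sc = \<lparr>carrier = UNIV, mult = (*), one = 1, zero = 0, add = (+), smult = sc\<rparr>"

definition mat_alg :: "('k \<Rightarrow> 'a \<Rightarrow> 'a) \<Rightarrow> nat \<Rightarrow> ('k, 'a::{ring,monoid_mult} mat) module" where
  "mat_alg sc n = \<lparr>carrier = carrier_mat n n, mult = (*), one = 1\<^sub>m n, zero = 0\<^sub>m n n,
     add = (+), smult = (\<lambda>c. map_mat (sc c))\<rparr>"

section \<open>Noncommutative rational expressions and functions\<close>

text \<open>A nc polynomial is a finitely supported family of coefficients indexed by words.\<close>

type_synonym ('d, 'k) nc_poly = "'d list \<Rightarrow>\<^sub>0 'k"

datatype 'p rat_expr =
    Poly 'p
  | Plus "'p rat_expr" "'p rat_expr"
  | Times "'p rat_expr" "'p rat_expr"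
  | Inv "'p rat_expr"

type_synonym ('d, 'k) nc_expr = "('d, 'k) nc_poly rat_expr"

definition poly_val :: "('k::zero, 'a) module \<Rightarrow> ('d, 'k) nc_poly \<Rightarrow> ('d \<Rightarrow> 'a) \<Rightarrow> 'a" where
  "poly_val A p a = (\<Oplus>\<^bsub>A\<^esub>w \<in> Poly_Mapping.keys p.
     Poly_Mapping.lookup p w \<odot>\<^bsub>A\<^esub> foldr (\<lambda>i b. a i \<otimes>\<^bsub>A\<^esub> b) w \<one>\<^bsub>A\<^esub>)"

primrec nc_val :: "('k::zero, 'a) module \<Rightarrow> ('d, 'k) nc_expr \<Rightarrow> ('d \<Rightarrow> 'a) \<Rightarrow> 'a" where
  "nc_val A (Poly p) a = poly_val A p a"
| "nc_val A (Plus R S) a = nc_val A R a \<oplus>\<^bsub>A\<^esub> nc_val A S a"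
| "nc_val A (Times R S) a = nc_val A R a \<otimes>\<^bsub>A\<^esub> nc_val A S a"
| "nc_val A (Inv R) a = inv\<^bsub>A\<^esub> (nc_val A R a)"

primrec nc_dom :: "('k::zero, 'a) module \<Rightarrow> ('d, 'k) nc_expr \<Rightarrow> ('d \<Rightarrow> 'a) set" where
  "nc_dom A (Poly p) = {a. \<forall>k. a k \<in> carrier A}"
| "nc_dom A (Plus R S) = nc_dom A R \<inter> nc_dom A S"
| "nc_dom A (Times R S) = nc_dom A R \<inter> nc_dom A S"
| "nc_dom A (Inv R) = {a \<in> nc_dom A R. nc_val A R a \<in> Units A}"

definition nondegenerate :: "('d, 'k::field) nc_expr \<Rightarrow> bool" where
  "nondegenerate R \<longleftrightarrow> (\<exists>n\<ge>1. nc_dom (mat_alg (*) n) R \<noteq> {})"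

definition nc_equiv :: "('d, 'k::field) nc_expr rel" where
  "nc_equiv = {(R, S). nondegenerate R \<and> nondegenerate S \<and>
     (\<forall>n\<ge>1. \<forall>X \<in> nc_dom (mat_alg (*) n) R \<inter> nc_dom (mat_alg (*) n) S.
        nc_val (mat_alg (*) n) R X = nc_val (mat_alg (*) n) S X)}"

definition nc_rational_functions :: "('d, 'k::field) nc_expr set set" where
  "nc_rational_functions = {R. nondegenerate R} // nc_equiv"

definition fun_dom :: "('k::zero, 'a) module \<Rightarrow> ('d, 'k) nc_expr set \<Rightarrow> ('d \<Rightarrow> 'a) set" where
  "fun_dom A F = (\<Union>R \<in> F. nc_dom A R)"

definition fun_val :: "('k::zero, 'a) module \<Rightarrow> ('d, 'k) nc_expr set \<Rightarrow> ('d \<Rightarrow> 'a) \<Rightarrow> 'a" where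
  "fun_val A F a = (THE v. \<exists>R \<in> F. a \<in> nc_dom A R \<and> v = nc_val A R a)"

section \<open>Kronecker products, sums and extensions of linear mappings\<close>

definition kron :: "'k::times mat \<Rightarrow> 'k mat \<Rightarrow> 'k mat" where
  "kron M N = mat (dim_row M * dim_row N) (dim_col M * dim_col N)
     (\<lambda>(i, j). M $$ (i div dim_row N, j div dim_col N) * N $$ (i mod dim_row N, j mod dim_col N))"

text \<open>\<open>tensor_elem sc M a\<close> is \<open>M \<otimes> a\<close> for a matrix \<open>M\<close> over the ground field and an element
  \<open>a\<close> of the algebra.\<close>

definition tensor_elem :: "('k \<Rightarrow> 'a \<Rightarrow> 'a) \<Rightarrow> 'k mat \<Rightarrow> 'a \<Rightarrow> 'a mat" where
  "tensor_elem sc M a = map_mat (\<lambda>c. sc c a) M"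

text \<open>Matrices of all sizes share one type, so a sum of matrices needs an explicit size.\<close>

definition mat_sum :: "nat \<Rightarrow> nat \<Rightarrow> ('d::finite \<Rightarrow> 'a::comm_monoid_add mat) \<Rightarrow> 'a mat" where
  "mat_sum p q M = mat p q (\<lambda>ij. \<Sum>k\<in>UNIV. M k $$ ij)"

definition linear_mat_map :: "nat \<Rightarrow> nat \<Rightarrow> nat \<Rightarrow> ('k::field mat \<Rightarrow> 'k mat) \<Rightarrow> bool" where
  "linear_mat_map s p q T \<longleftrightarrow>
     (\<forall>X \<in> carrier_mat s s. T X \<in> carrier_mat p q) \<and>
     (\<forall>X \<in> carrier_mat s s. \<forall>Y \<in> carrier_mat s s. T (X + Y) = T X + T Y) \<and>
     (\<forall>c. \<forall>X \<in> carrier_mat s s. T (c \<cdot>\<^sub>m X) = c \<cdot>\<^sub>m T X)"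

definition block :: "nat \<Rightarrow> 'k mat \<Rightarrow> nat \<Rightarrow> nat \<Rightarrow> 'k mat" where
  "block s X i j = mat s s (\<lambda>(a, b). X $$ (i * s + a, j * s + b))"

definition ext_map :: "nat \<Rightarrow> nat \<Rightarrow> nat \<Rightarrow> ('k mat \<Rightarrow> 'k mat) \<Rightarrow> nat \<Rightarrow> 'k mat \<Rightarrow> 'k mat" where
  "ext_map s p q T m X = mat (m * p) (m * q)
     (\<lambda>(i, j). T (block s X (i div p) (j div q)) $$ (i mod p, j mod q))"

definition unit_mat :: "nat \<Rightarrow> nat \<Rightarrow> nat \<Rightarrow> 'k::{zero,one} mat" where
  "unit_mat s i j = mat s s (\<lambda>(a, b). if a = i \<and> b = j then 1 else 0)"

text \<open>The extension to matrices \<open>\<Sum>i j. E\<^sub>i\<^sub>j \<otimes> a\<^sub>i\<^sub>j\<close> over an algebra, i.e.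
  \<open>\<Sum>i j. T E\<^sub>i\<^sub>j \<otimes> a\<^sub>i\<^sub>j\<close>, written entrywise.\<close>

definition ext_map_alg ::
  "('k \<Rightarrow> 'a \<Rightarrow> 'a) \<Rightarrow> nat \<Rightarrow> nat \<Rightarrow> nat \<Rightarrow> ('k::{zero,one} mat \<Rightarrow> 'k mat) \<Rightarrow>
     'a::comm_monoid_add mat \<Rightarrow> 'a mat" where
  "ext_map_alg sc s p q T X = mat p q
     (\<lambda>rc. \<Sum>i<s. \<Sum>j<s. tensor_elem sc (T (unit_mat s i j)) (X $$ (i, j)) $$ rc)"

section \<open>Fornasini--Marchesini realizations\<close>

text \<open>The mappings \<open>mapA k\<close> and \<open>mapB k\<close> are only relevant on \<open>s \<times> s\<close> matrices. The dimension \<open>0\<close>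
  is permitted: it is the minimal dimension for a constant function, for which no
  realization of positive dimension is controllable and observable.\<close>

record ('d, 'k) realization =
  fm_dim :: nat
  matD :: "'k mat"
  matC :: "'k mat"
  mapA :: "'d \<Rightarrow> 'k mat \<Rightarrow> 'k mat"
  mapB :: "'d \<Rightarrow> 'k mat \<Rightarrow> 'k mat"

definition fm_realization :: "nat \<Rightarrow> ('d, 'k::field) realization \<Rightarrow> bool" where
  "fm_realization s R \<longleftrightarrow>
     matD R \<in> carrier_mat s s \<and> matC R \<in> carrier_mat s (fm_dim R) \<and>
     (\<forall>k. linear_mat_map s (fm_dim R) (fm_dim R) (mapA R k)) \<and>
     (\<forall>k. linear_mat_map s (fm_dim R) s (mapB R k))"

definition pencil ::
  "nat \<Rightarrow> ('d::finite \<Rightarrow> 'k::field mat) \<Rightarrow> ('d, 'k) realization \<Rightarrow> nat \<Rightarrow> ('d \<Rightarrow> 'k mat) \<Rightarrow> 'k mat" where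
  "pencil s Y R m X = 1\<^sub>m (fm_dim R * m) - mat_sum (fm_dim R * m) (fm_dim R * m)
     (\<lambda>k. ext_map s (fm_dim R) (fm_dim R) (mapA R k) m (X k - kron (1\<^sub>m m) (Y k)))"

definition real_dom ::
  "nat \<Rightarrow> ('d::finite \<Rightarrow> 'k::field mat) \<Rightarrow> ('d, 'k) realization \<Rightarrow> nat \<Rightarrow> ('d \<Rightarrow> 'k mat) set" where
  "real_dom s Y R m =
     {X. (\<forall>k. X k \<in> carrier_mat (s * m) (s * m)) \<and> det (pencil s Y R m X) \<noteq> 0}"

definition real_val ::
  "nat \<Rightarrow> ('d::finite \<Rightarrow> 'k::field mat) \<Rightarrow> ('d, 'k) realization \<Rightarrow> nat \<Rightarrow> ('d \<Rightarrow> 'k mat) \<Rightarrow> 'k mat" where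
  "real_val s Y R m X = kron (1\<^sub>m m) (matD R) +
     kron (1\<^sub>m m) (matC R) * inv\<^bsub>mat_alg (*) (fm_dim R * m)\<^esub> (pencil s Y R m X) *
     mat_sum (fm_dim R * m) (s * m)
       (\<lambda>k. ext_map s (fm_dim R) s (mapB R k) m (X k - kron (1\<^sub>m m) (Y k)))"

definition pencil_alg ::
  "('k \<Rightarrow> 'a \<Rightarrow> 'a) \<Rightarrow> nat \<Rightarrow> ('d::finite \<Rightarrow> 'k::field mat) \<Rightarrow> ('d, 'k) realization \<Rightarrow>
     ('d \<Rightarrow> 'a::{ring,monoid_mult} mat) \<Rightarrow> 'a mat" where
  "pencil_alg sc s Y R X = tensor_elem sc (1\<^sub>m (fm_dim R)) 1 - mat_sum (fm_dim R) (fm_dim R)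
     (\<lambda>k. ext_map_alg sc s (fm_dim R) (fm_dim R) (mapA R k) (X k - tensor_elem sc (Y k) 1))"

definition real_dom_alg ::
  "('k \<Rightarrow> 'a \<Rightarrow> 'a) \<Rightarrow> nat \<Rightarrow> ('d::finite \<Rightarrow> 'k::field mat) \<Rightarrow> ('d, 'k) realization \<Rightarrow>
     ('d \<Rightarrow> 'a::{ring,monoid_mult} mat) set" where
  "real_dom_alg sc s Y R =
     {X. (\<forall>k. X k \<in> carrier_mat s s) \<and> pencil_alg sc s Y R X \<in> Units (mat_alg sc (fm_dim R))}"

definition real_val_alg ::
  "('k \<Rightarrow> 'a \<Rightarrow> 'a) \<Rightarrow> nat \<Rightarrow> ('d::finite \<Rightarrow> 'k::field mat) \<Rightarrow> ('d, 'k) realization \<Rightarrow>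
     ('d \<Rightarrow> 'a::{ring,monoid_mult} mat) \<Rightarrow> 'a mat" where
  "real_val_alg sc s Y R X = tensor_elem sc (matD R) 1 +
     tensor_elem sc (matC R) 1 * inv\<^bsub>mat_alg sc (fm_dim R)\<^esub> (pencil_alg sc s Y R X) *
     mat_sum (fm_dim R) s
       (\<lambda>k. ext_map_alg sc s (fm_dim R) s (mapB R k) (X k - tensor_elem sc (Y k) 1))"

section \<open>Controllability, observability, minimality, similarity\<close>

text \<open>The products \<open>A\<^sub>i\<^sub>1(X\<^sub>1) \<cdots> A\<^sub>i\<^sub>l(X\<^sub>l)\<close>, including the empty one.\<close>

definition A_word :: "('d, 'k::field) realization \<Rightarrow> ('d \<times> 'k mat) list \<Rightarrow> 'k mat" where
  "A_word R w = foldr (\<lambda>(i, X) M. mapA R i X * M) w (1\<^sub>m (fm_dim R))"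

definition words :: "nat \<Rightarrow> ('d \<times> 'k mat) list set" where
  "words s = lists (UNIV \<times> carrier_mat s s)"

definition controllable :: "nat \<Rightarrow> ('d, 'k::field) realization \<Rightarrow> bool" where
  "controllable s R \<longleftrightarrow>
     LinearCombinations.module.span class_ring (module_vec TYPE('k) (fm_dim R))
       {A_word R w * mapB R k X *\<^sub>v u | w k X u.
          w \<in> words s \<and> X \<in> carrier_mat s s \<and> u \<in> carrier_vec s} = carrier_vec (fm_dim R)"

definition observable :: "nat \<Rightarrow> ('d, 'k::field) realization \<Rightarrow> bool" where
  "observable s R \<longleftrightarrow> (\<forall>v \<in> carrier_vec (fm_dim R).
     (\<forall>w \<in> words s. matC R * A_word R w *\<^sub>v v = 0\<^sub>v s) \<longrightarrow> v = 0\<^sub>v (fm_dim R))"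

definition realizes ::
  "nat \<Rightarrow> ('d::finite \<Rightarrow> 'k::field mat) \<Rightarrow> ('d, 'k) nc_expr set \<Rightarrow> ('d, 'k) realization \<Rightarrow> bool" where
  "realizes s Y F R \<longleftrightarrow> (\<forall>m\<ge>1. \<forall>X \<in> fun_dom (mat_alg (*) (s * m)) F.
     X \<in> real_dom s Y R m \<and> fun_val (mat_alg (*) (s * m)) F X = real_val s Y R m X)"

definition minimal_for ::
  "nat \<Rightarrow> ('d::finite \<Rightarrow> 'k::field mat) \<Rightarrow> ('d, 'k) nc_expr set \<Rightarrow> ('d, 'k) realization \<Rightarrow> bool" where
  "minimal_for s Y F R \<longleftrightarrow>
     (\<forall>R'. fm_realization s R' \<and> realizes s Y F R' \<longrightarrow> fm_dim R \<le> fm_dim R')"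

definition minimal_realization ::
  "nat \<Rightarrow> ('d::finite \<Rightarrow> 'k::field mat) \<Rightarrow> ('d, 'k) nc_expr set \<Rightarrow> ('d, 'k) realization \<Rightarrow> bool" where
  "minimal_realization s Y F R \<longleftrightarrow> fm_realization s R \<and> realizes s Y F R \<and> minimal_for s Y F R \<and>
     observable s R \<and> controllable s R"

definition similarity ::
  "nat \<Rightarrow> ('d, 'k::field) realization \<Rightarrow> ('d, 'k) realization \<Rightarrow> 'k mat \<Rightarrow> bool" where
  "similarity s R R' T \<longleftrightarrow> T \<in> Units (mat_alg (*) (fm_dim R)) \<and>
     matC R' = matC R * inv\<^bsub>mat_alg (*) (fm_dim R)\<^esub> T \<and>
     (\<forall>k. \<forall>X \<in> carrier_mat s s. mapB R' k X = T * mapB R k X \<and>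
        mapA R' k X = T * mapA R k X * inv\<^bsub>mat_alg (*) (fm_dim R)\<^esub> T)"

end

theory Submission
  imports Defs
begin

text \<open>A state-space system for an expression is built by recursion, and its controllable and observable
  part is the realization sought. The moments \<open>C A\<^sup>w B\<close> of a realization are read off from its values at
  nilpotent perturbations of its centre, so that they are determined by the function.

  To evaluate another expression \<open>E\<close> of the same function over an algebra, at a point \<open>X\<close>, choose a common
  point \<open>W\<close> of the domains of the expressions involved. Translation to the centre \<open>W\<close> keeps a realization
  controllable and observable, and the translate has the same moments as a system for \<open>E\<close> centred at \<open>W\<close>.
  Hence it is a subquotient of that system. The pencil of the subquotient has a one-sided inverse
  wherever the pencil of the system for \<open>E\<close> is invertible, and stable finiteness makes it two-sided.
  This gives the value at \<open>I \<otimes> X\<close>, hence at \<open>X\<close>.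

  Matrices of all sizes over an algebra are embedded, as periodic matrices, into one ring of matrices with
  finite rows and columns, so that the calculus of systems takes place in a single ring.\<close>

section \<open>Row- and column-finite matrices\<close>

text \<open>The obstacle is the centre. A system for \<open>E\<close> can be built only at a point
  where \<open>E\<close> is defined, and \<open>Y\<close> need not be one: it belongs to the domain
  of some other expression \<open>S\<close> of the function. Hence the detour through
  \<open>W\<close>, where \<open>S\<close>, \<open>E\<close> and the representative
  \<open>R0\<close> of the class are all defined; \<open>R0\<close> takes part because the
  equivalence relates \<open>S\<close> and \<open>E\<close> to \<open>R0\<close>, and their values
  can be equated only where \<open>R0\<close> has one too. Since \<open>W\<close> may have to be
  larger than \<open>Y\<close>, everything is set up for centres of size \<open>s m\<close> and
  points of size \<open>s m l\<close>, and a point of the wrong size is first replaced by I_m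
  \<otimes> X. The subquotient involves two steps with opposite defects: restriction of a pencil to
  an invariant subspace keeps a left inverse, passage to a quotient keeps a right inverse. Stable
  finiteness repairs each. A field is stably finite, so matrix points and points of an algebra obey
  one argument. Uniqueness uses the same comparison: between two minimal systems of equal dimension
  both maps are square, hence invertible.\<close>

typedef (overloaded) ('i, 'a::zero) rcf =
  "{f :: 'i \<Rightarrow> 'i \<Rightarrow> 'a. (\<forall>i. finite {j. f i j \<noteq> 0}) \<and> (\<forall>j. finite {i. f i j \<noteq> 0})}"
  morphisms ent Mk
  by (rule exI[of _ "\<lambda>i j. 0"]) auto

lemma finite_row: "finite {j. ent M i j \<noteq> 0}"
  using ent[of M] by auto

lemma finite_col: "finite {i. ent M i j \<noteq> 0}"
  using ent[of M] by auto

lemma ent_Mk: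
  assumes "\<And>i. finite {j. f i j \<noteq> 0}" and "\<And>j. finite {i. f i j \<noteq> 0}"
  shows "ent (Mk f) = f"
  using assms by (auto intro!: Mk_inverse)

lemma rcf_eqI: "(\<And>i j. ent M i j = ent N i j) \<Longrightarrow> M = N"
  by (metis ent_inject ext)

instantiation rcf :: (type, ab_group_add) ab_group_add
begin

definition "0 = Mk (\<lambda>i j. 0)"
definition "M + N = Mk (\<lambda>i j. ent M i j + ent N i j)"
definition "- M = Mk (\<lambda>i j. - ent M i j)"
definition "M - N = Mk (\<lambda>i j. ent M i j - ent N i j)" for M N :: "('a, 'b) rcf"

lemma ent_zero [simp]: "ent 0 i j = (0::'b)"
  by (simp add: zero_rcf_def ent_Mk)

lemma ent_plus [simp]: "ent (M + N) i j = ent M i j + (ent N i j :: 'b)"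
proof -
  have "finite {j. ent M i j + ent N i j \<noteq> 0}" for i
    by (rule finite_subset[of _ "{j. ent M i j \<noteq> 0} \<union> {j. ent N i j \<noteq> 0}"]) (auto simp: finite_row)
  moreover have "finite {i. ent M i j + ent N i j \<noteq> 0}" for j
    by (rule finite_subset[of _ "{i. ent M i j \<noteq> 0} \<union> {i. ent N i j \<noteq> 0}"]) (auto simp: finite_col)
  ultimately show ?thesis unfolding plus_rcf_def by (simp add: ent_Mk)
qed

lemma ent_uminus [simp]: "ent (- M) i j = - (ent M i j :: 'b)"
  unfolding uminus_rcf_def by (subst ent_Mk) (auto simp: finite_row finite_col)

lemma ent_minus [simp]: "ent (M - N) i j = ent M i j - (ent N i j :: 'b)"
proof -
  have "finite {j. ent M i j \<noteq> ent N i j}" for i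
    by (rule finite_subset[of _ "{j. ent M i j \<noteq> 0} \<union> {j. ent N i j \<noteq> 0}"]) (auto simp: finite_row)
  moreover have "finite {i. ent M i j \<noteq> ent N i j}" for j
    by (rule finite_subset[of _ "{i. ent M i j \<noteq> 0} \<union> {i. ent N i j \<noteq> 0}"]) (auto simp: finite_col)
  ultimately show ?thesis unfolding minus_rcf_def by (simp add: ent_Mk)
qed

instance by standard (auto intro!: rcf_eqI)

end

instantiation rcf :: (type, ring) ring
begin

definition "M * N = Mk (\<lambda>i k. \<Sum>j\<in>{j. ent M i j \<noteq> 0}. ent M i j * ent N j k)"

text \<open>Any finite \<open>J\<close> that covers the nonzero products will do; later proofs
  choose the support of a row, that of a column, or a single index.\<close>

lemma ent_times:
  assumes J: "finite J" "{j. ent M i j \<noteq> 0 \<and> ent N j k \<noteq> 0} \<subseteq> J"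
  shows "ent (M * N) i k = (\<Sum>j\<in>J. ent M i j * (ent N j k :: 'b))"
proof -
  define f where "f = (\<lambda>i k. \<Sum>j\<in>{j. ent M i j \<noteq> 0}. ent M i j * ent N j k)"
  have f0: "\<exists>j. ent M i j \<noteq> 0 \<and> ent N j k \<noteq> 0" if "f i k \<noteq> 0" for i k
    using that unfolding f_def by (auto elim!: sum.not_neutral_contains_not_neutral)
  have "finite {k. f i k \<noteq> 0}" for i
    by (rule finite_subset[where B = "\<Union>j\<in>{j. ent M i j \<noteq> 0}. {k. ent N j k \<noteq> 0}"])
      (use f0 in \<open>auto simp: finite_row\<close>)
  moreover have "finite {i. f i k \<noteq> 0}" for k
    by (rule finite_subset[where B = "\<Union>j\<in>{j. ent N j k \<noteq> 0}. {i. ent M i j \<noteq> 0}"])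
      (use f0 in \<open>auto simp: finite_col\<close>)
  ultimately have "ent (M * N) i k = f i k"
    unfolding times_rcf_def f_def[symmetric] by (simp add: ent_Mk)
  also have "\<dots> = (\<Sum>j\<in>J. ent M i j * ent N j k)"
    unfolding f_def by (rule sum.mono_neutral_cong) (use J finite_row in auto)
  finally show ?thesis .
qed

instance
proof
  fix M N K :: "('a, 'b) rcf"
  show "M * N * K = M * (N * K)"
  proof (rule rcf_eqI)
    fix i l
    let ?J = "{j. ent M i j \<noteq> 0}" and ?K = "{k. ent K k l \<noteq> 0}"
    have "ent (M * N * K) i l = (\<Sum>k\<in>?K. ent (M * N) i k * ent K k l)"
      by (rule ent_times) (auto simp: finite_col)
    also have "\<dots> = (\<Sum>k\<in>?K. (\<Sum>j\<in>?J. ent M i j * ent N j k) * ent K k l)"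
      by (intro sum.cong refl arg_cong2[where f = "(*)"] ent_times) (auto simp: finite_row)
    also have "\<dots> = (\<Sum>j\<in>?J. ent M i j * (\<Sum>k\<in>?K. ent N j k * ent K k l))"
      by (simp add: sum_distrib_left sum_distrib_right mult.assoc) (rule sum.swap)
    also have "\<dots> = (\<Sum>j\<in>?J. ent M i j * ent (N * K) j l)"
      by (intro sum.cong refl arg_cong2[where f = "(*)"] ent_times[symmetric])
        (auto simp: finite_col)
    also have "\<dots> = ent (M * (N * K)) i l"
      by (rule ent_times[symmetric]) (auto simp: finite_row)
    finally show "ent (M * N * K) i l = ent (M * (N * K)) i l" .
  qed
  show "(M + N) * K = M * K + N * K"
  proof (rule rcf_eqI)
    fix i l
    let ?K = "{k. ent K k l \<noteq> 0}"
    show "ent ((M + N) * K) i l = ent (M * K + N * K) i l"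
      by (simp add: ent_times[of ?K] finite_col subset_iff distrib_right sum.distrib)
  qed
  show "M * (N + K) = M * N + M * K"
  proof (rule rcf_eqI)
    fix i l
    let ?K = "{k. ent M i k \<noteq> 0}"
    show "ent (M * (N + K)) i l = ent (M * N + M * K) i l"
      by (simp add: ent_times[of ?K] finite_row subset_iff distrib_left sum.distrib)
  qed
qed

end

lemma ent_times_row: "ent (M * N) i k = (\<Sum>j\<in>{j. ent M i j \<noteq> 0}. ent M i j * ent N j k)"
  by (rule ent_times) (auto simp: finite_row)

lemma ent_times_col: "ent (M * N) i k = (\<Sum>j\<in>{j. ent N j k \<noteq> 0}. ent M i j * ent N j k)"
  by (rule ent_times) (auto simp: finite_col)

lemma ent_sum: "ent (sum f A) i j = (\<Sum>x\<in>A. ent (f x) i j)"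
  by (induct A rule: infinite_finite_induct) auto

text \<open>The unit of the corner of matrices supported on \<open>S\<close>. A matrix of a given
  size is an element fixed by two such idempotents, so sizes appear as equations inside one
  ring.\<close>

definition idm :: "'i set \<Rightarrow> ('i, 'a::{ring,monoid_mult}) rcf" where
  "idm S = Mk (\<lambda>i j. if i = j \<and> i \<in> S then 1 else 0)"

definition unt :: "'a::ring \<Rightarrow> 'i \<Rightarrow> 'i \<Rightarrow> ('i, 'a) rcf" where
  "unt c i j = Mk (\<lambda>a b. if a = i \<and> b = j then c else 0)"

lemma ent_idm: "ent (idm S) i j = (if i = j \<and> i \<in> S then 1 else 0)"
  unfolding idm_def
  by (subst ent_Mk) (auto intro: finite_subset[of _ "{i}" for i])

lemma ent_unt: "ent (unt c i j) a b = (if a = i \<and> b = j then c else 0)"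
  unfolding unt_def
  by (subst ent_Mk) (auto intro: finite_subset[of _ "{i}" for i])

lemma ent_idm_times: "ent (idm S * M) i j = (if i \<in> S then ent M i j else 0)"
  by (subst ent_times[of "{i}"]) (auto simp: ent_idm)

lemma ent_times_idm: "ent (M * idm S) i j = (if j \<in> S then ent M i j else 0)"
  by (subst ent_times[of "{j}"]) (auto simp: ent_idm)

lemma ent_unt_times: "ent (unt c i j * M) a b = (if a = i then c * ent M j b else 0)"
  by (subst ent_times[of "{j}"]) (auto simp: ent_unt)

lemma ent_times_unt: "ent (M * unt c i j) a b = (if b = j then ent M a i * c else 0)"
  by (subst ent_times[of "{i}"]) (auto simp: ent_unt)

instantiation rcf :: (type, "{ring,monoid_mult}") monoid_mult
begin

definition "1 = (idm UNIV :: ('a, 'b) rcf)"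

instance by standard (auto intro!: rcf_eqI simp: one_rcf_def ent_idm_times ent_times_idm mult.assoc)

end

lemma ent_one: "ent 1 i j = (if i = j then 1 else 0)"
  by (simp add: one_rcf_def ent_idm)

lemma idm_times_idm: "idm S * idm T = (idm (S \<inter> T) :: ('i, 'a::{ring,monoid_mult}) rcf)"
  by (auto intro!: rcf_eqI simp: ent_idm_times ent_idm)

lemma unt_times_unt: "unt c i j * unt d k l = (if j = k then unt (c * d) i l else 0)"
  by (auto intro!: rcf_eqI simp: ent_unt_times ent_unt)

lemma idm_times_unt: "idm S * unt c i j = (if i \<in> S then unt c i j else 0)"
  by (auto intro!: rcf_eqI simp: ent_idm_times ent_unt)

lemma unt_times_idm: "unt c i j * idm S = (if j \<in> S then unt c i j else 0)"
  by (auto intro!: rcf_eqI simp: ent_times_idm ent_unt)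

lemma sum_unt_idm: "finite S \<Longrightarrow> (\<Sum>i\<in>S. unt 1 i i) = idm S"
  by (rule rcf_eqI) (auto simp: ent_sum ent_unt ent_idm intro!: sum.neutral)

text \<open>Right multiplication by \<open>unt 1 i k\<close> isolates column \<open>i\<close> and
  moves it to \<open>k\<close>: vectors become ring elements, and equalities of matrices are checked
  column by column.\<close>

lemma cols_zero_imp_zero:
  fixes M :: "('i, 'a::{ring,monoid_mult}) rcf"
  assumes "\<And>i. M * unt 1 i k = 0" shows "M = 0"
proof (rule rcf_eqI)
  fix a b show "ent M a b = ent 0 a b"
    using arg_cong[OF assms[of b], of "\<lambda>M. ent M a k"] by (simp add: ent_times_unt)
qed

lemma cols_eqI:
  fixes M N :: "('i, 'a::{ring,monoid_mult}) rcf"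
  assumes "\<And>i. M * unt 1 i k = N * unt 1 i k" shows "M = N"
  using cols_zero_imp_zero[of "M - N" k] assms by (simp add: left_diff_distrib)

section \<open>Matrices of finite support\<close>

definition fins :: "('i, 'a::zero) rcf \<Rightarrow> bool" where
  "fins M \<longleftrightarrow> finite {(i, j). ent M i j \<noteq> 0}"

lemma fins_zero [simp]: "fins (0 :: ('i, 'a::ab_group_add) rcf)"
  by (simp add: fins_def)

lemma fins_plus: "fins M \<Longrightarrow> fins N \<Longrightarrow> fins (M + N :: ('i, 'a::ab_group_add) rcf)"
  unfolding fins_def
  by (rule finite_subset[of _ "{(i, j). ent M i j \<noteq> 0} \<union> {(i, j). ent N i j \<noteq> 0}"]) auto

lemma fins_uminus: "fins M \<Longrightarrow> fins (- M :: ('i, 'a::ab_group_add) rcf)"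
  by (simp add: fins_def)

lemma fins_minus: "fins M \<Longrightarrow> fins N \<Longrightarrow> fins (M - N :: ('i, 'a::ab_group_add) rcf)"
  using fins_plus[of M "- N"] fins_uminus[of N] by simp

lemma ent_times_nonzeroD:
  fixes M :: "('i, 'a::ring) rcf"
  assumes "ent (M * N) i k \<noteq> 0" obtains j where "ent M i j \<noteq> 0" "ent N j k \<noteq> 0"
proof -
  obtain j where "ent M i j * ent N j k \<noteq> 0"
    using assms unfolding ent_times_row by (auto elim!: sum.not_neutral_contains_not_neutral)
  then show thesis by (intro that[of j]) auto
qed

lemma fins_times_left:
  fixes M :: "('i, 'a::ring) rcf" assumes "fins M" shows "fins (M * N)"
  unfolding fins_def
proof (rule finite_subset)
  let ?U = "{(i, j). ent M i j \<noteq> 0}"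
  show "{(i, k). ent (M * N) i k \<noteq> 0} \<subseteq> (\<Union>(i, j)\<in>?U. {i} \<times> {k. ent N j k \<noteq> 0})"
    by (auto elim: ent_times_nonzeroD)
  show "finite (\<Union>(i, j)\<in>?U. {i} \<times> {k. ent N j k \<noteq> 0})"
    using assms by (auto simp: fins_def finite_row)
qed

lemma fins_times_right:
  fixes M :: "('i, 'a::ring) rcf" assumes "fins N" shows "fins (M * N)"
  unfolding fins_def
proof (rule finite_subset)
  let ?U = "{(i, j). ent N i j \<noteq> 0}"
  show "{(i, k). ent (M * N) i k \<noteq> 0} \<subseteq> (\<Union>(j, k)\<in>?U. {i. ent M i j \<noteq> 0} \<times> {k})"
    by (auto elim!: ent_times_nonzeroD)
  show "finite (\<Union>(j, k)\<in>?U. {i. ent M i j \<noteq> 0} \<times> {k})"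
    using assms by (auto simp: fins_def finite_col)
qed

lemma fins_unt [simp]: "fins (unt c i j)"
  unfolding fins_def by (rule finite_subset[of _ "{(i, j)}"]) (auto simp: ent_unt split: if_splits)

lemma fins_idm: "finite S \<Longrightarrow> fins (idm S)"
  unfolding fins_def by (rule finite_subset[of _ "(\<lambda>i. (i, i)) ` S"]) (auto simp: ent_idm split: if_splits)

text \<open>Valid for all larger \<open>T\<close> too, so that finitely many matrices get a common
  finite support.\<close>

lemma fins_support:
  fixes M :: "('i, 'a::{ring,monoid_mult}) rcf"
  assumes "fins M"
  obtains S where "finite S" "\<And>T. S \<subseteq> T \<Longrightarrow> idm T * M = M" "\<And>T. S \<subseteq> T \<Longrightarrow> M * idm T = M"
proof
  let ?U = "{(i, j). ent M i j \<noteq> 0}"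
  let ?S = "fst ` ?U \<union> snd ` ?U"
  show "finite ?S" using assms by (auto simp: fins_def)
  show "idm T * M = M" if "?S \<subseteq> T" for T
    using that by (force intro!: rcf_eqI simp: ent_idm_times)
  show "M * idm T = M" if "?S \<subseteq> T" for T
    using that by (force intro!: rcf_eqI simp: ent_times_idm)
qed

text \<open>Closure under transposition is the reason for demanding finite rows and finite columns
  at once. It turns statements on rows and left annihilators into statements on columns and right
  annihilators.\<close>

definition trp :: "('i, 'a::zero) rcf \<Rightarrow> ('i, 'a) rcf" where
  "trp M = Mk (\<lambda>i j. ent M j i)"

lemma ent_trp [simp]: "ent (trp M) i j = ent M j i"
  unfolding trp_def by (subst ent_Mk) (auto simp: finite_row finite_col)

lemma trp_trp [simp]: "trp (trp M) = M"
  by (rule rcf_eqI) simp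

lemma trp_zero [simp]: "trp (0 :: ('i, 'a::ab_group_add) rcf) = 0"
  by (rule rcf_eqI) simp

lemma trp_times: "trp (M * N) = trp N * trp (M :: ('i, 'a::comm_ring) rcf)"
proof (rule rcf_eqI)
  fix i k
  show "ent (trp (M * N)) i k = ent (trp N * trp M) i k"
    by (simp add: ent_times_row[of M] ent_times_col[of _ "trp M"] mult.commute)
qed

lemma trp_idm [simp]: "trp (idm S) = idm S"
  by (rule rcf_eqI) (auto simp: ent_idm)

lemma trp_one [simp]: "trp 1 = (1 :: ('i, 'a::{ring,monoid_mult}) rcf)"
  by (simp add: one_rcf_def)

lemma trp_unt [simp]: "trp (unt c i j) = unt c j i"
  by (rule rcf_eqI) (auto simp: ent_unt)

lemma trp_minus: "trp (M - N) = trp M - trp (N :: ('i, 'a::ab_group_add) rcf)"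
  by (rule rcf_eqI) simp

subsection \<open>Kronecker products with a second index\<close>

text \<open>In the notation for Kronecker products, \<open>kap sc A\<close> is \<open>A \<otimes> 1\<close> and \<open>lft X\<close> is \<open>1 \<otimes> X\<close>.\<close>

definition kap :: "('k \<Rightarrow> 'a \<Rightarrow> 'a) \<Rightarrow> ('i, 'k::zero) rcf \<Rightarrow> ('i \<times> nat, 'a::{ring,monoid_mult}) rcf" where
  "kap sc M = Mk (\<lambda>a b. if snd a = snd b then sc (ent M (fst a) (fst b)) 1 else 0)"

definition lft :: "(nat, 'a::zero) rcf \<Rightarrow> ('i \<times> nat, 'a) rcf" where
  "lft X = Mk (\<lambda>a b. if fst a = fst b then ent X (snd a) (snd b) else 0)"

lemma ent_lft:
  fixes u v :: 'i
  shows "ent (lft X) (u, c) (v, c') = (if u = v then ent X c c' else 0)"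
proof -
  let ?f = "\<lambda>(a :: 'i \<times> nat) b. if fst a = fst b then ent X (snd a) (snd b) else 0"
  have "finite {b. ?f a b \<noteq> 0}" for a :: "'i \<times> nat"
    by (rule finite_subset[of _ "{fst a} \<times> {c'. ent X (snd a) c' \<noteq> 0}"])
      (auto simp: finite_row)
  moreover have "finite {a. ?f a b \<noteq> 0}" for b :: "'i \<times> nat"
    by (rule finite_subset[of _ "{fst b} \<times> {c'. ent X c' (snd b) \<noteq> 0}"])
      (auto simp: finite_col)
  ultimately have "ent (Mk ?f) = ?f" by (intro ent_Mk)
  then show ?thesis by (simp add: lft_def)
qed

context unital_algebra
begin

lemma ent_kap:
  fixes u v :: 'i
  shows "ent (kap sc M) (u, c) (v, c') = (if c = c' then sc (ent M u v) 1 else 0)"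
proof -
  let ?f = "\<lambda>(a :: 'i \<times> nat) b. if snd a = snd b then sc (ent M (fst a) (fst b)) 1 else 0"
  have "finite {b. ?f a b \<noteq> 0}" for a
    by (rule finite_subset[of _ "{v. ent M (fst a) v \<noteq> 0} \<times> {snd a}"])
      (auto simp: finite_row split: if_splits intro: ccontr)
  moreover have "finite {a. ?f a b \<noteq> 0}" for b
    by (rule finite_subset[of _ "{v. ent M v (fst b) \<noteq> 0} \<times> {snd b}"])
      (auto simp: finite_col split: if_splits intro: ccontr)
  ultimately have "ent (Mk ?f) = ?f" by (intro ent_Mk)
  then show ?thesis by (simp add: kap_def)
qed

lemma sc_times_sc: "sc c a * sc d b = sc (c * d) (a * b)"
  by (metis sc_mult_left sc_mult_right scale_scale)

lemma kap_add: "kap sc (M + N) = kap sc M + kap sc N"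
proof (rule rcf_eqI)
  fix a b show "ent (kap sc (M + N)) a b = ent (kap sc M + kap sc N) a b"
    by (cases a; cases b) (simp add: ent_kap scale_left_distrib)
qed

lemma kap_times:
  fixes M N :: "('i, 'k) rcf" shows "kap sc (M * N) = kap sc M * kap sc N"
proof (rule rcf_eqI)
  fix a b :: "'i \<times> nat"
  obtain u c v c' where a: "a = (u, c)" and b: "b = (v, c')" by fastforce
  let ?J = "{w. ent M u w \<noteq> 0}"
  have "ent (kap sc M * kap sc N) a b = (\<Sum>j\<in>?J \<times> {c}. ent (kap sc M) a j * ent (kap sc N) j b)"
    by (rule ent_times) (auto simp: a b ent_kap finite_row split: if_splits intro: ccontr)
  also have "\<dots> = (\<Sum>w\<in>?J. ent (kap sc M) a (w, c) * ent (kap sc N) (w, c) b)"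
    by (rule sum.reindex_cong[of "\<lambda>w. (w, c)"]) (auto simp: inj_on_def)
  also have "\<dots> = ent (kap sc (M * N)) a b"
    by (auto simp: a b ent_kap ent_times_row scale_sum_left sc_times_sc)
  finally show "ent (kap sc (M * N)) a b = ent (kap sc M * kap sc N) a b" by simp
qed

lemma kap_one: "kap sc 1 = 1"
proof (rule rcf_eqI)
  fix a b show "ent (kap sc 1) a b = ent 1 a b"
    by (cases a; cases b) (simp add: ent_kap ent_one)
qed

lemma ent_kap_lft: "ent (kap sc M * lft X) (u, c) (v, c') = sc (ent M u v) (ent X c c')"
  by (subst ent_times[of "{(v, c)}"])
    (auto simp: ent_kap ent_lft sc_mult_left[symmetric] split: if_splits)

lemma ent_lft_kap: "ent (lft X * kap sc M) (u, c) (v, c') = sc (ent M u v) (ent X c c')"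
  by (subst ent_times[of "{(u, c')}"])
    (auto simp: ent_kap ent_lft sc_mult_right[symmetric] split: if_splits)

text \<open>Scalars of the field are central in the algebra. This commutation is all that the
  calculus of systems asks of the coordinates of a point; it is assumption \<open>x_K\<close>
  below.\<close>

lemma lft_kap_commute: "lft X * kap sc M = kap sc M * lft X"
proof (rule rcf_eqI)
  fix a b show "ent (lft X * kap sc M) a b = ent (kap sc M * lft X) a b"
    by (cases a; cases b) (simp add: ent_kap_lft ent_lft_kap)
qed

end

section \<open>Linear systems over a ring\<close>

record ('i, 'b) lsys =
  sysD :: 'b
  sysC :: 'b
  sysA :: "'i \<Rightarrow> 'b"
  sysB :: "'i \<Rightarrow> 'b"

text \<open>\<open>K\<close> embeds the coefficients and \<open>x i\<close> is the i-th coordinate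
  of the point relative to the centre. Points of all sizes and over all algebras are instances, so
  each identity between systems is proved once.\<close>

locale pencil_eval =
  fixes K :: "'b::{ring,monoid_mult} \<Rightarrow> 'm::{ring,monoid_mult}"
    and x :: "'i \<Rightarrow> 'm" and I :: "'i set"
  assumes K_add: "K (a + b) = K a + K b"
    and K_times: "K (a * b) = K a * K b"
    and K_one [simp]: "K 1 = 1"
    and x_K: "i \<in> I \<Longrightarrow> x i * K b = K b * x i"
begin

lemma K_zero [simp]: "K 0 = 0"
  using K_add[of 0 0] by simp

lemma K_diff: "K (a - b) = K a - K b"
  using K_add[of "a - b" b] by (simp add: algebra_simps)

lemma K_uminus: "K (- a) = - K a"
  using K_diff[of 0 a] by simp

definition lin :: "('i \<Rightarrow> 'b) \<Rightarrow> 'm" where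
  "lin A = (\<Sum>i\<in>I. K (A i) * x i)"

lemma lin_add: "lin (\<lambda>i. A i + B i) = lin A + lin B"
  by (simp add: lin_def K_add distrib_right sum.distrib)

lemma lin_diff: "lin (\<lambda>i. A i - B i) = lin A - lin B"
  by (simp add: lin_def K_diff left_diff_distrib sum_subtractf)

lemma lin_lmult: "lin (\<lambda>i. U * A i) = K U * lin A"
  by (simp add: lin_def K_times mult.assoc sum_distrib_left)

lemma lin_rmult: "lin (\<lambda>i. A i * U) = lin A * K U"
proof -
  have "K (A i * U) * x i = K (A i) * x i * K U" if "i \<in> I" for i
    by (simp only: K_times mult.assoc x_K[OF that])
  then show ?thesis
    unfolding lin_def sum_distrib_right by (intro sum.cong) auto
qed

lemma lin_cong: "(\<And>i. i \<in> I \<Longrightarrow> A i = B i) \<Longrightarrow> lin A = lin B"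
  by (simp add: lin_def)

lemma lin_zero [simp]: "lin (\<lambda>i. 0) = 0"
  by (simp add: lin_def)

text \<open>A relation instead of a value: membership in the domain and the value travel together
  through every construction. The value is unique, as inverses are.\<close>

definition ev :: "('i, 'b) lsys \<Rightarrow> 'm \<Rightarrow> bool" where
  "ev \<Sigma> v \<longleftrightarrow> (\<exists>Q. Q * (1 - lin (sysA \<Sigma>)) = 1 \<and> (1 - lin (sysA \<Sigma>)) * Q = 1 \<and>
     v = K (sysD \<Sigma>) + K (sysC \<Sigma>) * Q * lin (sysB \<Sigma>))"

text \<open>Parallel connection. The hypotheses on \<open>t\<close> and \<open>j\<close> say that
  the state space is the direct sum of two copies of itself, with inclusions \<open>j\<close> and
  projections \<open>t\<close>; the pencil is block diagonal.\<close>

lemma ev_plus: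
  assumes ev1: "ev \<Sigma>1 v1" and ev2: "ev \<Sigma>2 v2"
    and j: "t1 * j1 = 1" "t2 * j2 = 1" "t1 * j2 = 0" "t2 * j1 = 0" "j1 * t1 + j2 * t2 = 1"
  shows "ev \<lparr>sysD = sysD \<Sigma>1 + sysD \<Sigma>2, sysC = sysC \<Sigma>1 * t1 + sysC \<Sigma>2 * t2,
    sysA = \<lambda>i. j1 * sysA \<Sigma>1 i * t1 + j2 * sysA \<Sigma>2 i * t2,
    sysB = \<lambda>i. j1 * sysB \<Sigma>1 i + j2 * sysB \<Sigma>2 i\<rparr> (v1 + v2)"
proof -
  obtain Q1 where Q1: "Q1 * (1 - lin (sysA \<Sigma>1)) = 1" "(1 - lin (sysA \<Sigma>1)) * Q1 = 1"
    "v1 = K (sysD \<Sigma>1) + K (sysC \<Sigma>1) * Q1 * lin (sysB \<Sigma>1)" using ev1 ev_def by auto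
  obtain Q2 where Q2: "Q2 * (1 - lin (sysA \<Sigma>2)) = 1" "(1 - lin (sysA \<Sigma>2)) * Q2 = 1"
    "v2 = K (sysD \<Sigma>2) + K (sysC \<Sigma>2) * Q2 * lin (sysB \<Sigma>2)" using ev2 ev_def by auto
  define P1 where "P1 = 1 - lin (sysA \<Sigma>1)"
  define P2 where "P2 = 1 - lin (sysA \<Sigma>2)"
  define Q where "Q = K j1 * Q1 * K t1 + K j2 * Q2 * K t2"
  have P: "1 - lin (\<lambda>i. j1 * sysA \<Sigma>1 i * t1 + j2 * sysA \<Sigma>2 i * t2) = K j1 * P1 * K t1 + K j2 * P2 * K t2"
    using K_add[of "j1 * t1" "j2 * t2"]
    by (simp add: j lin_add lin_lmult lin_rmult P1_def P2_def K_times algebra_simps)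
  note Kj = j(1-4)[THEN arg_cong[of _ _ K], unfolded K_times K_one K_zero]
  have KjA: "K t1 * (K j1 * z) = z" "K t2 * (K j2 * z) = z" "K t1 * (K j2 * z) = 0" "K t2 * (K j1 * z) = 0" for z
    by (simp_all add: Kj mult.assoc[symmetric])
  have K1: "K j1 * K t1 + K j2 * K t2 = 1"
    using arg_cong[OF j(5), of K] by (simp add: K_add K_times)
  have PQ: "P1 * (Q1 * z) = z" "Q1 * (P1 * z) = z" "P2 * (Q2 * z) = z" "Q2 * (P2 * z) = z" for z
    using Q1 Q2 by (simp_all add: P1_def P2_def mult.assoc[symmetric])
  show ?thesis
    unfolding ev_def lsys.simps P
    by (rule exI[of _ Q])
      (simp add: Q_def KjA PQ K1 Q1(3) Q2(3) K_add K_times lin_add lin_lmult algebra_simps)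
qed

text \<open>Cascade connection: the output of the second system is the input of the first, which
  puts \<open>sysB \<Sigma>1 i * sysC \<Sigma>2\<close> above the diagonal of a block triangular
  pencil.\<close>

lemma ev_times:
  assumes ev1: "ev \<Sigma>1 v1" and ev2: "ev \<Sigma>2 v2"
    and j: "t1 * j1 = 1" "t2 * j2 = 1" "t1 * j2 = 0" "t2 * j1 = 0" "j1 * t1 + j2 * t2 = 1"
  shows "ev \<lparr>sysD = sysD \<Sigma>1 * sysD \<Sigma>2, sysC = sysC \<Sigma>1 * t1 + sysD \<Sigma>1 * sysC \<Sigma>2 * t2,
    sysA = \<lambda>i. j1 * sysA \<Sigma>1 i * t1 + j2 * sysA \<Sigma>2 i * t2 + j1 * sysB \<Sigma>1 i * (sysC \<Sigma>2 * t2),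
    sysB = \<lambda>i. j1 * sysB \<Sigma>1 i * sysD \<Sigma>2 + j2 * sysB \<Sigma>2 i\<rparr> (v1 * v2)"
proof -
  obtain Q1 where Q1: "Q1 * (1 - lin (sysA \<Sigma>1)) = 1" "(1 - lin (sysA \<Sigma>1)) * Q1 = 1"
    "v1 = K (sysD \<Sigma>1) + K (sysC \<Sigma>1) * Q1 * lin (sysB \<Sigma>1)" using ev1 ev_def by auto
  obtain Q2 where Q2: "Q2 * (1 - lin (sysA \<Sigma>2)) = 1" "(1 - lin (sysA \<Sigma>2)) * Q2 = 1"
    "v2 = K (sysD \<Sigma>2) + K (sysC \<Sigma>2) * Q2 * lin (sysB \<Sigma>2)" using ev2 ev_def by auto
  define P1 where "P1 = 1 - lin (sysA \<Sigma>1)"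
  define P2 where "P2 = 1 - lin (sysA \<Sigma>2)"
  define N where "N = lin (sysB \<Sigma>1) * K (sysC \<Sigma>2)"
  \<comment> \<open>The inverse of a block triangular matrix; its off-diagonal block is
    \<open>Q1 * N * Q2\<close>.\<close>
  define Q where "Q = K j1 * Q1 * K t1 + K j2 * Q2 * K t2 + K j1 * Q1 * N * Q2 * K t2"
  have P: "1 - lin (\<lambda>i. j1 * sysA \<Sigma>1 i * t1 + j2 * sysA \<Sigma>2 i * t2 + j1 * sysB \<Sigma>1 i * (sysC \<Sigma>2 * t2))
    = K j1 * P1 * K t1 + K j2 * P2 * K t2 - K j1 * N * K t2"
    using K_add[of "j1 * t1" "j2 * t2"]
    by (simp add: j lin_add lin_lmult lin_rmult P1_def P2_def N_def K_times algebra_simps)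
  note Kj = j(1-4)[THEN arg_cong[of _ _ K], unfolded K_times K_one K_zero]
  have KjA: "K t1 * (K j1 * z) = z" "K t2 * (K j2 * z) = z" "K t1 * (K j2 * z) = 0" "K t2 * (K j1 * z) = 0" for z
    by (simp_all add: Kj mult.assoc[symmetric])
  have K1: "K j1 * K t1 + K j2 * K t2 = 1"
    using arg_cong[OF j(5), of K] by (simp add: K_add K_times)
  have PQ: "P1 * (Q1 * z) = z" "Q1 * (P1 * z) = z" "P2 * (Q2 * z) = z" "Q2 * (P2 * z) = z" for z
    using Q1 Q2 by (simp_all add: P1_def P2_def mult.assoc[symmetric])
  show ?thesis
    unfolding ev_def lsys.simps P
    by (rule exI[of _ Q])
      (simp add: Q_def KjA PQ K1 Q1(3) Q2(3) N_def K_add K_times lin_add lin_lmult lin_rmult algebra_simps)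
qed

text \<open>The inverse of \<open>P + b D\<^sup>-\<^sup>1 C\<close> is given by the Woodbury identity.\<close>

lemma ev_inverse:
  assumes ev: "ev \<Sigma> v" and v: "v * V = K f" "V * v = K f" "V * K f = V" "K f * V = V"
    and E: "E * sysD \<Sigma> = f" "sysD \<Sigma> * E = f" "E * f = E" "f * E = E"
    and f: "f * sysC \<Sigma> = sysC \<Sigma>" "\<And>i. i \<in> I \<Longrightarrow> sysB \<Sigma> i * f = sysB \<Sigma> i"
      "f * sysD \<Sigma> = sysD \<Sigma>" "sysD \<Sigma> * f = sysD \<Sigma>"
  shows "ev \<lparr>sysD = E, sysC = - (E * sysC \<Sigma>),
    sysA = \<lambda>i. sysA \<Sigma> i - sysB \<Sigma> i * (E * sysC \<Sigma>), sysB = \<lambda>i. sysB \<Sigma> i * E\<rparr> V"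
proof -
  obtain Q where Q: "Q * (1 - lin (sysA \<Sigma>)) = 1" "(1 - lin (sysA \<Sigma>)) * Q = 1"
    "v = K (sysD \<Sigma>) + K (sysC \<Sigma>) * Q * lin (sysB \<Sigma>)" using ev ev_def by auto
  define P where "P = 1 - lin (sysA \<Sigma>)"
  define b where "b = lin (sysB \<Sigma>)"
  define c where "c = K (sysC \<Sigma>)"
  define D where "D = K (sysD \<Sigma>)"
  define e where "e = K E"
  have PQ: "Q * P = 1" "P * Q = 1" using Q by (simp_all add: P_def)
  have bf: "b * K f = b"
    unfolding b_def lin_rmult[symmetric] by (rule lin_cong) (use f in auto)
  have fc: "K f * c = c" using f by (simp add: c_def K_times[symmetric])
  have De: "e * D = K f" "D * e = K f" "e * K f = e" "K f * e = e" "K f * D = D" "D * K f = D"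
    using E f by (simp_all add: e_def D_def K_times[symmetric])
  have cQb: "c * Q * b = v - D" using Q(3) by (simp add: c_def b_def D_def)
  have A: "1 - lin (\<lambda>i. sysA \<Sigma> i - sysB \<Sigma> i * (E * sysC \<Sigma>)) = P + b * e * c"
    by (simp add: lin_diff lin_rmult P_def b_def e_def c_def K_times mult.assoc)
  let ?R = "Q - Q * b * V * c * Q"
  \<comment> \<open>Resolvent identity for \<open>e\<close> and \<open>V\<close>, the inverses of
    \<open>D\<close> and \<open>v\<close> in the corner with unit \<open>K f\<close>. It collapses
    the products in which \<open>c * Q * b = v - D\<close> stands between them.\<close>
  have "e * (v - D) * V = e - V"
    using v De by (simp add: algebra_simps)
  then have 1: "b * e * (c * Q * b) * V * c * Q = b * e * c * Q - b * V * c * Q"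
    unfolding cQb by (metis (no_types, lifting) left_diff_distrib mult.assoc right_diff_distrib)
  have "V * (v - D) * e = e - V"
    using v De by (simp add: algebra_simps)
  then have 2: "Q * b * V * (c * Q * b) * e * c = Q * b * e * c - Q * b * V * c"
    unfolding cQb by (metis (no_types, lifting) left_diff_distrib mult.assoc right_diff_distrib)
  have R1: "(P + b * e * c) * ?R = 1"
  proof -
    have "(P + b * e * c) * ?R = P * Q - (P * Q) * b * V * c * Q + b * e * c * Q
      - b * e * (c * Q * b) * V * c * Q" by (simp add: algebra_simps)
    then show ?thesis unfolding 1 by (simp add: PQ)
  qed
  have R2: "?R * (P + b * e * c) = 1"
  proof -
    have "?R * (P + b * e * c) = Q * P + Q * b * e * c - Q * b * V * c * (Q * P)
      - Q * b * V * (c * Q * b) * e * c" by (simp add: algebra_simps)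
    then show ?thesis unfolding 2 by (simp add: PQ)
  qed
  have "e * c * ?R * b * e = e * (c * Q * b) * e - e * (c * Q * b) * V * (c * Q * b) * e"
    by (simp add: algebra_simps)
  also have "\<dots> = e * (v - D) * e - (e - V) * (v - D) * e"
    unfolding cQb \<open>e * (v - D) * V = e - V\<close> ..
  also have "\<dots> = V * (v - D) * e"
    by (simp add: algebra_simps)
  also have "\<dots> = e - V" by fact
  finally have val: "V = e - e * c * ?R * b * e" by simp
  show ?thesis
    unfolding ev_def lsys.simps A
    by (rule exI[of _ ?R])
      (use R1 R2 val in \<open>simp add: lin_rmult K_uminus K_times b_def e_def c_def mult.assoc\<close>)
qed

text \<open>\<open>G\<close> includes an invariant subspace of \<open>\<Sigma>'\<close> and
  \<open>H\<close> projects it onto \<open>\<Sigma>\<close>. The pencils satisfy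
  \<open>P' * K G = K G * Pt\<close> and \<open>K H * Pt = P * K H\<close>; the first relation
  carries over a left inverse, the second a right inverse, and \<open>fin1\<close>,
  \<open>fin2\<close> make them two-sided.\<close>

lemma ev_transfer:
  assumes ev: "ev \<Sigma>' v"
    and G: "\<And>i. i \<in> I \<Longrightarrow> sysA \<Sigma>' i * G = G * At i" "\<And>i. i \<in> I \<Longrightarrow> sysB \<Sigma>' i = G * Bt i"
      "Gp * G = \<epsilon>" "\<And>i. i \<in> I \<Longrightarrow> \<epsilon> * At i = At i"
    and H: "\<And>i. i \<in> I \<Longrightarrow> H * At i = sysA \<Sigma> i * H" "\<And>i. i \<in> I \<Longrightarrow> H * Bt i = sysB \<Sigma> i"
      "sysC \<Sigma> * H = sysC \<Sigma>' * G" "H * Hp = e" "\<And>i. i \<in> I \<Longrightarrow> sysA \<Sigma> i * e = sysA \<Sigma> i"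
    and D: "sysD \<Sigma> = sysD \<Sigma>'"
    and fin1: "\<And>Q. Q * (1 - lin At) = 1 \<Longrightarrow> (1 - lin At) * Q = 1"
    and fin2: "\<And>Q. (1 - lin (sysA \<Sigma>)) * Q = 1 \<Longrightarrow> Q * (1 - lin (sysA \<Sigma>)) = 1"
  shows "ev \<Sigma> v"
proof -
  obtain Q where Q: "Q * (1 - lin (sysA \<Sigma>')) = 1" "(1 - lin (sysA \<Sigma>')) * Q = 1"
    "v = K (sysD \<Sigma>') + K (sysC \<Sigma>') * Q * lin (sysB \<Sigma>')" using ev ev_def by auto
  define P' where "P' = 1 - lin (sysA \<Sigma>')"
  define Pt where "Pt = 1 - lin At"
  define P where "P = 1 - lin (sysA \<Sigma>)"
  have P'G: "P' * K G = K G * Pt"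
    using lin_cong[of "\<lambda>i. sysA \<Sigma>' i * G" "\<lambda>i. G * At i"] G(1)
    by (simp add: lin_rmult lin_lmult P'_def Pt_def algebra_simps)
  have HP: "K H * Pt = P * K H"
    using lin_cong[of "\<lambda>i. H * At i" "\<lambda>i. sysA \<Sigma> i * H"] H(1)
    by (simp add: lin_rmult lin_lmult P_def Pt_def algebra_simps)
  have eAt: "(1 - K \<epsilon>) * Pt = 1 - K \<epsilon>"
    using lin_cong[of "\<lambda>i. \<epsilon> * At i" At] G(4)
    by (simp add: lin_lmult Pt_def algebra_simps)
  have Pe: "P * (1 - K e) = 1 - K e"
    using lin_cong[of "\<lambda>i. sysA \<Sigma> i * e" "sysA \<Sigma>"] H(5)
    by (simp add: lin_rmult P_def algebra_simps)
  \<comment> \<open>Compression of \<open>Q\<close> to the subspace. The summand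
    \<open>1 - K \<epsilon>\<close> inverts \<open>Pt\<close> off the corner of
    \<open>\<epsilon>\<close>, where \<open>Pt\<close> is the identity.\<close>
  define U where "U = K Gp * Q * K G + (1 - K \<epsilon>)"
  have "U * Pt = K Gp * Q * (K G * Pt) + (1 - K \<epsilon>) * Pt"
    by (simp add: U_def distrib_right mult.assoc)
  also have "\<dots> = K Gp * (Q * P') * K G + (1 - K \<epsilon>)"
    unfolding P'G[symmetric] eAt by (simp add: mult.assoc)
  also have "\<dots> = 1" using Q(1) G(3) by (simp add: P'_def K_times[symmetric])
  finally have UP: "U * Pt = 1" .
  then have PU: "Pt * U = 1" unfolding Pt_def by (rule fin1)
  define V where "V = K H * U * K Hp + (1 - K e)"
  have "P * V = (P * K H) * U * K Hp + P * (1 - K e)"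
    by (simp add: V_def distrib_left mult.assoc)
  also have "\<dots> = K H * (Pt * U) * K Hp + (1 - K e)"
    unfolding HP[symmetric] Pe by (simp add: mult.assoc)
  also have "\<dots> = 1" using H(4) by (simp add: PU K_times[symmetric])
  finally have PV: "P * V = 1" .
  then have VP: "V * P = 1" unfolding P_def by (rule fin2)
  have "K G * U = (Q * P') * K G * U" using Q(1) by (simp add: P'_def)
  also have "\<dots> = Q * (P' * K G) * U" by (simp add: mult.assoc)
  also have "\<dots> = Q * K G * (Pt * U)" unfolding P'G by (simp add: mult.assoc)
  finally have QG: "Q * K G = K G * U" using PU by simp
  have "V * K H = V * K H * (Pt * U)" using PU by simp
  also have "\<dots> = V * (K H * Pt) * U" by (simp add: mult.assoc)
  also have "\<dots> = (V * P) * K H * U" unfolding HP by (simp add: mult.assoc)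
  finally have VH: "V * K H = K H * U" using VP by simp
  have B': "lin (sysB \<Sigma>') = K G * lin Bt" and B: "lin (sysB \<Sigma>) = K H * lin Bt"
    using lin_cong[of "sysB \<Sigma>'" "\<lambda>i. G * Bt i"] lin_cong[of "sysB \<Sigma>" "\<lambda>i. H * Bt i"] G(2) H(2)
    by (simp_all add: lin_lmult)
  have "K (sysC \<Sigma>') * Q * lin (sysB \<Sigma>') = K (sysC \<Sigma>') * (Q * K G) * lin Bt"
    by (simp add: B' mult.assoc)
  also have "\<dots> = K (sysC \<Sigma>' * G) * U * lin Bt"
    by (simp add: QG K_times mult.assoc)
  also have "\<dots> = K (sysC \<Sigma>) * (K H * U) * lin Bt"
    unfolding H(3)[symmetric] by (simp add: K_times mult.assoc)
  also have "\<dots> = K (sysC \<Sigma>) * V * lin (sysB \<Sigma>)"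
    unfolding VH[symmetric] B by (simp add: mult.assoc)
  finally show ?thesis
    unfolding ev_def using Q(3) D PV VP by (auto simp: P_def)
qed

text \<open>\<open>Aw\<close> and \<open>Bw\<close> are the linear parts at the new centre,
  \<open>lin\<close> gives the remainder in coordinates relative to it. The pencil factors as
  \<open>K (1 - Aw) * (1 - lin (\<lambda>i. Q * A i))\<close>. Taking out the first factor leaves a
  pencil that is the identity at the new centre, and the constant term becomes the value
  there.\<close>

lemma ev_recentre:
  assumes Q: "Q * (1 - Aw) = 1" "(1 - Aw) * Q = 1"
    and U: "U * (1 - (K Aw + lin A)) = 1" "(1 - (K Aw + lin A)) * U = 1"
  shows "ev \<lparr>sysD = D + C * (Q * Bw), sysC = C, sysA = \<lambda>i. Q * A i,
    sysB = \<lambda>i. Q * (A i * (Q * Bw) + B i)\<rparr> (K D + K C * U * (K Bw + lin B))"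
proof -
  define P where "P = 1 - (K Aw + lin A)"
  have KQ: "K Q * K (1 - Aw) = 1" "K (1 - Aw) * K Q = 1"
    by (simp_all add: K_times[symmetric] Q)
  have UP: "U * P = 1" "P * U = 1" using U by (simp_all add: P_def)
  have A: "1 - lin (\<lambda>i. Q * A i) = K Q * P"
  proof -
    have "K Q * P = K Q * K (1 - Aw) - K Q * lin A"
      by (simp add: P_def K_diff algebra_simps)
    then show ?thesis by (simp add: KQ lin_lmult)
  qed
  let ?V = "U * K (1 - Aw)"
  have V: "?V * (K Q * P) = 1" "K Q * P * ?V = 1"
  proof -
    have "?V * (K Q * P) = U * (K (1 - Aw) * K Q) * P" by (simp only: mult.assoc)
    then show "?V * (K Q * P) = 1" using KQ UP by simp
    have "K Q * P * ?V = K Q * (P * U) * K (1 - Aw)" by (simp only: mult.assoc)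
    then show "K Q * P * ?V = 1" using KQ UP by simp
  qed
  have B: "lin (\<lambda>i. Q * (A i * (Q * Bw) + B i)) = K Q * (lin A * (K Q * K Bw) + lin B)"
    by (simp add: lin_lmult lin_add lin_rmult K_times)
  have linA: "lin A = K (1 - Aw) - P" by (simp add: P_def K_diff)
  have "?V * lin (\<lambda>i. Q * (A i * (Q * Bw) + B i))
      = U * (K (1 - Aw) * K Q) * (lin A * (K Q * K Bw) + lin B)"
    unfolding B by (simp only: mult.assoc)
  also have "\<dots> = U * lin A * (K Q * K Bw) + U * lin B"
    unfolding KQ by (simp add: algebra_simps)
  also have "\<dots> = U * (K (1 - Aw) * K Q) * K Bw - (U * P) * (K Q * K Bw) + U * lin B"
    unfolding linA by (simp add: algebra_simps)
  also have "\<dots> = U * (K Bw + lin B) - K (Q * Bw)"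
    unfolding KQ UP by (simp add: K_times algebra_simps)
  finally have "?V * lin (\<lambda>i. Q * (A i * (Q * Bw) + B i)) = U * (K Bw + lin B) - K (Q * Bw)" .
  then show ?thesis
    unfolding ev_def lsys.simps A
    by (intro exI[of _ ?V] conjI V) (simp add: K_add K_times mult.assoc right_diff_distrib)
qed

lemma ev_recentreD:
  assumes Q: "Q * (1 - Aw) = 1" "(1 - Aw) * Q = 1"
    and ev: "ev \<lparr>sysD = D + C * (Q * Bw), sysC = C, sysA = \<lambda>i. Q * A i,
      sysB = \<lambda>i. Q * (A i * (Q * Bw) + B i)\<rparr> v"
  shows "\<exists>U. U * (1 - (K Aw + lin A)) = 1 \<and> (1 - (K Aw + lin A)) * U = 1 \<and>
    v = K D + K C * U * (K Bw + lin B)"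
proof -
  define P where "P = 1 - (K Aw + lin A)"
  have KQ: "K Q * K (1 - Aw) = 1" "K (1 - Aw) * K Q = 1"
    by (simp_all add: K_times[symmetric] Q)
  have A: "1 - lin (\<lambda>i. Q * A i) = K Q * P"
  proof -
    have "K Q * P = K Q * K (1 - Aw) - K Q * lin A"
      by (simp add: P_def K_diff algebra_simps)
    then show ?thesis by (simp add: KQ lin_lmult)
  qed
  obtain V where V: "V * (K Q * P) = 1" "K Q * P * V = 1"
    and v: "v = K (D + C * (Q * Bw)) + K C * V * lin (\<lambda>i. Q * (A i * (Q * Bw) + B i))"
    using ev unfolding ev_def lsys.simps A by auto
  have UP: "V * K Q * P = 1" using V by (simp add: mult.assoc)
  have PU: "P * (V * K Q) = 1"
  proof -
    have "P * (V * K Q) = K (1 - Aw) * K Q * P * V * K Q" by (simp add: KQ mult.assoc)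
    also have "\<dots> = K (1 - Aw) * (K Q * P * V) * K Q" by (simp add: mult.assoc)
    finally show ?thesis using V KQ by simp
  qed
  \<comment> \<open>The inverse found above also satisfies the forward direction; comparing the two
    resulting values then only takes uniqueness of inverses.\<close>
  have "ev \<lparr>sysD = D + C * (Q * Bw), sysC = C, sysA = \<lambda>i. Q * A i,
      sysB = \<lambda>i. Q * (A i * (Q * Bw) + B i)\<rparr> (K D + K C * (V * K Q) * (K Bw + lin B))"
    using ev_recentre[OF Q, of "V * K Q" A D C Bw B] UP PU unfolding P_def by blast
  then obtain V' where V': "V' * (K Q * P) = 1" "K Q * P * V' = 1"
    and v': "K D + K C * (V * K Q) * (K Bw + lin B) =
      K (D + C * (Q * Bw)) + K C * V' * lin (\<lambda>i. Q * (A i * (Q * Bw) + B i))"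
    unfolding ev_def lsys.simps A by auto
  have "V' = V' * ((K Q * P) * V)" using V by simp
  also have "\<dots> = V" using V'(1) by (simp add: mult.assoc[symmetric])
  finally have "v = K D + K C * (V * K Q) * (K Bw + lin B)" using v v' by simp
  with UP PU show ?thesis unfolding P_def by blast
qed

end

section \<open>Controllability and observability\<close>

text \<open>The corner of a finite set is a full matrix ring over the algebra, by enumeration of
  \<open>S\<close>. The empty corner is treated apart because \<open>stably_finite\<close> speaks of
  sizes from 1 on.\<close>

lemma rcf_inverse_commute:
  fixes M N :: "('i, 'a::{ring,monoid_mult}) rcf"
  assumes sf: "stably_finite TYPE('a)" and S: "finite S"
    and M: "idm S * M = M" "M * idm S = M" and N: "idm S * N = N" "N * idm S = N"
    and MN: "M * N = idm S"
  shows "N * M = idm S"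
proof (cases "S = {}")
  case True
  then have "idm S = (0 :: ('i, 'a) rcf)" by (intro rcf_eqI) (simp add: ent_idm)
  then show ?thesis using M by simp
next
  case False
  define n where "n = card S"
  obtain h where h: "bij_betw h {..<n} S"
    using S unfolding n_def by (metis atLeast0LessThan ex_bij_betw_nat_finite)
  have inj: "h i = h j \<longleftrightarrow> i = j" if "i < n" "j < n" for i j
    using h that by (auto simp: bij_betw_def inj_on_def)
  have hS: "h i \<in> S" if "i < n" for i using h that by (auto simp: bij_betw_def)
  have n: "n \<ge> 1" using False S by (simp add: n_def card_gt_0_iff Suc_le_eq)
  define J where "J = (\<lambda>A :: ('i, 'a) rcf. mat n n (\<lambda>(i, j). ent A (h i) (h j)))"
  have J: "J A \<in> carrier_mat n n" for A by (simp add: J_def)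
  have ent0: "ent A i j = 0" if "A * idm S = A" "j \<notin> S" for A :: "('i, 'a) rcf" and i j
    using arg_cong[OF that(1), of "\<lambda>A. ent A i j"] that(2) by (simp add: ent_times_idm)
  have ent0': "ent A i j = 0" if "idm S * A = A" "i \<notin> S" for A :: "('i, 'a) rcf" and i j
    using arg_cong[OF that(1), of "\<lambda>A. ent A i j"] that(2) by (simp add: ent_idm_times)
  have mul: "J (A * B) = J A * J B" if "A * idm S = A" for A B
  proof (rule eq_matI)
    fix i j assume "i < dim_row (J A * J B)" "j < dim_col (J A * J B)"
    then have ij: "i < n" "j < n" by (auto simp: J_def)
    have "ent (A * B) (h i) (h j) = (\<Sum>s\<in>S. ent A (h i) s * ent B s (h j))"
      by (rule ent_times[OF S]) (use ent0[OF that] in auto)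
    also have "\<dots> = (\<Sum>k<n. ent A (h i) (h k) * ent B (h k) (h j))"
      by (rule sum.reindex_bij_betw[OF h, symmetric])
    finally show "J (A * B) $$ (i, j) = (J A * J B) $$ (i, j)"
      using ij by (simp add: J_def scalar_prod_def atLeast0LessThan)
  qed (auto simp: J_def)
  have one: "J (idm S) = 1\<^sub>m n"
    by (rule eq_matI) (auto simp: J_def ent_idm inj hS)
  have "J M * J N = 1\<^sub>m n" using mul[OF M(2)] MN one by metis
  then have "J N * J M = 1\<^sub>m n"
    using sf J n unfolding stably_finite_def by blast
  then have e: "J (N * M) = J (idm S)" using mul[OF N(2)] one by metis
  show ?thesis
  proof (rule rcf_eqI)
    fix i j
    show "ent (N * M) i j = ent (idm S) i j"
    proof (cases "i \<in> S \<and> j \<in> S")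
      case True
      then obtain a b where "a < n" "b < n" "i = h a" "j = h b"
        using h by (fastforce simp: bij_betw_def)
      then show ?thesis using arg_cong[OF e, of "\<lambda>A. A $$ (a, b)"] by (simp add: J_def)
    next
      case F: False
      have "idm S * (N * M) = N * M" "(N * M) * idm S = N * M"
        using N M by (simp_all add: mult.assoc[symmetric], simp add: mult.assoc)
      then have "ent (N * M) i j = 0" using F ent0 ent0' by blast
      then show ?thesis using F by (auto simp: ent_idm)
    qed
  qed
qed

lemma stably_finite_field: "stably_finite TYPE('k::field)"
  unfolding stably_finite_def by (metis mat_mult_left_right_inverse)

text \<open>A dimension count without ranks. If \<open>T\<close> were smaller, an embedding of
  \<open>T\<close> into \<open>S\<close> would turn \<open>M\<close> and \<open>N\<close> into
  square matrices on \<open>S\<close> that are inverse on one side, hence on both, although one of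
  them has a zero row.\<close>

lemma card_le_of_factor:
  fixes M N :: "('i, 'k::field) rcf"
  assumes fin: "finite S" "finite T" and MN: "M * N = idm S" and T: "idm T * N = N"
  shows "card S \<le> card T"
proof (rule ccontr)
  assume "\<not> card S \<le> card T"
  then obtain g where g: "inj_on g T" "g ` T \<subset> S"
    using fin by (metis card_le_inj card_image nat_le_linear order.not_eq_order_implies_strict order_less_irrefl psubsetI)
  then obtain s0 where s0: "s0 \<in> S" "s0 \<notin> g ` T" by auto
  define R where "R = (\<Sum>t\<in>T. unt (1::'k) t (g t))"
  define R' where "R' = (\<Sum>t\<in>T. unt (1::'k) (g t) t)"
  have RR: "R * R' = idm T"
  proof -
    have "R * R' = (\<Sum>t\<in>T. \<Sum>u\<in>T. if g t = g u then unt 1 t u else 0)"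
      by (simp add: R_def R'_def sum_product unt_times_unt cong: if_cong)
    also have "\<dots> = (\<Sum>t\<in>T. \<Sum>u\<in>T. if t = u then unt 1 t u else 0)"
      using g by (intro sum.cong refl) (auto simp: inj_on_def)
    also have "\<dots> = idm T" using fin by (simp add: sum_unt_idm)
    finally show ?thesis .
  qed
  have RS: "R * idm S = R" "idm S * R' = R'"
    using g by (auto simp: R_def R'_def sum_distrib_right sum_distrib_left unt_times_idm idm_times_unt
        intro!: sum.cong)
  have idS: "idm S * idm S = (idm S :: ('i, 'k) rcf)" by (simp add: idm_times_idm)
  let ?A = "idm S * (M * R)" and ?B = "R' * N * idm S"
  have "?A * ?B = idm S * (M * (R * R') * N) * idm S" by (simp add: mult.assoc)
  also have "\<dots> = idm S * (M * (idm T * N)) * idm S" by (simp add: RR mult.assoc)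
  also have "\<dots> = idm S" by (simp add: T MN idS)
  finally have AB: "?A * ?B = idm S" .
  have "?B * ?A = idm S"
    by (rule rcf_inverse_commute[OF stably_finite_field fin(1) _ _ _ _ AB])
      (simp_all add: mult.assoc RS idS, simp_all add: mult.assoc[symmetric] RS idS)
  then have "unt 1 s0 s0 * (?B * ?A) = unt 1 s0 s0 * idm S" by simp
  moreover have "unt 1 s0 s0 * R' = 0"
    using s0 by (auto simp: R'_def sum_distrib_left unt_times_unt intro!: sum.neutral)
  then have "unt 1 s0 s0 * (?B * ?A) = 0" by (simp add: mult.assoc[symmetric])
  ultimately have "unt (1::'k) s0 s0 = 0" using s0 by (simp add: unt_times_idm)
  then have "ent (unt (1::'k) s0 s0) s0 s0 = 0" by simp
  then show False unfolding ent_unt by simp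
qed

section \<open>Columns, spans and bases\<close>

abbreviation o0 :: "nat \<times> nat" where "o0 \<equiv> (0, 0)"

text \<open>A state index is a pair of a position and a block number. Spaces without block structure
  occupy block 0 only and appear as \<open>box r (Suc 0)\<close>.\<close>

abbreviation box :: "nat \<Rightarrow> nat \<Rightarrow> (nat \<times> nat) set" where
  "box r m \<equiv> {..<r} \<times> {..<m}"

text \<open>Vectors are matrices with all their entries in column \<open>o0\<close>.\<close>

abbreviation col :: "(nat \<times> nat, 'k) rcf \<Rightarrow> nat \<times> nat \<Rightarrow> (nat \<times> nat, 'k::{ring,monoid_mult}) rcf" where
  "col M u \<equiv> M * unt 1 u o0"

text \<open>A basis of the span of the column vectors \<open>Gen\<close>, chosen among them: \<open>Gp\<close> gives the coordinates.\<close>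

lemma rank_factor:
  fixes Gen :: "(nat \<times> nat, 'k::field) rcf set"
  assumes S: "finite S" and Gen: "\<And>z. z \<in> Gen \<Longrightarrow> idm S * z = z \<and> z * unt 1 o0 o0 = z"
  obtains G r Gp where "G * idm (box r (Suc 0)) = G" "idm (box r (Suc 0)) * Gp = Gp" "Gp * G = idm (box r (Suc 0))"
    "idm S * G = G" "\<forall>z\<in>Gen. G * Gp * z = z" "\<forall>j<r. col G (j, 0) \<in> Gen"
proof -
  define P where "P r \<longleftrightarrow> (\<exists>G Gp. G * idm (box r (Suc 0)) = G \<and> idm (box r (Suc 0)) * Gp = Gp \<and>
    Gp * G = idm (box r (Suc 0)) \<and> idm S * G = G \<and> (\<forall>j<r. col G (j, 0) \<in> Gen))" for r
  have P0: "P 0"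
    unfolding P_def by (intro exI[of _ 0]) (auto intro!: rcf_eqI simp: ent_idm)
  have bd: "r \<le> card S" if Pr: "P r" for r
  proof -
    obtain G Gp :: "(nat \<times> nat, 'k) rcf" where "Gp * G = idm (box r (Suc 0))" "idm S * G = G"
      using Pr P_def by auto
    from card_le_of_factor[OF _ S this] show ?thesis by simp
  qed
  \<comment> \<open>A largest independent family among the generators; it spans, for otherwise it
    could be enlarged.\<close>
  obtain r where r: "P r" "\<not> P (Suc r)"
    using P0 bd by (metis Suc_n_not_le_n nat_induct)
  obtain G Gp where G: "G * idm (box r (Suc 0)) = G" "idm (box r (Suc 0)) * Gp = Gp" "Gp * G = idm (box r (Suc 0))"
      "idm S * G = G" "\<And>j. j < r \<Longrightarrow> col G (j, 0) \<in> Gen"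
    using r(1) P_def by auto
  have "G * Gp * z = z" if z: "z \<in> Gen" for z
  proof (rule ccontr)
    assume ne: "G * Gp * z \<noteq> z"
    define y where "y = z - G * Gp * z"
    have zz: "z * unt 1 o0 o0 = z" using Gen[OF z] by simp
    then have yo: "y * unt 1 o0 o0 = y" by (simp add: y_def left_diff_distrib mult.assoc)
    have "y \<noteq> 0" using ne by (simp add: y_def)
    then obtain a b where ab: "ent y a b \<noteq> 0" by (metis ent_zero rcf_eqI)
    have "b = o0" using ab arg_cong[OF yo, of "\<lambda>A. ent A a b"] by (auto simp: ent_times_unt split: if_splits)
    define c where "c = ent y a o0"
    have c: "c \<noteq> 0" using ab \<open>b = o0\<close> by (simp add: c_def)
    have y0: "ent y i j = (if j = o0 then ent y i j else 0)" for i j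
      using arg_cong[OF yo, of "\<lambda>A. ent A i j"] by (auto simp: ent_times_unt split: if_splits)
    \<comment> \<open>A functional with value 1 at \<open>z\<close> that vanishes on the columns of
      \<open>G\<close>, obtained from a nonzero entry of the residue \<open>y\<close> of
      \<open>z\<close>.\<close>
    define \<phi> where "\<phi> = unt (1 / c) o0 a * (1 - G * Gp)"
    have \<phi>G: "\<phi> * G = 0"
      by (simp add: \<phi>_def mult.assoc left_diff_distrib G)
    have "\<phi> * z = unt (1 / c) o0 a * y" by (simp add: \<phi>_def y_def mult.assoc algebra_simps)
    also have "\<dots> = unt 1 o0 o0"
    proof (rule rcf_eqI)
      fix i j show "ent (unt (1 / c) o0 a * y) i j = ent (unt 1 o0 o0) i j"
        using c by (subst ent_unt_times, subst y0) (auto simp: ent_unt c_def)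
    qed
    finally have \<phi>z: "\<phi> * z = unt 1 o0 o0" .
    define G1 where "G1 = G + z * unt 1 o0 (r, 0)"
    \<comment> \<open>Coordinates in the enlarged family: \<open>\<phi>\<close> is the new
      coordinate, and the share of \<open>z\<close> is removed from the old ones.\<close>
    define Gp1 where "Gp1 = Gp - Gp * z * \<phi> + unt 1 (r, 0) o0 * \<phi>"
    have GpG: "Gp1 * G = idm (box r (Suc 0))" by (simp add: Gp1_def algebra_simps \<phi>G G)
    have "Gp1 * z = Gp * z - Gp * (z * unt 1 o0 o0) + unt 1 (r, 0) o0"
      by (simp add: Gp1_def algebra_simps \<phi>z unt_times_unt)
    then have Gpz: "Gp1 * z = unt 1 (r, 0) o0" by (simp add: zz)
    have "Gp1 * G1 = idm (box r (Suc 0)) + Gp1 * z * unt 1 o0 (r, 0)"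
      by (simp add: G1_def distrib_left GpG mult.assoc)
    also have "\<dots> = idm (box (Suc r) (Suc 0))"
      unfolding Gpz by (intro rcf_eqI) (auto simp: unt_times_unt ent_idm ent_unt)
    finally have 1: "Gp1 * G1 = idm (box (Suc r) (Suc 0))" .
    have bb: "box (Suc r) (Suc 0) \<inter> box r (Suc 0) = box r (Suc 0)" "box r (Suc 0) \<inter> box (Suc r) (Suc 0) = box r (Suc 0)" by auto
    have "G * idm (box (Suc r) (Suc 0)) = G * (idm (box r (Suc 0)) * idm (box (Suc r) (Suc 0)))"
      by (simp add: G mult.assoc[symmetric])
    then have 2: "G1 * idm (box (Suc r) (Suc 0)) = G1"
      by (simp add: G1_def distrib_right mult.assoc unt_times_idm idm_times_idm bb G)
    have "idm (box (Suc r) (Suc 0)) * Gp = (idm (box (Suc r) (Suc 0)) * idm (box r (Suc 0))) * Gp"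
      by (simp add: G mult.assoc)
    then have e: "idm (box (Suc r) (Suc 0)) * Gp = Gp" by (simp add: idm_times_idm bb G)
    have 3: "idm (box (Suc r) (Suc 0)) * Gp1 = Gp1"
      by (simp add: Gp1_def distrib_left right_diff_distrib mult.assoc[symmetric] idm_times_unt e)
    have 4: "idm S * G1 = G1"
      by (simp add: G1_def distrib_left mult.assoc[symmetric] G Gen[OF z])
    have 5: "col G1 (j, 0) \<in> Gen" if "j < Suc r" for j
    proof (cases "j = r")
      case True
      have "col G (r, 0) = G * (idm (box r (Suc 0)) * unt 1 (r, 0) o0)" by (simp add: G mult.assoc[symmetric])
      then show ?thesis
        using z by (simp add: True G1_def distrib_right mult.assoc unt_times_unt idm_times_unt zz)
    next
      case False
      then show ?thesis
        using that G(5)[of j] by (simp add: G1_def distrib_right mult.assoc unt_times_unt)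
    qed
    have "P (Suc r)" unfolding P_def using 1 2 3 4 5 by blast
    then show False using r by simp
  qed
  then show ?thesis using that G by blast
qed

section \<open>Reachability, observability and reduction of systems\<close>

abbreviation wprod :: "('i \<Rightarrow> 'b::monoid_mult) \<Rightarrow> 'i list \<Rightarrow> 'b" where
  "wprod A w \<equiv> prod_list (map A w)"

text \<open>Controllability in dual form: a functional that vanishes on all reachable states
  vanishes on the state space. In this form it is the mirror image of \<open>obsv\<close>.\<close>

definition contr :: "'i set \<Rightarrow> (nat \<times> nat) set \<Rightarrow> ('i, (nat \<times> nat, 'k::field) rcf) lsys \<Rightarrow> bool" where
  "contr I S \<Sigma> \<longleftrightarrow> (\<forall>Z. (\<forall>w\<in>lists I. \<forall>i\<in>I. Z * wprod (sysA \<Sigma>) w * sysB \<Sigma> i = 0) \<longrightarrow> Z * idm S = 0)"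

definition obsv :: "'i set \<Rightarrow> (nat \<times> nat) set \<Rightarrow> ('i, (nat \<times> nat, 'k::field) rcf) lsys \<Rightarrow> bool" where
  "obsv I S \<Sigma> \<longleftrightarrow> (\<forall>Z. (\<forall>w\<in>lists I. sysC \<Sigma> * wprod (sysA \<Sigma>) w * Z = 0) \<longrightarrow> idm S * Z = 0)"

definition supp :: "'i set \<Rightarrow> (nat \<times> nat) set \<Rightarrow> ('i, (nat \<times> nat, 'k::field) rcf) lsys \<Rightarrow> bool" where
  "supp I S \<Sigma> \<longleftrightarrow> sysC \<Sigma> * idm S = sysC \<Sigma> \<and> (\<forall>i\<in>I. idm S * sysA \<Sigma> i = sysA \<Sigma> i \<and>
     sysA \<Sigma> i * idm S = sysA \<Sigma> i \<and> idm S * sysB \<Sigma> i = sysB \<Sigma> i)"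

text \<open>Together with the constant term \<open>sysD\<close>, the moments are the coefficients of
  the noncommutative power series of the system at its centre.\<close>

definition moments_eq :: "'i set \<Rightarrow> ('i, (nat \<times> nat, 'k::field) rcf) lsys \<Rightarrow>
    ('i, (nat \<times> nat, 'k) rcf) lsys \<Rightarrow> bool" where
  "moments_eq I \<Sigma> \<Sigma>' \<longleftrightarrow> sysD \<Sigma> = sysD \<Sigma>' \<and> (\<forall>w\<in>lists I. \<forall>i\<in>I.
     sysC \<Sigma> * wprod (sysA \<Sigma>) w * sysB \<Sigma> i = sysC \<Sigma>' * wprod (sysA \<Sigma>') w * sysB \<Sigma>' i)"

lemma wprod_intertwine:
  fixes A :: "'i \<Rightarrow> 'b::{ring,monoid_mult}"
  assumes "\<And>i. i \<in> I \<Longrightarrow> A i * G = G * B i" "w \<in> lists I"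
  shows "wprod A w * G = G * wprod B w"
  using assms(2)
proof induction
  case (Cons i w)
  then show ?case using assms(1)[OF Cons(1)] by (simp add: mult.assoc) (simp add: mult.assoc[symmetric])
qed simp

lemma supp_wprod:
  assumes "supp I S \<Sigma>" "w \<in> lists I" "i \<in> I"
  shows "idm S * (wprod (sysA \<Sigma>) w * sysB \<Sigma> i) = wprod (sysA \<Sigma>) w * sysB \<Sigma> i"
  using assms by (cases w) (auto simp: supp_def mult.assoc[symmetric])

definition gens :: "'i set \<Rightarrow> ('i, (nat \<times> nat, 'k::field) rcf) lsys \<Rightarrow> (nat \<times> nat, 'k) rcf set" where
  "gens I \<Sigma> = {col (wprod (sysA \<Sigma>) w * sysB \<Sigma> i) u | w i u. w \<in> lists I \<and> i \<in> I}"

lemma gens_intros: "w \<in> lists I \<Longrightarrow> i \<in> I \<Longrightarrow> col (wprod (sysA \<Sigma>) w * sysB \<Sigma> i) u \<in> gens I \<Sigma>"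
  unfolding gens_def by blast

lemma gens_Cons: "i \<in> I \<Longrightarrow> z \<in> gens I \<Sigma> \<Longrightarrow> sysA \<Sigma> i * z \<in> gens I \<Sigma>"
proof -
  assume i: "i \<in> I" and "z \<in> gens I \<Sigma>"
  then obtain w k u where w: "w \<in> lists I" "k \<in> I" "z = col (wprod (sysA \<Sigma>) w * sysB \<Sigma> k) u"
    unfolding gens_def by blast
  then show "sysA \<Sigma> i * z \<in> gens I \<Sigma>"
    using gens_intros[of "i # w" I k \<Sigma> u] i by (simp add: mult.assoc)
qed

lemma gens_col: "z \<in> gens I \<Sigma> \<Longrightarrow> z * unt 1 o0 o0 = z"
  unfolding gens_def by (auto simp: mult.assoc unt_times_unt)

lemma gens_supp: "supp I S \<Sigma> \<Longrightarrow> z \<in> gens I \<Sigma> \<Longrightarrow> idm S * z = z"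
proof -
  assume su: "supp I S \<Sigma>" and "z \<in> gens I \<Sigma>"
  then obtain w k u where w: "w \<in> lists I" "k \<in> I" "z = col (wprod (sysA \<Sigma>) w * sysB \<Sigma> k) u"
    unfolding gens_def by blast
  have "idm S * z = col (idm S * (wprod (sysA \<Sigma>) w * sysB \<Sigma> k)) u" by (simp only: w mult.assoc)
  then show "idm S * z = z" using supp_wprod[OF su w(1,2)] w by simp
qed

lemma col_outside:
  assumes "G * idm T = G" "u \<notin> T" shows "col G u = 0"
proof -
  have "col G u = G * (idm T * unt 1 u o0)" using assms(1) by (simp add: mult.assoc[symmetric])
  then show ?thesis using assms(2) by (simp add: idm_times_unt)
qed

text \<open>Restriction to the reachable subspace.\<close>

lemma reachable_factor:
  assumes S: "finite S" and supp: "supp I S \<Sigma>"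
  obtains G r Gp where "G * idm (box r (Suc 0)) = G" "idm (box r (Suc 0)) * Gp = Gp" "Gp * G = idm (box r (Suc 0))"
    "idm S * G = G" "\<forall>j<r. col G (j, 0) \<in> gens I \<Sigma>"
    "\<forall>i\<in>I. sysA \<Sigma> i * G = G * (Gp * sysA \<Sigma> i * G)"
    "\<forall>i\<in>I. sysB \<Sigma> i = G * (Gp * sysB \<Sigma> i)"
proof -
  obtain G r Gp where g: "G * idm (box r (Suc 0)) = G" "idm (box r (Suc 0)) * Gp = Gp" "Gp * G = idm (box r (Suc 0))"
    "idm S * G = G" "\<forall>z\<in>gens I \<Sigma>. G * Gp * z = z" "\<forall>j<r. col G (j, 0) \<in> gens I \<Sigma>"
    by (rule rank_factor[OF S, of "gens I \<Sigma>", OF conjI[OF gens_supp[OF supp] gens_col]])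
  note G = g(1-4) g(5,6)[rule_format]
  have A: "sysA \<Sigma> i * G = G * (Gp * sysA \<Sigma> i * G)" if i: "i \<in> I" for i
  proof (rule cols_eqI[of _ o0])
    fix u show "col (sysA \<Sigma> i * G) u = col (G * (Gp * sysA \<Sigma> i * G)) u"
    proof (cases "u \<in> box r (Suc 0)")
      case True
      then obtain j where "u = (j, 0)" "j < r" by auto
      then have "sysA \<Sigma> i * col G u \<in> gens I \<Sigma>" using G(6) gens_Cons[OF i] by blast
      from G(5)[OF this] show ?thesis by (simp add: mult.assoc)
    next
      case False
      then show ?thesis using col_outside[OF G(1) False] by (simp add: mult.assoc)
    qed
  qed
  have B: "sysB \<Sigma> i = G * (Gp * sysB \<Sigma> i)" if i: "i \<in> I" for i
  proof (rule cols_eqI[of _ o0])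
    fix u
    have "col (sysB \<Sigma> i) u \<in> gens I \<Sigma>" using gens_intros[of "[]" I i \<Sigma> u] i by simp
    from G(5)[OF this] show "col (sysB \<Sigma> i) u = col (G * (Gp * sysB \<Sigma> i)) u"
      by (simp add: mult.assoc)
  qed
  show ?thesis using that[OF g(1-4,6)] A B by blast
qed

text \<open>A minimal system \<open>\<Sigma>\<close> is a subquotient of every system \<open>\<Sigma>'\<close> with the same moments: \<open>G\<close> includes the
  reachable subspace of \<open>\<Sigma>'\<close>, and \<open>H\<close> projects it onto \<open>\<Sigma>\<close>.\<close>

lemma compare_systems:
  fixes \<Sigma> \<Sigma>' :: "('i, (nat \<times> nat, 'k::field) rcf) lsys"
  assumes S: "finite S" "finite S'" and supp: "supp I S \<Sigma>" "supp I S' \<Sigma>'"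
    and mom: "moments_eq I \<Sigma> \<Sigma>'" and con: "contr I S \<Sigma>" and obs: "obsv I S \<Sigma>"
  obtains r G Gp At Bt H Hp where
    "G * idm (box r (Suc 0)) = G" "idm (box r (Suc 0)) * Gp = Gp" "Gp * G = idm (box r (Suc 0))" "idm S' * G = G"
    "\<And>i. i \<in> I \<Longrightarrow> sysA \<Sigma>' i * G = G * At i" "\<And>i. i \<in> I \<Longrightarrow> sysB \<Sigma>' i = G * Bt i"
    "\<And>i. i \<in> I \<Longrightarrow> idm (box r (Suc 0)) * At i = At i" "\<And>i. i \<in> I \<Longrightarrow> At i * idm (box r (Suc 0)) = At i"
    "\<And>i. i \<in> I \<Longrightarrow> At i = Gp * sysA \<Sigma>' i * G" "\<And>i. i \<in> I \<Longrightarrow> Bt i = Gp * sysB \<Sigma>' i"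
    "H * idm (box r (Suc 0)) = H" "idm S * H = H"
    "\<And>i. i \<in> I \<Longrightarrow> H * At i = sysA \<Sigma> i * H" "\<And>i. i \<in> I \<Longrightarrow> H * Bt i = sysB \<Sigma> i"
    "sysC \<Sigma> * H = sysC \<Sigma>' * G" "H * Hp = idm S" "idm (box r (Suc 0)) * Hp = Hp" "Hp * idm S = Hp"
proof -
  obtain G r Gp where g: "G * idm (box r (Suc 0)) = G" "idm (box r (Suc 0)) * Gp = Gp" "Gp * G = idm (box r (Suc 0))"
    "idm S' * G = G" "\<forall>j<r. col G (j, 0) \<in> gens I \<Sigma>'"
    "\<forall>i\<in>I. sysA \<Sigma>' i * G = G * (Gp * sysA \<Sigma>' i * G)"
    "\<forall>i\<in>I. sysB \<Sigma>' i = G * (Gp * sysB \<Sigma>' i)"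
    by (rule reachable_factor[OF S(2) supp(2)])
  note G = g(1-4) g(5)[rule_format] and GA = g(6)[rule_format] and GB = g(7)[rule_format]
  let ?At = "\<lambda>i. Gp * sysA \<Sigma>' i * G" and ?Bt = "\<lambda>i. Gp * sysB \<Sigma>' i"
  have "\<forall>j<r. \<exists>w i u. w \<in> lists I \<and> i \<in> I \<and> col G (j, 0) = col (wprod (sysA \<Sigma>') w * sysB \<Sigma>' i) u"
    using G(5) unfolding gens_def by blast
  then obtain w i u where wiu: "\<And>j. j < r \<Longrightarrow> w j \<in> lists I" "\<And>j. j < r \<Longrightarrow> i j \<in> I"
    "\<And>j. j < r \<Longrightarrow> col G (j, 0) = col (wprod (sysA \<Sigma>') (w j) * sysB \<Sigma>' (i j)) (u j)"
    by metis
  \<comment> \<open>\<open>H\<close> sends the basis vector that \<open>\<Sigma>'\<close> reaches by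
    a word to the state that \<open>\<Sigma>\<close> reaches by the same word. Equality of moments
    makes the outputs agree, which is \<open>CH\<close>.\<close>
  define h where "h j = col (wprod (sysA \<Sigma>) (w j) * sysB \<Sigma> (i j)) (u j)" for j
  define H where "H = (\<Sum>j<r. h j * unt 1 o0 (j, 0))"
  have hj: "h j * unt 1 o0 o0 = h j" for j by (simp add: h_def mult.assoc unt_times_unt)
  have Hcol: "col H (j, 0) = h j" if "j < r" for j
  proof -
    have "col H (j, 0) = (\<Sum>j'<r. if j' = j then h j' * unt 1 o0 o0 else 0)"
      unfolding H_def sum_distrib_right by (intro sum.cong refl) (auto simp: mult.assoc unt_times_unt)
    then show ?thesis using that by (simp add: hj)
  qed
  have Hr: "H * idm (box r (Suc 0)) = H"
    unfolding H_def sum_distrib_right by (intro sum.cong refl) (auto simp: mult.assoc unt_times_idm)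
  have SH: "idm S * H = H"
    unfolding H_def sum_distrib_left
  proof (intro sum.cong refl)
    fix j assume "j \<in> {..<r}"
    then have "idm S * h j = h j"
      using supp_wprod[OF supp(1) wiu(1,2), of j] by (simp add: h_def mult.assoc[symmetric])
    then show "idm S * (h j * unt 1 o0 (j, 0)) = h j * unt 1 o0 (j, 0)" by (simp add: mult.assoc[symmetric])
  qed
  have momI: "sysC \<Sigma> * wprod (sysA \<Sigma>) v * sysB \<Sigma> a = sysC \<Sigma>' * wprod (sysA \<Sigma>') v * sysB \<Sigma>' a"
    if "v \<in> lists I" "a \<in> I" for v a using mom that by (auto simp: moments_eq_def)
  have CH: "sysC \<Sigma> * wprod (sysA \<Sigma>) v * H = sysC \<Sigma>' * wprod (sysA \<Sigma>') v * G" if v: "v \<in> lists I" for v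
  proof (rule cols_eqI[of _ o0])
    fix t show "col (sysC \<Sigma> * wprod (sysA \<Sigma>) v * H) t = col (sysC \<Sigma>' * wprod (sysA \<Sigma>') v * G) t"
    proof (cases "t \<in> box r (Suc 0)")
      case True
      then obtain j where t: "t = (j, 0)" "j < r" by auto
      have vw: "v @ w j \<in> lists I" using v wiu(1)[OF t(2)] by simp
      have "col (sysC \<Sigma> * wprod (sysA \<Sigma>) v * H) t
          = sysC \<Sigma> * wprod (sysA \<Sigma>) (v @ w j) * sysB \<Sigma> (i j) * unt 1 (u j) o0"
        using Hcol[of j] t by (simp add: mult.assoc h_def)
      also have "\<dots> = sysC \<Sigma>' * wprod (sysA \<Sigma>') (v @ w j) * sysB \<Sigma>' (i j) * unt 1 (u j) o0"
        by (simp only: momI[OF vw wiu(2)[OF t(2)]])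
      also have "\<dots> = col (sysC \<Sigma>' * wprod (sysA \<Sigma>') v * G) t"
        using wiu(3)[of j] t by (simp add: mult.assoc)
      finally show ?thesis .
    next
      case False
      show ?thesis using col_outside[OF G(1) False] col_outside[OF Hr False] by (simp add: mult.assoc)
    qed
  qed
  \<comment> \<open>Observability as a cancellation law: the intertwining relations for
    \<open>H\<close> are verified on outputs.\<close>
  have obsD: "X = Y" if "idm S * X = X" "idm S * Y = Y"
    "\<And>v. v \<in> lists I \<Longrightarrow> sysC \<Sigma> * wprod (sysA \<Sigma>) v * X = sysC \<Sigma> * wprod (sysA \<Sigma>) v * Y" for X Y
    using obs[unfolded obsv_def, rule_format, of "X - Y"] that by (simp add: right_diff_distrib)
  have suppD: "sysC \<Sigma> * idm S = sysC \<Sigma>" "\<And>a. a \<in> I \<Longrightarrow> idm S * sysA \<Sigma> a = sysA \<Sigma> a"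
    "\<And>a. a \<in> I \<Longrightarrow> sysA \<Sigma> a * idm S = sysA \<Sigma> a" "\<And>a. a \<in> I \<Longrightarrow> idm S * sysB \<Sigma> a = sysB \<Sigma> a"
    using supp(1) by (auto simp: supp_def)
  have HA: "H * ?At a = sysA \<Sigma> a * H" if a: "a \<in> I" for a
  proof (rule obsD)
    show "idm S * (H * ?At a) = H * ?At a" by (simp add: mult.assoc[symmetric] SH)
    show "idm S * (sysA \<Sigma> a * H) = sysA \<Sigma> a * H" by (simp add: mult.assoc[symmetric] suppD a)
    fix v assume v: "v \<in> lists I"
    have "sysC \<Sigma> * wprod (sysA \<Sigma>) v * (H * ?At a) = (sysC \<Sigma> * wprod (sysA \<Sigma>) v * H) * ?At a"
      by (simp add: mult.assoc)
    also have "\<dots> = sysC \<Sigma>' * wprod (sysA \<Sigma>') v * (G * ?At a)"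
      unfolding CH[OF v] by (simp add: mult.assoc)
    also have "\<dots> = sysC \<Sigma>' * wprod (sysA \<Sigma>') (v @ [a]) * G"
      unfolding GA[OF a, symmetric] by (simp add: mult.assoc)
    also have "\<dots> = sysC \<Sigma> * wprod (sysA \<Sigma>) (v @ [a]) * H"
      using CH[of "v @ [a]"] v a by (simp add: in_lists_conv_set)
    finally show "sysC \<Sigma> * wprod (sysA \<Sigma>) v * (H * ?At a) = sysC \<Sigma> * wprod (sysA \<Sigma>) v * (sysA \<Sigma> a * H)"
      by (simp add: mult.assoc)
  qed
  have HB: "H * ?Bt a = sysB \<Sigma> a" if a: "a \<in> I" for a
  proof (rule obsD)
    show "idm S * (H * ?Bt a) = H * ?Bt a" by (simp add: mult.assoc[symmetric] SH)
    show "idm S * sysB \<Sigma> a = sysB \<Sigma> a" by (simp add: suppD a)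
    fix v assume v: "v \<in> lists I"
    have "sysC \<Sigma> * wprod (sysA \<Sigma>) v * (H * ?Bt a) = (sysC \<Sigma> * wprod (sysA \<Sigma>) v * H) * ?Bt a"
      by (simp add: mult.assoc)
    also have "\<dots> = sysC \<Sigma>' * wprod (sysA \<Sigma>') v * (G * ?Bt a)"
      unfolding CH[OF v] by (simp add: mult.assoc)
    also have "\<dots> = sysC \<Sigma> * wprod (sysA \<Sigma>) v * sysB \<Sigma> a"
      unfolding GB[OF a, symmetric] momI[OF v a] ..
    finally show "sysC \<Sigma> * wprod (sysA \<Sigma>) v * (H * ?Bt a) = sysC \<Sigma> * wprod (sysA \<Sigma>) v * sysB \<Sigma> a" .
  qed
  \<comment> \<open>Surjectivity of \<open>H\<close>. A basis \<open>O2\<close> of its column space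
    is chosen among its columns; \<open>1 - O2 * Op\<close> annihilates all reachable states of
    \<open>\<Sigma>\<close>, so controllability makes \<open>O2\<close> span. Selecting the chosen
    columns by \<open>Sel\<close> yields the right inverse.\<close>
  obtain O2 r2 Op where O2: "O2 * idm (box r2 (Suc 0)) = O2" "O2 * Op * H = H"
    "\<And>j. j < r2 \<Longrightarrow> col O2 (j, 0) \<in> {col H (j, 0) | j. j < r}"
  proof -
    let ?Gen = "{col H (j, 0) | j. j < r}"
    have Gen: "idm S * z = z \<and> z * unt 1 o0 o0 = z" if "z \<in> ?Gen" for z
    proof -
      have "idm S * (H * a) = H * a" for a by (simp add: mult.assoc[symmetric] SH)
      then show ?thesis using that by (auto simp: mult.assoc unt_times_unt)
    qed
    obtain O2 r2 Op where g: "O2 * idm (box r2 (Suc 0)) = O2" "idm (box r2 (Suc 0)) * Op = Op" "Op * O2 = idm (box r2 (Suc 0))"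
      "idm S * O2 = O2" "\<forall>z\<in>?Gen. O2 * Op * z = z" "\<forall>j<r2. col O2 (j, 0) \<in> ?Gen"
      by (rule rank_factor[OF S(1), of ?Gen, OF Gen])
    note O2 = g(1-4) g(5,6)[rule_format]
    have "O2 * Op * H = H"
    proof (rule cols_eqI[of _ o0])
      fix t show "col (O2 * Op * H) t = col H t"
      proof (cases "t \<in> box r (Suc 0)")
        case True
        then have "O2 * Op * col H t = col H t" by (intro O2(5)) auto
        then show ?thesis by (simp add: mult.assoc)
      next
        case False
        show ?thesis using col_outside[OF Hr False] by (simp add: mult.assoc)
      qed
    qed
    then show ?thesis by (rule that[OF O2(1) _ O2(6)])
  qed
  have "\<forall>v\<in>lists I. \<forall>a\<in>I. (1 - O2 * Op) * wprod (sysA \<Sigma>) v * sysB \<Sigma> a = 0"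
  proof (intro ballI)
    fix v a assume v: "v \<in> lists I" and a: "a \<in> I"
    have "wprod (sysA \<Sigma>) v * sysB \<Sigma> a = wprod (sysA \<Sigma>) v * H * ?Bt a"
      by (simp add: HB[OF a] mult.assoc)
    also have "\<dots> = H * wprod ?At v * ?Bt a"
      using wprod_intertwine[of I "sysA \<Sigma>" H ?At v] HA v by simp
    finally have "wprod (sysA \<Sigma>) v * sysB \<Sigma> a = H * (wprod ?At v * ?Bt a)" by (simp only: mult.assoc)
    then show "(1 - O2 * Op) * wprod (sysA \<Sigma>) v * sysB \<Sigma> a = 0"
      by (simp add: mult.assoc left_diff_distrib) (simp add: mult.assoc[symmetric] O2)
  qed
  then have "(1 - O2 * Op) * idm S = 0" using con unfolding contr_def by blast
  then have OS: "O2 * Op * idm S = idm S" by (simp add: left_diff_distrib)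
  have "\<forall>j<r2. \<exists>k<r. col O2 (j, 0) = col H (k, 0)" using O2(3) by blast
  then obtain k where k: "\<And>j. j < r2 \<Longrightarrow> k j < r" "\<And>j. j < r2 \<Longrightarrow> col O2 (j, 0) = col H (k j, 0)"
    by metis
  define Sel where "Sel = (\<Sum>j<r2. unt (1::'k) (k j, 0) (j, 0::nat))"
  have "O2 = H * Sel"
  proof (rule cols_eqI[of _ o0])
    fix t show "col O2 t = col (H * Sel) t"
    proof (cases "t \<in> box r2 (Suc 0)")
      case True
      then obtain j where t: "t = (j, 0)" "j < r2" by auto
      have "Sel * unt 1 t o0 = (\<Sum>j'<r2. if j' = j then unt 1 (k j', 0) o0 else 0)"
        unfolding Sel_def sum_distrib_right t by (intro sum.cong refl) (auto simp: unt_times_unt)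
      then show ?thesis using t k by (simp add: mult.assoc)
    next
      case False
      have "Sel * unt 1 t o0 = 0"
        unfolding Sel_def sum_distrib_right using False by (intro sum.neutral) (auto simp: unt_times_unt)
      then show ?thesis using col_outside[OF O2(1) False] by (simp add: mult.assoc)
    qed
  qed
  then have "H * (Sel * Op * idm S) = idm S" using OS by (simp add: mult.assoc)
  then have Hp: "H * (idm (box r (Suc 0)) * Sel * Op * idm S) = idm S"
    using Hr by (metis mult.assoc)
  have idr: "idm (box r (Suc 0)) * (idm (box r (Suc 0)) * z) = idm (box r (Suc 0)) * z" for z :: "(nat \<times> nat, 'k) rcf"
    by (simp add: mult.assoc[symmetric] idm_times_idm)
  show ?thesis
    by (rule that[of G r Gp ?At ?Bt H "idm (box r (Suc 0)) * Sel * Op * idm S"])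
      (use G GA GB Hr SH HA HB CH[of "[]"] Hp in
        \<open>simp_all add: mult.assoc idm_times_idm idr, simp_all add: mult.assoc[symmetric]\<close>)
qed

text \<open>Kalman reduction: restriction to the reachable subspace, then division by the
  unobservable part. The second half is the first one transposed, with the rows of all
  \<open>C * wprod A w\<close> in place of the reachable columns.\<close>

lemma minimal_system_exists:
  fixes \<Sigma>' :: "('i, (nat \<times> nat, 'k::field) rcf) lsys"
  assumes S': "finite S'" and supp': "supp I S' \<Sigma>'"
    and f: "finite T" "idm T * sysC \<Sigma>' = sysC \<Sigma>'" "\<And>i. i \<in> I \<Longrightarrow> sysB \<Sigma>' i * idm T = sysB \<Sigma>' i"
  obtains L \<Sigma> where "supp I (box L (Suc 0)) \<Sigma>" "moments_eq I \<Sigma> \<Sigma>'" "contr I (box L (Suc 0)) \<Sigma>" "obsv I (box L (Suc 0)) \<Sigma>"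
    "idm T * sysC \<Sigma> = sysC \<Sigma>" "\<And>i. i \<in> I \<Longrightarrow> sysB \<Sigma> i * idm T = sysB \<Sigma> i"
proof -
  obtain G r Gp where g: "G * idm (box r (Suc 0)) = G" "idm (box r (Suc 0)) * Gp = Gp" "Gp * G = idm (box r (Suc 0))"
    "idm S' * G = G" "\<forall>j<r. col G (j, 0) \<in> gens I \<Sigma>'"
    "\<forall>i\<in>I. sysA \<Sigma>' i * G = G * (Gp * sysA \<Sigma>' i * G)"
    "\<forall>i\<in>I. sysB \<Sigma>' i = G * (Gp * sysB \<Sigma>' i)"
    by (rule reachable_factor[OF S' supp'])
  note G = g(1-4) g(5)[rule_format] and GA = g(6)[rule_format] and GB = g(7)[rule_format]
  define A where "A i = Gp * sysA \<Sigma>' i * G" for i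
  define B where "B i = Gp * sysB \<Sigma>' i" for i
  define C where "C = sysC \<Sigma>' * G"
  let ?\<epsilon> = "idm (box r (Suc 0)) :: (nat \<times> nat, 'k) rcf"
  have AG: "wprod (sysA \<Sigma>') w * G = G * wprod A w" if "w \<in> lists I" for w
    using wprod_intertwine[of I "sysA \<Sigma>'" G A w] GA that by (simp add: A_def)
  have \<epsilon>A: "?\<epsilon> * A i = A i" "A i * ?\<epsilon> = A i" "?\<epsilon> * B i = B i" for i
    by (simp_all add: A_def B_def mult.assoc G) (simp_all add: mult.assoc[symmetric] G)
  have \<epsilon>w: "?\<epsilon> * (wprod A w * B i) = wprod A w * B i" for w i
    by (cases w) (simp_all add: \<epsilon>A mult.assoc[symmetric])
  have con: "Z * ?\<epsilon> = 0" if Z: "\<And>w i. w \<in> lists I \<Longrightarrow> i \<in> I \<Longrightarrow> Z * wprod A w * B i = 0" for Z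
  proof (rule cols_zero_imp_zero[of _ o0])
    fix t show "col (Z * ?\<epsilon>) t = 0"
    proof (cases "t \<in> box r (Suc 0)")
      case True
      then obtain j where t: "t = (j, 0)" "j < r" by auto
      obtain w i u where w: "w \<in> lists I" "i \<in> I" "col G t = col (wprod (sysA \<Sigma>') w * sysB \<Sigma>' i) u"
        using G(5)[of j] t by (auto simp: gens_def)
      have "col (wprod (sysA \<Sigma>') w * sysB \<Sigma>' i) u = col (wprod (sysA \<Sigma>') w * (G * B i)) u"
        using GB[OF w(2)] by (simp add: B_def)
      also have "\<dots> = G * (wprod A w * B i) * unt 1 u o0"
        using AG[OF w(1)] by (simp add: mult.assoc[symmetric])
      finally have "Gp * col G t = Gp * (G * (wprod A w * B i) * unt 1 u o0)" using w by simp
      then have "?\<epsilon> * unt 1 t o0 = ?\<epsilon> * (wprod A w * B i) * unt 1 u o0"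
        by (simp add: mult.assoc[symmetric] G)
      then have "?\<epsilon> * unt 1 t o0 = wprod A w * B i * unt 1 u o0" by (simp add: \<epsilon>w)
      then show ?thesis using Z[OF w(1,2)] by (simp add: mult.assoc) (simp add: mult.assoc[symmetric])
    next
      case False
      then show ?thesis by (simp add: mult.assoc idm_times_unt)
    qed
  qed
  define Gen where "Gen = {trp (unt 1 o0 u * (C * wprod A w)) | u w. w \<in> lists I}"
  have C\<epsilon>: "C * ?\<epsilon> = C" by (simp add: C_def mult.assoc G)
  have Cw: "C * wprod A w * ?\<epsilon> = C * wprod A w" for w
  proof (cases w rule: rev_cases)
    case (snoc w' a)
    then show ?thesis by (simp add: mult.assoc \<epsilon>A)
  qed (simp add: C\<epsilon>)
  have Gen: "idm (box r (Suc 0)) * z = z \<and> z * unt 1 o0 o0 = z" if "z \<in> Gen" for z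
  proof -
    obtain u w where "z = trp (unt 1 o0 u * (C * wprod A w))" using \<open>z \<in> Gen\<close> by (auto simp: Gen_def)
    then have "trp z = unt 1 o0 u * (C * wprod A w)" by simp
    then have "trp (idm (box r (Suc 0)) * z) = trp z" "trp (z * unt 1 o0 o0) = trp z"
      by (simp_all add: trp_times mult.assoc Cw[unfolded mult.assoc]) (simp add: mult.assoc[symmetric] unt_times_unt)
    then show ?thesis by (metis trp_trp)
  qed
  obtain G2 L Gp2 where g2: "G2 * idm (box L (Suc 0)) = G2" "idm (box L (Suc 0)) * Gp2 = Gp2" "Gp2 * G2 = idm (box L (Suc 0))"
    "idm (box r (Suc 0)) * G2 = G2" "\<forall>z\<in>Gen. G2 * Gp2 * z = z" "\<forall>j<L. col G2 (j, 0) \<in> Gen"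
    by (rule rank_factor[of "box r (Suc 0)" Gen, OF finite_SigmaI[OF finite_lessThan finite_lessThan] Gen])
  note G2 = g2(1-4) g2(5,6)[rule_format]
  \<comment> \<open>The rows of \<open>R\<close> are a basis of the span of all observation
    functionals. So the kernel of \<open>R\<close> in the reachable space is the unobservable
    subspace, and \<open>R\<close> is the projection to the quotient.\<close>
  define R where "R = trp G2"
  define Rp where "Rp = trp Gp2"
  let ?e = "idm (box L (Suc 0)) :: (nat \<times> nat, 'k) rcf"
  have R: "?e * R = R" "Rp * ?e = Rp" "R * Rp = ?e" "R * ?\<epsilon> = R"
    using arg_cong[OF G2(1), of trp] arg_cong[OF G2(2), of trp] arg_cong[OF G2(3), of trp] arg_cong[OF G2(4), of trp]
    by (simp_all add: R_def Rp_def trp_times)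
  have row: "C * wprod A w * Rp * R = C * wprod A w" if w: "w \<in> lists I" for w
  proof -
    have "trp (C * wprod A w * Rp * R) = trp (C * wprod A w)"
    proof (rule cols_eqI[of _ o0])
      fix u
      have "trp (unt 1 o0 u * (C * wprod A w)) \<in> Gen" using w unfolding Gen_def by blast
      from G2(5)[OF this] show "col (trp (C * wprod A w * Rp * R)) u = col (trp (C * wprod A w)) u"
        by (simp add: trp_times R_def Rp_def mult.assoc)
    qed
    then show ?thesis by (metis trp_trp)
  qed
  define A2 where "A2 i = R * A i * Rp" for i
  define B2 where "B2 i = R * B i" for i
  define C2 where "C2 = C * Rp"
  have Rrow: "\<exists>u w. w \<in> lists I \<and> unt 1 o0 (j, 0) * R = unt 1 o0 u * (C * wprod A w)" if "j < L" for j
  proof -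
    obtain u w where "w \<in> lists I" "col G2 (j, 0) = trp (unt 1 o0 u * (C * wprod A w))"
      using G2(6)[OF \<open>j < L\<close>] by (auto simp: Gen_def)
    then have "w \<in> lists I" "trp (col G2 (j, 0)) = unt 1 o0 u * (C * wprod A w)" by simp_all
    moreover have "trp (col G2 (j, 0)) = unt 1 o0 (j, 0) * R" by (simp add: trp_times R_def)
    ultimately show ?thesis by metis
  qed
  have rows_zeroI: "X = 0" if "?e * X = X" "\<And>j. j < L \<Longrightarrow> unt 1 o0 (j, 0) * X = 0" for X
  proof (rule rcf_eqI)
    fix p q show "ent X p q = ent 0 p q"
    proof (cases "p \<in> box L (Suc 0)")
      case True
      then obtain j where "p = (j, 0)" "j < L" by auto
      then show ?thesis using arg_cong[OF that(2)[of j], of "\<lambda>X. ent X o0 q"] by (simp add: ent_unt_times)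
    next
      case False
      then show ?thesis using arg_cong[OF that(1), of "\<lambda>X. ent X p q"] by (simp add: ent_idm_times)
    qed
  qed
  have RA: "A2 i * R = R * A i" if i: "i \<in> I" for i
  proof -
    have "A2 i * R - R * A i = 0"
    proof (rule rows_zeroI)
      show "?e * (A2 i * R - R * A i) = A2 i * R - R * A i"
        by (simp add: A2_def right_diff_distrib mult.assoc[symmetric] R)
      fix j assume "j < L"
      then obtain u w where w: "w \<in> lists I" "unt 1 o0 (j, 0) * R = unt 1 o0 u * (C * wprod A w)"
        using Rrow by blast
      have "unt 1 o0 (j, 0) * (A2 i * R) = (unt 1 o0 (j, 0) * R) * (A i * (Rp * R))"
        by (simp add: A2_def mult.assoc)
      also have "\<dots> = unt 1 o0 u * (C * wprod A (w @ [i]) * Rp * R)"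
        by (simp add: w mult.assoc)
      also have "\<dots> = unt 1 o0 u * (C * wprod A (w @ [i]))"
        using row[of "w @ [i]"] w i by simp
      also have "\<dots> = unt 1 o0 (j, 0) * (R * A i)"
        by (simp add: mult.assoc[symmetric] w(2))
      finally show "unt 1 o0 (j, 0) * (A2 i * R - R * A i) = 0" by (simp add: right_diff_distrib)
    qed
    then show ?thesis by simp
  qed
  have C2R: "C2 * R = C" using row[of "[]"] by (simp add: C2_def)
  have RwA: "wprod A2 w * R = R * wprod A w" if "w \<in> lists I" for w
    using wprod_intertwine[of I A2 R A w] RA that by simp
  define \<Sigma> where "\<Sigma> = \<lparr>sysD = sysD \<Sigma>', sysC = C2, sysA = A2, sysB = B2\<rparr>"
  show ?thesis
  proof (rule that[of L \<Sigma>])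
    show "supp I (box L (Suc 0)) \<Sigma>"
      by (simp add: supp_def \<Sigma>_def A2_def B2_def C2_def mult.assoc R)
        (simp add: mult.assoc[symmetric] R)
    show "moments_eq I \<Sigma> \<Sigma>'"
      unfolding moments_eq_def \<Sigma>_def lsys.simps
    proof (intro conjI refl ballI)
      fix w i assume w: "w \<in> lists I" and i: "i \<in> I"
      have "C2 * wprod A2 w * B2 i = C2 * (wprod A2 w * R) * B i" by (simp add: B2_def mult.assoc)
      also have "\<dots> = (C2 * R) * wprod A w * B i" using RwA[OF w] by (simp add: mult.assoc)
      also have "\<dots> = sysC \<Sigma>' * (G * wprod A w) * B i" by (simp add: C2R C_def mult.assoc)
      also have "\<dots> = sysC \<Sigma>' * wprod (sysA \<Sigma>') w * (G * B i)"
        unfolding AG[OF w, symmetric] by (simp only: mult.assoc)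
      finally show "C2 * wprod A2 w * B2 i = sysC \<Sigma>' * wprod (sysA \<Sigma>') w * sysB \<Sigma>' i"
        using GB[OF i] by (simp add: B_def)
    qed
    show "contr I (box L (Suc 0)) \<Sigma>"
      unfolding contr_def \<Sigma>_def lsys.simps
    proof (intro allI impI)
      fix Z assume Z: "\<forall>w\<in>lists I. \<forall>i\<in>I. Z * wprod A2 w * B2 i = 0"
      have "Z * R * ?\<epsilon> = 0"
      proof (rule con)
        fix w i assume w: "w \<in> lists I" and i: "i \<in> I"
        have "Z * R * wprod A w * B i = Z * wprod A2 w * B2 i"
          using RwA[OF w] by (simp add: B2_def mult.assoc) (simp add: mult.assoc[symmetric])
        then show "Z * R * wprod A w * B i = 0" using Z w i by simp
      qed
      then have "Z * R * ?\<epsilon> * Rp = 0" by simp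
      then show "Z * ?e = 0" using R by (simp add: mult.assoc)
    qed
    show "obsv I (box L (Suc 0)) \<Sigma>"
      unfolding obsv_def \<Sigma>_def lsys.simps
    proof (intro allI impI)
      fix Z assume Z: "\<forall>w\<in>lists I. C2 * wprod A2 w * Z = 0"
      show "?e * Z = 0"
      proof (rule rows_zeroI)
        show "?e * (?e * Z) = ?e * Z" by (simp add: mult.assoc[symmetric] idm_times_idm)
        fix j assume "j < L"
        then obtain u w where w: "w \<in> lists I" "unt 1 o0 (j, 0) * R = unt 1 o0 u * (C * wprod A w)"
          using Rrow by blast
        have "C * wprod A w = C2 * wprod A2 w * R"
          using RwA[OF w(1)] by (simp add: mult.assoc C2R[symmetric])
        then have "unt 1 o0 (j, 0) * (R * Rp) = unt 1 o0 u * (C2 * wprod A2 w * (R * Rp))"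
          using w(2) by (simp add: mult.assoc[symmetric])
        then have "unt 1 o0 (j, 0) * ?e * Z = unt 1 o0 u * (C2 * wprod A2 w * ?e * Z)"
          by (simp add: R mult.assoc)
        moreover have "C2 * wprod A2 w * ?e = C2 * wprod A2 w"
        proof (cases w rule: rev_cases)
          case (snoc w' a)
          then show ?thesis by (simp add: mult.assoc A2_def R)
        qed (simp add: C2_def mult.assoc R)
        ultimately have "unt 1 o0 (j, 0) * ?e * Z = unt 1 o0 u * (C2 * wprod A2 w * Z)" by simp
        then show "unt 1 o0 (j, 0) * (?e * Z) = 0"
          using Z w(1) by (simp add: mult.assoc)
      qed
    qed
    show "idm T * sysC \<Sigma> = sysC \<Sigma>" "\<And>i. i \<in> I \<Longrightarrow> sysB \<Sigma> i * idm T = sysB \<Sigma> i"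
      using f by (simp_all add: \<Sigma>_def C2_def C_def B2_def B_def mult.assoc[symmetric])
        (simp add: mult.assoc)
  qed
qed

section \<open>Change of centre\<close>

interpretation fld: unital_algebra "(*) :: 'k::field \<Rightarrow> 'k \<Rightarrow> 'k"
  by unfold_locales (auto simp: algebra_simps)

text \<open>An annihilator stable under \<open>P\<^sup>-\<^sup>1\<close> is stable under \<open>P\<close>, by finite dimensionality.\<close>

lemma annihilator_stable:
  fixes P Q :: "(nat \<times> nat, 'k::field) rcf"
  assumes QP: "Q * P = 1" "P * Q = 1" and S: "finite S"
    and e: "idm S * (1 - P) = 1 - P" "(1 - P) * idm S = 1 - P" "\<And>R. R \<in> \<S> \<Longrightarrow> R * idm S = R"
    and stable: "\<And>Z R. (\<And>R. R \<in> \<S> \<Longrightarrow> R * Z = 0) \<Longrightarrow> R \<in> \<S> \<Longrightarrow> R * (Q * Z) = 0"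
    and Z: "\<And>R. R \<in> \<S> \<Longrightarrow> R * Z = 0" and R: "R \<in> \<S>"
  shows "R * (P * Z) = 0"
proof -
  let ?e = "idm S"
  have eP: "?e * P = P * ?e" using e by (simp add: algebra_simps)
  have "?e * Q = Q * P * ?e * Q" using QP by simp
  also have "\<dots> = Q * ?e * (P * Q)" by (simp add: mult.assoc eP[symmetric])
  finally have eQ: "?e * Q = Q * ?e" using QP by simp
  define Gen where "Gen = {col Z u | Z u. (\<forall>R\<in>\<S>. R * Z = 0) \<and> ?e * Z = Z}"
  have Gen: "?e * z = z \<and> z * unt 1 o0 o0 = z" if z: "z \<in> Gen" for z
  proof -
    obtain Z u where z: "z = col Z u" "?e * Z = Z" using z unfolding Gen_def by blast
    have "?e * z = col (?e * Z) u" by (simp only: z(1) mult.assoc)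
    then show ?thesis by (simp add: z mult.assoc unt_times_unt)
  qed
  obtain G r Gp where g: "G * idm (box r (Suc 0)) = G" "idm (box r (Suc 0)) * Gp = Gp"
    "Gp * G = idm (box r (Suc 0))" "?e * G = G" "\<forall>z\<in>Gen. G * Gp * z = z" "\<forall>j<r. col G (j, 0) \<in> Gen"
    by (rule rank_factor[OF S, of Gen, OF Gen])
  note G = g(1-4) g(5,6)[rule_format]
  let ?\<epsilon> = "idm (box r (Suc 0)) :: (nat \<times> nat, 'k) rcf"
  have RG: "R * G = 0" if R': "R \<in> \<S>" for R
  proof (rule cols_zero_imp_zero[of _ o0])
    fix t show "col (R * G) t = 0"
    proof (cases "t \<in> box r (Suc 0)")
      case True
      then obtain j where t: "t = (j, 0)" "j < r" by auto
      obtain Z u where Zu: "col G (j, 0) = col Z u" "\<forall>R\<in>\<S>. R * Z = 0"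
        using G(6)[OF t(2)] unfolding Gen_def by blast
      have "col (R * G) t = col (R * Z) u" using Zu(1) by (simp add: t mult.assoc)
      then show ?thesis using Zu(2) R' by simp
    next
      case False
      then show ?thesis using col_outside[OF G(1) False] by (simp add: mult.assoc)
    qed
  qed
  have QG: "Q * G = G * (Gp * Q * G)"
  proof (rule cols_eqI[of _ o0])
    fix t show "col (Q * G) t = col (G * (Gp * Q * G)) t"
    proof (cases "t \<in> box r (Suc 0)")
      case True
      then obtain j where t: "t = (j, 0)" "j < r" by auto
      obtain Z u where Zu: "col G (j, 0) = col Z u" "\<forall>R\<in>\<S>. R * Z = 0" "?e * Z = Z"
        using G(6)[OF t(2)] unfolding Gen_def by blast
      have "\<forall>R\<in>\<S>. R * (Q * Z) = 0" using stable Zu(2) by blast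
      moreover have "?e * (Q * Z) = Q * Z"
        by (simp add: mult.assoc[symmetric] eQ) (simp add: mult.assoc Zu)
      ultimately have "col (Q * Z) u \<in> Gen" unfolding Gen_def by blast
      from G(5)[OF this] Zu(1) show ?thesis by (simp add: t mult.assoc)
    next
      case False
      then show ?thesis using col_outside[OF G(1) False] by (simp add: mult.assoc)
    qed
  qed
  \<comment> \<open>\<open>M\<close> is the matrix of \<open>Q\<close> on the annihilator, in the
    basis \<open>G\<close>. In finite dimension \<open>N * M = 1\<close> gives
    \<open>M * N = 1\<close>: the annihilator is mapped by \<open>Q\<close> onto itself, and
    \<open>P\<close> maps it back.\<close>
  define M where "M = Gp * Q * G"
  define N where "N = Gp * P * G"
  have "N * M = Gp * P * (G * M)" by (simp add: N_def mult.assoc)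
  also have "\<dots> = Gp * (P * Q) * G" unfolding M_def QG[symmetric] by (simp add: mult.assoc)
  finally have NM: "N * M = ?\<epsilon>" using QP G by simp
  have MN: "M * N = ?\<epsilon>"
    by (rule rcf_inverse_commute[OF stably_finite_field _ _ _ _ _ NM])
      (simp_all add: M_def N_def mult.assoc G, simp_all add: mult.assoc[symmetric] G)
  have "P * G = P * (G * (M * N))" by (simp add: MN G)
  also have "\<dots> = P * (G * M) * N" by (simp only: mult.assoc)
  also have "\<dots> = (P * Q) * G * N" unfolding M_def QG[symmetric] by (simp add: mult.assoc)
  finally have PG: "P * G = G * N" using QP by simp
  have eZ: "?e * Z = G * (Gp * (?e * Z))"
  proof (rule cols_eqI[of _ o0])
    fix u
    have "R * (?e * Z) = 0" if "R \<in> \<S>" for R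
      using Z[OF that] e(3)[OF that] by (simp add: mult.assoc[symmetric])
    moreover have "?e * (?e * Z) = ?e * Z" by (simp add: mult.assoc[symmetric] idm_times_idm)
    ultimately have "col (?e * Z) u \<in> Gen" unfolding Gen_def by blast
    from G(5)[OF this] show "col (?e * Z) u = col (G * (Gp * (?e * Z))) u" by (simp add: mult.assoc)
  qed
  have "R * (P * (?e * Z)) = R * (P * G) * (Gp * (?e * Z))" by (subst eZ) (simp only: mult.assoc)
  also have "\<dots> = (R * G) * N * (Gp * (?e * Z))" unfolding PG by (simp only: mult.assoc)
  finally have 1: "R * (P * (?e * Z)) = 0" using RG[OF R] by simp
  \<comment> \<open>Off \<open>S\<close> the matrix \<open>P\<close> is the identity, which settles
    the remaining part of \<open>Z\<close>.\<close>
  have "P * (1 - ?e) = 1 - ?e" using e(2) by (simp add: algebra_simps)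
  then have "R * (P * ((1 - ?e) * Z)) = R * (1 - ?e) * Z" by (simp add: mult.assoc[symmetric])
  also have "\<dots> = 0" using e(3)[OF R] by (simp add: right_diff_distrib)
  finally have "R * (P * ((1 - ?e) * Z)) = 0" .
  with 1 show ?thesis by (simp add: algebra_simps)
qed

text \<open>Transposition exchanges left and right annihilators, which reduces this to
  \<open>annihilator_stable\<close>.\<close>

lemma annihilator_stable_left:
  fixes P Q :: "(nat \<times> nat, 'k::field) rcf"
  assumes QP: "Q * P = 1" "P * Q = 1" and S: "finite S"
    and e: "idm S * (1 - P) = 1 - P" "(1 - P) * idm S = 1 - P" "\<And>R. R \<in> \<S> \<Longrightarrow> idm S * R = R"
    and stable: "\<And>Z R. (\<And>R. R \<in> \<S> \<Longrightarrow> Z * R = 0) \<Longrightarrow> R \<in> \<S> \<Longrightarrow> Z * Q * R = 0"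
    and Z: "\<And>R. R \<in> \<S> \<Longrightarrow> Z * R = 0" and R: "R \<in> \<S>"
  shows "Z * P * R = 0"
proof -
  have "trp R * (trp P * trp Z) = 0"
  proof (rule annihilator_stable[where \<S> = "trp ` \<S>" and Q = "trp Q" and S = S])
    show "trp Q * trp P = 1" "trp P * trp Q = 1"
      using QP by (simp_all add: trp_times[symmetric])
    show "idm S * (1 - trp P) = 1 - trp P" "(1 - trp P) * idm S = 1 - trp P"
      using e(1,2)[THEN arg_cong, of trp] by (simp_all add: trp_times trp_minus)
    show "R * idm S = R" if "R \<in> trp ` \<S>" for R
      using that e(3)[THEN arg_cong, of _ trp] by (auto simp: trp_times)
    show "R * (trp Q * Z) = 0" if Z: "\<And>R. R \<in> trp ` \<S> \<Longrightarrow> R * Z = 0" and R: "R \<in> trp ` \<S>" for Z R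
    proof -
      have "trp Z * R' = 0" if "R' \<in> \<S>" for R'
        using Z[OF imageI[OF that], THEN arg_cong, of trp] by (simp add: trp_times)
      then have "trp Z * Q * trp R = 0" using stable[of "trp Z" "trp R"] R by auto
      from arg_cong[OF this, of trp] show ?thesis by (simp add: trp_times mult.assoc)
    qed
    show "R * trp Z = 0" if "R \<in> trp ` \<S>" for R
      using that Z[THEN arg_cong, of _ trp] by (auto simp: trp_times)
    show "trp R \<in> trp ` \<S>" using R by simp
  qed (rule S)
  from arg_cong[OF this, of trp] show ?thesis by (simp add: trp_times mult.assoc)
qed

text \<open>Multiplication by a scalar, as a central element of the ring of matrices.\<close>

definition scl :: "'k::field \<Rightarrow> ('i, 'k) rcf" where
  "scl c = Mk (\<lambda>i j. if i = j then c else 0)"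

lemma ent_scl: "ent (scl c) i j = (if i = j then c else 0)"
  unfolding scl_def by (subst ent_Mk) (auto intro: finite_subset[of _ "{i}" for i])

lemma ent_scl_times: "ent (scl c * M) i j = c * ent M i j"
  by (subst ent_times[of "{i}"]) (auto simp: ent_scl)

lemma scl_commute: "M * scl c = scl c * M"
  by (rule rcf_eqI) (subst ent_times[of "{j}" for j], auto simp: ent_scl ent_scl_times)

lemma lft_times: "lft (X * Y) = (lft X * lft Y :: ('i \<times> nat, 'a::ring) rcf)"
proof (rule rcf_eqI)
  fix a b :: "'i \<times> nat"
  obtain u c v c' where a: "a = (u, c)" and b: "b = (v, c')" by fastforce
  let ?J = "{d. ent X c d \<noteq> 0}"
  have "ent (lft X * lft Y) a b = (\<Sum>j\<in>{u} \<times> ?J. ent (lft X) a j * ent (lft Y) j b)"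
    by (rule ent_times) (auto simp: a b ent_lft finite_row split: if_splits)
  also have "\<dots> = (\<Sum>d\<in>?J. ent (lft X) a (u, d) * ent (lft Y) (u, d) b)"
    by (rule sum.reindex_cong[of "\<lambda>d. (u, d)"]) (auto simp: inj_on_def)
  also have "\<dots> = ent (lft (X * Y)) a b"
    by (auto simp: a b ent_lft ent_times_row)
  finally show "ent (lft (X * Y)) a b = ent (lft X * lft Y) a b" by simp
qed

lemma lft_zero [simp]: "lft 0 = (0 :: ('i \<times> nat, 'a::ab_group_add) rcf)"
proof (rule rcf_eqI)
  fix a b show "ent (lft 0 :: ('i \<times> nat, 'a) rcf) a b = ent 0 a b"
    by (cases a; cases b) (simp add: ent_lft)
qed

lemma idm_box: "idm (A \<times> B) = kap (*) (idm A) * (lft (idm B) :: ('i \<times> nat, 'k::field) rcf)"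
proof (rule rcf_eqI)
  fix a b show "ent (idm (A \<times> B)) a b = ent (kap (*) (idm A) * (lft (idm B) :: ('i \<times> nat, 'k) rcf)) a b"
    by (cases a; cases b) (auto simp: ent_idm fld.ent_kap_lft)
qed

lemma lft_idm: "finite B \<Longrightarrow> lft (idm B) = (\<Sum>p\<in>B. lft (unt 1 p p) :: ('i \<times> nat, 'a::{ring,monoid_mult}) rcf)"
proof (rule rcf_eqI)
  fix a b assume "finite B" then show "ent (lft (idm B) :: ('i \<times> nat, 'a) rcf) a b = ent (\<Sum>p\<in>B. lft (unt 1 p p)) a b"
    by (cases a; cases b) (auto simp: ent_sum ent_lft ent_unt ent_idm intro!: sum.neutral)
qed

text \<open>The system \<open>(d, c, a, b)\<close>, with coefficients supported in \<open>{..<L}\<close>, placed at the \<open>0\<close>-th copy of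
  the state space, and its translate to the centre with coordinates \<open>wt\<close>, of size \<open>m\<close>.\<close>

locale recentring =
  fixes a b :: "'i \<Rightarrow> (nat, 'k::field) rcf" and c d :: "(nat, 'k) rcf" and I :: "'i set"
    and L m :: nat and wt :: "'i \<Rightarrow> nat \<Rightarrow> nat \<Rightarrow> 'k" and Q :: "(nat \<times> nat, 'k) rcf"
  assumes I: "finite I" and m: "m \<ge> 1"
    and a: "\<And>i. i \<in> I \<Longrightarrow> idm {..<L} * a i = a i" "\<And>i. i \<in> I \<Longrightarrow> a i * idm {..<L} = a i"
    and b: "\<And>i. i \<in> I \<Longrightarrow> idm {..<L} * b i = b i" and c: "c * idm {..<L} = c"
begin

abbreviation "kp \<equiv> kap ((*) :: 'k \<Rightarrow> 'k \<Rightarrow> 'k)"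

text \<open>Matrix units of the block numbers. They commute with \<open>kp x\<close>, which acts
  inside the blocks; \<open>a1 (i, p, q)\<close> is therefore the coefficient of block
  \<open>(p, q)\<close> of the variable \<open>i\<close>.\<close>

definition T :: "nat \<Rightarrow> nat \<Rightarrow> (nat \<times> nat, 'k) rcf" where "T p q = lft (unt 1 p q)"

definition J :: "('i \<times> nat \<times> nat) set" where "J = I \<times> {..<m} \<times> {..<m}"

definition a1 :: "'i \<times> nat \<times> nat \<Rightarrow> (nat \<times> nat, 'k) rcf" where "a1 = (\<lambda>(i, p, q). kp (a i) * T p q)"

definition b1 :: "'i \<times> nat \<times> nat \<Rightarrow> (nat \<times> nat, 'k) rcf" where "b1 = (\<lambda>(i, p, q). kp (b i) * T p q)"

definition wv :: "'i \<times> nat \<times> nat \<Rightarrow> (nat \<times> nat, 'k) rcf" where "wv = (\<lambda>(i, p, q). scl (wt i p q))"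

definition "Aw = (\<Sum>j\<in>J. a1 j * wv j)"

definition "Bw = (\<Sum>j\<in>J. b1 j * wv j)"

definition "C1 = kp c * lft (idm {..<m})"

definition "D1 = kp d * lft (idm {..<m})"

definition base :: "('i, (nat \<times> nat, 'k) rcf) lsys" where
  "base = \<lparr>sysD = kp d * T 0 0, sysC = kp c * T 0 0, sysA = \<lambda>i. kp (a i) * T 0 0, sysB = \<lambda>i. kp (b i) * T 0 0\<rparr>"

definition shifted :: "('i \<times> nat \<times> nat, (nat \<times> nat, 'k) rcf) lsys" where
  "shifted = \<lparr>sysD = D1 + C1 * (Q * Bw), sysC = C1, sysA = \<lambda>j. Q * a1 j, sysB = \<lambda>j. Q * (a1 j * (Q * Bw) + b1 j)\<rparr>"

lemma T_T: "T p q * T p' q' = (if q = p' then T p q' else 0)"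
  by (simp add: T_def lft_times[symmetric] unt_times_unt)

lemma T_TA: "T p q * (T p' q' * z) = (if q = p' then T p q' * z else 0)"
  by (simp add: mult.assoc[symmetric] T_T)

lemma T_kp: "T p q * kp x = kp x * T p q"
  by (simp add: T_def fld.lft_kap_commute)

lemma T_kpA: "T p q * (kp x * z) = kp x * (T p q * z)"
  by (simp add: mult.assoc[symmetric] T_kp)

lemma iota: "lft (idm {..<m}) = (\<Sum>p<m. T p p)"
  by (simp add: lft_idm T_def)

lemma iota_T: "p < m \<Longrightarrow> lft (idm {..<m}) * T p q = T p q" "q < m \<Longrightarrow> T p q * lft (idm {..<m}) = T p q"
  by (simp_all add: T_def lft_times[symmetric] idm_times_unt unt_times_idm)

abbreviation "e \<equiv> idm (box L m) :: (nat \<times> nat, 'k) rcf"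

lemma e_eq: "e = kp (idm {..<L}) * lft (idm {..<m})"
  by (rule idm_box)

lemma lft_kp: "lft x * kp y = kp y * lft x"
  by (rule fld.lft_kap_commute)

lemma e_a1: "j \<in> J \<Longrightarrow> e * a1 j = a1 j" "j \<in> J \<Longrightarrow> a1 j * e = a1 j"
proof -
  assume "j \<in> J"
  then obtain i p q where j: "j = (i, p, q)" "i \<in> I" "p < m" "q < m" by (auto simp: J_def)
  have "e * a1 j = kp (idm {..<L}) * (lft (idm {..<m}) * kp (a i)) * T p q"
    by (simp add: j a1_def e_eq mult.assoc)
  also have "\<dots> = kp (idm {..<L} * a i) * (lft (idm {..<m}) * T p q)"
    by (simp only: lft_kp fld.kap_times mult.assoc)
  finally show "e * a1 j = a1 j" using j by (simp add: a iota_T a1_def)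
  have "a1 j * e = kp (a i) * (T p q * kp (idm {..<L})) * lft (idm {..<m})"
    by (simp add: j a1_def e_eq mult.assoc)
  also have "\<dots> = kp (a i * idm {..<L}) * (T p q * lft (idm {..<m}))"
    by (simp only: T_kp fld.kap_times mult.assoc)
  finally show "a1 j * e = a1 j" using j by (simp add: a iota_T a1_def)
qed

lemma e_b1: "j \<in> J \<Longrightarrow> e * b1 j = b1 j"
proof -
  assume "j \<in> J"
  then obtain i p q where j: "j = (i, p, q)" "i \<in> I" "p < m" "q < m" by (auto simp: J_def)
  have "e * b1 j = kp (idm {..<L}) * (lft (idm {..<m}) * kp (b i)) * T p q"
    by (simp add: j b1_def e_eq mult.assoc)
  also have "\<dots> = kp (idm {..<L} * b i) * (lft (idm {..<m}) * T p q)"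
    by (simp only: lft_kp fld.kap_times mult.assoc)
  finally show "e * b1 j = b1 j" using j by (simp add: b iota_T b1_def)
qed

lemma C1_e: "C1 * e = C1"
proof -
  have "C1 * e = kp c * (lft (idm {..<m}) * kp (idm {..<L})) * lft (idm {..<m})"
    by (simp add: C1_def e_eq mult.assoc)
  also have "\<dots> = kp (c * idm {..<L}) * (lft (idm {..<m}) * lft (idm {..<m}))"
    by (simp only: lft_kp fld.kap_times mult.assoc)
  finally show ?thesis by (simp add: c C1_def lft_times[symmetric] idm_times_idm)
qed

lemma wv_commute: "wv j * M = M * wv j"
  by (simp add: wv_def scl_commute split: prod.splits)

lemma e_Aw: "e * Aw = Aw" "Aw * e = Aw"
proof -
  show "e * Aw = Aw"
    unfolding Aw_def sum_distrib_left by (intro sum.cong refl) (simp add: mult.assoc[symmetric] e_a1)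
  show "Aw * e = Aw"
    unfolding Aw_def sum_distrib_right
    by (intro sum.cong refl) (simp only: mult.assoc wv_commute, simp add: mult.assoc[symmetric] e_a1)
qed

lemma wprod_base: "wprod (sysA base) w * T 0 0 = kp (wprod a w) * T 0 0"
  by (induct w) (simp_all add: base_def fld.kap_one fld.kap_times mult.assoc T_kpA T_T T_TA)

end

text \<open>Invertibility of the pencil at the new centre, that is, membership of this centre in the
  domain of the realization.\<close>

locale recentring_inverse = recentring a b c d I L m wt Q
  for a b :: "'i \<Rightarrow> (nat, 'k::field) rcf" and c d I L m wt Q +
  assumes Q: "Q * (1 - Aw) = 1" "(1 - Aw) * Q = 1"
begin

lemma Q_eq: "Q = 1 + Q * Aw" "Q = 1 + Aw * Q"
  using Q by (simp_all add: algebra_simps)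

lemma e_Q: "e * Q = Q * e"
proof -
  have "e * Q = Q * (1 - Aw) * e * Q" by (simp add: Q)
  also have "\<dots> = Q * e * ((1 - Aw) * Q)"
    using e_Aw by (simp add: mult.assoc left_diff_distrib right_diff_distrib) (simp add: mult.assoc[symmetric])
  finally show ?thesis by (simp add: Q)
qed

lemma e_QM: "e * M = M \<Longrightarrow> e * (Q * M) = Q * M"
  by (simp add: mult.assoc[symmetric] e_Q) (simp add: mult.assoc)

lemma supp_shifted: "supp J (box L m) shifted"
  unfolding supp_def shifted_def lsys.simps
proof (intro conjI ballI)
  show "C1 * e = C1" by (rule C1_e)
  fix j assume j: "j \<in> J"
  show "e * (Q * a1 j) = Q * a1 j" by (rule e_QM) (rule e_a1(1)[OF j])
  show "Q * a1 j * e = Q * a1 j" by (simp add: mult.assoc e_a1 j)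
  show "e * (Q * (a1 j * (Q * Bw) + b1 j)) = Q * (a1 j * (Q * Bw) + b1 j)"
    by (rule e_QM) (simp add: distrib_left mult.assoc[symmetric] e_a1 e_b1 j)
qed

text \<open>The states invisible to the shifted system form a set stable under every
  \<open>Q * a1 j\<close>, hence under \<open>Q * Aw\<close> and \<open>Q = 1 + Q * Aw\<close>.
  Finite dimension makes it stable under \<open>1 - Aw\<close>, and so under every
  \<open>a1 j\<close>. The block components of such a state are then invisible to the system before
  the shift.\<close>

lemma obsv_shifted:
  assumes obs: "obsv I (box L (Suc 0)) base"
  shows "obsv J (box L m) shifted"
  unfolding obsv_def
proof (intro allI impI)
  define \<S> where "\<S> = {sysC shifted * wprod (sysA shifted) w | w. w \<in> lists J}"
  fix Z assume "\<forall>w\<in>lists J. sysC shifted * wprod (sysA shifted) w * Z = 0"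
  then have Z: "R * Z = 0" if "R \<in> \<S>" for R using that unfolding \<S>_def by blast
  have Re: "R * e = R" if "R \<in> \<S>" for R
  proof -
    obtain w where w: "w \<in> lists J" "R = sysC shifted * wprod (sysA shifted) w"
      using \<open>R \<in> \<S>\<close> unfolding \<S>_def by blast
    show ?thesis
    proof (cases w rule: rev_cases)
      case Nil
      then show ?thesis by (simp add: w shifted_def C1_e)
    next
      case (snoc w' j)
      then show ?thesis using w by (simp add: shifted_def mult.assoc e_a1)
    qed
  qed
  have 0: "R * (Q * a1 j * Z) = 0" if j: "j \<in> J" and Z: "\<And>R. R \<in> \<S> \<Longrightarrow> R * Z = 0" and "R \<in> \<S>" for R Z j
  proof -
    obtain w where w: "w \<in> lists J" "R = sysC shifted * wprod (sysA shifted) w"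
      using \<open>R \<in> \<S>\<close> unfolding \<S>_def by blast
    have "w @ [j] \<in> lists J" using w j by simp
    then have "sysC shifted * wprod (sysA shifted) (w @ [j]) \<in> \<S>" unfolding \<S>_def by blast
    from Z[OF this] show ?thesis by (simp add: w shifted_def mult.assoc)
  qed
  have 1: "R * (Q * Z) = 0" if Z: "\<And>R. R \<in> \<S> \<Longrightarrow> R * Z = 0" and R: "R \<in> \<S>" for R Z
  proof -
    have "R * (Q * Aw * Z) = (\<Sum>j\<in>J. R * (Q * a1 j * Z) * wv j)"
      by (simp add: Aw_def sum_distrib_left sum_distrib_right mult.assoc wv_commute)
    also have "\<dots> = 0" using 0[OF _ Z R] by simp
    finally show ?thesis using Z[OF R] by (subst Q_eq(1)) (simp add: algebra_simps)
  qed
  have e: "e * (1 - (1 - Aw)) = 1 - (1 - Aw)" "(1 - (1 - Aw)) * e = 1 - (1 - Aw)"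
    by (simp_all add: e_Aw)
  have 2: "R * ((1 - Aw) * Z) = 0" if Z: "\<And>R. R \<in> \<S> \<Longrightarrow> R * Z = 0" and R: "R \<in> \<S>" for R Z
    by (rule annihilator_stable[OF Q _ e Re 1 Z R]) auto
  have 3: "R * (a1 j * Z) = 0" if j: "j \<in> J" and Z: "\<And>R. R \<in> \<S> \<Longrightarrow> R * Z = 0" and R: "R \<in> \<S>" for R Z j
  proof -
    have "R * ((1 - Aw) * (Q * a1 j * Z)) = 0" using 0[OF j Z] R by (rule 2)
    moreover have "(1 - Aw) * (Q * a1 j * Z) = ((1 - Aw) * Q) * (a1 j * Z)" by (simp only: mult.assoc)
    ultimately show ?thesis by (simp add: Q)
  qed
  \<comment> \<open>The last letter moves block \<open>p\<close> to block 0, the letters before it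
    stay in block 0.\<close>
  have w4: "R * (kp (wprod a u) * (T 0 p * Z)) = 0" if "u \<in> lists I" "u \<noteq> []" "p < m" "R \<in> \<S>" for u p R
    using that(1,2,4)
  proof (induction u arbitrary: R)
    case (Cons i u)
    show ?case
    proof (cases "u = []")
      case True
      have "R * (a1 (i, 0, p) * Z) = 0"
        using Cons that m by (intro 3 Z) (auto simp: J_def)
      then show ?thesis by (simp add: True a1_def mult.assoc)
    next
      case False
      have "R * (a1 (i, 0, 0) * (kp (wprod a u) * (T 0 p * Z))) = 0"
        using Cons False m by (intro 3) (auto simp: J_def)
      then show ?thesis by (simp add: a1_def mult.assoc T_kpA T_TA fld.kap_times)
    qed
  qed simp
  have C: "C1 \<in> \<S>" unfolding \<S>_def by (auto simp: shifted_def intro: exI[of _ "[]"])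
  have T0C: "T 0 p * C1 = kp c * T 0 p" if "p < m" for p
    using that by (simp add: C1_def T_kpA iota_T)
  have 5: "sysC base * wprod (sysA base) u * (T 0 p * Z) = 0" if u: "u \<in> lists I" and p: "p < m" for u p
  proof -
    have "sysC base * wprod (sysA base) u * (T 0 p * Z)
      = kp c * T 0 0 * (wprod (sysA base) u * T 0 0) * (T 0 p * Z)"
      by (simp add: base_def mult.assoc T_TA)
    also have "\<dots> = kp c * (T 0 0 * (kp (wprod a u) * (T 0 p * Z)))"
      unfolding wprod_base by (simp add: mult.assoc T_TA)
    also have "\<dots> = 0"
    proof (cases "u = []")
      case True
      have "kp c * (T 0 0 * (kp (wprod a u) * (T 0 p * Z))) = T 0 p * C1 * Z"
        using T0C[OF p] by (simp add: True fld.kap_one T_TA mult.assoc)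
      then show ?thesis using Z[OF C] by (simp add: mult.assoc)
    next
      case False
      have "kp c * (T 0 0 * (kp (wprod a u) * (T 0 p * Z))) = T 0 0 * (C1 * (kp (wprod a u) * (T 0 p * Z)))"
        using T0C[of 0] m by (simp add: mult.assoc[symmetric])
      then show ?thesis using w4[OF u False p C] by simp
    qed
    finally show ?thesis .
  qed
  have "kp (idm {..<L}) * (T p p * Z) = 0" if p: "p < m" for p
  proof -
    have "idm (box L (Suc 0)) * (T 0 p * Z) = 0" using obs 5[OF _ p] unfolding obsv_def by blast
    moreover have "idm (box L (Suc 0)) = kp (idm {..<L}) * T 0 0"
      unfolding idm_box by (simp add: lft_idm T_def lessThan_Suc)
    ultimately have "T p 0 * (kp (idm {..<L}) * (T 0 p * Z)) = 0" by (simp add: mult.assoc T_TA)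
    then show ?thesis by (simp add: T_kpA T_TA)
  qed
  then show "e * Z = 0"
    unfolding e_eq iota by (simp add: sum_distrib_left sum_distrib_right mult.assoc)
qed

text \<open>The mirror image of \<open>obsv_shifted\<close>, with one more point: the shifted input
  map is \<open>Q * (a1 j * (Q * Bw) + b1 j)\<close>, and the contribution of \<open>Q * Bw\<close>
  has to be shown to vanish before \<open>b1 j\<close> itself is reached.\<close>

lemma contr_shifted:
  assumes con: "contr I (box L (Suc 0)) base"
  shows "contr J (box L m) shifted"
  unfolding contr_def
proof (intro allI impI)
  define \<S> where "\<S> = {wprod (sysA shifted) w * sysB shifted j | w j. w \<in> lists J \<and> j \<in> J}"
  fix Z assume "\<forall>w\<in>lists J. \<forall>j\<in>J. Z * wprod (sysA shifted) w * sysB shifted j = 0"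
  then have Z: "Z * R = 0" if "R \<in> \<S>" for R using that unfolding \<S>_def by (auto simp: mult.assoc)
  have Re: "e * R = R" if "R \<in> \<S>" for R
    using that supp_wprod[OF supp_shifted] unfolding \<S>_def by blast
  have 0: "Z * (Q * a1 j) * R = 0" if j: "j \<in> J" and Z: "\<And>R. R \<in> \<S> \<Longrightarrow> Z * R = 0" and "R \<in> \<S>" for R Z j
  proof -
    obtain w k where w: "w \<in> lists J" "k \<in> J" "R = wprod (sysA shifted) w * sysB shifted k"
      using \<open>R \<in> \<S>\<close> unfolding \<S>_def by blast
    have "j # w \<in> lists J" using w j by simp
    then have "wprod (sysA shifted) (j # w) * sysB shifted k \<in> \<S>"
      using w(2) unfolding \<S>_def by blast
    from Z[OF this] show ?thesis by (simp add: w shifted_def mult.assoc)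
  qed
  have 1: "Z * Q * R = 0" if Z: "\<And>R. R \<in> \<S> \<Longrightarrow> Z * R = 0" and R: "R \<in> \<S>" for R Z
  proof -
    have "Z * (Q * Aw) * R = (\<Sum>j\<in>J. Z * (Q * a1 j) * R * wv j)"
      by (simp add: Aw_def sum_distrib_left sum_distrib_right mult.assoc wv_commute)
    also have "\<dots> = 0" using 0[OF _ Z R] by simp
    finally show ?thesis using Z[OF R] by (subst Q_eq(1)) (simp add: algebra_simps)
  qed
  have e: "e * (1 - (1 - Aw)) = 1 - (1 - Aw)" "(1 - (1 - Aw)) * e = 1 - (1 - Aw)"
    by (simp_all add: e_Aw)
  have 2: "Z * (1 - Aw) * R = 0" if Z: "\<And>R. R \<in> \<S> \<Longrightarrow> Z * R = 0" and R: "R \<in> \<S>" for R Z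
    by (rule annihilator_stable_left[OF Q _ e Re 1 Z R]) auto
  have 3: "Z * a1 j * R = 0" if j: "j \<in> J" and Z: "\<And>R. R \<in> \<S> \<Longrightarrow> Z * R = 0" and R: "R \<in> \<S>" for R Z j
  proof -
    have "Z * (1 - Aw) * (Q * a1 j) * R = 0" by (rule 0[OF j 2[OF Z] R])
    moreover have "Z * (1 - Aw) * (Q * a1 j) * R = Z * ((1 - Aw) * Q) * a1 j * R" by (simp only: mult.assoc)
    ultimately show ?thesis by (simp add: Q)
  qed
  have Bj: "Q * (a1 j * (Q * Bw) + b1 j) \<in> \<S>" if "j \<in> J" for j
  proof -
    have "wprod (sysA shifted) [] * sysB shifted j \<in> \<S>"
      unfolding \<S>_def using that lists.Nil by blast
    then show ?thesis by (simp add: shifted_def)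
  qed
  have 4: "Z * (a1 j * (Q * Bw) + b1 j) = 0" if j: "j \<in> J" and Z: "\<And>R. R \<in> \<S> \<Longrightarrow> Z * R = 0" for Z j
  proof -
    have "Z * (1 - Aw) * (Q * (a1 j * (Q * Bw) + b1 j)) = 0" by (rule 2[OF Z Bj[OF j]])
    moreover have "Z * (1 - Aw) * (Q * (a1 j * (Q * Bw) + b1 j)) = Z * ((1 - Aw) * Q) * (a1 j * (Q * Bw) + b1 j)"
      by (simp only: mult.assoc)
    ultimately show ?thesis by (simp add: Q)
  qed
  \<comment> \<open>Weighted by the coordinates of the centre, the relations of step 4 add up to
    \<open>Z * (Aw * (Q * Bw) + Bw)\<close>, which is \<open>Z * (Q * Bw)\<close> by
    \<open>Q = 1 + Aw * Q\<close>.\<close>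
  have 5: "Z * (Q * Bw) = 0" if Z: "\<And>R. R \<in> \<S> \<Longrightarrow> Z * R = 0" for Z
  proof -
    have "(\<Sum>j\<in>J. Z * (a1 j * (Q * Bw) + b1 j) * wv j) = 0" using 4[OF _ Z] by (intro sum.neutral) auto
    moreover have "(\<Sum>j\<in>J. Z * (a1 j * (Q * Bw) + b1 j) * wv j) = Z * (Aw * (Q * Bw) + Bw)"
    proof -
      have "Z * (a1 j * (Q * Bw) + b1 j) * wv j = Z * (a1 j * wv j) * (Q * Bw) + Z * (b1 j * wv j)" for j
      proof -
        have "Q * (Bw * wv j) = wv j * (Q * Bw)" by (simp only: wv_commute mult.assoc)
        then show ?thesis by (simp only: distrib_left distrib_right mult.assoc)
      qed
      then have "(\<Sum>j\<in>J. Z * (a1 j * (Q * Bw) + b1 j) * wv j)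
          = (\<Sum>j\<in>J. Z * (a1 j * wv j) * (Q * Bw) + Z * (b1 j * wv j))" by simp
      also have "\<dots> = Z * Aw * (Q * Bw) + Z * Bw"
        by (simp only: sum.distrib sum_distrib_left[symmetric] sum_distrib_right[symmetric]
            Aw_def[symmetric] Bw_def[symmetric])
      finally show ?thesis by (simp only: distrib_left mult.assoc)
    qed
    moreover have "Aw * (Q * Bw) + Bw = (1 + Aw * Q) * Bw" by (simp add: algebra_simps)
    ultimately show ?thesis using Q_eq(2) by (simp add: mult.assoc)
  qed
  have 6: "Z * b1 j = 0" if j: "j \<in> J" and Z: "\<And>R. R \<in> \<S> \<Longrightarrow> Z * R = 0" for Z j
  proof -
    have "Z * a1 j * (Q * Bw) = 0" by (rule 5) (rule 3[OF j Z])
    then show ?thesis using 4[OF j Z] by (simp add: distrib_left mult.assoc)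
  qed
  have 7: "Z * T p 0 * (kp (wprod a u) * (kp (b i) * T 0 0)) = 0"
    if "u \<in> lists I" "i \<in> I" "p < m" "\<And>R. R \<in> \<S> \<Longrightarrow> Z * R = 0" for u i p Z
    using that
  proof (induction u arbitrary: p Z)
    case Nil
    then have "Z * b1 (i, p, 0) = 0" using m by (intro 6) (auto simp: J_def)
    then show ?case by (simp add: b1_def fld.kap_one mult.assoc T_kpA T_T)
  next
    case (Cons k u)
    have "(Z * a1 (k, p, 0)) * T 0 0 * (kp (wprod a u) * (kp (b i) * T 0 0)) = 0"
    proof (rule Cons.IH)
      show "Z * a1 (k, p, 0) * R = 0" if "R \<in> \<S>" for R
        using Cons m that by (intro 3) (auto simp: J_def)
    qed (use Cons m in auto)
    then show ?case by (simp add: a1_def mult.assoc T_kpA T_TA T_T fld.kap_times)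
  qed
  have 8: "Z * T p 0 * wprod (sysA base) u * sysB base i = 0" if u: "u \<in> lists I" "i \<in> I" and p: "p < m" for u i p
  proof -
    have "Z * T p 0 * wprod (sysA base) u * sysB base i = Z * T p 0 * (wprod (sysA base) u * T 0 0) * (kp (b i) * T 0 0)"
      by (simp add: base_def mult.assoc T_kpA T_T)
    also have "\<dots> = Z * T p 0 * (kp (wprod a u) * (kp (b i) * T 0 0))"
      unfolding wprod_base by (simp add: mult.assoc T_kpA T_T)
    finally show ?thesis using 7[OF u p Z] by simp
  qed
  have "Z * (kp (idm {..<L}) * T p p) = 0" if p: "p < m" for p
  proof -
    have "Z * T p 0 * idm (box L (Suc 0)) = 0" using con 8[OF _ _ p] unfolding contr_def by blast
    moreover have "idm (box L (Suc 0)) = kp (idm {..<L}) * T 0 0"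
      unfolding idm_box by (simp add: lft_idm T_def lessThan_Suc)
    ultimately have "Z * T p 0 * (kp (idm {..<L}) * T 0 0) * T 0 p = 0" by simp
    then show ?thesis by (simp add: mult.assoc T_kpA T_T)
  qed
  then show "Z * e = 0"
    unfolding e_eq iota by (simp add: sum_distrib_left)
qed

end

section \<open>Moments from values\<close>

text \<open>At the shift along the word \<open>w\<close> the pencil is unipotent, and the value lists the moments of the suffixes.\<close>

lemma ev_at_nilpotent:
  fixes \<Sigma> :: "('i, (nat \<times> nat, 'k::field) rcf) lsys" and \<xi> :: "'i \<Rightarrow> (nat, 'k) rcf"
  assumes I: "finite I" and w: "w \<in> lists I" "w \<noteq> []"
    and step: "\<And>i q. i \<in> I \<Longrightarrow> q < length w \<Longrightarrow> \<xi> i * unt 1 (\<iota> (Suc q)) z = (if w ! q = i then unt 1 (\<iota> q) z else 0)"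
    and zero: "\<And>i. i \<in> I \<Longrightarrow> \<xi> i * unt 1 (\<iota> 0) z = 0"
    and ev: "pencil_eval.ev (kap (*)) (\<lambda>i. lft (\<xi> i)) I \<Sigma> v"
  shows "v * lft (unt 1 (\<iota> (length w)) z) = kap (*) (sysD \<Sigma>) * lft (unt 1 (\<iota> (length w)) z) +
    (\<Sum>q<length w. kap (*) (sysC \<Sigma> * wprod (sysA \<Sigma>) (drop q (butlast w)) * sysB \<Sigma> (last w)) * lft (unt 1 (\<iota> q) z))"
proof -
  interpret pencil_eval "kap (*)" "\<lambda>i. lft (\<xi> i)" I
    by unfold_locales (auto simp: fld.kap_add fld.kap_times fld.kap_one fld.lft_kap_commute)
  let ?K = "kap (*) :: (nat \<times> nat, 'k) rcf \<Rightarrow> _"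
  define t where "t q = (lft (unt 1 (\<iota> q) z) :: ((nat \<times> nat) \<times> nat, 'k) rcf)" for q
  define l where "l = length w"
  define M where "M q = wprod (sysA \<Sigma>) (drop q (butlast w)) * sysB \<Sigma> (last w)" for q
  have lin_t: "lin A * (?K M * t (Suc q)) = ?K (A (w ! q) * M) * t q" if q: "q < l" for A M q
  proof -
    have "lin A * (?K M * t (Suc q)) = (\<Sum>i\<in>I. ?K (A i * M) * lft (\<xi> i * unt 1 (\<iota> (Suc q)) z))"
      unfolding lin_def sum_distrib_right t_def lft_times K_times
      by (intro sum.cong refl) (simp add: mult.assoc[symmetric], simp add: mult.assoc fld.lft_kap_commute)
    also have "\<dots> = (\<Sum>i\<in>I. if i = w ! q then ?K (A i * M) * t q else 0)"
      by (intro sum.cong refl) (use step q in \<open>auto simp: l_def t_def\<close>)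
    also have "\<dots> = ?K (A (w ! q) * M) * t q"
      using I w q by (simp add: l_def in_lists_conv_set)
    finally show ?thesis .
  qed
  have lin_0: "lin A * (?K M * t 0) = 0" for A M
  proof -
    have "lin A * (?K M * t 0) = (\<Sum>i\<in>I. ?K (A i * M) * lft (\<xi> i * unt 1 (\<iota> 0) z))"
      unfolding lin_def sum_distrib_right t_def lft_times K_times
      by (intro sum.cong refl) (simp add: mult.assoc[symmetric], simp add: mult.assoc fld.lft_kap_commute)
    then show ?thesis using zero by simp
  qed
  obtain n where n: "l = Suc n" using w by (cases w) (auto simp: l_def)
  have MS: "sysA \<Sigma> (w ! q) * M (Suc q) = M q" if "q < n" for q
  proof -
    have "drop q (butlast w) = w ! q # drop (Suc q) (butlast w)"
      using that n by (subst Cons_nth_drop_Suc[symmetric]) (auto simp: l_def nth_butlast)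
    then show ?thesis by (simp add: M_def mult.assoc)
  qed
  have Mn: "M n = sysB \<Sigma> (last w)" using n by (simp add: M_def l_def)
  have wn: "w ! n = last w" using n w by (simp add: last_conv_nth l_def)
  \<comment> \<open>The series for the inverse pencil, applied to
    \<open>lin (sysB \<Sigma>) * t l\<close>. It is finite because each factor
    \<open>lin (sysA \<Sigma>)\<close> moves one letter towards the beginning of the word.\<close>
  define y where "y = (\<Sum>q<Suc n. ?K (M q) * t q)"
  have "lin (sysA \<Sigma>) * y = (\<Sum>q<n. lin (sysA \<Sigma>) * (?K (M (Suc q)) * t (Suc q)))"
    unfolding y_def by (subst sum.lessThan_Suc_shift) (simp add: distrib_left sum_distrib_left lin_0)
  also have "\<dots> = (\<Sum>q<n. ?K (M q) * t q)"
    by (intro sum.cong refl) (use n in \<open>simp add: lin_t MS\<close>)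
  finally have "(1 - lin (sysA \<Sigma>)) * y = ?K (M n) * t n"
    by (simp add: left_diff_distrib y_def)
  also have "\<dots> = lin (sysB \<Sigma>) * (?K 1 * t l)"
    using lin_t[of n "sysB \<Sigma>" 1] n by (simp add: Mn wn)
  finally have Py: "(1 - lin (sysA \<Sigma>)) * y = lin (sysB \<Sigma>) * t l" by simp
  obtain Q where Q: "Q * (1 - lin (sysA \<Sigma>)) = 1"
    "v = ?K (sysD \<Sigma>) + ?K (sysC \<Sigma>) * Q * lin (sysB \<Sigma>)" using ev ev_def by auto
  have "v * t l = ?K (sysD \<Sigma>) * t l + ?K (sysC \<Sigma>) * (Q * (1 - lin (sysA \<Sigma>))) * y"
    by (simp add: Q(2) distrib_right mult.assoc Py)
  also have "\<dots> = ?K (sysD \<Sigma>) * t l + (\<Sum>q<l. ?K (sysC \<Sigma> * M q) * t q)"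
    by (simp add: Q(1) y_def n sum_distrib_left K_times distrib_left mult.assoc)
  finally show ?thesis by (simp add: t_def l_def M_def mult.assoc)
qed

text \<open>In the column of the last basis vector, the row of \<open>\<iota> 0\<close> contains the
  moment of the full word and nothing else, since \<open>\<iota>\<close> is injective.\<close>

lemma moment_eq:
  fixes \<Sigma> \<Sigma>' :: "('i, (nat \<times> nat, 'k::field) rcf) lsys" and \<xi> :: "'i \<Rightarrow> (nat, 'k) rcf"
  assumes I: "finite I" and w: "w \<in> lists I" "i \<in> I"
    and inj: "inj_on \<iota> {..Suc (length w)}"
    and step: "\<And>j q. j \<in> I \<Longrightarrow> q \<le> length w \<Longrightarrow>
      \<xi> j * unt 1 (\<iota> (Suc q)) 0 = (if (w @ [i]) ! q = j then unt 1 (\<iota> q) 0 else 0)"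
    and zero: "\<And>j. j \<in> I \<Longrightarrow> \<xi> j * unt 1 (\<iota> 0) 0 = 0"
    and ev: "pencil_eval.ev (kap (*)) (\<lambda>i. lft (\<xi> i)) I \<Sigma> v" "pencil_eval.ev (kap (*)) (\<lambda>i. lft (\<xi> i)) I \<Sigma>' v"
  shows "sysC \<Sigma> * wprod (sysA \<Sigma>) w * sysB \<Sigma> i = sysC \<Sigma>' * wprod (sysA \<Sigma>') w * sysB \<Sigma>' i"
proof (rule rcf_eqI)
  fix u u'
  let ?w = "w @ [i]"
  have \<iota>: "\<iota> 0 = \<iota> q \<longleftrightarrow> 0 = q" if "q \<le> Suc (length w)" for q
    using inj that by (auto simp: inj_on_def)
  have "ent (v * lft (unt 1 (\<iota> (length ?w)) 0)) (u, \<iota> 0) (u', 0)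
      = ent (sysC \<Sigma> * wprod (sysA \<Sigma>) w * sysB \<Sigma> i) u u'"
    if "pencil_eval.ev (kap (*)) (\<lambda>i. lft (\<xi> i)) I \<Sigma> v" for \<Sigma> :: "('i, (nat \<times> nat, 'k) rcf) lsys"
  proof -
    have E: "v * lft (unt 1 (\<iota> (length ?w)) 0) = kap (*) (sysD \<Sigma>) * lft (unt 1 (\<iota> (length ?w)) 0) +
      (\<Sum>q<length ?w. kap (*) (sysC \<Sigma> * wprod (sysA \<Sigma>) (drop q (butlast ?w)) * sysB \<Sigma> (last ?w)) * lft (unt 1 (\<iota> q) 0))"
      by (rule ev_at_nilpotent[where w = ?w and \<xi> = \<xi> and \<iota> = \<iota> and z = 0, OF I _ _ _ zero that]) (use w step in auto)
    show ?thesis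
      unfolding E ent_plus ent_sum fld.ent_kap_lft ent_unt using \<iota>[of "length ?w"] \<iota>
      by (simp add: sum.lessThan_Suc_shift del: sum.lessThan_Suc cong: sum.cong_simp)
  qed
  from this[OF ev(1)] this[OF ev(2)]
  show "ent (sysC \<Sigma> * wprod (sysA \<Sigma>) w * sysB \<Sigma> i) u u' = ent (sysC \<Sigma>' * wprod (sysA \<Sigma>') w * sysB \<Sigma>' i) u u'"
    by simp
qed

section \<open>Evaluation of expressions under homomorphisms\<close>

lemma mat_alg_simps [simp]:
  "carrier (mat_alg sc n) = carrier_mat n n" "mult (mat_alg sc n) = (*)" "one (mat_alg sc n) = 1\<^sub>m n"
  "zero (mat_alg sc n) = 0\<^sub>m n n" "add (mat_alg sc n) = (+)" "smult (mat_alg sc n) = (\<lambda>c. map_mat (sc c))"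
  by (simp_all add: mat_alg_def)

lemma type_alg_simps [simp]:
  "carrier (type_alg sc) = UNIV" "mult (type_alg sc) = (*)" "one (type_alg sc) = 1"
  "zero (type_alg sc) = 0" "add (type_alg sc) = (+)" "smult (type_alg sc) = sc"
  by (simp_all add: type_alg_def)

lemma one_mat_mult:
  fixes M :: "'a::{ring,monoid_mult} mat"
  assumes "M \<in> carrier_mat n k" shows "1\<^sub>m n * M = M"
proof (rule eq_matI)
  fix i j assume ij: "i < dim_row M" "j < dim_col M"
  then have "(1\<^sub>m n * M) $$ (i, j) = (\<Sum>l<n. (if i = l then 1 else 0) * M $$ (l, j))"
    using assms by (simp add: scalar_prod_def atLeast0LessThan)
  also have "\<dots> = (\<Sum>l<n. if l = i then M $$ (l, j) else 0)"
    by (intro sum.cong) auto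
  finally show "(1\<^sub>m n * M) $$ (i, j) = M $$ (i, j)" using assms ij by simp
qed (use assms in auto)

lemma mult_one_mat:
  fixes M :: "'a::{ring,monoid_mult} mat"
  assumes "M \<in> carrier_mat k n" shows "M * 1\<^sub>m n = M"
proof (rule eq_matI)
  fix i j assume ij: "i < dim_row M" "j < dim_col M"
  then have "(M * 1\<^sub>m n) $$ (i, j) = (\<Sum>l<n. M $$ (i, l) * (if l = j then 1 else 0))"
    using assms by (simp add: scalar_prod_def atLeast0LessThan)
  also have "\<dots> = (\<Sum>l<n. if l = j then M $$ (i, l) else 0)"
    by (intro sum.cong) auto
  finally show "(M * 1\<^sub>m n) $$ (i, j) = M $$ (i, j)" using assms ij by simp
qed (use assms in auto)

lemma ring_mat_alg: "ring (mat_alg sc n :: ('k, 'a::{ring,monoid_mult} mat) module)"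
proof (rule ringI)
  show "abelian_group (mat_alg sc n :: ('k, 'a mat) module)"
  proof (rule abelian_groupI)
    fix x assume "x \<in> carrier (mat_alg sc n :: ('k, 'a mat) module)"
    then show "\<exists>y\<in>carrier (mat_alg sc n). y \<oplus>\<^bsub>mat_alg sc n\<^esub> x = \<zero>\<^bsub>mat_alg sc n\<^esub>"
      by (intro bexI[of _ "- x"]) (auto intro!: eq_matI)
  qed (auto intro!: eq_matI simp: add.assoc add.commute)
  show "monoid (mat_alg sc n :: ('k, 'a mat) module)"
    by (rule monoidI) (auto simp: one_mat_mult mult_one_mat)
qed (auto simp: add_mult_distrib_mat mult_add_distrib_mat)

lemma ring_type_alg: "ring (type_alg sc :: ('k, 'a::{ring,monoid_mult}) module)"
proof (rule ringI)
  show "abelian_group (type_alg sc :: ('k, 'a) module)"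
  proof (rule abelian_groupI)
    fix x :: 'a
    show "\<exists>y\<in>carrier (type_alg sc). y \<oplus>\<^bsub>type_alg sc\<^esub> x = \<zero>\<^bsub>type_alg sc\<^esub>"
      by (intro bexI[of _ "- x"]) auto
  qed (auto simp: add.assoc add.commute)
  show "monoid (type_alg sc :: ('k, 'a) module)"
    by (rule monoidI) (auto simp: mult.assoc)
qed (auto simp: distrib_left distrib_right)

text \<open>Homomorphisms of unital algebras. Closure of \<open>A\<close> under scalars is included
  because the records carry no algebra axioms.\<close>

definition nc_hom :: "('k, 'a) module \<Rightarrow> ('k, 'b) module \<Rightarrow> ('a \<Rightarrow> 'b) \<Rightarrow> bool" where
  "nc_hom A B \<phi> \<longleftrightarrow> ring A \<and> ring B \<and> \<phi> \<in> Ring.ring_hom A B \<and>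
     (\<forall>c. \<forall>x\<in>carrier A. c \<odot>\<^bsub>A\<^esub> x \<in> carrier A \<and> \<phi> (c \<odot>\<^bsub>A\<^esub> x) = c \<odot>\<^bsub>B\<^esub> \<phi> x)"

lemma finsum_hom:
  assumes "ring A" "ring B" "\<phi> \<in> Ring.ring_hom A B" "finite S" "f \<in> S \<rightarrow> carrier A"
  shows "\<phi> (finsum A f S) = finsum B (\<lambda>x. \<phi> (f x)) S"
proof -
  interpret A: ring A by fact
  interpret B: ring B by fact
  have cl: "\<phi> x \<in> carrier B" if "x \<in> carrier A" for x
    using assms(3) that by (rule ring_hom_closed)
  show ?thesis
    using assms(4,5)
  proof induction
    case empty
    then show ?case using ring_hom_zero[OF assms(3,1,2)] by simp
  next
    case (insert x S)
    then have f: "f \<in> S \<rightarrow> carrier A" "f x \<in> carrier A" by auto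
    have "\<phi> (finsum A f (insert x S)) = \<phi> (f x \<oplus>\<^bsub>A\<^esub> finsum A f S)"
      using insert f by (simp add: A.finsum_insert)
    also have "\<dots> = \<phi> (f x) \<oplus>\<^bsub>B\<^esub> finsum B (\<lambda>x. \<phi> (f x)) S"
      using insert f by (simp add: ring_hom_add[OF assms(3)] A.finsum_closed)
    also have "\<dots> = finsum B (\<lambda>x. \<phi> (f x)) (insert x S)"
      using insert f cl by (subst B.finsum_insert) auto
    finally show ?case .
  qed
qed

lemma nc_dom_carrier: "a \<in> nc_dom A R \<Longrightarrow> a k \<in> carrier A"
  by (induct R) auto

context
  fixes A :: "('k::zero, 'a) module" and a :: "'d \<Rightarrow> 'a"
  assumes A: "ring A" and smult: "\<And>c x. x \<in> carrier A \<Longrightarrow> c \<odot>\<^bsub>A\<^esub> x \<in> carrier A"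
begin

interpretation A: ring A by (rule A)

lemma word_closed: "\<forall>k. a k \<in> carrier A \<Longrightarrow> foldr (\<lambda>i b. a i \<otimes>\<^bsub>A\<^esub> b) w \<one>\<^bsub>A\<^esub> \<in> carrier A"
  by (induct w) auto

lemma poly_val_closed: "\<forall>k. a k \<in> carrier A \<Longrightarrow> poly_val A p a \<in> carrier A"
  unfolding poly_val_def by (intro A.finsum_closed) (auto intro!: smult word_closed)

lemma nc_val_closed: "a \<in> nc_dom A R \<Longrightarrow> nc_val A R a \<in> carrier A"
  by (induct R) (auto intro: poly_val_closed)

end

lemma nc_hom_poly_val:
  assumes \<phi>: "nc_hom A B \<phi>" and a: "\<forall>k. a k \<in> carrier A"
  shows "poly_val B p (\<lambda>k. \<phi> (a k)) = \<phi> (poly_val A p a)"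
proof -
  have AB: "ring A" "ring B" "\<phi> \<in> Ring.ring_hom A B" and sm: "\<And>c x. x \<in> carrier A \<Longrightarrow> c \<odot>\<^bsub>A\<^esub> x \<in> carrier A"
    "\<And>c x. x \<in> carrier A \<Longrightarrow> \<phi> (c \<odot>\<^bsub>A\<^esub> x) = c \<odot>\<^bsub>B\<^esub> \<phi> x"
    using \<phi> by (auto simp: nc_hom_def)
  note cl = word_closed[OF AB(1) sm(1) a]
  have w: "foldr (\<lambda>i b. \<phi> (a i) \<otimes>\<^bsub>B\<^esub> b) w \<one>\<^bsub>B\<^esub> = \<phi> (foldr (\<lambda>i b. a i \<otimes>\<^bsub>A\<^esub> b) w \<one>\<^bsub>A\<^esub>)" for w
    by (induct w) (use a cl in \<open>auto simp: ring_hom_one[OF AB(3)] ring_hom_mult[OF AB(3)]\<close>)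
  have "\<phi> (poly_val A p a) = finsum B (\<lambda>w. \<phi> (Poly_Mapping.lookup p w \<odot>\<^bsub>A\<^esub> foldr (\<lambda>i b. a i \<otimes>\<^bsub>A\<^esub> b) w \<one>\<^bsub>A\<^esub>)) (Poly_Mapping.keys p)"
    unfolding poly_val_def by (rule finsum_hom[OF AB]) (auto intro!: sm cl)
  then show ?thesis unfolding poly_val_def by (simp add: sm cl w)
qed

text \<open>Homomorphisms preserve inverses, so points of the domain go to points of the domain.
  This serves for I_m \<otimes> X and for the diagonal embedding of an algebra into its
  matrices.\<close>

lemma nc_hom_val:
  assumes \<phi>: "nc_hom A B \<phi>" and a: "a \<in> nc_dom A R"
  shows "(\<lambda>k. \<phi> (a k)) \<in> nc_dom B R \<and> nc_val B R (\<lambda>k. \<phi> (a k)) = \<phi> (nc_val A R a)"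
proof -
  have AB: "ring A" "ring B" "\<phi> \<in> Ring.ring_hom A B" and sm: "\<And>c x. x \<in> carrier A \<Longrightarrow> c \<odot>\<^bsub>A\<^esub> x \<in> carrier A"
    using \<phi> by (auto simp: nc_hom_def)
  interpret A: ring A by fact
  interpret B: ring B by fact
  note cl = nc_val_closed[OF AB(1) sm] and hcl = ring_hom_closed[OF AB(3)]
  show ?thesis
    using a
  proof (induction R)
    case (Poly p)
    then show ?case using nc_hom_poly_val[OF \<phi>, of a p] by (auto intro: hcl)
  next
    case (Plus R S)
    then show ?case by (simp add: ring_hom_add[OF AB(3)] cl)
  next
    case (Times R S)
    then show ?case by (simp add: ring_hom_mult[OF AB(3)] cl)
  next
    case (Inv R)
    let ?u = "nc_val A R a"
    have u: "?u \<in> Units A" using Inv by simp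
    have c: "\<phi> ?u \<in> carrier B" "\<phi> (inv\<^bsub>A\<^esub> ?u) \<in> carrier B" using u by (auto intro: hcl)
    have i: "\<phi> ?u \<otimes>\<^bsub>B\<^esub> \<phi> (inv\<^bsub>A\<^esub> ?u) = \<one>\<^bsub>B\<^esub>" "\<phi> (inv\<^bsub>A\<^esub> ?u) \<otimes>\<^bsub>B\<^esub> \<phi> ?u = \<one>\<^bsub>B\<^esub>"
      using u by (simp_all add: ring_hom_mult[OF AB(3), symmetric] ring_hom_one[OF AB(3)] A.Units_closed)
    have "\<phi> ?u \<in> Units B" using c i unfolding Units_def by blast
    moreover have "inv\<^bsub>B\<^esub> (\<phi> ?u) = \<phi> (inv\<^bsub>A\<^esub> ?u)" using B.inv_unique'[OF c i] by simp
    ultimately show ?case using Inv by simp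
  qed
qed

section \<open>Inflation of matrices by an identity matrix\<close>

lemma kron_carrier [simp]: "M \<in> carrier_mat a b \<Longrightarrow> N \<in> carrier_mat c d \<Longrightarrow> kron M N \<in> carrier_mat (a * c) (b * d)"
  by (auto simp: kron_def)

lemma index_kron_one:
  fixes M :: "'a::{ring,monoid_mult} mat"
  assumes "M \<in> carrier_mat n n'" "i < m * n" "j < m * n'"
  shows "kron (1\<^sub>m m) M $$ (i, j) = (if i div n = j div n' then M $$ (i mod n, j mod n') else 0)"
  using assms by (auto simp: kron_def less_mult_imp_div_less)

lemma sum_div_mod:
  fixes f :: "nat \<Rightarrow> nat \<Rightarrow> 'a::comm_monoid_add"
  shows "(\<Sum>l<r * n. f (l div n) (l mod n)) = (\<Sum>c<r. \<Sum>v<n. f c v)"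
proof (cases "n = 0")
  case False
  have "(\<Sum>c<r. \<Sum>v<n. f c v) = (\<Sum>(c, v)\<in>{..<r} \<times> {..<n}. f c v)"
    by (simp add: sum.cartesian_product)
  also have "\<dots> = (\<Sum>l<r * n. f (l div n) (l mod n))"
  proof (rule sum.reindex_bij_witness[where i = "\<lambda>l. (l div n, l mod n)" and j = "\<lambda>(c, v). c * n + v"])
    fix cv assume "cv \<in> {..<r} \<times> {..<n}"
    then obtain c v where cv: "cv = (c, v)" "c < r" "v < n" by auto
    have "c * n + v < Suc c * n" using cv by simp
    also have "\<dots> \<le> r * n" using cv by (intro mult_le_mono1) simp
    finally show "(\<lambda>(c, v). c * n + v) cv \<in> {..<r * n}" using cv by simp
  qed (use False in \<open>auto simp: less_mult_imp_div_less\<close>)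
  finally show ?thesis ..
qed simp

lemma kron_one_mult:
  fixes M N :: "'a::{ring,monoid_mult} mat"
  assumes M: "M \<in> carrier_mat a b" and N: "N \<in> carrier_mat b c"
  shows "kron (1\<^sub>m m) M * kron (1\<^sub>m m) N = kron (1\<^sub>m m) (M * N)"
proof (rule eq_matI)
  have cM: "kron (1\<^sub>m m) M \<in> carrier_mat (m * a) (m * b)" and cN: "kron (1\<^sub>m m) N \<in> carrier_mat (m * b) (m * c)"
    and cMN: "kron (1\<^sub>m m) (M * N) \<in> carrier_mat (m * a) (m * c)"
    using M N by auto
  fix i j assume "i < dim_row (kron (1\<^sub>m m) (M * N))" "j < dim_col (kron (1\<^sub>m m) (M * N))"
  then have ij: "i < m * a" "j < m * c" using cMN by auto
  then have pos: "a > 0" "c > 0" by (auto intro: gr0I)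
  have "(kron (1\<^sub>m m) M * kron (1\<^sub>m m) N) $$ (i, j)
      = (\<Sum>l<m * b. kron (1\<^sub>m m) M $$ (i, l) * kron (1\<^sub>m m) N $$ (l, j))"
    using cM cN ij by (simp add: scalar_prod_def atLeast0LessThan)
  also have "\<dots> = (\<Sum>l<m * b. (\<lambda>p q. (if i div a = p then M $$ (i mod a, q) else 0) *
      (if p = j div c then N $$ (q, j mod c) else 0)) (l div b) (l mod b))"
    using M N ij by (intro sum.cong refl) (simp add: index_kron_one)
  also have "\<dots> = (\<Sum>p<m. \<Sum>q<b. (if i div a = p then M $$ (i mod a, q) else 0) *
      (if p = j div c then N $$ (q, j mod c) else 0))"
    by (rule sum_div_mod)
  also have "\<dots> = (\<Sum>p<m. if p = i div a then (\<Sum>q<b. if i div a = j div c then M $$ (i mod a, q) * N $$ (q, j mod c) else 0) else 0)"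
    by (intro sum.cong refl) (auto intro!: sum.cong)
  also have "\<dots> = (if i div a = j div c then \<Sum>q<b. M $$ (i mod a, q) * N $$ (q, j mod c) else 0)"
    using ij by (simp add: less_mult_imp_div_less)
  also have "\<dots> = kron (1\<^sub>m m) (M * N) $$ (i, j)"
    using M N ij pos by (subst index_kron_one[of _ a c]) (auto simp: scalar_prod_def atLeast0LessThan)
  finally show "(kron (1\<^sub>m m) M * kron (1\<^sub>m m) N) $$ (i, j) = kron (1\<^sub>m m) (M * N) $$ (i, j)" .
qed (use M N in \<open>auto simp: kron_def\<close>)

lemma (in unital_algebra) nc_hom_kron: "nc_hom (mat_alg sc n) (mat_alg sc (m * n)) (kron (1\<^sub>m m))"
proof -
  have "kron (1\<^sub>m m) \<in> Ring.ring_hom (mat_alg sc n) (mat_alg sc (m * n))"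
  proof (rule ring_hom_memI)
    fix M N assume M: "M \<in> carrier (mat_alg sc n)" "N \<in> carrier (mat_alg sc n)"
    then have pos: "i < m * n \<Longrightarrow> i mod n < n" for i by (cases "n = 0") auto
    show "kron (1\<^sub>m m) (M \<otimes>\<^bsub>mat_alg sc n\<^esub> N) = kron (1\<^sub>m m) M \<otimes>\<^bsub>mat_alg sc (m * n)\<^esub> kron (1\<^sub>m m) N"
      using M by (simp add: kron_one_mult)
    have c: "kron (1\<^sub>m m) M \<in> carrier_mat (m * n) (m * n)" "kron (1\<^sub>m m) N \<in> carrier_mat (m * n) (m * n)"
      "kron (1\<^sub>m m) (M + N) \<in> carrier_mat (m * n) (m * n)" using M by auto
    note dims = c[THEN carrier_matD(1)] c[THEN carrier_matD(2)]
    show "kron (1\<^sub>m m) (M \<oplus>\<^bsub>mat_alg sc n\<^esub> N) = kron (1\<^sub>m m) M \<oplus>\<^bsub>mat_alg sc (m * n)\<^esub> kron (1\<^sub>m m) N"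
      unfolding mat_alg_simps
      by (rule eq_matI) (use M pos in \<open>auto simp: dims index_kron_one[of _ n n]\<close>)
  next
    show "kron (1\<^sub>m m) \<one>\<^bsub>mat_alg sc n\<^esub> = \<one>\<^bsub>mat_alg sc (m * n)\<^esub>"
    proof (unfold mat_alg_simps, rule eq_matI)
      fix i j assume "i < dim_row (1\<^sub>m (m * n) :: 'a mat)" "j < dim_col (1\<^sub>m (m * n) :: 'a mat)"
      then have ij: "i < m * n" "j < m * n" by auto
      then have n: "n > 0" by (auto intro: gr0I)
      have "i = j \<longleftrightarrow> i div n = j div n \<and> i mod n = j mod n" by (metis div_mult_mod_eq)
      then show "kron (1\<^sub>m m) (1\<^sub>m n :: 'a mat) $$ (i, j) = 1\<^sub>m (m * n) $$ (i, j)"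
        using ij n by (subst index_kron_one[of _ n n]) auto
    qed (auto simp: kron_def)
  qed auto
  moreover have "kron (1\<^sub>m m) (map_mat (sc c) M) = map_mat (sc c) (kron (1\<^sub>m m) M)"
    if "M \<in> carrier_mat n n" for c M
  proof (rule eq_matI)
    fix i j assume "i < dim_row (map_mat (sc c) (kron (1\<^sub>m m) M))" "j < dim_col (map_mat (sc c) (kron (1\<^sub>m m) M))"
    then have ij: "i < m * n" "j < m * n" using that by (auto simp: kron_def)
    then have n: "n > 0" by (auto intro: gr0I)
    have "kron (1\<^sub>m m) M \<in> carrier_mat (m * n) (m * n)" using that by simp
    note dims = this[THEN carrier_matD(1)] this[THEN carrier_matD(2)]
    show "kron (1\<^sub>m m) (map_mat (sc c) M) $$ (i, j) = map_mat (sc c) (kron (1\<^sub>m m) M) $$ (i, j)"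
      using that ij n by (auto simp: dims index_kron_one[of _ n n])
  qed (auto simp: kron_def)
  ultimately show ?thesis by (auto simp: nc_hom_def ring_mat_alg)
qed

section \<open>Common points of domains\<close>

lemma nc_hom_poly_at:
  "nc_hom (mat_alg Polynomial.smult n) (mat_alg (*) n) (map_mat (\<lambda>q. poly q (t0::'k::field)))"
proof -
  interpret h: comm_ring_hom "\<lambda>q. poly q t0" by unfold_locales auto
  have "map_mat (\<lambda>q. poly q t0) \<in> Ring.ring_hom (mat_alg Polynomial.smult n) (mat_alg (*) n)"
  proof (rule ring_hom_memI)
    fix M N assume M: "M \<in> carrier (mat_alg Polynomial.smult n :: ('k, 'k poly mat) module)"
      "N \<in> carrier (mat_alg Polynomial.smult n :: ('k, 'k poly mat) module)"
    then show "map_mat (\<lambda>q. poly q t0) (M \<otimes>\<^bsub>mat_alg Polynomial.smult n\<^esub> N) =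
      map_mat (\<lambda>q. poly q t0) M \<otimes>\<^bsub>mat_alg (*) n\<^esub> map_mat (\<lambda>q. poly q t0) N"
      by (simp add: h.mat_hom_mult[of _ n n _ n])
    show "map_mat (\<lambda>q. poly q t0) (M \<oplus>\<^bsub>mat_alg Polynomial.smult n\<^esub> N) =
      map_mat (\<lambda>q. poly q t0) M \<oplus>\<^bsub>mat_alg (*) n\<^esub> map_mat (\<lambda>q. poly q t0) N"
      using M by (auto intro!: eq_matI)
  qed (auto intro!: eq_matI)
  then show ?thesis by (auto simp: nc_hom_def ring_mat_alg intro!: eq_matI)
qed

text \<open>On a line \<open>X\<close> through a point of its domain, an expression is defined away from the zeros of a
  polynomial \<open>h\<close>, where its value is \<open>N / h\<close>. The parameter of the line is specialised by \<open>\<phi>\<close>, and \<open>u\<close>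
  stands for the inverse of \<open>h\<close>.\<close>

definition specializes :: "nat \<Rightarrow> ('d \<Rightarrow> 'k poly mat) \<Rightarrow> ('d, 'k::field) nc_expr \<Rightarrow> 'k poly \<Rightarrow> 'k poly mat \<Rightarrow> bool" where
  "specializes n X R h N \<longleftrightarrow> (\<forall>(B :: ('k, 'k mat) module) \<phi> u. nc_hom (mat_alg Polynomial.smult n) B \<phi> \<longrightarrow>
      (\<forall>Z\<in>carrier_mat n n. \<phi> ((h * u) \<cdot>\<^sub>m Z) = \<phi> Z) \<longrightarrow>
      (\<lambda>k. \<phi> (X k)) \<in> nc_dom B R \<and> nc_val B R (\<lambda>k. \<phi> (X k)) = \<phi> (u \<cdot>\<^sub>m N))"

text \<open>\<open>u\<close> has to act as an inverse of \<open>h\<close> only after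
  \<open>\<phi>\<close>. Thus one induction covers evaluation at a parameter and representations of
  quotients k[t]/p, and the determinant required for inverses is taken over the commutative ring
  k[t].\<close>

lemma poly_specialize:
  fixes R :: "('d, 'k::field) nc_expr" and X :: "'d \<Rightarrow> 'k poly mat" and t0 :: 'k
  assumes X: "\<And>k. X k \<in> carrier_mat n n"
    and x0: "(\<lambda>k. map_mat (\<lambda>q. poly q t0) (X k)) \<in> nc_dom (mat_alg (*) n) R"
  shows "\<exists>h N. poly h t0 \<noteq> 0 \<and> N \<in> carrier_mat n n \<and> specializes n X R h N"
  using x0 unfolding specializes_def
proof (induction R)
  case (Poly p)
  let ?A = "mat_alg Polynomial.smult n :: ('k, 'k poly mat) module"
  have cl: "poly_val ?A p X \<in> carrier_mat n n"
    using poly_val_closed[of ?A X p] ring_mat_alg X by auto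
  show ?case
  proof (intro exI[of _ 1] exI[of _ "poly_val ?A p X"] conjI allI impI)
    fix B :: "('k, 'k mat) module" and \<phi> u
    assume \<phi>: "nc_hom ?A B \<phi>" and u: "\<forall>Z\<in>carrier_mat n n. \<phi> ((1 * u) \<cdot>\<^sub>m Z) = \<phi> Z"
    show "(\<lambda>k. \<phi> (X k)) \<in> nc_dom B (Poly p)"
      using \<phi> X by (auto simp: nc_hom_def intro: ring_hom_closed[of \<phi> "mat_alg Polynomial.smult n"])
    show "nc_val B (Poly p) (\<lambda>k. \<phi> (X k)) = \<phi> (u \<cdot>\<^sub>m poly_val ?A p X)"
      using nc_hom_poly_val[OF \<phi>, of X p] X cl u by simp
  qed (use cl in auto)
next
  case (Plus R S)
  then obtain h1 N1 h2 N2 where h: "poly h1 t0 \<noteq> 0" "poly h2 t0 \<noteq> 0"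
    and N: "N1 \<in> carrier_mat n n" "N2 \<in> carrier_mat n n"
    and 1: "\<And>(B :: ('k, 'k mat) module) \<phi> u. nc_hom (mat_alg Polynomial.smult n) B \<phi> \<Longrightarrow>
      (\<forall>Z\<in>carrier_mat n n. \<phi> ((h1 * u) \<cdot>\<^sub>m Z) = \<phi> Z) \<Longrightarrow>
      (\<lambda>k. \<phi> (X k)) \<in> nc_dom B R \<and> nc_val B R (\<lambda>k. \<phi> (X k)) = \<phi> (u \<cdot>\<^sub>m N1)"
    and 2: "\<And>(B :: ('k, 'k mat) module) \<phi> u. nc_hom (mat_alg Polynomial.smult n) B \<phi> \<Longrightarrow>
      (\<forall>Z\<in>carrier_mat n n. \<phi> ((h2 * u) \<cdot>\<^sub>m Z) = \<phi> Z) \<Longrightarrow>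
      (\<lambda>k. \<phi> (X k)) \<in> nc_dom B S \<and> nc_val B S (\<lambda>k. \<phi> (X k)) = \<phi> (u \<cdot>\<^sub>m N2)"
    by (auto simp del: mat_alg_simps)
  show ?case
  proof (intro exI[of _ "h1 * h2"] exI[of _ "h2 \<cdot>\<^sub>m N1 + h1 \<cdot>\<^sub>m N2"] conjI allI impI)
    fix B :: "('k, 'k mat) module" and \<phi> u
    assume \<phi>: "nc_hom (mat_alg Polynomial.smult n) B \<phi>"
      and u: "\<forall>Z\<in>carrier_mat n n. \<phi> ((h1 * h2 * u) \<cdot>\<^sub>m Z) = \<phi> Z"
    have R: "(\<lambda>k. \<phi> (X k)) \<in> nc_dom B R \<and> nc_val B R (\<lambda>k. \<phi> (X k)) = \<phi> ((h2 * u) \<cdot>\<^sub>m N1)"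
      by (rule 1[OF \<phi>]) (use u in \<open>simp add: ac_simps\<close>)
    have S: "(\<lambda>k. \<phi> (X k)) \<in> nc_dom B S \<and> nc_val B S (\<lambda>k. \<phi> (X k)) = \<phi> ((h1 * u) \<cdot>\<^sub>m N2)"
      by (rule 2[OF \<phi>]) (use u in \<open>simp add: ac_simps\<close>)
    show "(\<lambda>k. \<phi> (X k)) \<in> nc_dom B (Plus R S)" using R S by simp
    have "(h2 * u) \<cdot>\<^sub>m N1 + (h1 * u) \<cdot>\<^sub>m N2 = u \<cdot>\<^sub>m (h2 \<cdot>\<^sub>m N1 + h1 \<cdot>\<^sub>m N2)"
      by (rule eq_matI) (use N in \<open>auto simp: algebra_simps\<close>)
    moreover have "\<phi> ((h2 * u) \<cdot>\<^sub>m N1 + (h1 * u) \<cdot>\<^sub>m N2) = \<phi> ((h2 * u) \<cdot>\<^sub>m N1) \<oplus>\<^bsub>B\<^esub> \<phi> ((h1 * u) \<cdot>\<^sub>m N2)"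
      using ring_hom_add[of \<phi> "mat_alg Polynomial.smult n" B] \<phi> N by (simp add: nc_hom_def)
    ultimately show "nc_val B (Plus R S) (\<lambda>k. \<phi> (X k)) = \<phi> (u \<cdot>\<^sub>m (h2 \<cdot>\<^sub>m N1 + h1 \<cdot>\<^sub>m N2))"
      using R S by simp
  qed (use h N in auto)
next
  case (Times R S)
  then obtain h1 N1 h2 N2 where h: "poly h1 t0 \<noteq> 0" "poly h2 t0 \<noteq> 0"
    and N: "N1 \<in> carrier_mat n n" "N2 \<in> carrier_mat n n"
    and 1: "\<And>(B :: ('k, 'k mat) module) \<phi> u. nc_hom (mat_alg Polynomial.smult n) B \<phi> \<Longrightarrow>
      (\<forall>Z\<in>carrier_mat n n. \<phi> ((h1 * u) \<cdot>\<^sub>m Z) = \<phi> Z) \<Longrightarrow>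
      (\<lambda>k. \<phi> (X k)) \<in> nc_dom B R \<and> nc_val B R (\<lambda>k. \<phi> (X k)) = \<phi> (u \<cdot>\<^sub>m N1)"
    and 2: "\<And>(B :: ('k, 'k mat) module) \<phi> u. nc_hom (mat_alg Polynomial.smult n) B \<phi> \<Longrightarrow>
      (\<forall>Z\<in>carrier_mat n n. \<phi> ((h2 * u) \<cdot>\<^sub>m Z) = \<phi> Z) \<Longrightarrow>
      (\<lambda>k. \<phi> (X k)) \<in> nc_dom B S \<and> nc_val B S (\<lambda>k. \<phi> (X k)) = \<phi> (u \<cdot>\<^sub>m N2)"
    by (auto simp del: mat_alg_simps)
  show ?case
  proof (intro exI[of _ "h1 * h2"] exI[of _ "N1 * N2"] conjI allI impI)
    fix B :: "('k, 'k mat) module" and \<phi> u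
    assume \<phi>: "nc_hom (mat_alg Polynomial.smult n) B \<phi>"
      and u: "\<forall>Z\<in>carrier_mat n n. \<phi> ((h1 * h2 * u) \<cdot>\<^sub>m Z) = \<phi> Z"
    have R: "(\<lambda>k. \<phi> (X k)) \<in> nc_dom B R \<and> nc_val B R (\<lambda>k. \<phi> (X k)) = \<phi> ((h2 * u) \<cdot>\<^sub>m N1)"
      by (rule 1[OF \<phi>]) (use u in \<open>simp add: ac_simps\<close>)
    have S: "(\<lambda>k. \<phi> (X k)) \<in> nc_dom B S \<and> nc_val B S (\<lambda>k. \<phi> (X k)) = \<phi> ((h1 * u) \<cdot>\<^sub>m N2)"
      by (rule 2[OF \<phi>]) (use u in \<open>simp add: ac_simps\<close>)
    show "(\<lambda>k. \<phi> (X k)) \<in> nc_dom B (Times R S)" using R S by simp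
    have "((h2 * u) \<cdot>\<^sub>m N1) * ((h1 * u) \<cdot>\<^sub>m N2) = (h1 * h2 * u) \<cdot>\<^sub>m (u \<cdot>\<^sub>m (N1 * N2))"
      by (rule eq_matI) (use N in \<open>auto simp: algebra_simps\<close>)
    moreover have "\<phi> (((h2 * u) \<cdot>\<^sub>m N1) * ((h1 * u) \<cdot>\<^sub>m N2)) = \<phi> ((h2 * u) \<cdot>\<^sub>m N1) \<otimes>\<^bsub>B\<^esub> \<phi> ((h1 * u) \<cdot>\<^sub>m N2)"
      using ring_hom_mult[of \<phi> "mat_alg Polynomial.smult n" B] \<phi> N by (simp add: nc_hom_def)
    ultimately show "nc_val B (Times R S) (\<lambda>k. \<phi> (X k)) = \<phi> (u \<cdot>\<^sub>m (N1 * N2))"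
      using R S u N by simp
  qed (use h N in auto)
next
  case (Inv R)
  then obtain h1 N1 where h: "poly h1 t0 \<noteq> 0" and N: "N1 \<in> carrier_mat n n"
    and 1: "\<And>(B :: ('k, 'k mat) module) \<phi> u. nc_hom (mat_alg Polynomial.smult n) B \<phi> \<Longrightarrow>
      (\<forall>Z\<in>carrier_mat n n. \<phi> ((h1 * u) \<cdot>\<^sub>m Z) = \<phi> Z) \<Longrightarrow>
      (\<lambda>k. \<phi> (X k)) \<in> nc_dom B R \<and> nc_val B R (\<lambda>k. \<phi> (X k)) = \<phi> (u \<cdot>\<^sub>m N1)"
    by (auto simp del: mat_alg_simps)
  interpret hom: comm_ring_hom "\<lambda>q. poly q t0" by unfold_locales auto
  let ?at = "map_mat (\<lambda>q. poly q t0)"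
  \<comment> \<open>Evaluation at \<open>t0\<close> is itself an instance of the induction
    hypothesis, with the constant \<open>1 / poly h1 t0\<close>. It shows that \<open>det N1\<close>
    does not vanish at \<open>t0\<close>.\<close>
  let ?u0 = "[:1 / poly h1 t0:]"
  have "\<forall>Z\<in>carrier_mat n n. ?at ((h1 * ?u0) \<cdot>\<^sub>m Z) = ?at Z"
    using h by (auto intro!: eq_matI)
  then have "nc_val (mat_alg (*) n) R (\<lambda>k. ?at (X k)) = ?at (?u0 \<cdot>\<^sub>m N1)"
    using 1[OF nc_hom_poly_at, of t0 ?u0] by blast
  then have "?at (?u0 \<cdot>\<^sub>m N1) \<in> Units (mat_alg (*) n)" using Inv.prems by simp
  then obtain V where V: "V \<in> carrier_mat n n" "?at (?u0 \<cdot>\<^sub>m N1) * V = 1\<^sub>m n"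
    unfolding Units_def by auto
  have "det (?at (?u0 \<cdot>\<^sub>m N1)) * det V = 1"
    using det_mult[of "?at (?u0 \<cdot>\<^sub>m N1)" n V] V N by simp
  then have "det (?at (?u0 \<cdot>\<^sub>m N1)) \<noteq> 0" by (intro notI) (simp only: mult_zero_left zero_neq_one)
  then have d: "poly (det N1) t0 \<noteq> 0" unfolding hom.hom_det det_smult poly_mult mult_eq_0_iff by blast
  note adj = adj_mat[OF N]
  \<comment> \<open>The inverse of \<open>N1 / h1\<close> is \<open>h1\<close> times the adjugate of
    \<open>N1\<close>, divided by \<open>det N1\<close>; over the denominator
    \<open>h1 * det N1\<close> the numerator acquires the square of \<open>h1\<close>.\<close>
  let ?N = "(h1 * h1) \<cdot>\<^sub>m adj_mat N1"
  show ?case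
  proof (intro exI[of _ "h1 * det N1"] exI[of _ ?N] conjI allI impI)
    fix B :: "('k, 'k mat) module" and \<phi> u
    assume \<phi>: "nc_hom (mat_alg Polynomial.smult n) B \<phi>"
      and u: "\<forall>Z\<in>carrier_mat n n. \<phi> ((h1 * det N1 * u) \<cdot>\<^sub>m Z) = \<phi> Z"
    interpret B: ring B using \<phi> by (simp add: nc_hom_def)
    let ?W = "(det N1 * u) \<cdot>\<^sub>m N1" and ?V = "u \<cdot>\<^sub>m ?N"
    have R: "(\<lambda>k. \<phi> (X k)) \<in> nc_dom B R \<and> nc_val B R (\<lambda>k. \<phi> (X k)) = \<phi> ?W"
      by (rule 1[OF \<phi>]) (use u in \<open>simp add: ac_simps\<close>)
    have rh: "\<phi> \<in> Ring.ring_hom (mat_alg Polynomial.smult n) B" using \<phi> by (simp add: nc_hom_def)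
    have c: "\<phi> ?W \<in> carrier B" "\<phi> ?V \<in> carrier B"
      using ring_hom_closed[OF rh, of ?W] ring_hom_closed[OF rh, of ?V] N adj by auto
    have one: "\<phi> ((h1 * det N1 * u) \<cdot>\<^sub>m ((h1 * det N1 * u) \<cdot>\<^sub>m 1\<^sub>m n)) = \<one>\<^bsub>B\<^esub>"
      using u ring_hom_one[OF rh] by simp
    have "?W * ?V = (det N1 * u * (u * (h1 * h1))) \<cdot>\<^sub>m (N1 * adj_mat N1)"
      by (rule eq_matI) (use N adj(1) in \<open>auto simp: algebra_simps\<close>)
    also have "\<dots> = (h1 * det N1 * u) \<cdot>\<^sub>m ((h1 * det N1 * u) \<cdot>\<^sub>m 1\<^sub>m n)"
      unfolding adj(2) by (rule eq_matI) (auto simp: algebra_simps)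
    finally have WV: "\<phi> ?W \<otimes>\<^bsub>B\<^esub> \<phi> ?V = \<one>\<^bsub>B\<^esub>"
      using ring_hom_mult[OF rh, of ?W ?V] N adj(1) one by simp
    have "?V * ?W = (det N1 * u * (u * (h1 * h1))) \<cdot>\<^sub>m (adj_mat N1 * N1)"
      by (rule eq_matI) (use N adj(1) in \<open>auto simp: algebra_simps\<close>)
    also have "\<dots> = (h1 * det N1 * u) \<cdot>\<^sub>m ((h1 * det N1 * u) \<cdot>\<^sub>m 1\<^sub>m n)"
      unfolding adj(3) by (rule eq_matI) (auto simp: algebra_simps)
    finally have VW: "\<phi> ?V \<otimes>\<^bsub>B\<^esub> \<phi> ?W = \<one>\<^bsub>B\<^esub>"
      using ring_hom_mult[OF rh, of ?V ?W] N adj(1) one by simp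
    have "\<phi> ?W \<in> Units B" using c WV VW unfolding Units_def by blast
    then show "(\<lambda>k. \<phi> (X k)) \<in> nc_dom B (Inv R)" using R by simp
    show "nc_val B (Inv R) (\<lambda>k. \<phi> (X k)) = \<phi> ?V"
      using B.inv_unique'[OF c WV VW] R by simp
  qed (use h d adj in auto)
qed

text \<open>The regular representation of \<open>k[t]/p\<close>.\<close>

definition rh :: "'k::field poly \<Rightarrow> 'k poly \<Rightarrow> nat \<Rightarrow> nat \<Rightarrow> 'k" where
  "rh p q i j = coeff ((q * monom 1 j) mod p) i"

lemma rh_add: "rh p (q + q') i j = rh p q i j + rh p q' i j"
  by (simp add: rh_def distrib_right poly_mod_add_left)

lemma rh_smult: "rh p (Polynomial.smult c q) i j = c * rh p q i j"
  by (simp add: rh_def mod_smult_left)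

lemma rh_zero [simp]: "rh p 0 i j = 0"
  by (simp add: rh_def)

lemma rh_sum: "rh p (sum f A) i j = (\<Sum>x\<in>A. rh p (f x) i j)"
  by (induct A rule: infinite_finite_induct) (auto simp: rh_add)

lemma rh_one: "j < degree p \<Longrightarrow> rh p 1 i j = (if i = j then 1 else 0)"
  by (auto simp: rh_def mod_poly_less degree_monom_eq coeff_monom)

lemma rh_mult: "degree p \<ge> 1 \<Longrightarrow> (\<Sum>c<degree p. rh p q i c * rh p q' c j) = rh p (q * q') i j"
proof -
  assume p: "degree p \<ge> 1"
  define g where "g = (q' * monom 1 j) mod p"
  have "degree g < degree p"
    using p degree_mod_less'[of p "q' * monom 1 j"] by (cases "p = 0"; cases "g = 0") (auto simp: g_def)
  then have "g = (\<Sum>c<degree p. monom (coeff g c) c)"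
    by (intro poly_eqI) (auto simp: coeff_sum coeff_monom coeff_eq_0)
  then have "q * g = (\<Sum>c<degree p. Polynomial.smult (coeff g c) (q * monom 1 c))"
    by (metis (no_types, lifting) mult.right_neutral mult_smult_right smult_monom sum.cong sum_distrib_left)
  then have "coeff ((q * g) mod p) i = (\<Sum>c<degree p. coeff g c * rh p q i c)"
    by (simp add: rh_def[symmetric] rh_sum[where j = 0, unfolded rh_def, simplified]
        rh_smult[where j = 0, unfolded rh_def, simplified])
  moreover have "(q * g) mod p = (q * q' * monom 1 j) mod p"
    by (simp add: g_def mod_mult_right_eq mult.assoc)
  ultimately show ?thesis by (simp add: rh_def g_def mult.commute)
qed

lemma rh_cong: "p dvd q - q' \<Longrightarrow> rh p (q * z) i j = rh p (q' * z) i j"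
proof -
  assume "p dvd q - q'"
  then have "p dvd (q - q') * (z * monom 1 j)" by simp
  then have "(q * z * monom 1 j) mod p = (q' * z * monom 1 j) mod p"
    by (subst mod_eq_dvd_iff) (simp add: left_diff_distrib mult.assoc)
  then show ?thesis by (simp add: rh_def)
qed

text \<open>The index of the representation is the outer one, so that a constant matrix goes to its
  inflation by an identity matrix.\<close>

definition rho :: "'k::field poly \<Rightarrow> nat \<Rightarrow> 'k poly mat \<Rightarrow> 'k mat" where
  "rho p n M = mat (degree p * n) (degree p * n)
     (\<lambda>(i, j). rh p (M $$ (i mod n, j mod n)) (i div n) (j div n))"

lemma nc_hom_rho:
  assumes p: "degree p \<ge> 1"
  shows "nc_hom (mat_alg Polynomial.smult n) (mat_alg (*) (degree p * n)) (rho p n)"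
proof -
  let ?r = "degree p"
  have "rho p n \<in> Ring.ring_hom (mat_alg Polynomial.smult n) (mat_alg (*) (?r * n))"
  proof (rule ring_hom_memI, unfold mat_alg_simps)
    fix M N :: "'a poly mat" assume M: "M \<in> carrier_mat n n" "N \<in> carrier_mat n n"
    show "rho p n M \<in> carrier_mat (?r * n) (?r * n)" by (simp add: rho_def)
    show "rho p n (M * N) = rho p n M * rho p n N"
    proof (rule eq_matI)
      fix i j assume "i < dim_row (rho p n M * rho p n N)" "j < dim_col (rho p n M * rho p n N)"
      then have ij: "i < ?r * n" "j < ?r * n" by (auto simp: rho_def)
      then have n: "n > 0" by (auto intro: gr0I)
      have "(rho p n M * rho p n N) $$ (i, j) = (\<Sum>l<?r * n.
          rh p (M $$ (i mod n, l mod n)) (i div n) (l div n) * rh p (N $$ (l mod n, j mod n)) (l div n) (j div n))"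
        using ij by (simp add: rho_def scalar_prod_def atLeast0LessThan)
      also have "\<dots> = (\<Sum>c<?r. \<Sum>v<n.
          rh p (M $$ (i mod n, v)) (i div n) c * rh p (N $$ (v, j mod n)) c (j div n))"
        by (rule sum_div_mod[where f = "\<lambda>c v. rh p (M $$ (i mod n, v)) (i div n) c * rh p (N $$ (v, j mod n)) c (j div n)"])
      also have "\<dots> = (\<Sum>v<n. rh p (M $$ (i mod n, v) * N $$ (v, j mod n)) (i div n) (j div n))"
        by (subst sum.swap) (simp add: rh_mult[OF p])
      also have "\<dots> = rho p n (M * N) $$ (i, j)"
        using M ij n by (simp add: rho_def rh_sum scalar_prod_def atLeast0LessThan)
      finally show "rho p n (M * N) $$ (i, j) = (rho p n M * rho p n N) $$ (i, j)" ..
    qed (auto simp: rho_def)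
    show "rho p n (M + N) = rho p n M + rho p n N"
    proof (rule eq_matI)
      fix i j assume "i < dim_row (rho p n M + rho p n N)" "j < dim_col (rho p n M + rho p n N)"
      then have ij: "i < ?r * n" "j < ?r * n" by (auto simp: rho_def)
      then have n: "n > 0" by (auto intro: gr0I)
      show "rho p n (M + N) $$ (i, j) = (rho p n M + rho p n N) $$ (i, j)"
        using M ij n by (simp add: rho_def rh_add)
    qed (auto simp: rho_def)
  next
    show "rho p n (1\<^sub>m n) = 1\<^sub>m (?r * n)"
    proof (rule eq_matI)
      fix i j assume "i < dim_row (1\<^sub>m (?r * n) :: 'a mat)" "j < dim_col (1\<^sub>m (?r * n) :: 'a mat)"
      then have ij: "i < ?r * n" "j < ?r * n" by auto
      then have n: "n > 0" by (auto intro: gr0I)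
      have "i = j \<longleftrightarrow> i div n = j div n \<and> i mod n = j mod n" by (metis div_mult_mod_eq)
      then show "rho p n (1\<^sub>m n) $$ (i, j) = 1\<^sub>m (?r * n) $$ (i, j)"
        using ij n by (auto simp: rho_def rh_one less_mult_imp_div_less)
    qed (auto simp: rho_def)
  qed
  moreover have "rho p n (map_mat (Polynomial.smult c) M) = map_mat ((*) c) (rho p n M)"
    if "M \<in> carrier_mat n n" for c M
  proof (rule eq_matI)
    fix i j assume "i < dim_row (map_mat ((*) c) (rho p n M))" "j < dim_col (map_mat ((*) c) (rho p n M))"
    then have ij: "i < ?r * n" "j < ?r * n" by (auto simp: rho_def)
    then have n: "n > 0" by (auto intro: gr0I)
    show "rho p n (map_mat (Polynomial.smult c) M) $$ (i, j) = map_mat ((*) c) (rho p n M) $$ (i, j)"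
      using that ij n by (simp add: rho_def rh_smult)
  qed (auto simp: rho_def)
  ultimately show ?thesis by (auto simp: nc_hom_def ring_mat_alg)
qed

lemma rho_cong:
  assumes "p dvd q - 1" "Z \<in> carrier_mat n n"
  shows "rho p n (q \<cdot>\<^sub>m Z) = rho p n Z"
proof (rule eq_matI)
  fix i j assume "i < dim_row (rho p n Z)" "j < dim_col (rho p n Z)"
  then have ij: "i < degree p * n" "j < degree p * n" by (auto simp: rho_def)
  then have n: "n > 0" by (auto intro: gr0I)
  show "rho p n (q \<cdot>\<^sub>m Z) $$ (i, j) = rho p n Z $$ (i, j)"
    using assms ij n rh_cong[OF assms(1)] by (simp add: rho_def)
qed (auto simp: rho_def)

text \<open>A common point of the given size need not exist over a finite field. On the line through \<open>Z1\<close> and \<open>Z2\<close>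
  the product \<open>h\<close> of both denominators is invertible modulo \<open>1 + t h\<close>.\<close>

lemma common_point_same_size:
  fixes R S :: "('d, 'k::field) nc_expr"
  assumes Z1: "Z1 \<in> nc_dom (mat_alg (*) n) R" and Z2: "Z2 \<in> nc_dom (mat_alg (*) n) S"
  shows "\<exists>r\<ge>1. nc_dom (mat_alg (*) (r * n)) (Plus R S) \<noteq> {}"
proof -
  have c: "Z1 k \<in> carrier_mat n n" "Z2 k \<in> carrier_mat n n" for k
    using nc_dom_carrier[OF Z1, of k] nc_dom_carrier[OF Z2, of k] by auto
  define X where "X k = mat n n (\<lambda>ij. [:Z1 k $$ ij, Z2 k $$ ij - Z1 k $$ ij:])" for k
  have X: "X k \<in> carrier_mat n n" for k by (simp add: X_def)
  have "(\<lambda>k. map_mat (\<lambda>q. poly q 0) (X k)) = Z1" "(\<lambda>k. map_mat (\<lambda>q. poly q 1) (X k)) = Z2"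
    using c[THEN carrier_matD(1)] c[THEN carrier_matD(2)] by (auto simp: X_def intro!: ext eq_matI)
  with poly_specialize[where X = X and ?t0.0 = 0 and R = R, OF X] poly_specialize[where X = X and ?t0.0 = 1 and R = S, OF X] Z1 Z2
  obtain h1 N1 h2 N2 where h: "poly h1 0 \<noteq> 0" "poly h2 1 \<noteq> 0"
    and sp: "specializes n X R h1 N1" "specializes n X S h2 N2"
    by auto
  note 1 = sp(1)[unfolded specializes_def, rule_format] and 2 = sp(2)[unfolded specializes_def, rule_format]
  define h where "h = h1 * h2"
  have "h \<noteq> 0" using h by (auto simp: h_def)
  define p where "p = 1 + [:0, 1:] * h"
  have deg: "degree p \<ge> 1"
  proof -
    have "degree ([:0, 1:] * h) = Suc (degree h)" using \<open>h \<noteq> 0\<close> by (simp add: degree_mult_eq)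
    then show ?thesis unfolding p_def by (subst degree_add_eq_right) auto
  qed
  \<comment> \<open>The inverse of \<open>h\<close> modulo \<open>p\<close> is - t; the inverse of
    one factor of \<open>h\<close> is - t times the other factor.\<close>
  have u: "p dvd h * [:0, - 1:] - 1"
  proof -
    have "h * [:0, - 1:] - 1 = - p" by (simp add: p_def)
    then show ?thesis by simp
  qed
  note hom = nc_hom_rho[OF deg, of n]
  have "(\<lambda>k. rho p n (X k)) \<in> nc_dom (mat_alg (*) (degree p * n)) R"
    using 1[OF hom, of "h2 * [:0, - 1:]"] rho_cong[OF u] by (simp add: h_def mult.assoc)
  moreover have "(\<lambda>k. rho p n (X k)) \<in> nc_dom (mat_alg (*) (degree p * n)) S"
    using 2[OF hom, of "h1 * [:0, - 1:]"] rho_cong[OF u] by (simp add: h_def ac_simps)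
  ultimately show ?thesis using deg by auto
qed

text \<open>\<open>Plus\<close> serves to intersect domains. Both points are first inflated to the
  common size \<open>n2 * n1\<close>.\<close>

lemma nondegenerate_Plus:
  fixes R S :: "('d, 'k::field) nc_expr"
  assumes "nondegenerate R" "nondegenerate S"
  shows "nondegenerate (Plus R S)"
proof -
  obtain n1 Z1 n2 Z2 where Z: "n1 \<ge> 1" "Z1 \<in> nc_dom (mat_alg (*) n1) R" "n2 \<ge> 1" "Z2 \<in> nc_dom (mat_alg (*) n2) S"
    using assms unfolding nondegenerate_def by blast
  have "(\<lambda>k. kron (1\<^sub>m n2) (Z1 k)) \<in> nc_dom (mat_alg (*) (n2 * n1)) R"
    using nc_hom_val[OF fld.nc_hom_kron Z(2)] by blast
  moreover have "(\<lambda>k. kron (1\<^sub>m n1) (Z2 k)) \<in> nc_dom (mat_alg (*) (n2 * n1)) S"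
    using nc_hom_val[OF fld.nc_hom_kron Z(4), of n1] by (simp only: mult.commute[of n2 n1])
  ultimately obtain r where "r \<ge> 1" "nc_dom (mat_alg (*) (r * (n2 * n1))) (Plus R S) \<noteq> {}"
    using common_point_same_size by blast
  moreover have "r * (n2 * n1) \<ge> 1" using \<open>r \<ge> 1\<close> Z by simp
  ultimately show ?thesis unfolding nondegenerate_def by blast
qed

lemma coeff_mod_monom: "i < e \<Longrightarrow> coeff (q mod monom 1 e) i = coeff (q :: 'k::field poly) i"
proof -
  assume i: "i < e"
  have "q = monom 1 e * (q div monom 1 e) + q mod monom 1 e" by (simp add: mult.commute)
  then have "coeff q i = coeff (monom 1 e * (q div monom 1 e)) i + coeff (q mod monom 1 e) i"
    by (metis coeff_add)
  then show ?thesis using i by (simp add: coeff_monom_mult)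
qed

text \<open>The point \<open>W + t Z\<close> over \<open>k[t]/t\<^sup>e\<close> in the regular representation.\<close>

lemma near_point:
  fixes R :: "('d, 'k::field) nc_expr"
  assumes W: "W \<in> nc_dom (mat_alg (*) n) R" and Z: "\<And>k. Z k \<in> carrier_mat n n" and e: "e \<ge> 1"
  shows "(\<lambda>k. mat (e * n) (e * n) (\<lambda>(i, j). (if i div n = j div n then W k $$ (i mod n, j mod n) else 0) +
    (if i div n = Suc (j div n) then Z k $$ (i mod n, j mod n) else 0))) \<in> nc_dom (mat_alg (*) (e * n)) R"
proof -
  have c: "W k \<in> carrier_mat n n" for k using nc_dom_carrier[OF W, of k] by auto
  define X where "X k = mat n n (\<lambda>ij. [:W k $$ ij, Z k $$ ij:])" for k
  have X: "X k \<in> carrier_mat n n" for k by (simp add: X_def)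
  have "(\<lambda>k. map_mat (\<lambda>q. poly q 0) (X k)) = W"
    using c[THEN carrier_matD(1)] c[THEN carrier_matD(2)] by (auto simp: X_def intro!: ext eq_matI)
  with poly_specialize[where X = X and ?t0.0 = 0 and R = R, OF X] W
  obtain h N where h: "poly h 0 \<noteq> 0" and sp: "specializes n X R h N" by auto
  note 1 = sp[unfolded specializes_def, rule_format]
  define p where "p = (monom 1 e :: 'k poly)"
  have deg: "degree p = e" by (simp add: p_def degree_monom_eq)
  define c0 where "c0 = poly h 0"
  have "[:0, 1:] dvd h - [:c0:]"
    using h by (subst poly_eq_0_iff_dvd[of _ 0, simplified, symmetric]) (simp add: c0_def)
  then obtain g where g: "h = [:c0:] + [:0, 1:] * g" by (metis dvdE diff_add_cancel add.commute)
  \<comment> \<open>\<open>y\<close> is divisible by t and \<open>h / c0 = 1 - y\<close>, so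
    \<open>h\<close> is inverted modulo t^e by a finite geometric series.\<close>
  define y where "y = [:0, 1:] * ([:- 1 / c0:] * g)"
  have "c0 \<noteq> 0" using h by (simp add: c0_def)
  then have hy: "[:1 / c0:] * h = 1 - y"
    by (simp add: g y_def one_pCons)
  define u where "u = [:1 / c0:] * (\<Sum>i<e. y ^ i)"
  have "h * u = ([:1 / c0:] * h) * (\<Sum>i<e. y ^ i)" by (simp only: u_def ac_simps)
  also have "\<dots> = 1 - y ^ e"
    unfolding hy by (rule one_diff_power_eq[symmetric])
  finally have hu: "h * u - 1 = - (y ^ e)" by simp
  have "[:0, 1:] dvd y" unfolding y_def by (rule dvd_triv_left)
  then have "[:0, 1:] ^ e dvd y ^ e" by (rule dvd_power_same)
  then have u: "p dvd h * u - 1" unfolding hu p_def monom_altdef by simp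
  have "(\<lambda>k. rho p n (X k)) \<in> nc_dom (mat_alg (*) (e * n)) R"
    using 1[OF nc_hom_rho[of p n], of u] rho_cong[OF u] e by (simp add: deg)
  moreover have "rho p n (X k) = mat (e * n) (e * n) (\<lambda>(i, j). (if i div n = j div n then W k $$ (i mod n, j mod n) else 0) +
    (if i div n = Suc (j div n) then Z k $$ (i mod n, j mod n) else 0))" for k
  proof (rule eq_matI)
    let ?M = "mat (e * n) (e * n) (\<lambda>(i, j). (if i div n = j div n then W k $$ (i mod n, j mod n) else 0) +
      (if i div n = Suc (j div n) then Z k $$ (i mod n, j mod n) else 0))"
    fix i j assume "i < dim_row ?M" "j < dim_col ?M"
    then have ij: "i < e * n" "j < e * n" by auto
    then have n: "n > 0" by (auto intro: gr0I)
    have "i div n < e" using ij by (simp add: less_mult_imp_div_less)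
    then show "rho p n (X k) $$ (i, j) = ?M $$ (i, j)"
      using ij n unfolding rho_def deg
      by (simp add: rh_def p_def coeff_mod_monom X_def mult.commute[of _ "monom 1 (j div n)"] coeff_monom_mult
          coeff_pCons split: nat.splits)
  qed (auto simp: rho_def deg)
  ultimately show ?thesis by simp
qed

section \<open>Block matrices as periodic matrices\<close>

text \<open>Mixed-radix digits of a row number: a position inside a block of height
  \<open>L\<close>, then one of the \<open>m\<close> blocks of the centre, then the block of the
  point. Reduction modulo \<open>l\<close> makes the row number periodic in the last digit;
  \<open>rix\<close> recovers the digits.\<close>

definition lix :: "nat \<Rightarrow> nat \<Rightarrow> nat \<Rightarrow> (nat \<times> nat) \<times> nat \<Rightarrow> nat" where
  "lix L m l u = ((snd u mod l) * m + snd (fst u)) * L + fst (fst u)"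

definition rix :: "nat \<Rightarrow> nat \<Rightarrow> nat \<Rightarrow> (nat \<times> nat) \<times> nat" where
  "rix L m r = ((r mod L, (r div L) mod m), r div L div m)"

lemma lix_less:
  assumes "a < L" "p < m" "l \<ge> 1" shows "lix L m l ((a, p), c) < L * (m * l)"
proof -
  let ?c = "c mod l"
  have "?c < l" using assms by simp
  then have "?c * m + p < l * m"
    using assms(2) by (metis add.commute add_less_cancel_left less_le_trans mult_Suc mult_le_mono1 Suc_leI)
  then have "Suc (?c * m + p) * L \<le> (l * m) * L" by (intro mult_le_mono1) simp
  moreover have "(?c * m + p) * L + a < Suc (?c * m + p) * L" using assms by simp
  ultimately show ?thesis by (simp add: lix_def ac_simps)
qed

lemma rix_lix: "a < L \<Longrightarrow> p < m \<Longrightarrow> rix L m (lix L m l ((a, p), c)) = ((a, p), c mod l)"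
  by (simp add: rix_def lix_def)

lemma rix_in:
  fixes r L m l :: nat
  assumes r: "r < L * (m * l)"
  shows "r mod L < L \<and> (r div L) mod m < m \<and> r div L div m < l"
proof -
  have pos: "L > 0" "m > 0" using r by (auto intro: gr0I)
  have "r div L < m * l" using r pos by (simp add: less_mult_imp_div_less mult.commute)
  then have "r div L div m < l" by (simp add: less_mult_imp_div_less mult.commute)
  then show ?thesis using pos by simp
qed

lemma lix_rix: "r < L * (m * l) \<Longrightarrow> lix L m l (rix L m r) = r"
  using rix_in[of r L m l] by (simp add: rix_def lix_def)

lemma bij_rix: "l \<ge> 1 \<Longrightarrow> bij_betw (rix L m) {..<L * (m * l)} (box L m \<times> {..<l})"
proof (rule bij_betw_byWitness[where f' = "lix L m l"])
  show "\<forall>r\<in>{..<L * (m * l)}. lix L m l (rix L m r) = r" by (simp add: lix_rix)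
  show "\<forall>u\<in>box L m \<times> {..<l}. rix L m (lix L m l u) = u" by (auto simp: rix_lix)
  show "rix L m ` {..<L * (m * l)} \<subseteq> box L m \<times> {..<l}" using rix_in by (auto simp: rix_def)
  assume "l \<ge> 1"
  then show "lix L m l ` (box L m \<times> {..<l}) \<subseteq> {..<L * (m * l)}" by (auto intro: lix_less)
qed

text \<open>\<open>per L L' m l M\<close> repeats the block matrix \<open>M\<close>, with \<open>l \<times> l\<close> blocks of \<open>m \<times> m\<close> blocks of size
  \<open>L \<times> L'\<close>, along the diagonal. So unital algebras of block matrices of all sizes embed into one ring.\<close>

definition per :: "nat \<Rightarrow> nat \<Rightarrow> nat \<Rightarrow> nat \<Rightarrow> 'a mat \<Rightarrow> ((nat \<times> nat) \<times> nat, 'a::ring) rcf" where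
  "per L L' m l M = Mk (\<lambda>u v. if fst u \<in> box L m \<and> fst v \<in> box L' m \<and> snd u div l = snd v div l
     then M $$ (lix L m l u, lix L' m l v) else 0)"

lemma finite_same_div: "(l::nat) \<ge> 1 \<Longrightarrow> finite {c. c div l = b}"
  by (rule finite_subset[of _ "{..<(Suc b) * l}"]) (auto intro: dividend_less_div_times)

lemma ent_per:
  assumes l: "l \<ge> 1"
  shows "ent (per L L' m l M) (u, c) (v, c') =
    (if u \<in> box L m \<and> v \<in> box L' m \<and> c div l = c' div l then M $$ (lix L m l (u, c), lix L' m l (v, c')) else 0)"
proof -
  let ?f = "\<lambda>u v. if fst u \<in> box L m \<and> fst v \<in> box L' m \<and> snd u div l = snd v div l
     then M $$ (lix L m l u, lix L' m l v) else 0"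
  have "finite {v. ?f u v \<noteq> 0}" for u
    by (rule finite_subset[of _ "box L' m \<times> {c. c div l = snd u div l}"])
      (auto simp: finite_same_div[OF l] split: if_splits)
  moreover have "finite {u. ?f u v \<noteq> 0}" for v
    by (rule finite_subset[of _ "box L m \<times> {c. c div l = snd v div l}"])
      (auto simp: finite_same_div[OF l] split: if_splits)
  ultimately have "ent (Mk ?f) = ?f" by (intro ent_Mk)
  then show ?thesis by (simp add: per_def)
qed

lemma sum_block:
  assumes l: "l \<ge> 1"
  shows "(\<Sum>w\<in>box L m \<times> {c. c div l = b}. f (fst w) (snd w)) =
    (\<Sum>r<L * (m * l). f (fst (rix L m r)) (b * l + snd (rix L m r)))"
proof -
  have "(\<Sum>r<L * (m * l). f (fst (rix L m r)) (b * l + snd (rix L m r)))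
      = (\<Sum>w\<in>box L m \<times> {..<l}. f (fst w) (b * l + snd w))"
    by (rule sum.reindex_bij_betw[OF bij_rix[OF l]])
  also have "\<dots> = (\<Sum>w\<in>box L m \<times> {c. c div l = b}. f (fst w) (snd w))"
    by (rule sum.reindex_bij_witness[where i = "\<lambda>w. (fst w, snd w mod l)" and j = "\<lambda>w. (fst w, b * l + snd w)"])
      (use l in auto)
  finally show ?thesis ..
qed

lemma per_mult:
  assumes l: "l \<ge> 1" and M: "M \<in> carrier_mat (L * (m * l)) (L' * (m * l))"
    and N: "N \<in> carrier_mat (L' * (m * l)) (L'' * (m * l))"
  shows "per L L'' m l (M * N) = per L L' m l M * per L' L'' m l N"
proof (rule rcf_eqI)
  fix U V :: "(nat \<times> nat) \<times> nat"
  obtain u c v c' where UV: "U = (u, c)" "V = (v, c')" by fastforce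
  let ?J = "box L' m \<times> {d. d div l = c div l}"
  have "ent (per L L' m l M * per L' L'' m l N) U V = (\<Sum>w\<in>?J. ent (per L L' m l M) U w * ent (per L' L'' m l N) w V)"
    by (rule ent_times) (auto simp: UV ent_per[OF l] finite_same_div[OF l] split: if_splits)
  also have "\<dots> = (\<Sum>w\<in>?J. (\<lambda>x d. ent (per L L' m l M) U (x, d) * ent (per L' L'' m l N) (x, d) V) (fst w) (snd w))"
    by simp
  also have "\<dots> = (\<Sum>r<L' * (m * l). ent (per L L' m l M) U (fst (rix L' m r), c div l * l + snd (rix L' m r)) *
      ent (per L' L'' m l N) (fst (rix L' m r), c div l * l + snd (rix L' m r)) V)"
    by (rule sum_block[OF l])
  also have "\<dots> = (\<Sum>r<L' * (m * l). if u \<in> box L m \<and> v \<in> box L'' m \<and> c div l = c' div l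
      then M $$ (lix L m l U, r) * N $$ (r, lix L'' m l V) else 0)"
  proof (intro sum.cong refl)
    fix r assume "r \<in> {..<L' * (m * l)}"
    then have r: "r < L' * (m * l)" by simp
    note in_r = rix_in[OF r]
    define d where "d = c div l * l + snd (rix L' m r)"
    have b: "fst (rix L' m r) \<in> box L' m" "d div l = c div l"
      using in_r by (auto simp: rix_def d_def)
    have "lix L' m l (fst (rix L' m r), d) = lix L' m l (rix L' m r)"
      by (simp add: lix_def d_def)
    then have "lix L' m l (fst (rix L' m r), d) = r" using lix_rix[OF r] by simp
    then show "ent (per L L' m l M) U (fst (rix L' m r), c div l * l + snd (rix L' m r)) *
      ent (per L' L'' m l N) (fst (rix L' m r), c div l * l + snd (rix L' m r)) V =
      (if u \<in> box L m \<and> v \<in> box L'' m \<and> c div l = c' div l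
      then M $$ (lix L m l U, r) * N $$ (r, lix L'' m l V) else 0)"
      using b unfolding d_def[symmetric] by (simp add: UV ent_per[OF l])
  qed
  also have "\<dots> = ent (per L L'' m l (M * N)) U V"
  proof (cases "u \<in> box L m \<and> v \<in> box L'' m \<and> c div l = c' div l")
    case True
    then have "lix L m l U < L * (m * l)" "lix L'' m l V < L'' * (m * l)"
      using lix_less l by (auto simp: UV)
    then have "(M * N) $$ (lix L m l U, lix L'' m l V) = (\<Sum>r<L' * (m * l). M $$ (lix L m l U, r) * N $$ (r, lix L'' m l V))"
      using M N by (simp add: scalar_prod_def atLeast0LessThan)
    then show ?thesis using True by (simp add: UV ent_per[OF l])
  next
    case False
    show ?thesis by (simp only: UV ent_per[OF l] if_not_P[OF False] sum.neutral_const)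
  qed
  finally show "ent (per L L'' m l (M * N)) U V = ent (per L L' m l M * per L' L'' m l N) U V" ..
qed

lemma per_add:
  assumes l: "l \<ge> 1" and N: "N \<in> carrier_mat (L * (m * l)) (L' * (m * l))"
  shows "per L L' m l (M + N) = per L L' m l M + per L L' m l N"
proof (rule rcf_eqI)
  fix U V :: "(nat \<times> nat) \<times> nat"
  obtain a p c b q c' where UV: "U = ((a, p), c)" "V = ((b, q), c')" by (metis surj_pair)
  show "ent (per L L' m l (M + N)) U V = ent (per L L' m l M + per L L' m l N) U V"
    using N lix_less[OF _ _ l, of _ L _ m c] lix_less[OF _ _ l, of _ L' _ m c'] by (auto simp: UV ent_per[OF l])
qed

lemma per_minus:
  assumes l: "l \<ge> 1" and N: "N \<in> carrier_mat (L * (m * l)) (L' * (m * l))"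
  shows "per L L' m l (M - N) = per L L' m l M - per L L' m l N"
proof (rule rcf_eqI)
  fix U V :: "(nat \<times> nat) \<times> nat"
  obtain a p c b q c' where UV: "U = ((a, p), c)" "V = ((b, q), c')" by (metis surj_pair)
  show "ent (per L L' m l (M - N)) U V = ent (per L L' m l M - per L L' m l N) U V"
    using N lix_less[OF _ _ l, of _ L _ m c] lix_less[OF _ _ l, of _ L' _ m c'] by (auto simp: UV ent_per[OF l])
qed

lemma lix_eq_iff:
  assumes "u \<in> box L m" "v \<in> box L m" "l \<ge> 1" "c div l = c' div l"
  shows "lix L m l (u, c) = lix L m l (v, c') \<longleftrightarrow> u = v \<and> c = c'"
proof
  assume e: "lix L m l (u, c) = lix L m l (v, c')"
  obtain a p b q where uv: "u = (a, p)" "v = (b, q)" by fastforce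
  have "rix L m (lix L m l (u, c)) = rix L m (lix L m l (v, c'))" using e by simp
  then have "u = v" "c mod l = c' mod l" using assms by (auto simp: uv rix_lix)
  then show "u = v \<and> c = c'" using assms(4) by (metis div_mult_mod_eq)
qed simp

text \<open>Reads off the period of the blocks below \<open>l\<close>. The argument may be
  non-periodic, as with an inverse of which only the defining equation is known.\<close>

definition unper :: "nat \<Rightarrow> nat \<Rightarrow> nat \<Rightarrow> nat \<Rightarrow> ((nat \<times> nat) \<times> nat, 'a::ring) rcf \<Rightarrow> 'a mat" where
  "unper L L' m l N = mat (L * (m * l)) (L' * (m * l)) (\<lambda>(r, t). ent N (rix L m r) (rix L' m t))"

lemma unper_carrier [simp]: "unper L L' m l N \<in> carrier_mat (L * (m * l)) (L' * (m * l))"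
  by (simp add: unper_def)

lemma unper_per:
  assumes l: "l \<ge> 1" and M: "M \<in> carrier_mat (L * (m * l)) (L' * (m * l))"
  shows "unper L L' m l (per L L' m l M) = M"
proof (rule eq_matI)
  fix r t assume "r < dim_row M" "t < dim_col M"
  then have rt: "r < L * (m * l)" "t < L' * (m * l)" using M by auto
  obtain u c v c' where U: "rix L m r = (u, c)" and V: "rix L' m t = (v, c')" by fastforce
  have "u \<in> box L m" "c < l" "v \<in> box L' m" "c' < l"
    using rix_in[OF rt(1)] rix_in[OF rt(2)] U V by (auto simp: rix_def)
  then have "ent (per L L' m l M) (u, c) (v, c') = M $$ (lix L m l (u, c), lix L' m l (v, c'))"
    by (simp add: ent_per[OF l])
  then have "ent (per L L' m l M) (rix L m r) (rix L' m t) = M $$ (lix L m l (rix L m r), lix L' m l (rix L' m t))"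
    unfolding U V .
  then show "unper L L' m l (per L L' m l M) $$ (r, t) = M $$ (r, t)"
    using rt by (simp add: unper_def lix_rix)
qed (use M in \<open>auto simp: unper_def\<close>)

lemma per_inject:
  assumes "l \<ge> 1" "M \<in> carrier_mat (L * (m * l)) (L' * (m * l))" "N \<in> carrier_mat (L * (m * l)) (L' * (m * l))"
    "per L L' m l M = per L L' m l N"
  shows "M = N"
  using unper_per assms by metis

text \<open>One periodic factor is enough: its columns do not leave the period of their index, so
  entries of \<open>Q\<close> in columns outside the period do not contribute.\<close>

lemma unper_mult_per:
  assumes l: "l \<ge> 1" and M: "M \<in> carrier_mat (L' * (m * l)) (L'' * (m * l))"
  shows "unper L L'' m l (Q * per L' L'' m l M) = unper L L' m l Q * M"
proof (rule eq_matI)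
  fix r t assume "r < dim_row (unper L L' m l Q * M)" "t < dim_col (unper L L' m l Q * M)"
  then have rt: "r < L * (m * l)" "t < L'' * (m * l)" using M by (auto simp: unper_def)
  obtain v c' where V: "rix L'' m t = (v, c')" by fastforce
  have v: "v \<in> box L'' m" "c' < l" using rix_in[OF rt(2)] V by (auto simp: rix_def)
  have V': "lix L'' m l (v, c') = t" using lix_rix[OF rt(2)] V by simp
  let ?J = "box L' m \<times> {d. d div l = 0}"
  have "ent (Q * per L' L'' m l M) (rix L m r) (v, c') = (\<Sum>w\<in>?J. ent Q (rix L m r) w * ent (per L' L'' m l M) w (v, c'))"
    by (rule ent_times) (use v in \<open>auto simp: ent_per[OF l] finite_same_div[OF l] split: if_splits\<close>)
  also have "\<dots> = (\<Sum>w\<in>?J. (\<lambda>x d. ent Q (rix L m r) (x, d) * ent (per L' L'' m l M) (x, d) (v, c')) (fst w) (snd w))"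
    by simp
  also have "\<dots> = (\<Sum>k<L' * (m * l). ent Q (rix L m r) (fst (rix L' m k), 0 * l + snd (rix L' m k)) *
      ent (per L' L'' m l M) (fst (rix L' m k), 0 * l + snd (rix L' m k)) (v, c'))"
    by (rule sum_block[OF l])
  also have "\<dots> = (\<Sum>k<L' * (m * l). ent Q (rix L m r) (rix L' m k) * M $$ (k, t))"
  proof (intro sum.cong refl)
    fix k assume "k \<in> {..<L' * (m * l)}"
    then have k: "k < L' * (m * l)" by simp
    obtain x d where X: "rix L' m k = (x, d)" by fastforce
    have x: "x \<in> box L' m" "d < l" using rix_in[OF k] X by (auto simp: rix_def)
    show "ent Q (rix L m r) (fst (rix L' m k), 0 * l + snd (rix L' m k)) *
      ent (per L' L'' m l M) (fst (rix L' m k), 0 * l + snd (rix L' m k)) (v, c') =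
      ent Q (rix L m r) (rix L' m k) * M $$ (k, t)"
      using x v lix_rix[OF k] by (simp add: X ent_per[OF l] V')
  qed
  also have "\<dots> = (unper L L' m l Q * M) $$ (r, t)"
    using rt M by (simp add: unper_def scalar_prod_def atLeast0LessThan)
  finally show "unper L L'' m l (Q * per L' L'' m l M) $$ (r, t) = (unper L L' m l Q * M) $$ (r, t)"
    using rt by (simp add: unper_def V)
qed (use M in \<open>auto simp: unper_def\<close>)

lemma unper_per_mult:
  assumes l: "l \<ge> 1" and M: "M \<in> carrier_mat (L * (m * l)) (L' * (m * l))"
  shows "unper L L'' m l (per L L' m l M * Q) = M * unper L' L'' m l Q"
proof (rule eq_matI)
  fix r t assume "r < dim_row (M * unper L' L'' m l Q)" "t < dim_col (M * unper L' L'' m l Q)"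
  then have rt: "r < L * (m * l)" "t < L'' * (m * l)" using M by (auto simp: unper_def)
  obtain v c' where V: "rix L m r = (v, c')" by fastforce
  have v: "v \<in> box L m" "c' < l" using rix_in[OF rt(1)] V by (auto simp: rix_def)
  have V': "lix L m l (v, c') = r" using lix_rix[OF rt(1)] V by simp
  let ?J = "box L' m \<times> {d. d div l = 0}"
  have "ent (per L L' m l M * Q) (v, c') (rix L'' m t) = (\<Sum>w\<in>?J. ent (per L L' m l M) (v, c') w * ent Q w (rix L'' m t))"
    by (rule ent_times) (use v in \<open>auto simp: ent_per[OF l] finite_same_div[OF l] split: if_splits\<close>)
  also have "\<dots> = (\<Sum>w\<in>?J. (\<lambda>x d. ent (per L L' m l M) (v, c') (x, d) * ent Q (x, d) (rix L'' m t)) (fst w) (snd w))"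
    by simp
  also have "\<dots> = (\<Sum>k<L' * (m * l). ent (per L L' m l M) (v, c') (fst (rix L' m k), 0 * l + snd (rix L' m k)) *
      ent Q (fst (rix L' m k), 0 * l + snd (rix L' m k)) (rix L'' m t))"
    by (rule sum_block[OF l])
  also have "\<dots> = (\<Sum>k<L' * (m * l). M $$ (r, k) * ent Q (rix L' m k) (rix L'' m t))"
  proof (intro sum.cong refl)
    fix k assume "k \<in> {..<L' * (m * l)}"
    then have k: "k < L' * (m * l)" by simp
    obtain x d where X: "rix L' m k = (x, d)" by fastforce
    have x: "x \<in> box L' m" "d < l" using rix_in[OF k] X by (auto simp: rix_def)
    show "ent (per L L' m l M) (v, c') (fst (rix L' m k), 0 * l + snd (rix L' m k)) *
      ent Q (fst (rix L' m k), 0 * l + snd (rix L' m k)) (rix L'' m t) =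
      M $$ (r, k) * ent Q (rix L' m k) (rix L'' m t)"
      using x v lix_rix[OF k] by (simp add: X ent_per[OF l] V')
  qed
  also have "\<dots> = (M * unper L' L'' m l Q) $$ (r, t)"
    using rt M by (simp add: unper_def scalar_prod_def atLeast0LessThan)
  finally show "unper L L'' m l (per L L' m l M * Q) $$ (r, t) = (M * unper L' L'' m l Q) $$ (r, t)"
    using rt by (simp add: unper_def V)
qed (use M in \<open>auto simp: unper_def\<close>)

lemma (in unital_algebra) per_one: "l \<ge> 1 \<Longrightarrow> per L L m l (1\<^sub>m (L * (m * l))) = kap sc (idm (box L m))"
proof (rule rcf_eqI)
  assume l: "l \<ge> 1"
  fix U V :: "(nat \<times> nat) \<times> nat"
  obtain a p c b q c' where UV: "U = ((a, p), c)" "V = ((b, q), c')" by (metis surj_pair)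
  show "ent (per L L m l (1\<^sub>m (L * (m * l)))) U V = ent (kap sc (idm (box L m))) U V"
    using lix_less[OF _ _ l, of _ L _ m c] lix_less[OF _ _ l, of _ L _ m c'] lix_eq_iff[OF _ _ l, of "(a, p)" L m "(b, q)" c c']
    by (auto simp: UV ent_per[OF l] ent_kap ent_idm)
qed

lemma per_supp:
  assumes "l \<ge> 1"
  shows "idm (box L m \<times> UNIV) * per L L' m l M = per L L' m l M" "per L L' m l M * idm (box L' m \<times> UNIV) = per L L' m l M"
proof -
  show "idm (box L m \<times> UNIV) * per L L' m l M = per L L' m l M"
  proof (rule rcf_eqI)
    fix U V show "ent (idm (box L m \<times> UNIV) * per L L' m l M) U V = ent (per L L' m l M) U V"
      by (cases U; cases V) (auto simp: ent_idm_times ent_per[OF assms])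
  qed
  show "per L L' m l M * idm (box L' m \<times> UNIV) = per L L' m l M"
  proof (rule rcf_eqI)
    fix U V show "ent (per L L' m l M * idm (box L' m \<times> UNIV)) U V = ent (per L L' m l M) U V"
      by (cases U; cases V) (auto simp: ent_times_idm ent_per[OF assms])
  qed
qed

lemma (in unital_algebra) kap_idm: "kap sc (idm S) = (idm (S \<times> UNIV) :: ('i \<times> nat, 'a) rcf)"
proof (rule rcf_eqI)
  fix U V show "ent (kap sc (idm S)) U V = ent (idm (S \<times> UNIV) :: ('i \<times> nat, 'a) rcf) U V"
    by (cases U; cases V) (auto simp: ent_kap ent_idm)
qed

section \<open>Invertible pencils and stable finiteness\<close>

context unital_algebra
begin

text \<open>One-sided inverses pass between matrices and the ring. Off the corner \<open>e\<close>
  the element \<open>1 - per L L m l N\<close> is the identity, which accounts for the summand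
  \<open>1 - e\<close>.\<close>

lemma per_unit_iff:
  assumes l: "l \<ge> 1" and N: "N \<in> carrier_mat (L * (m * l)) (L * (m * l))"
  defines "e \<equiv> kap sc (idm (box L m))"
  shows "Q0 \<in> carrier_mat (L * (m * l)) (L * (m * l)) \<Longrightarrow> Q0 * (1\<^sub>m (L * (m * l)) - N) = 1\<^sub>m (L * (m * l)) \<Longrightarrow>
      (per L L m l Q0 + (1 - e)) * (1 - per L L m l N) = 1"
    and "Q0 \<in> carrier_mat (L * (m * l)) (L * (m * l)) \<Longrightarrow> (1\<^sub>m (L * (m * l)) - N) * Q0 = 1\<^sub>m (L * (m * l)) \<Longrightarrow>
      (1 - per L L m l N) * (per L L m l Q0 + (1 - e)) = 1"
    and "Q * (1 - per L L m l N) = 1 \<Longrightarrow> unper L L m l Q * (1\<^sub>m (L * (m * l)) - N) = 1\<^sub>m (L * (m * l))"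
    and "(1 - per L L m l N) * Q = 1 \<Longrightarrow> (1\<^sub>m (L * (m * l)) - N) * unper L L m l Q = 1\<^sub>m (L * (m * l))"
proof -
  let ?n = "L * (m * l)" and ?X = "per L L m l N"
  let ?Pm = "1\<^sub>m ?n - N"
  have P0: "?Pm \<in> carrier_mat ?n ?n" using N by (rule minus_carrier_mat)
  have one: "per L L m l (1\<^sub>m ?n) = e" unfolding e_def by (rule per_one[OF l])
  have eX: "e * per L L m l M = per L L m l M" "per L L m l M * e = per L L m l M" for M
    unfolding e_def kap_idm by (rule per_supp[OF l])+
  have perP: "per L L m l ?Pm = e - ?X" using per_minus[OF l N, of "1\<^sub>m ?n"] one by simp
  have Pe: "(1 - ?X) * e = per L L m l ?Pm" "e * (1 - ?X) = per L L m l ?Pm"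
    unfolding perP by (simp_all add: left_diff_distrib right_diff_distrib eX)
  have P1e: "(1 - ?X) * (1 - e) = 1 - e" "(1 - e) * (1 - ?X) = 1 - e"
    by (simp_all add: algebra_simps eX)
  have un: "unper L L m l e = 1\<^sub>m ?n" unfolding one[symmetric] by (rule unper_per[OF l]) simp
  {
    assume Q0: "Q0 \<in> carrier_mat ?n ?n"
    { assume "Q0 * ?Pm = 1\<^sub>m ?n"
      then have "per L L m l Q0 * (e * (1 - ?X)) = e"
        unfolding Pe using per_mult[OF l Q0 P0] one by simp
      then have "per L L m l Q0 * (1 - ?X) = e" using eX by (metis mult.assoc)
      then show "(per L L m l Q0 + (1 - e)) * (1 - ?X) = 1"
        by (simp add: distrib_right P1e) }
    { assume "?Pm * Q0 = 1\<^sub>m ?n"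
      then have "((1 - ?X) * e) * per L L m l Q0 = e"
        unfolding Pe using per_mult[OF l P0 Q0] one by simp
      then have "(1 - ?X) * per L L m l Q0 = e" using eX by (metis mult.assoc)
      then show "(1 - ?X) * (per L L m l Q0 + (1 - e)) = 1"
        by (simp add: distrib_left P1e) }
  }
  { assume "Q * (1 - ?X) = 1"
    then have "Q * per L L m l ?Pm = e" unfolding Pe[symmetric] by (simp add: mult.assoc[symmetric])
    then show "unper L L m l Q * ?Pm = 1\<^sub>m ?n" using unper_mult_per[OF l P0, of L Q] un by simp }
  { assume "(1 - ?X) * Q = 1"
    then have "per L L m l ?Pm * Q = e" unfolding Pe(2)[symmetric] by (simp add: mult.assoc)
    then show "?Pm * unper L L m l Q = 1\<^sub>m ?n" using unper_per_mult[OF l P0, of L Q] un by simp }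
qed

text \<open>A one-sided inverse \<open>Q\<close> is cut down to a period, where stable finiteness of
  square matrices applies. Extended periodically, it is an inverse on the other side, and a left and
  a right inverse coincide.\<close>

lemma per_stably_finite:
  fixes N :: "'a mat"
  assumes l: "l \<ge> 1" and N: "N \<in> carrier_mat (L * (m * l)) (L * (m * l))" and sf: "stably_finite TYPE('a)"
  shows "Q * (1 - per L L m l N) = 1 \<longleftrightarrow> (1 - per L L m l N) * Q = 1"
proof -
  let ?n = "L * (m * l)" and ?P = "1 - per L L m l N"
  let ?Pm = "1\<^sub>m ?n - N"
  have P0: "?Pm \<in> carrier_mat ?n ?n" using N by (rule minus_carrier_mat)
  have com: "A * B = 1\<^sub>m ?n \<longleftrightarrow> B * A = 1\<^sub>m ?n" if "A \<in> carrier_mat ?n ?n" "B \<in> carrier_mat ?n ?n" for A B :: "'a mat"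
  proof (cases "?n = 0")
    case True
    then show ?thesis using that by (intro iffI eq_matI) auto
  next
    case False
    then show ?thesis using sf that unfolding stably_finite_def by (metis One_nat_def Suc_leI neq0_conv)
  qed
  let ?Q' = "per L L m l (unper L L m l Q) + (1 - kap sc (idm (box L m)))"
  note u = unper_carrier[of L L m l Q]
  show ?thesis
  proof
    assume 1: "Q * ?P = 1"
    have "unper L L m l Q * ?Pm = 1\<^sub>m ?n" by (rule per_unit_iff(3)[OF l N 1])
    then have "?Pm * unper L L m l Q = 1\<^sub>m ?n" using com[OF u P0] by simp
    then have 2: "?P * ?Q' = 1" by (rule per_unit_iff(2)[OF l N u])
    have "Q * (?P * ?Q') = ?Q'" using 1 by (simp add: mult.assoc[symmetric])
    then show "?P * Q = 1" using 2 by simp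
  next
    assume 1: "?P * Q = 1"
    have "?Pm * unper L L m l Q = 1\<^sub>m ?n" by (rule per_unit_iff(4)[OF l N 1])
    then have "unper L L m l Q * ?Pm = 1\<^sub>m ?n" using com[OF u P0] by simp
    then have 2: "?Q' * ?P = 1" by (rule per_unit_iff(1)[OF l N u])
    have "(?Q' * ?P) * Q = ?Q'" using 1 by (simp add: mult.assoc)
    then show "Q * ?P = 1" using 2 by simp
  qed
qed

end

section \<open>Realizations of expressions\<close>

text \<open>\<open>((k, i, i'), p, q)\<close> names entry \<open>(i, i')\<close> of block
  \<open>(p, q)\<close> of the variable \<open>k\<close>. At a point of size \<open>s m l\<close>
  this coordinate is an l x l matrix, repeated periodically.\<close>

type_synonym 'd idx = "('d \<times> nat \<times> nat) \<times> nat \<times> nat"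

definition Jx :: "nat \<Rightarrow> nat \<Rightarrow> 'd idx set" where
  "Jx s m = (UNIV \<times> {..<s} \<times> {..<s}) \<times> {..<m} \<times> {..<m}"

lemma finite_Jx [simp]: "finite (Jx s m :: 'd::finite idx set)"
  by (simp add: Jx_def)

definition frm :: "nat \<Rightarrow> nat \<Rightarrow> 'k mat \<Rightarrow> (nat \<times> nat, 'k::ring) rcf" where
  "frm s m W = Mk (\<lambda>u v. if u \<in> box s m \<and> v \<in> box s m then W $$ (snd u * s + fst u, snd v * s + fst v) else 0)"

lemma ent_frm: "ent (frm s m W) u v =
  (if u \<in> box s m \<and> v \<in> box s m then W $$ (snd u * s + fst u, snd v * s + fst v) else 0)"
  unfolding frm_def by (subst ent_Mk) (auto intro: finite_subset[of _ "box s m"])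

text \<open>The coordinates of a point \<open>X\<close> of size \<open>s m l\<close> relative to a centre \<open>W\<close> of size \<open>s m\<close>.\<close>

definition xi :: "('k \<Rightarrow> 'a \<Rightarrow> 'a) \<Rightarrow> nat \<Rightarrow> nat \<Rightarrow> nat \<Rightarrow> ('d \<Rightarrow> 'k mat) \<Rightarrow> ('d \<Rightarrow> 'a mat) \<Rightarrow> 'd idx \<Rightarrow>
    (nat, 'a::{ring,monoid_mult}) rcf" where
  "xi sc s m l W X = (\<lambda>((k, i, i'), p, q). Mk (\<lambda>c c'. if c div l = c' div l
     then X k $$ (lix s m l ((i, p), c), lix s m l ((i', q), c')) -
       (if c = c' then sc (W k $$ (p * s + i, q * s + i')) 1 else 0) else 0))"

lemma ent_xi:
  assumes l: "l \<ge> 1"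
  shows "ent (xi sc s m l W X ((k, i, i'), p, q)) c c' = (if c div l = c' div l
     then X k $$ (lix s m l ((i, p), c), lix s m l ((i', q), c')) -
       (if c = c' then sc (W k $$ (p * s + i, q * s + i')) 1 else 0) else 0)"
proof -
  let ?f = "\<lambda>c c'. if c div l = c' div l
     then X k $$ (lix s m l ((i, p), c), lix s m l ((i', q), c')) -
       (if c = c' then sc (W k $$ (p * s + i, q * s + i')) 1 else 0) else 0"
  have "finite {c'. ?f c c' \<noteq> 0}" for c
    by (rule finite_subset[OF _ finite_same_div[OF l, of "c div l"]]) (auto split: if_splits)
  moreover have "finite {c. ?f c c' \<noteq> 0}" for c'
    by (rule finite_subset[OF _ finite_same_div[OF l, of "c' div l"]]) (auto split: if_splits)
  ultimately have "ent (Mk ?f) = ?f" by (intro ent_Mk)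
  then show ?thesis by (simp add: xi_def)
qed

lemma same_block_eq: "c div l = c' div l \<Longrightarrow> c mod l = c' mod l \<longleftrightarrow> c = (c'::nat)"
  by (metis div_mult_mod_eq)

lemma xi_mod:
  assumes l: "l \<ge> 1"
  shows "ent (xi sc s m l W X j) c c' = (if c div l = c' div l then ent (xi sc s m l W X j) (c mod l) (c' mod l) else 0)"
proof -
  obtain k i i' p q where j: "j = ((k, i, i'), p, q)" by (metis surj_pair)
  show ?thesis using l same_block_eq[of c l c'] by (simp add: j ent_xi[OF l] lix_def)
qed

context unital_algebra
begin

lemma pencil_eval_lft: "pencil_eval (kap sc) (\<lambda>j. lft (y j)) I"
  by unfold_locales (auto simp: kap_add kap_times kap_one lft_kap_commute)

definition evx :: "nat \<Rightarrow> nat \<Rightarrow> nat \<Rightarrow> ('d \<Rightarrow> 'k mat) \<Rightarrow> ('d \<Rightarrow> 'a mat) \<Rightarrow> ('d idx, (nat \<times> nat, 'k) rcf) lsys \<Rightarrow>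
    ((nat \<times> nat) \<times> nat, 'a) rcf \<Rightarrow> bool" where
  "evx s m l W X \<Sigma> v \<longleftrightarrow> pencil_eval.ev (kap sc) (\<lambda>j. lft (xi sc s m l W X j)) (Jx s m) \<Sigma> v"

abbreviation linx :: "nat \<Rightarrow> nat \<Rightarrow> nat \<Rightarrow> ('d \<Rightarrow> 'k mat) \<Rightarrow> ('d \<Rightarrow> 'a mat) \<Rightarrow> ('d idx \<Rightarrow> (nat \<times> nat, 'k) rcf) \<Rightarrow>
    ((nat \<times> nat) \<times> nat, 'a) rcf" where
  "linx s m l W X A \<equiv> pencil_eval.lin (kap sc) (\<lambda>j. lft (xi sc s m l W X j)) (Jx s m) A"

lemma ent_linx: "ent (linx s m l W X A) (u, c) (v, c') = (\<Sum>j\<in>Jx s m. sc (ent (A j) u v) (ent (xi sc s m l W X j) c c'))"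
  unfolding pencil_eval.lin_def[OF pencil_eval_lft] by (simp add: ent_sum ent_kap_lft)

lemma linx_periodic:
  assumes l: "l \<ge> 1" and A: "\<And>j. j \<in> Jx s m \<Longrightarrow> idm (box L n) * A j = A j" "\<And>j. j \<in> Jx s m \<Longrightarrow> A j * idm (box L' n) = A j"
  shows "linx s m l W X A = per L L' n l (unper L L' n l (linx s m l W X A))"
proof (rule rcf_eqI)
  fix U V :: "(nat \<times> nat) \<times> nat"
  obtain u c v c' where UV: "U = (u, c)" "V = (v, c')" by fastforce
  show "ent (linx s m l W X A) U V = ent (per L L' n l (unper L L' n l (linx s m l W X A))) U V"
  proof (cases "u \<in> box L n \<and> v \<in> box L' n \<and> c div l = c' div l")
    case True
    then obtain a p b q where uv: "u = (a, p)" "v = (b, q)" "a < L" "p < n" "b < L'" "q < n" by auto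
    have "ent (linx s m l W X A) U V = ent (linx s m l W X A) (u, c mod l) (v, c' mod l)"
      using True xi_mod[OF l, of sc s m W X _ c c'] by (simp add: UV ent_linx)
    then show ?thesis
      using True uv lix_less[of a L p n l c] lix_less[of b L' q n l c'] l
      by (simp add: UV ent_per[OF l] unper_def rix_lix)
  next
    case False
    have z: "sc (ent (A j) u v) (ent (xi sc s m l W X j) c c') = 0" if j: "j \<in> Jx s m" for j
    proof (cases "c div l = c' div l")
      case True
      have "ent (A j) u v = 0"
        using False True arg_cong[OF A(1)[OF j], of "\<lambda>M. ent M u v"] arg_cong[OF A(2)[OF j], of "\<lambda>M. ent M u v"]
        by (auto simp: ent_times_idm ent_idm_times split: if_splits)
      then show ?thesis by simp
    next
      case False
      then show ?thesis using xi_mod[OF l, of sc s m W X j c c'] by simp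
    qed
    show ?thesis
      unfolding UV ent_linx ent_per[OF l] if_not_P[OF False] by (rule sum.neutral) (use z in blast)
  qed
qed

text \<open>This supplies the hypotheses \<open>fin1\<close> and \<open>fin2\<close> of
  \<open>ev_transfer\<close>: a linear form with coefficients supported in a box is periodic, hence
  governed by a matrix of finite size.\<close>

lemma linx_stably_finite:
  assumes l: "l \<ge> 1" and sf: "stably_finite TYPE('a)"
    and A: "\<And>j. j \<in> Jx s m \<Longrightarrow> idm (box L n) * A j = A j" "\<And>j. j \<in> Jx s m \<Longrightarrow> A j * idm (box L n) = A j"
  shows "Q * (1 - linx s m l W X A) = 1 \<longleftrightarrow> (1 - linx s m l W X A) * Q = 1"
proof -
  obtain N where N: "N \<in> carrier_mat (L * (n * l)) (L * (n * l))" and e: "linx s m l W X A = per L L n l N"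
    using linx_periodic[where W = W and X = X and A = A, OF l A] unper_carrier by blast
  show ?thesis unfolding e by (rule per_stably_finite[OF l N sf])
qed

text \<open>A point is its centre plus a linear form in the coordinates; so a variable is given by a
  system with \<open>sysA\<close> equal to 0.\<close>

lemma per_point:
  assumes l: "l \<ge> 1"
  shows "per s s m l (X k) = kap sc (frm s m (W k)) +
    linx s m l W X (\<lambda>((k', i, i'), p, q). if k' = (k::'d::finite) then unt 1 (i, p) (i', q) else 0)"
proof (rule rcf_eqI)
  fix U V :: "(nat \<times> nat) \<times> nat"
  obtain a p c b q c' where UV: "U = ((a, p), c)" "V = ((b, q), c')" by (metis surj_pair)
  let ?A = "\<lambda>((k', i, i'), p, q). if k' = k then unt (1::'k) (i, p) (i', q) else 0"
  let ?j = "((k, a, b), p, q)"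
  have "ent (linx s m l W X ?A) U V = (\<Sum>j\<in>Jx s m. if j = ?j then ent (xi sc s m l W X ?j) c c' else 0)"
    unfolding UV ent_linx
  proof (intro sum.cong refl)
    fix j :: "'d idx"
    obtain k' i i' p' q' where j: "j = ((k', i, i'), p', q')" by (metis surj_pair)
    show "sc (ent (?A j) (a, p) (b, q)) (ent (xi sc s m l W X j) c c') =
        (if j = ?j then ent (xi sc s m l W X ?j) c c' else 0)"
      by (cases "j = ?j") (auto simp: j ent_unt)
  qed
  also have "\<dots> = (if ?j \<in> Jx s m then ent (xi sc s m l W X ?j) c c' else 0)"
    by simp
  finally have lin: "ent (linx s m l W X ?A) U V = (if ?j \<in> Jx s m then ent (xi sc s m l W X ?j) c c' else 0)" .
  have J: "?j \<in> Jx s m \<longleftrightarrow> a < s \<and> p < m \<and> b < s \<and> q < m" by (auto simp: Jx_def)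
  show "ent (per s s m l (X k)) U V = ent (kap sc (frm s m (W k)) + linx s m l W X ?A) U V"
  proof (cases "a < s \<and> p < m \<and> b < s \<and> q < m")
    case False
    then show ?thesis
      unfolding ent_plus lin J
      by (cases "a < s"; cases "p < m"; cases "b < s"; cases "q < m") (simp_all add: UV ent_per[OF l] ent_kap ent_frm)
  next
    case box: True
    show ?thesis
    proof (cases "c div l = c' div l")
      case True
      then show ?thesis
        unfolding ent_plus lin J using box by (simp add: UV ent_per[OF l] ent_kap ent_frm ent_xi[OF l])
    next
      case False
      then have "c \<noteq> c'" by auto
      then show ?thesis
        unfolding ent_plus lin J using box False by (simp add: UV ent_per[OF l] ent_kap ent_frm ent_xi[OF l])
    qed
  qed
qed

end

subsection \<open>Arithmetic of systems\<close>

text \<open>Injections onto the even and the odd positions. With their transposes they satisfy the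
  relations of \<open>ev_plus\<close>, so that two state spaces fit into one index set.\<close>

definition jn :: "nat \<Rightarrow> (nat \<times> nat, 'k::{ring,monoid_mult}) rcf" where
  "jn d = Mk (\<lambda>u v. if snd u = snd v \<and> fst u = 2 * fst v + d then 1 else 0)"

lemma ent_jn: "ent (jn d) u v = (if snd u = snd v \<and> fst u = 2 * fst v + d then 1 else 0)"
proof -
  let ?f = "\<lambda>(u :: nat \<times> nat) v. if snd u = snd v \<and> fst u = 2 * fst v + d then 1 else 0 :: 'a"
  have "finite {v. ?f u v \<noteq> 0}" for u
    by (rule finite_subset[of _ "{((fst u - d) div 2, snd u)}"]) (auto split: if_splits)
  moreover have "finite {u. ?f u v \<noteq> 0}" for v
    by (rule finite_subset[of _ "{(2 * fst v + d, snd v)}"]) (auto split: if_splits)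
  ultimately have "ent (Mk ?f) = ?f" by (intro ent_Mk)
  then show ?thesis by (simp add: jn_def)
qed

lemma jn_rels:
  "trp (jn 0) * jn 0 = (1 :: (nat \<times> nat, 'k::{ring,monoid_mult}) rcf)"
  "trp (jn 1) * jn 1 = (1 :: (nat \<times> nat, 'k) rcf)"
  "trp (jn 0) * jn 1 = (0 :: (nat \<times> nat, 'k) rcf)" "trp (jn 1) * jn 0 = (0 :: (nat \<times> nat, 'k) rcf)"
  "jn 0 * trp (jn 0) + jn 1 * trp (jn 1) = (1 :: (nat \<times> nat, 'k) rcf)"
proof -
  have tj: "ent (trp (jn d) * jn d' :: (nat \<times> nat, 'k) rcf) u v =
    (if snd u = snd v \<and> 2 * fst u + d = 2 * fst v + d' then 1 else 0)" for d d' u v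
    by (subst ent_times[of "{(2 * fst u + d, snd u)}"]) (auto simp: ent_jn split: if_splits)
  have jt: "ent (jn d * trp (jn d) :: (nat \<times> nat, 'k) rcf) u v =
    (if u = v \<and> fst u mod 2 = d then 1 else 0)" if "d < 2" for d u v
  proof -
    have sub: "{w. ent (jn d :: (nat \<times> nat, 'k) rcf) u w \<noteq> 0 \<and> ent (trp (jn d) :: (nat \<times> nat, 'k) rcf) w v \<noteq> 0}
      \<subseteq> {(fst u div 2, snd u)}"
    proof
      fix w assume "w \<in> {w. ent (jn d :: (nat \<times> nat, 'k) rcf) u w \<noteq> 0 \<and> ent (trp (jn d) :: (nat \<times> nat, 'k) rcf) w v \<noteq> 0}"
      then have "snd u = snd w" "fst u = 2 * fst w + d" by (auto simp: ent_jn split: if_splits)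
      then show "w \<in> {(fst u div 2, snd u)}" using that by (simp add: prod_eq_iff)
    qed
    have "ent (jn d * trp (jn d) :: (nat \<times> nat, 'k) rcf) u v = ent (jn d) u (fst u div 2, snd u) * ent (trp (jn d)) (fst u div 2, snd u) v"
      using ent_times[OF _ sub] by simp
    also have "\<dots> = (if fst u = 2 * (fst u div 2) + d \<and> snd v = snd u \<and> fst v = 2 * (fst u div 2) + d then 1 else 0)"
      by (simp add: ent_jn)
    also have "\<dots> = (if u = v \<and> fst u mod 2 = d then 1 else 0)"
    proof (rule if_cong)
      have 1: "fst u = 2 * (fst u div 2) + d \<longleftrightarrow> fst u mod 2 = d" using that by presburger
      have 2: "x = y \<and> snd v = snd u \<and> fst v = y \<longleftrightarrow> x = y \<and> snd u = snd v \<and> x = fst v" for x y by auto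
      show "fst u = 2 * (fst u div 2) + d \<and> snd v = snd u \<and> fst v = 2 * (fst u div 2) + d \<longleftrightarrow> u = v \<and> fst u mod 2 = d"
        unfolding 2 unfolding 1 prod_eq_iff by blast
    qed auto
    finally show ?thesis .
  qed
  show "trp (jn 0) * jn 0 = (1 :: (nat \<times> nat, 'k) rcf)" "trp (jn 1) * jn 1 = (1 :: (nat \<times> nat, 'k) rcf)"
    by (rule rcf_eqI, subst tj, auto simp: ent_one prod_eq_iff)+
  have tz: "trp (jn d) * jn d' = (0 :: (nat \<times> nat, 'k) rcf)" if "d < 2" "d' < 2" "d \<noteq> d'" for d d'
  proof (rule rcf_eqI)
    fix u v :: "nat \<times> nat"
    have "2 * fst u + d \<noteq> 2 * fst v + d'" using that by presburger
    then show "ent (trp (jn d) * jn d' :: (nat \<times> nat, 'k) rcf) u v = ent 0 u v" by (simp add: tj)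
  qed
  show "trp (jn 0) * jn 1 = (0 :: (nat \<times> nat, 'k) rcf)" "trp (jn 1) * jn 0 = (0 :: (nat \<times> nat, 'k) rcf)"
    by (rule tz; simp)+
  show "jn 0 * trp (jn 0) + jn 1 * trp (jn 1) = (1 :: (nat \<times> nat, 'k) rcf)"
    by (rule rcf_eqI) (auto simp: jt ent_one)
qed

type_synonym ('d, 'k) ksys = "('d idx, (nat \<times> nat, 'k) rcf) lsys"

text \<open>Finite support replaces a fixed state dimension: the sum of two state spaces is formed inside the same
  index set by \<open>jn\<close>.\<close>

definition sysok :: "nat \<Rightarrow> nat \<Rightarrow> ('d, 'k::field) ksys \<Rightarrow> bool" where
  "sysok s m \<Sigma> \<longleftrightarrow> idm (box s m) * sysC \<Sigma> = sysC \<Sigma> \<and> idm (box s m) * sysD \<Sigma> = sysD \<Sigma> \<and>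
     sysD \<Sigma> * idm (box s m) = sysD \<Sigma> \<and> fins (sysC \<Sigma>) \<and>
     (\<forall>j\<in>Jx s m. sysB \<Sigma> j * idm (box s m) = sysB \<Sigma> j \<and> fins (sysA \<Sigma> j) \<and> fins (sysB \<Sigma> j))"

lemma sysok_supp:
  fixes \<Sigma> :: "('d::finite, 'k::field) ksys"
  assumes "sysok s m \<Sigma>"
  obtains S where "finite S" "supp (Jx s m) S \<Sigma>"
proof -
  have "\<exists>S. finite S \<and> (\<forall>T. S \<subseteq> T \<longrightarrow> idm T * M = M \<and> M * idm T = M)" if "fins M" for M :: "(nat \<times> nat, 'k) rcf"
    using fins_support[OF that] by metis
  then obtain S where S: "\<And>M :: (nat \<times> nat, 'k) rcf. fins M \<Longrightarrow> finite (S M)"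
    "\<And>(M :: (nat \<times> nat, 'k) rcf) T. fins M \<Longrightarrow> S M \<subseteq> T \<Longrightarrow> idm T * M = M \<and> M * idm T = M" by metis
  let ?U = "S (sysC \<Sigma>) \<union> (\<Union>j\<in>Jx s m. S (sysA \<Sigma> j) \<union> S (sysB \<Sigma> j))"
  have f: "fins (sysC \<Sigma>)" "\<And>j. j \<in> Jx s m \<Longrightarrow> fins (sysA \<Sigma> j)" "\<And>j. j \<in> Jx s m \<Longrightarrow> fins (sysB \<Sigma> j)"
    using assms by (auto simp: sysok_def)
  show ?thesis
  proof (rule that[of ?U])
    show "finite ?U" using S(1) f by auto
    have "sysC \<Sigma> * idm ?U = sysC \<Sigma>" using S(2)[OF f(1), of ?U] by blast
    moreover have "idm ?U * sysA \<Sigma> j = sysA \<Sigma> j \<and> sysA \<Sigma> j * idm ?U = sysA \<Sigma> j" if "j \<in> Jx s m" for j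
      using S(2)[OF f(2)[OF that], of ?U] that by blast
    moreover have "idm ?U * sysB \<Sigma> j = sysB \<Sigma> j" if "j \<in> Jx s m" for j
      using S(2)[OF f(3)[OF that], of ?U] that by blast
    ultimately show "supp (Jx s m) ?U \<Sigma>" by (simp add: supp_def)
  qed
qed

definition sys_plus :: "('d, 'k::field) ksys \<Rightarrow> ('d, 'k) ksys \<Rightarrow> ('d, 'k) ksys" where
  "sys_plus \<Sigma>1 \<Sigma>2 = \<lparr>sysD = sysD \<Sigma>1 + sysD \<Sigma>2, sysC = sysC \<Sigma>1 * trp (jn 0) + sysC \<Sigma>2 * trp (jn 1),
    sysA = \<lambda>i. jn 0 * sysA \<Sigma>1 i * trp (jn 0) + jn 1 * sysA \<Sigma>2 i * trp (jn 1),
    sysB = \<lambda>i. jn 0 * sysB \<Sigma>1 i + jn 1 * sysB \<Sigma>2 i\<rparr>"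

definition sys_times :: "('d, 'k::field) ksys \<Rightarrow> ('d, 'k) ksys \<Rightarrow> ('d, 'k) ksys" where
  "sys_times \<Sigma>1 \<Sigma>2 = \<lparr>sysD = sysD \<Sigma>1 * sysD \<Sigma>2, sysC = sysC \<Sigma>1 * trp (jn 0) + sysD \<Sigma>1 * sysC \<Sigma>2 * trp (jn 1),
    sysA = \<lambda>i. jn 0 * sysA \<Sigma>1 i * trp (jn 0) + jn 1 * sysA \<Sigma>2 i * trp (jn 1) + jn 0 * sysB \<Sigma>1 i * (sysC \<Sigma>2 * trp (jn 1)),
    sysB = \<lambda>i. jn 0 * sysB \<Sigma>1 i * sysD \<Sigma>2 + jn 1 * sysB \<Sigma>2 i\<rparr>"

definition sys_inv :: "(nat \<times> nat, 'k::field) rcf \<Rightarrow> ('d, 'k) ksys \<Rightarrow> ('d, 'k) ksys" where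
  "sys_inv E \<Sigma> = \<lparr>sysD = E, sysC = - (E * sysC \<Sigma>),
    sysA = \<lambda>i. sysA \<Sigma> i - sysB \<Sigma> i * (E * sysC \<Sigma>), sysB = \<lambda>i. sysB \<Sigma> i * E\<rparr>"

lemma idm_mult_left: "idm S * x = x \<Longrightarrow> idm S * (x * y) = x * y"
  by (simp add: mult.assoc[symmetric])

lemma sysok_plus: "sysok s m \<Sigma>1 \<Longrightarrow> sysok s m \<Sigma>2 \<Longrightarrow> sysok s m (sys_plus \<Sigma>1 \<Sigma>2)"
  by (auto simp: sysok_def sys_plus_def distrib_left distrib_right mult.assoc idm_mult_left
      fins_plus fins_times_left fins_times_right)

lemma sysok_times: "sysok s m \<Sigma>1 \<Longrightarrow> sysok s m \<Sigma>2 \<Longrightarrow> sysok s m (sys_times \<Sigma>1 \<Sigma>2)"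
  by (auto simp: sysok_def sys_times_def distrib_left distrib_right mult.assoc idm_mult_left
      fins_plus fins_times_left fins_times_right)

lemma sysok_inv:
  assumes "sysok s m \<Sigma>" "idm (box s m) * E = E" "E * idm (box s m) = E"
  shows "sysok s m (sys_inv E \<Sigma>)"
  using assms by (auto simp: sysok_def sys_inv_def mult.assoc idm_mult_left
      fins_minus fins_uminus fins_times_right fins_times_left)

context unital_algebra
begin

text \<open>\<open>D\<close> and \<open>V\<close> are arbitrary families of domains and values, one
  for each \<open>l\<close>; words and partial sums of a polynomial are thus treated like
  expressions.\<close>

definition models :: "nat \<Rightarrow> nat \<Rightarrow> ('d::finite \<Rightarrow> 'k mat) \<Rightarrow> (nat \<Rightarrow> ('d \<Rightarrow> 'a mat) set) \<Rightarrow>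
    (nat \<Rightarrow> ('d \<Rightarrow> 'a mat) \<Rightarrow> 'a mat) \<Rightarrow> ('d, 'k) ksys \<Rightarrow> bool" where
  "models s m W D V \<Sigma> \<longleftrightarrow> (\<forall>l\<ge>1. \<forall>X\<in>D l. V l X \<in> carrier_mat (s * (m * l)) (s * (m * l)) \<and>
     evx s m l W X \<Sigma> (per s s m l (V l X)))"

lemma models_plus:
  assumes "models s m W D1 V1 \<Sigma>1" "models s m W D2 V2 \<Sigma>2"
  shows "models s m W (\<lambda>l. D1 l \<inter> D2 l) (\<lambda>l X. V1 l X + V2 l X) (sys_plus \<Sigma>1 \<Sigma>2)"
  unfolding models_def
proof (intro allI impI ballI conjI)
  fix l X assume l: "l \<ge> 1" and X: "X \<in> D1 l \<inter> D2 l"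
  then have c: "V1 l X \<in> carrier_mat (s * (m * l)) (s * (m * l))" "V2 l X \<in> carrier_mat (s * (m * l)) (s * (m * l))"
    and e: "evx s m l W X \<Sigma>1 (per s s m l (V1 l X))" "evx s m l W X \<Sigma>2 (per s s m l (V2 l X))"
    using assms unfolding models_def by auto
  show "V1 l X + V2 l X \<in> carrier_mat (s * (m * l)) (s * (m * l))" using c by simp
  show "evx s m l W X (sys_plus \<Sigma>1 \<Sigma>2) (per s s m l (V1 l X + V2 l X))"
    unfolding per_add[OF l c(2)] sys_plus_def evx_def
    by (rule pencil_eval.ev_plus[OF pencil_eval_lft e[unfolded evx_def] jn_rels])
qed

lemma models_times:
  assumes "models s m W D1 V1 \<Sigma>1" "models s m W D2 V2 \<Sigma>2"
  shows "models s m W (\<lambda>l. D1 l \<inter> D2 l) (\<lambda>l X. V1 l X * V2 l X) (sys_times \<Sigma>1 \<Sigma>2)"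
  unfolding models_def
proof (intro allI impI ballI conjI)
  fix l X assume l: "l \<ge> 1" and X: "X \<in> D1 l \<inter> D2 l"
  then have c: "V1 l X \<in> carrier_mat (s * (m * l)) (s * (m * l))" "V2 l X \<in> carrier_mat (s * (m * l)) (s * (m * l))"
    and e: "evx s m l W X \<Sigma>1 (per s s m l (V1 l X))" "evx s m l W X \<Sigma>2 (per s s m l (V2 l X))"
    using assms unfolding models_def by auto
  show "V1 l X * V2 l X \<in> carrier_mat (s * (m * l)) (s * (m * l))" using c by simp
  show "evx s m l W X (sys_times \<Sigma>1 \<Sigma>2) (per s s m l (V1 l X * V2 l X))"
    unfolding per_mult[OF l c] sys_times_def evx_def
    by (rule pencil_eval.ev_times[OF pencil_eval_lft e[unfolded evx_def] jn_rels])
qed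

lemma models_inv:
  assumes mod: "models s m W D V \<Sigma>" and ok: "sysok s m \<Sigma>"
    and E: "E * sysD \<Sigma> = idm (box s m)" "sysD \<Sigma> * E = idm (box s m)" "E * idm (box s m) = E" "idm (box s m) * E = E"
    and U: "\<And>l X. l \<ge> 1 \<Longrightarrow> X \<in> D' l \<Longrightarrow> X \<in> D l \<and> U l X \<in> carrier_mat (s * (m * l)) (s * (m * l)) \<and>
      V l X * U l X = 1\<^sub>m (s * (m * l)) \<and> U l X * V l X = 1\<^sub>m (s * (m * l))"
  shows "models s m W D' U (sys_inv E \<Sigma>)"
  unfolding models_def
proof (intro allI impI ballI conjI)
  fix l X assume l: "l \<ge> 1" and X: "X \<in> D' l"
  note u = U[OF l X]
  then have c: "V l X \<in> carrier_mat (s * (m * l)) (s * (m * l))"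
    and e: "evx s m l W X \<Sigma> (per s s m l (V l X))"
    using mod l unfolding models_def by auto
  show cU: "U l X \<in> carrier_mat (s * (m * l)) (s * (m * l))" using u by simp
  have "per s s m l (V l X) * per s s m l (U l X) = kap sc (idm (box s m))"
    "per s s m l (U l X) * per s s m l (V l X) = kap sc (idm (box s m))"
    using u per_mult[OF l c cU] per_mult[OF l cU c] per_one[OF l] by simp_all
  moreover have "per s s m l (U l X) * kap sc (idm (box s m)) = per s s m l (U l X)"
    "kap sc (idm (box s m)) * per s s m l (U l X) = per s s m l (U l X)"
    unfolding kap_idm by (rule per_supp[OF l])+
  ultimately show "evx s m l W X (sys_inv E \<Sigma>) (per s s m l (U l X))"
    unfolding evx_def sys_inv_def using ok
    by (intro pencil_eval.ev_inverse[OF pencil_eval_lft e[unfolded evx_def] _ _ _ _ E]) (auto simp: sysok_def)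
qed

lemma models_var:
  fixes k :: "'d::finite"
  shows "models s m W (\<lambda>l. {X. \<forall>k. X k \<in> carrier_mat (s * (m * l)) (s * (m * l))}) (\<lambda>l X. X k)
    \<lparr>sysD = frm s m (W k), sysC = idm (box s m), sysA = \<lambda>_. 0,
     sysB = \<lambda>((k', i, i'), p, q). if k' = k then unt 1 (i, p) (i', q) else 0\<rparr>"
  unfolding models_def
proof (intro allI impI ballI conjI)
  fix l :: nat and X :: "'d \<Rightarrow> 'a mat" assume l: "l \<ge> 1" and X: "X \<in> {X. \<forall>k. X k \<in> carrier_mat (s * (m * l)) (s * (m * l))}"
  show "X k \<in> carrier_mat (s * (m * l)) (s * (m * l))" using X by simp
  let ?B = "\<lambda>((k', i, i'), p, q). if k' = k then unt (1::'k) (i, p) (i', q) else 0"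
  interpret pe: pencil_eval "kap sc" "\<lambda>j. lft (xi sc s m l W X j)" "Jx s m" by (rule pencil_eval_lft)
  have "pe.lin ?B = kap sc (idm (box s m)) * pe.lin ?B"
    unfolding pe.lin_lmult[symmetric]
    by (rule pe.lin_cong) (auto simp: Jx_def idm_times_unt)
  then show "evx s m l W X \<lparr>sysD = frm s m (W k), sysC = idm (box s m), sysA = \<lambda>_. 0, sysB = ?B\<rparr> (per s s m l (X k))"
    unfolding evx_def pe.ev_def lsys.simps per_point[OF l, of s m X k W]
    by (intro exI[of _ 1]) simp
qed

lemma models_const:
  fixes W :: "'d::finite \<Rightarrow> 'k mat"
  shows "models s m W (\<lambda>l. UNIV) (\<lambda>l X. map_mat (sc c) (1\<^sub>m (s * (m * l))))
    \<lparr>sysD = scl c * idm (box s m), sysC = 0, sysA = \<lambda>_. 0, sysB = \<lambda>_. 0\<rparr>"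
  unfolding models_def
proof (intro allI impI ballI conjI)
  fix l :: nat and X :: "'d \<Rightarrow> 'a mat" assume l: "l \<ge> 1"
  interpret pe: pencil_eval "kap sc" "\<lambda>j. lft (xi sc s m l W X j)" "Jx s m" by (rule pencil_eval_lft)
  have "per s s m l (map_mat (sc c) (1\<^sub>m (s * (m * l)))) = kap sc (scl c * idm (box s m))"
  proof (rule rcf_eqI)
    fix U V :: "(nat \<times> nat) \<times> nat"
    obtain a p d b q d' where UV: "U = ((a, p), d)" "V = ((b, q), d')" by (metis surj_pair)
    show "ent (per s s m l (map_mat (sc c) (1\<^sub>m (s * (m * l))))) U V = ent (kap sc (scl c * idm (box s m))) U V"
      using lix_less[OF _ _ l, of _ s _ m d] lix_less[OF _ _ l, of _ s _ m d'] lix_eq_iff[OF _ _ l, of "(a, p)" s m "(b, q)" d d']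
      by (auto simp: UV ent_per[OF l] ent_kap ent_times_idm ent_scl)
  qed
  then show "evx s m l W X \<lparr>sysD = scl c * idm (box s m), sysC = 0, sysA = \<lambda>_. 0, sysB = \<lambda>_. 0\<rparr>
      (per s s m l (map_mat (sc c) (1\<^sub>m (s * (m * l)))))"
    unfolding evx_def pe.ev_def lsys.simps by (intro exI[of _ 1]) simp
qed simp

lemma models_cong:
  assumes "models s m W D V \<Sigma>" "\<And>l X. l \<ge> 1 \<Longrightarrow> X \<in> D' l \<Longrightarrow> X \<in> D l \<and> V' l X = V l X"
  shows "models s m W D' V' \<Sigma>"
  using assms unfolding models_def by auto

text \<open>The system has to be chosen uniformly for evaluation over the ground field and over the algebra.\<close>

definition modelled :: "nat \<Rightarrow> nat \<Rightarrow> ('d::finite \<Rightarrow> 'k mat) \<Rightarrow>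
    (nat \<Rightarrow> ('d \<Rightarrow> 'k mat) set) \<Rightarrow> (nat \<Rightarrow> ('d \<Rightarrow> 'k mat) \<Rightarrow> 'k mat) \<Rightarrow>
    (nat \<Rightarrow> ('d \<Rightarrow> 'a mat) set) \<Rightarrow> (nat \<Rightarrow> ('d \<Rightarrow> 'a mat) \<Rightarrow> 'a mat) \<Rightarrow> bool" where
  "modelled s m W D1 V1 D2 V2 \<longleftrightarrow> (\<exists>\<Sigma>. sysok s m \<Sigma> \<and> unital_algebra.models (*) s m W D1 V1 \<Sigma> \<and> models s m W D2 V2 \<Sigma>)"

lemma modelled_plus:
  assumes "modelled s m W D1 V1 D2 V2" "modelled s m W D1' V1' D2' V2'"
  shows "modelled s m W (\<lambda>l. D1 l \<inter> D1' l) (\<lambda>l X. V1 l X + V1' l X) (\<lambda>l. D2 l \<inter> D2' l) (\<lambda>l X. V2 l X + V2' l X)"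
  using assms unfolding modelled_def by (blast intro: sysok_plus fld.models_plus models_plus)

lemma modelled_times:
  assumes "modelled s m W D1 V1 D2 V2" "modelled s m W D1' V1' D2' V2'"
  shows "modelled s m W (\<lambda>l. D1 l \<inter> D1' l) (\<lambda>l X. V1 l X * V1' l X) (\<lambda>l. D2 l \<inter> D2' l) (\<lambda>l X. V2 l X * V2' l X)"
  using assms unfolding modelled_def by (blast intro: sysok_times fld.models_times models_times)

lemma modelled_cong:
  assumes "modelled s m W D1 V1 D2 V2" "\<And>l X. l \<ge> 1 \<Longrightarrow> X \<in> D1' l \<Longrightarrow> X \<in> D1 l \<and> V1' l X = V1 l X"
    "\<And>l X. l \<ge> 1 \<Longrightarrow> X \<in> D2' l \<Longrightarrow> X \<in> D2 l \<and> V2' l X = V2 l X"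
  shows "modelled s m W D1' V1' D2' V2'"
proof -
  obtain \<Sigma> where \<Sigma>: "sysok s m \<Sigma>" "fld.models s m W D1 V1 \<Sigma>" "models s m W D2 V2 \<Sigma>"
    using assms(1) unfolding modelled_def by blast
  have "fld.models s m W D1' V1' \<Sigma>" by (rule fld.models_cong[OF \<Sigma>(2) assms(2)])
  moreover have "models s m W D2' V2' \<Sigma>" by (rule models_cong[OF \<Sigma>(3) assms(3)])
  ultimately show ?thesis using \<Sigma>(1) unfolding modelled_def by blast
qed

abbreviation carr :: "nat \<Rightarrow> nat \<Rightarrow> nat \<Rightarrow> ('d \<Rightarrow> 'x mat) set" where
  "carr s m l \<equiv> {X. \<forall>k. X k \<in> carrier_mat (s * (m * l)) (s * (m * l))}"

lemma modelled_var: "modelled s m W (carr s m) (\<lambda>l X. X k) (carr s m) (\<lambda>l X. X k)"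
proof -
  have "sysok s m \<lparr>sysD = frm s m (W k), sysC = idm (box s m), sysA = \<lambda>_. 0,
     sysB = \<lambda>((k', i, i'), p, q). if k' = k then unt 1 (i, p) (i', q) else 0\<rparr>"
    by (auto simp: sysok_def idm_times_idm unt_times_idm Jx_def ent_idm_times ent_times_idm ent_frm
        intro!: rcf_eqI fins_idm)
  then show ?thesis unfolding modelled_def using fld.models_var models_var by blast
qed

lemma modelled_const: "modelled s m W (carr s m) (\<lambda>l X. map_mat ((*) c) (1\<^sub>m (s * (m * l))))
    (carr s m) (\<lambda>l X. map_mat (sc c) (1\<^sub>m (s * (m * l))))"
proof -
  have "sysok s m \<lparr>sysD = scl c * idm (box s m), sysC = 0, sysA = \<lambda>_. 0, sysB = \<lambda>_. 0\<rparr>"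
    by (auto simp: sysok_def idm_times_idm mult.assoc scl_commute[symmetric])
      (simp add: idm_times_idm mult.assoc[symmetric])
  then have "modelled s m W (\<lambda>l. UNIV) (\<lambda>l X. map_mat ((*) c) (1\<^sub>m (s * (m * l))))
    (\<lambda>l. UNIV) (\<lambda>l X. map_mat (sc c) (1\<^sub>m (s * (m * l))))"
    unfolding modelled_def using fld.models_const models_const by blast
  then show ?thesis by (rule modelled_cong) auto
qed

lemma smult_mat_eq:
  assumes "M \<in> carrier_mat n n'"
  shows "map_mat (sc c) M = map_mat (sc c) (1\<^sub>m n) * M"
proof -
  have "map_mat (sc c) M = map_mat (sc c) (1\<^sub>m n * M)" using one_mat_mult[OF assms] by simp
  also have "\<dots> = map_mat (sc c) (1\<^sub>m n) * M"
    by (rule eq_matI) (use assms in \<open>auto simp: scalar_prod_def scale_sum_right sc_mult_left\<close>)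
  finally show ?thesis .
qed

lemma word_closed_mat:
  "X \<in> carr s m l \<Longrightarrow> foldr (\<lambda>i. (*) (X i)) w (1\<^sub>m (s * (m * l))) \<in> carrier_mat (s * (m * l)) (s * (m * l))"
  for X :: "'d \<Rightarrow> 'b::{ring,monoid_mult} mat"
  by (induct w) (auto intro: mult_carrier_mat)

lemma modelled_word: "modelled s m W (carr s m) (\<lambda>l X. foldr (\<lambda>i. (*) (X i)) w (1\<^sub>m (s * (m * l))))
    (carr s m) (\<lambda>l X. foldr (\<lambda>i. (*) (X i)) w (1\<^sub>m (s * (m * l))))"
proof (induct w)
  case Nil
  show ?case by (rule modelled_cong[OF modelled_const[of s m W 1]]) (auto intro!: eq_matI)
next
  case (Cons i w)
  show ?case by (rule modelled_cong[OF modelled_times[OF modelled_var[of s m W i] Cons]]) auto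
qed

lemma modelled_poly:
  fixes W :: "'d::finite \<Rightarrow> 'k mat"
  shows "modelled s m W (carr s m) (\<lambda>l. poly_val (mat_alg (*) (s * (m * l))) p)
    (carr s m) (\<lambda>l. poly_val (mat_alg sc (s * (m * l))) p)"
proof -
  have "modelled s m W (carr s m) (\<lambda>l X. \<Oplus>\<^bsub>mat_alg (*) (s * (m * l))\<^esub>w\<in>K.
      map_mat ((*) (Poly_Mapping.lookup p w)) (foldr (\<lambda>i. (*) (X i)) w (1\<^sub>m (s * (m * l)))))
    (carr s m) (\<lambda>l X. \<Oplus>\<^bsub>mat_alg sc (s * (m * l))\<^esub>w\<in>K.
      map_mat (sc (Poly_Mapping.lookup p w)) (foldr (\<lambda>i. (*) (X i)) w (1\<^sub>m (s * (m * l)))))"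
    if "finite K" for K
    using that
  proof induction
    case empty
    have z1: "finsum (mat_alg (*) n :: ('k, 'k mat) module) f {} = map_mat ((*) 0) (1\<^sub>m n)" for n f
      using abelian_monoid.finsum_empty[OF ring.axioms(1)[OF ring_mat_alg, THEN abelian_group.axioms(1)], of "(*)" n f]
      by (auto intro!: eq_matI)
    have z2: "finsum (mat_alg sc n :: ('k, 'a mat) module) f {} = map_mat (sc 0) (1\<^sub>m n)" for n f
      using abelian_monoid.finsum_empty[OF ring.axioms(1)[OF ring_mat_alg, THEN abelian_group.axioms(1)], of sc n f]
      by (auto intro!: eq_matI)
    show ?case unfolding z1 z2 by (rule modelled_const)
  next
    case (insert w K)
    let ?t1 = "\<lambda>l X w. map_mat ((*) (Poly_Mapping.lookup p w)) (foldr (\<lambda>i. (*) (X i)) w (1\<^sub>m (s * (m * l))))"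
    let ?t2 = "\<lambda>l X w. map_mat (sc (Poly_Mapping.lookup p w)) (foldr (\<lambda>i. (*) (X i)) w (1\<^sub>m (s * (m * l))))"
    have s1: "finsum (mat_alg (*) (s * (m * l))) (?t1 l X) (insert w K) =
        ?t1 l X w + finsum (mat_alg (*) (s * (m * l))) (?t1 l X) K"
      if X: "X \<in> carr s m l" for X :: "'d \<Rightarrow> 'k mat" and l
    proof -
      interpret A: ring "mat_alg (*) (s * (m * l)) :: ('k, 'k mat) module" by (rule ring_mat_alg)
      show ?thesis using word_closed_mat[OF X] insert by (subst A.finsum_insert) auto
    qed
    have s2: "finsum (mat_alg sc (s * (m * l))) (?t2 l X) (insert w K) =
        ?t2 l X w + finsum (mat_alg sc (s * (m * l))) (?t2 l X) K"
      if X: "X \<in> carr s m l" for X :: "'d \<Rightarrow> 'a mat" and l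
    proof -
      interpret A: ring "mat_alg sc (s * (m * l)) :: ('k, 'a mat) module" by (rule ring_mat_alg)
      show ?thesis using word_closed_mat[OF X] insert by (subst A.finsum_insert) auto
    qed
    show ?case
      by (rule modelled_cong[OF modelled_plus[OF modelled_times[OF modelled_const[of s m W "Poly_Mapping.lookup p w"]
              modelled_word[of s m W w]] insert.IH]])
        (auto simp: s1 s2 fld.smult_mat_eq[OF word_closed_mat, symmetric] smult_mat_eq[OF word_closed_mat, symmetric])
  qed
  then show ?thesis unfolding poly_val_def by simp
qed

lemma frm_idm: "idm (box s m) * frm s m W = frm s m W" "frm s m W * idm (box s m) = frm s m W"
  by (auto intro!: rcf_eqI simp: ent_idm_times ent_times_idm ent_frm)

end

lemma kap_inject: "kap (*) A = kap (*) (B :: ('i, 'k::field) rcf) \<Longrightarrow> A = B"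
proof (rule rcf_eqI)
  fix u v assume "kap (*) A = kap (*) B"
  from arg_cong[OF this, of "\<lambda>M. ent M (u, 0) (v, 0)"] show "ent A u v = ent B u v" by (simp add: fld.ent_kap)
qed

lemma per_eq_kap_frm: "per s s m 1 M = kap (*) (frm s m (M :: 'k::field mat))"
proof (rule rcf_eqI)
  fix U V show "ent (per s s m 1 M) U V = ent (kap (*) (frm s m M)) U V"
    by (cases U; cases V) (auto simp: ent_per fld.ent_kap ent_frm lix_def)
qed

lemma xi_centre: "ent (xi (*) s m 1 W W j) c c' = (0 :: 'k::field)"
proof -
  obtain k i i' p q where j: "j = ((k, i, i'), p, q)" by (metis surj_pair)
  show ?thesis by (simp add: j ent_xi lix_def)
qed

lemma ev_at_centre: "fld.evx s m 1 W W \<Sigma> v \<Longrightarrow> v = kap (*) (sysD \<Sigma>)"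
proof -
  interpret pe: pencil_eval "kap (*)" "\<lambda>j. lft (xi (*) s m 1 W W j)" "Jx s m" by (rule fld.pencil_eval_lft)
  have "xi (*) s m 1 W W j = 0" for j by (rule rcf_eqI) (simp only: xi_centre ent_zero)
  then have lin: "pe.lin A = 0" for A unfolding pe.lin_def by simp
  then show "fld.evx s m 1 W W \<Sigma> v \<Longrightarrow> v = kap (*) (sysD \<Sigma>)"
    unfolding fld.evx_def pe.ev_def lin by auto
qed

text \<open>Induction on the expression. The hypothesis on the centre takes effect at inverses: the
  constant term of the system for \<open>R\<close> is the value at \<open>W\<close>, which is
  invertible because \<open>W\<close> belongs to the domain of \<open>Inv R\<close>.\<close>

lemma (in unital_algebra) synthesis:
  fixes W :: "'d::finite \<Rightarrow> 'k mat"
  assumes W: "W \<in> nc_dom (mat_alg (*) (s * m)) R"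
  shows "modelled s m W (\<lambda>l. nc_dom (mat_alg (*) (s * (m * l))) R) (\<lambda>l. nc_val (mat_alg (*) (s * (m * l))) R)
    (\<lambda>l. nc_dom (mat_alg sc (s * (m * l))) R) (\<lambda>l. nc_val (mat_alg sc (s * (m * l))) R)"
  using W
proof (induction R)
  case (Poly p)
  show ?case using modelled_poly[of s m W p] by simp
next
  case (Plus R S)
  then show ?case using modelled_plus by fastforce
next
  case (Times R S)
  then show ?case using modelled_times by fastforce
next
  case (Inv R)
  let ?A1 = "\<lambda>l. mat_alg (*) (s * (m * l)) :: ('k, 'k mat) module"
  let ?A2 = "\<lambda>l. mat_alg sc (s * (m * l)) :: ('k, 'a mat) module"
  obtain \<Sigma> where ok: "sysok s m \<Sigma>" and mod1: "fld.models s m W (\<lambda>l. nc_dom (?A1 l) R) (\<lambda>l. nc_val (?A1 l) R) \<Sigma>"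
    and mod2: "models s m W (\<lambda>l. nc_dom (?A2 l) R) (\<lambda>l. nc_val (?A2 l) R) \<Sigma>"
    using Inv unfolding modelled_def by auto
  interpret A1: ring "?A1 l" for l by (rule ring_mat_alg)
  interpret A2: ring "?A2 l" for l by (rule ring_mat_alg)
  let ?u = "nc_val (?A1 1) R W"
  have W1: "W \<in> nc_dom (?A1 1) R" and u: "?u \<in> Units (?A1 1)" using Inv.prems by auto
  let ?v = "inv\<^bsub>?A1 1\<^esub> ?u"
  have cu: "?u \<in> carrier_mat (s * (m * 1)) (s * (m * 1))" "?v \<in> carrier_mat (s * (m * 1)) (s * (m * 1))"
    using A1.Units_closed[OF u] A1.Units_inv_closed[OF u] by auto
  have uv: "?u * ?v = 1\<^sub>m (s * (m * 1))" "?v * ?u = 1\<^sub>m (s * (m * 1))"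
    using A1.Units_r_inv[OF u] A1.Units_l_inv[OF u] by simp_all
  have "fld.evx s m 1 W W \<Sigma> (per s s m 1 ?u)" using mod1 W1 unfolding fld.models_def by auto
  then have "per s s m 1 ?u = kap (*) (sysD \<Sigma>)" by (rule ev_at_centre)
  then have D: "sysD \<Sigma> = frm s m ?u" unfolding per_eq_kap_frm using kap_inject by metis
  have fuv: "frm s m ?u * frm s m ?v = idm (box s m)" "frm s m ?v * frm s m ?u = idm (box s m)"
  proof -
    have "kap (*) (frm s m ?u * frm s m ?v) = kap (*) (idm (box s m))"
      unfolding fld.kap_times per_eq_kap_frm[symmetric] per_mult[OF order_refl cu, symmetric] uv
      by (rule fld.per_one) simp
    then show "frm s m ?u * frm s m ?v = idm (box s m)" by (rule kap_inject)
    have "kap (*) (frm s m ?v * frm s m ?u) = kap (*) (idm (box s m))"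
      unfolding fld.kap_times per_eq_kap_frm[symmetric] per_mult[OF order_refl cu(2,1), symmetric] uv
      by (rule fld.per_one) simp
    then show "frm s m ?v * frm s m ?u = idm (box s m)" by (rule kap_inject)
  qed
  have E: "frm s m ?v * sysD \<Sigma> = idm (box s m)" "sysD \<Sigma> * frm s m ?v = idm (box s m)"
    "frm s m ?v * idm (box s m) = frm s m ?v" "idm (box s m) * frm s m ?v = frm s m ?v"
    using fuv by (simp_all add: D frm_idm)
  have "fld.models s m W (\<lambda>l. nc_dom (?A1 l) (Inv R)) (\<lambda>l. nc_val (?A1 l) (Inv R)) (sys_inv (frm s m ?v) \<Sigma>)"
    by (rule fld.models_inv[OF mod1 ok E])
      (use A1.Units_inv_closed A1.Units_l_inv A1.Units_r_inv in auto)
  moreover have "models s m W (\<lambda>l. nc_dom (?A2 l) (Inv R)) (\<lambda>l. nc_val (?A2 l) (Inv R)) (sys_inv (frm s m ?v) \<Sigma>)"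
    by (rule models_inv[OF mod2 ok E])
      (use A2.Units_inv_closed A2.Units_l_inv A2.Units_r_inv in auto)
  ultimately show ?case
    unfolding modelled_def using sysok_inv[OF ok E(4,3)] by blast
qed

section \<open>Comparison at points\<close>

text \<open>Directed from an arbitrary system to the minimal one: minimisation may enlarge the
  domain but does not shrink it.\<close>

lemma (in unital_algebra) transfer_point:
  fixes W :: "'d::finite \<Rightarrow> 'k mat"
  assumes sf: "stably_finite TYPE('a)" and l: "l \<ge> 1"
    and ok: "sysok s m \<Sigma>'" and sup: "supp (Jx s m) (box L m) \<Sigma>" and mom: "moments_eq (Jx s m) \<Sigma> \<Sigma>'"
    and con: "contr (Jx s m) (box L m) \<Sigma>" and obs: "obsv (Jx s m) (box L m) \<Sigma>"
    and ev: "evx s m l W X \<Sigma>' v"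
  shows "evx s m l W X \<Sigma> v"
proof -
  obtain S' where S': "finite S'" "supp (Jx s m) S' \<Sigma>'" using sysok_supp[OF ok] .
  interpret pe: pencil_eval "kap sc" "\<lambda>j. lft (xi sc s m l W X j)" "Jx s m" by (rule pencil_eval_lft)
  show ?thesis
  proof (rule compare_systems[OF _ S'(1) sup S'(2) mom con obs])
    fix G r Gp At Bt H Hp
    assume G: "Gp * G = idm (box r (Suc 0))"
      "\<And>i. i \<in> Jx s m \<Longrightarrow> sysA \<Sigma>' i * G = G * At i" "\<And>i. i \<in> Jx s m \<Longrightarrow> sysB \<Sigma>' i = G * Bt i"
      "\<And>i. i \<in> Jx s m \<Longrightarrow> idm (box r (Suc 0)) * At i = At i" "\<And>i. i \<in> Jx s m \<Longrightarrow> At i * idm (box r (Suc 0)) = At i"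
      and H: "\<And>i. i \<in> Jx s m \<Longrightarrow> H * At i = sysA \<Sigma> i * H" "\<And>i. i \<in> Jx s m \<Longrightarrow> H * Bt i = sysB \<Sigma> i"
      "sysC \<Sigma> * H = sysC \<Sigma>' * G" "H * Hp = idm (box L m)"
    have sA: "\<And>i. i \<in> Jx s m \<Longrightarrow> idm (box L m) * sysA \<Sigma> i = sysA \<Sigma> i"
      "\<And>i. i \<in> Jx s m \<Longrightarrow> sysA \<Sigma> i * idm (box L m) = sysA \<Sigma> i"
      using sup by (auto simp: supp_def)
    have D: "sysD \<Sigma> = sysD \<Sigma>'" using mom by (simp add: moments_eq_def)
    have f1: "(1 - pe.lin At) * Q = 1" if "Q * (1 - pe.lin At) = 1" for Q
      using that linx_stably_finite[where A = At and W = W and X = X, OF l sf G(4,5)] by blast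
    have f2: "Q * (1 - pe.lin (sysA \<Sigma>)) = 1" if "(1 - pe.lin (sysA \<Sigma>)) * Q = 1" for Q
      using that linx_stably_finite[where A = "sysA \<Sigma>" and W = W and X = X, OF l sf sA] by blast
    show ?thesis
      unfolding evx_def
      by (rule pe.ev_transfer[OF ev[unfolded evx_def] G(2,3,1,4) H sA(2) D f1 f2])
  qed simp
qed

text \<open>Points near the centre detect moments: in the regular representation of k[t]/t^r, the
  point W + t Z, with W inflated, belongs to the domain for every \<open>Z\<close>. Here
  \<open>Z\<close> is chosen so that the coordinates walk along a given word.\<close>

lemma moments_at:
  fixes W :: "'d::finite \<Rightarrow> 'k::field mat"
  assumes s: "s \<ge> 1" and m: "m \<ge> 1" and W: "W \<in> nc_dom (mat_alg (*) (s * m)) R"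
    and ev: "\<And>l X. l \<ge> 1 \<Longrightarrow> X \<in> nc_dom (mat_alg (*) (s * (m * l))) R \<Longrightarrow>
      \<exists>v. fld.evx s m l W X \<Sigma> v \<and> fld.evx s m l W X \<Sigma>' v"
  shows "moments_eq (Jx s m) \<Sigma> \<Sigma>'"
  unfolding moments_eq_def
proof (intro conjI ballI)
  have "W \<in> nc_dom (mat_alg (*) (s * (m * 1))) R" using W by simp
  from ev[OF _ this] obtain v where "fld.evx s m 1 W W \<Sigma> v" "fld.evx s m 1 W W \<Sigma>' v" by auto
  then show "sysD \<Sigma> = sysD \<Sigma>'" using ev_at_centre kap_inject by metis
  fix w :: "'d idx list" and i :: "'d idx" assume w: "w \<in> lists (Jx s m)" and i: "i \<in> Jx s m"
  \<comment> \<open>A word of \<open>h\<close> letters visits the positions 0 to \<open>h\<close>,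
    and each step raises the degree in t by one. Hence \<open>r = h + 1\<close> serves for the
    positions as well as for the powers of t, and \<open>l = r * r\<close>.\<close>
  define h where "h = Suc (length w)"
  define r where "r = Suc h"
  define l where "l = r * r"
  have l: "l \<ge> 1" by (simp add: l_def r_def)
  define n where "n = s * m"
  have n: "n > 0" using s m by (simp add: n_def)
  define ws where "ws = w @ [i]"
  \<comment> \<open>Over all variables, block \<open>(q, q + 1)\<close> has a single nonzero entry,
    the one named by the letter \<open>ws ! q\<close>.\<close>
  define Z where "Z k = (mat (r * n) (r * n) (\<lambda>(a, b). if b div n = Suc (a div n) \<and> a div n < h \<and>
    ws ! (a div n) = ((k, a mod n mod s, b mod n mod s), a mod n div s, b mod n div s) then 1 else 0) :: 'k mat)" for k :: 'd
  define X where "X k = mat (r * (r * n)) (r * (r * n)) (\<lambda>(i, j). (if i div (r * n) = j div (r * n) then kron (1\<^sub>m r) (W k) $$ (i mod (r * n), j mod (r * n)) else 0) +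
    (if i div (r * n) = Suc (j div (r * n)) then Z k $$ (i mod (r * n), j mod (r * n)) else 0))" for k
  have cW: "W k \<in> carrier_mat n n" for k using nc_dom_carrier[OF W, of k] by (simp add: n_def)
  have "(\<lambda>k. kron (1\<^sub>m r) (W k)) \<in> nc_dom (mat_alg (*) (r * n)) R"
    using nc_hom_val[OF fld.nc_hom_kron W, of r] by (simp add: n_def)
  from near_point[OF this, of Z r]
  have "X \<in> nc_dom (mat_alg (*) (r * (r * n))) R" unfolding X_def Z_def by (simp add: r_def)
  moreover have sz: "r * (r * n) = s * (m * l)" by (simp add: n_def l_def ac_simps)
  ultimately have "X \<in> nc_dom (mat_alg (*) (s * (m * l))) R" by simp
  from ev[OF l this] obtain v where v: "fld.evx s m l W X \<Sigma> v" "fld.evx s m l W X \<Sigma>' v" by blast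
  have xi: "ent (xi (*) s m l W X j) c c' = (if c < l \<and> c div r = Suc (c' div r) \<and> c' mod r = Suc (c mod r) \<and> c mod r < h \<and>
      ws ! (c mod r) = j then 1 else 0)" if j: "j \<in> Jx s m" and c': "c' < l" for j c c'
  proof (cases "c < l")
    case False
    then have "c div l \<noteq> 0" using l by (simp add: div_eq_0_iff)
    then show ?thesis using False c' xi_mod[OF l, of "(*)" s m W X j c c'] by simp
  next
    case c: True
    obtain k a b p q where j': "j = ((k, a, b), p, q)" "a < s" "b < s" "p < m" "q < m"
      using j by (auto simp: Jx_def)
    have dm: "(d * m + p') * s + a' = d * n + (p' * s + a')" for d p' a' by (simp add: n_def algebra_simps)
    have lt: "p' * s + a' < n" if "p' < m" "a' < s" for p' a'
    proof -
      have "p' * s + a' < Suc p' * s" using that by simp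
      also have "\<dots> \<le> m * s" using that by (intro mult_le_mono1) simp
      finally show ?thesis by (simp add: n_def mult.commute)
    qed
    have dd: "(d * n + u) div (r * n) = d div r" "(d * n + u) mod (r * n) = (d mod r) * n + u" if "u < n" for d u
    proof -
      have "(d * n + u) div (r * n) = (d * n + u) div n div r" by (simp add: div_mult2_eq mult.commute)
      then show 1: "(d * n + u) div (r * n) = d div r" using that by simp
      have "d * n + u = (d div r) * (r * n) + ((d mod r) * n + u)"
        by (metis (no_types, lifting) add.assoc distrib_right div_mult_mod_eq mult.assoc)
      moreover have "(d mod r) * n + u < r * n"
      proof -
        have "(d mod r) * n + u < Suc (d mod r) * n" using that by simp
        also have "\<dots> \<le> r * n" by (intro mult_le_mono1) (simp add: r_def Suc_le_eq)
        finally show ?thesis .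
      qed
      ultimately show "(d * n + u) mod (r * n) = (d mod r) * n + u" by (metis mod_less mod_mult_self3)
    qed
    let ?u = "p * s + a" and ?u' = "q * s + b"
    have u: "?u < n" "?u' < n" using lt j' by auto
    have bnd: "d * n + u < r * (r * n)" if "d < l" "u < n" for d u
    proof -
      have "d * n + u < Suc d * n" using that by simp
      also have "\<dots> \<le> l * n" using that by (intro mult_le_mono1) simp
      finally show ?thesis by (simp add: l_def mult.assoc)
    qed
    have bnd2: "d mod r * n + u < r * n" if "u < n" for d u
    proof -
      have "(d mod r) * n + u < Suc (d mod r) * n" using that by simp
      also have "\<dots> \<le> r * n" by (intro mult_le_mono1) (simp add: r_def Suc_le_eq)
      finally show ?thesis .
    qed
    have "ent (xi (*) s m l W X j) c c' = X k $$ (c * n + ?u, c' * n + ?u') - (if c = c' then W k $$ (?u, ?u') else 0)"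
      using c c' by (simp add: j' ent_xi[OF l] lix_def dm)
    also have "X k $$ (c * n + ?u, c' * n + ?u') = (if c div r = c' div r then kron (1\<^sub>m r) (W k) $$ (c mod r * n + ?u, c' mod r * n + ?u') else 0) +
        (if c div r = Suc (c' div r) then Z k $$ (c mod r * n + ?u, c' mod r * n + ?u') else 0)"
      using bnd[OF c u(1)] bnd[OF c' u(2)] by (simp add: X_def dd u)
    also have "kron (1\<^sub>m r) (W k) $$ (c mod r * n + ?u, c' mod r * n + ?u') = (if c mod r = c' mod r then W k $$ (?u, ?u') else 0)"
      using index_kron_one[OF cW, OF bnd2[OF u(1)] bnd2[OF u(2)]] u by simp
    also have "Z k $$ (c mod r * n + ?u, c' mod r * n + ?u') = (if c' mod r = Suc (c mod r) \<and> c mod r < h \<and> ws ! (c mod r) = j then 1 else 0)"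
      using bnd2[OF u(1), of c] bnd2[OF u(2), of c'] u j' by (simp add: Z_def)
    finally show ?thesis using c same_block_eq[of c r c'] by auto
  qed
  \<comment> \<open>Position \<open>q\<close> in degree \<open>h - q\<close>: the walk starts at
    position \<open>h\<close> in degree 0 and ends at position 0 in degree \<open>h\<close>.\<close>
  define \<iota> where "\<iota> q = (h - q) * r + q" for q
  have \<iota>: "\<iota> q div r = h - q" "\<iota> q mod r = q" "\<iota> q < l" if "q \<le> h" for q
  proof -
    have "q < r" using that by (simp add: r_def)
    then show 1: "\<iota> q div r = h - q" and 2: "\<iota> q mod r = q" by (simp_all add: \<iota>_def)
    have "\<iota> q < Suc (h - q) * r" using \<open>q < r\<close> by (simp add: \<iota>_def)
    also have "\<dots> \<le> r * r" by (intro mult_le_mono1) (simp add: r_def)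
    finally show "\<iota> q < l" by (simp add: l_def)
  qed
  show "sysC \<Sigma> * wprod (sysA \<Sigma>) w * sysB \<Sigma> i = sysC \<Sigma>' * wprod (sysA \<Sigma>') w * sysB \<Sigma>' i"
  proof (rule moment_eq[OF finite_Jx w i _ _ _ v[unfolded fld.evx_def], where \<iota> = \<iota>])
    show "inj_on \<iota> {..Suc (length w)}" using \<iota>(2) by (metis atMost_iff h_def inj_onI)
    fix j assume j: "j \<in> (Jx s m :: 'd idx set)"
    show "xi (*) s m l W X j * unt 1 (\<iota> 0) 0 = 0"
      by (rule rcf_eqI) (simp add: ent_times_unt xi[OF j] \<iota>)
    fix q assume q: "q \<le> length w"
    then have q': "Suc q \<le> h" "q \<le> h" "q < h" by (auto simp: h_def)
    show "xi (*) s m l W X j * unt 1 (\<iota> (Suc q)) 0 = (if (w @ [i]) ! q = j then unt 1 (\<iota> q) 0 else 0)"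
    proof (rule rcf_eqI)
      fix a b
      have "a = \<iota> q \<longleftrightarrow> a < l \<and> a div r = h - q \<and> a mod r = q"
        using \<iota>[OF q'(2)] by (metis div_mult_mod_eq)
      moreover have "Suc (h - Suc q) = h - q" using q' by simp
      ultimately show "ent (xi (*) s m l W X j * unt 1 (\<iota> (Suc q)) 0) a b = ent (if (w @ [i]) ! q = j then unt 1 (\<iota> q) 0 else 0) a b"
        using q' by (auto simp: ent_times_unt xi[OF j] \<iota> ent_unt ws_def)
    qed
  qed
qed

section \<open>Realizations evaluated at matrices over an algebra\<close>

lemma linear_mat_map_zero:
  fixes T :: "'k::field mat \<Rightarrow> 'k mat"
  assumes "linear_mat_map s p q T" shows "T (0\<^sub>m s s) = 0\<^sub>m p q"
proof -
  have T: "T (0\<^sub>m s s) \<in> carrier_mat p q" using assms by (simp add: linear_mat_map_def)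
  have "T (0 \<cdot>\<^sub>m 0\<^sub>m s s) = 0 \<cdot>\<^sub>m T (0\<^sub>m s s)" using assms unfolding linear_mat_map_def by (metis zero_carrier_mat)
  moreover have "(0::'k) \<cdot>\<^sub>m 0\<^sub>m s s = 0\<^sub>m s s" "(0::'k) \<cdot>\<^sub>m T (0\<^sub>m s s) = 0\<^sub>m p q"
    using T by (auto intro!: eq_matI)
  ultimately show ?thesis by simp
qed

lemma unit_mat_carrier [simp]: "unit_mat s i j \<in> carrier_mat s s"
  by (simp add: unit_mat_def)

lemma linear_mat_map_expand:
  fixes T :: "'k::field mat \<Rightarrow> 'k mat"
  assumes T: "linear_mat_map s p q T" and B: "B \<in> carrier_mat s s" and ab: "a < p" "b < q"
  shows "T B $$ (a, b) = (\<Sum>i<s. \<Sum>j<s. T (unit_mat s i j) $$ (a, b) * B $$ (i, j))"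
proof -
  define part where "part S = mat s s (\<lambda>ij. if ij \<in> S then B $$ ij else 0)" for S
  have pc: "part S \<in> carrier_mat s s" for S by (simp add: part_def)
  have Tc: "T X \<in> carrier_mat p q" if "X \<in> carrier_mat s s" for X using T that by (simp add: linear_mat_map_def)
  have "T (part S) $$ (a, b) = (\<Sum>ij\<in>S. T (unit_mat s (fst ij) (snd ij)) $$ (a, b) * B $$ ij)"
    if "finite S" "S \<subseteq> {..<s} \<times> {..<s}" for S
    using that
  proof induction
    case empty
    have "part {} = 0\<^sub>m s s" by (auto simp: part_def intro!: eq_matI)
    then show ?case using linear_mat_map_zero[OF T] ab by simp
  next
    case (insert ij S)
    let ?E = "unit_mat s (fst ij) (snd ij) :: 'k mat"
    have "part (insert ij S) = part S + B $$ ij \<cdot>\<^sub>m ?E"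
      using insert by (auto simp: part_def unit_mat_def intro!: eq_matI)
    then have "T (part (insert ij S)) = T (part S) + B $$ ij \<cdot>\<^sub>m T ?E"
      using T pc by (simp add: linear_mat_map_def)
    then show ?case using insert Tc[OF pc[of S]] Tc[OF unit_mat_carrier, of "fst ij" "snd ij"] ab
      by (simp add: mult.commute add.commute)
  qed
  from this[of "{..<s} \<times> {..<s}"]
  have "T (part ({..<s} \<times> {..<s})) $$ (a, b) = (\<Sum>ij\<in>{..<s} \<times> {..<s}. T (unit_mat s (fst ij) (snd ij)) $$ (a, b) * B $$ ij)"
    by simp
  moreover have "part ({..<s} \<times> {..<s}) = B" using B by (auto simp: part_def intro!: eq_matI)
  ultimately show ?thesis by (simp add: sum.cartesian_product case_prod_beta)
qed

text \<open>Entrywise forms of \<open>M \<otimes> 1\<close> and of the linear part of a pencil, common to matrices of size \<open>s n\<close>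
  over the ground field and to those of size \<open>s\<close> over an algebra.\<close>

definition jk :: "('k \<Rightarrow> 'a \<Rightarrow> 'a) \<Rightarrow> nat \<Rightarrow> 'k mat \<Rightarrow> 'a::{ring,monoid_mult} mat" where
  "jk sc n M = mat (dim_row M * n) (dim_col M * n) (\<lambda>(r, t). if r div dim_row M = t div dim_col M
     then sc (M $$ (r mod dim_row M, t mod dim_col M)) 1 else 0)"

definition jl :: "('k \<Rightarrow> 'a \<Rightarrow> 'a) \<Rightarrow> nat \<Rightarrow> nat \<Rightarrow> nat \<Rightarrow> ('d::finite \<Rightarrow> 'k::field mat \<Rightarrow> 'k mat) \<Rightarrow> nat \<Rightarrow>
    ('d \<Rightarrow> 'k mat) \<Rightarrow> ('d \<Rightarrow> 'a mat) \<Rightarrow> 'a::{ring,monoid_mult} mat" where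
  "jl sc s L L' T n Y X = mat (L * n) (L' * n) (\<lambda>(r, t). \<Sum>k\<in>UNIV. \<Sum>i<s. \<Sum>j<s.
     sc (T k (unit_mat s i j) $$ (r mod L, t mod L')) (X k $$ ((r div L) * s + i, (t div L') * s + j) -
       (if r div L = t div L' then sc (Y k $$ (i, j)) 1 else 0)))"

lemma jl_carrier [simp]: "jl sc s L L' T n Y X \<in> carrier_mat (L * n) (L' * n)"
  by (simp add: jl_def)

lemma jk_carrier: "M \<in> carrier_mat a b \<Longrightarrow> jk sc n M \<in> carrier_mat (a * n) (b * n)"
  by (auto simp: jk_def)

definition evJ :: "('k \<Rightarrow> 'a \<Rightarrow> 'a) \<Rightarrow> nat \<Rightarrow> ('d::finite \<Rightarrow> 'k::field mat) \<Rightarrow> ('d, 'k) realization \<Rightarrow> nat \<Rightarrow>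
    ('d \<Rightarrow> 'a mat) \<Rightarrow> 'a::{ring,monoid_mult} mat \<Rightarrow> bool" where
  "evJ sc s Y R n X v \<longleftrightarrow> (let L = fm_dim R; P = 1\<^sub>m (L * n) - jl sc s L L (mapA R) n Y X in
     \<exists>Q\<in>carrier_mat (L * n) (L * n). Q * P = 1\<^sub>m (L * n) \<and> P * Q = 1\<^sub>m (L * n) \<and>
       v = jk sc n (matD R) + jk sc n (matC R) * Q * jl sc s L s (mapB R) n Y X)"

lemma ext_map_jl:
  fixes T :: "'d::finite \<Rightarrow> 'k::field mat \<Rightarrow> 'k mat"
  assumes T: "\<And>k. linear_mat_map s L L' (T k)" and X: "\<And>k. X k \<in> carrier_mat (s * n) (s * n)"
    and Y: "\<And>k. Y k \<in> carrier_mat s s"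
  shows "mat_sum (L * n) (L' * n) (\<lambda>k. ext_map s L L' (T k) n (X k - kron (1\<^sub>m n) (Y k))) = jl (*) s L L' T n Y X"
proof (rule eq_matI)
  fix r t assume "r < dim_row (jl (*) s L L' T n Y X)" "t < dim_col (jl (*) s L L' T n Y X)"
  then have rt: "r < L * n" "t < L' * n" by (auto simp: jl_def)
  then have pos: "L > 0" "L' > 0" by (auto intro: gr0I)
  have div: "r div L < n" "t div L' < n" using rt by (simp_all add: less_mult_imp_div_less mult.commute)
  have "ext_map s L L' (T k) n (X k - kron (1\<^sub>m n) (Y k)) $$ (r, t) = (\<Sum>i<s. \<Sum>j<s.
     T k (unit_mat s i j) $$ (r mod L, t mod L') * (X k $$ ((r div L) * s + i, (t div L') * s + j) -
       (if r div L = t div L' then Y k $$ (i, j) * 1 else 0)))" for k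
  proof -
    let ?Z = "X k - kron (1\<^sub>m n) (Y k)"
    have "ext_map s L L' (T k) n ?Z $$ (r, t) = T k (block s ?Z (r div L) (t div L')) $$ (r mod L, t mod L')"
      using rt by (simp add: ext_map_def mult.commute)
    also have "\<dots> = (\<Sum>i<s. \<Sum>j<s. T k (unit_mat s i j) $$ (r mod L, t mod L') * block s ?Z (r div L) (t div L') $$ (i, j))"
      by (rule linear_mat_map_expand[OF T]) (use pos in \<open>auto simp: block_def\<close>)
    also have "\<dots> = (\<Sum>i<s. \<Sum>j<s. T k (unit_mat s i j) $$ (r mod L, t mod L') *
       (X k $$ ((r div L) * s + i, (t div L') * s + j) - (if r div L = t div L' then Y k $$ (i, j) * 1 else 0)))"
    proof (intro sum.cong refl arg_cong2[where f = "(*)"])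
      fix i j assume "i \<in> {..<s}" "j \<in> {..<s}"
      then have ij: "i < s" "j < s" by auto
      have bd: "p * s + i < n * s" if "p < n" "i < s" for p i
      proof -
        have "p * s + i < Suc p * s" using that by simp
        also have "\<dots> \<le> n * s" using that by (intro mult_le_mono1) simp
        finally show ?thesis .
      qed
      have c: "kron (1\<^sub>m n) (Y k) \<in> carrier_mat (n * s) (n * s)" using Y by simp
      show "block s ?Z (r div L) (t div L') $$ (i, j) = X k $$ ((r div L) * s + i, (t div L') * s + j) -
          (if r div L = t div L' then Y k $$ (i, j) * 1 else 0)"
        using ij bd[OF div(1) ij(1)] bd[OF div(2) ij(2)] c index_kron_one[OF Y bd[OF div(1) ij(1)] bd[OF div(2) ij(2)]]
        by (simp add: block_def)
    qed
    finally show ?thesis .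
  qed
  then show "mat_sum (L * n) (L' * n) (\<lambda>k. ext_map s L L' (T k) n (X k - kron (1\<^sub>m n) (Y k))) $$ (r, t) =
      jl (*) s L L' T n Y X $$ (r, t)"
    using rt by (simp add: mat_sum_def jl_def)
qed (auto simp: mat_sum_def jl_def)

lemma kron_jk:
  fixes M :: "'k::field mat" shows "kron (1\<^sub>m n) M = jk (*) n M"
  by (rule eq_matI) (auto simp: kron_def jk_def mult.commute less_mult_imp_div_less)

lemma Units_mat_iff:
  "P \<in> Units (mat_alg sc n :: ('k, 'a::{ring,monoid_mult} mat) module) \<longleftrightarrow>
    P \<in> carrier_mat n n \<and> (\<exists>Q\<in>carrier_mat n n. Q * P = 1\<^sub>m n \<and> P * Q = 1\<^sub>m n)"
  by (auto simp: Units_def)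

lemma inv_mat_eq:
  assumes "P \<in> carrier_mat n n" "Q \<in> carrier_mat n n" "Q * P = 1\<^sub>m n" "P * Q = 1\<^sub>m n"
  shows "inv\<^bsub>(mat_alg sc n :: ('k, 'a::{ring,monoid_mult} mat) module)\<^esub> P = Q"
proof -
  interpret A: ring "mat_alg sc n :: ('k, 'a mat) module" by (rule ring_mat_alg)
  show ?thesis using A.inv_unique'[of P Q] assms by simp
qed

lemma det_nonzero_iff:
  fixes P :: "'k::field mat"
  assumes P: "P \<in> carrier_mat n n"
  shows "det P \<noteq> 0 \<longleftrightarrow> (\<exists>Q\<in>carrier_mat n n. Q * P = 1\<^sub>m n \<and> P * Q = 1\<^sub>m n)"
proof
  assume "det P \<noteq> 0"
  from det_non_zero_imp_unit[OF P this, of "()"]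
  show "\<exists>Q\<in>carrier_mat n n. Q * P = 1\<^sub>m n \<and> P * Q = 1\<^sub>m n"
    by (auto simp: Units_def ring_mat_simps)
next
  assume "\<exists>Q\<in>carrier_mat n n. Q * P = 1\<^sub>m n \<and> P * Q = 1\<^sub>m n"
  then obtain Q where Q: "Q \<in> carrier_mat n n" "Q * P = 1\<^sub>m n" by blast
  have "det Q * det P = 1" using det_mult[OF Q(1) P] Q(2) by simp
  then show "det P \<noteq> 0" by auto
qed

lemma evJ_field:
  fixes R :: "('d::finite, 'k::field) realization"
  assumes R: "fm_realization s R" and X: "\<And>k. X k \<in> carrier_mat (s * n) (s * n)" and Y: "\<And>k. Y k \<in> carrier_mat s s"
  shows "evJ (*) s Y R n X v \<longleftrightarrow> X \<in> real_dom s Y R n \<and> v = real_val s Y R n X"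
proof -
  let ?L = "fm_dim R"
  let ?P = "1\<^sub>m (?L * n) - jl (*) s ?L ?L (mapA R) n Y X"
  have P: "?P \<in> carrier_mat (?L * n) (?L * n)" by (rule minus_carrier_mat) simp
  have A: "\<And>k. linear_mat_map s ?L ?L (mapA R k)" and B: "\<And>k. linear_mat_map s ?L s (mapB R k)"
    using R by (auto simp: fm_realization_def)
  have pen: "pencil s Y R n X = ?P"
    unfolding pencil_def by (simp only: ext_map_jl[where T = "mapA R", OF A X Y])
  have B': "mat_sum (?L * n) (s * n) (\<lambda>k. ext_map s ?L s (mapB R k) n (X k - kron (1\<^sub>m n) (Y k))) = jl (*) s ?L s (mapB R) n Y X"
    by (rule ext_map_jl[OF B X Y])
  note B' = B'[unfolded kron_jk]
  have inv: "inv\<^bsub>(mat_alg (*) (?L * n) :: ('k, 'k mat) module)\<^esub> ?P = Q"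
    if "Q \<in> carrier_mat (?L * n) (?L * n)" "Q * ?P = 1\<^sub>m (?L * n)" "?P * Q = 1\<^sub>m (?L * n)" for Q
    using inv_mat_eq[OF P that] .
  show ?thesis
    unfolding evJ_def Let_def real_dom_def real_val_def pen kron_jk B' mem_Collect_eq det_nonzero_iff[OF P]
    using X inv by (auto cong: conj_cong)
qed

lemma (in unital_algebra) evJ_algebra:
  fixes R :: "('d::finite, 'k) realization" and X :: "'d \<Rightarrow> 'a mat"
  assumes R: "fm_realization s R" and X: "\<And>k. X k \<in> carrier_mat s s" and Y: "\<And>k. Y k \<in> carrier_mat s s"
  shows "evJ sc s Y R 1 X v \<longleftrightarrow> X \<in> real_dom_alg sc s Y R \<and> v = real_val_alg sc s Y R X"
proof -
  let ?L = "fm_dim R"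
  let ?P = "1\<^sub>m (?L * 1) - jl sc s ?L ?L (mapA R) 1 Y X"
  have P: "?P \<in> carrier_mat (?L * 1) (?L * 1)" by (rule minus_carrier_mat[OF jl_carrier])
  have lin: "mat_sum p q (\<lambda>k. ext_map_alg sc s p q (T k) (X k - tensor_elem sc (Y k) 1)) = jl sc s p q T 1 Y X"
    if T: "\<And>k. linear_mat_map s p q (T k)" for p q T
  proof (rule eq_matI)
    fix r t assume "r < dim_row (jl sc s p q T 1 Y X)" "t < dim_col (jl sc s p q T 1 Y X)"
    then have rt: "r < p" "t < q" by (auto simp: jl_def)
    have Tc: "T k (unit_mat s i j) \<in> carrier_mat p q" for k i j using T[of k] by (simp add: linear_mat_map_def)
    have "tensor_elem sc (T k (unit_mat s i j)) ((X k - tensor_elem sc (Y k) 1) $$ (i, j)) $$ (r, t) =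
        sc (T k (unit_mat s i j) $$ (r, t)) (X k $$ (i, j) - sc (Y k $$ (i, j)) 1)" if "i < s" "j < s" for k i j
      using Tc[of k i j] X[of k] Y[of k] rt that by (simp add: tensor_elem_def)
    then show "mat_sum p q (\<lambda>k. ext_map_alg sc s p q (T k) (X k - tensor_elem sc (Y k) 1)) $$ (r, t) =
        jl sc s p q T 1 Y X $$ (r, t)"
      using rt by (simp add: mat_sum_def ext_map_alg_def jl_def)
  qed (auto simp: mat_sum_def jl_def)
  have A: "\<And>k. linear_mat_map s ?L ?L (mapA R k)" and B: "\<And>k. linear_mat_map s ?L s (mapB R k)"
    using R by (auto simp: fm_realization_def)
  have "tensor_elem sc (1\<^sub>m ?L) 1 = 1\<^sub>m (?L * 1)"
    by (auto simp: tensor_elem_def intro!: eq_matI)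
  then have pen: "pencil_alg sc s Y R X = ?P"
    unfolding pencil_alg_def by (simp only: lin[OF A])
  have tens: "tensor_elem sc M 1 = jk sc 1 M" for M
    by (auto simp: tensor_elem_def jk_def intro!: eq_matI)
  have inv: "inv\<^bsub>mat_alg sc ?L\<^esub> ?P = Q"
    if "Q \<in> carrier_mat (?L * 1) (?L * 1)" "Q * ?P = 1\<^sub>m (?L * 1)" "?P * Q = 1\<^sub>m (?L * 1)" for Q
    using inv_mat_eq[OF P that] by simp
  have U: "?P \<in> Units (mat_alg sc ?L) \<longleftrightarrow> (\<exists>Q\<in>carrier_mat (?L * 1) (?L * 1). Q * ?P = 1\<^sub>m (?L * 1) \<and> ?P * Q = 1\<^sub>m (?L * 1))"
    using P Units_mat_iff[of ?P sc ?L] by simp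
  show ?thesis
    unfolding evJ_def Let_def real_dom_alg_def real_val_alg_def pen tens lin[OF B, unfolded tens] mem_Collect_eq U
    using X inv by (auto cong: conj_cong)
qed

section \<open>Coordinates relative to a second centre\<close>

definition fr0 :: "'k::zero mat \<Rightarrow> (nat, 'k) rcf" where
  "fr0 M = Mk (\<lambda>a b. if a < dim_row M \<and> b < dim_col M then M $$ (a, b) else 0)"

lemma ent_fr0: "ent (fr0 M) a b = (if a < dim_row M \<and> b < dim_col M then M $$ (a, b) else 0)"
  unfolding fr0_def
  by (subst ent_Mk) (auto intro: finite_subset[of _ "{..<dim_col M}"] finite_subset[of _ "{..<dim_row M}"])

definition Ix :: "nat \<Rightarrow> ('d \<times> nat \<times> nat) set" where
  "Ix s = UNIV \<times> {..<s} \<times> {..<s}"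

definition coef :: "nat \<Rightarrow> ('d \<Rightarrow> 'k::field mat \<Rightarrow> 'k mat) \<Rightarrow> 'd \<times> nat \<times> nat \<Rightarrow> (nat, 'k) rcf" where
  "coef s T = (\<lambda>(k, i, j). fr0 (T k (unit_mat s i j)))"

text \<open>Block \<open>(p, q)\<close> of W - I_m \<otimes> Y: the coordinates of the new centre
  relative to the old one.\<close>

definition wtx :: "nat \<Rightarrow> ('d \<Rightarrow> 'k::field mat) \<Rightarrow> ('d \<Rightarrow> 'k mat) \<Rightarrow> 'd \<times> nat \<times> nat \<Rightarrow> nat \<Rightarrow> nat \<Rightarrow> 'k" where
  "wtx s W Y = (\<lambda>(k, i, j) p q. W k $$ (p * s + i, q * s + j) - (if p = q then Y k $$ (i, j) else 0))"

lemma lix_div_mod: "a < L \<Longrightarrow> lix L m l ((a, p), c) div L = (c mod l) * m + p"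
  "a < L \<Longrightarrow> lix L m l ((a, p), c) mod L = a"
  by (simp_all add: lix_def)

lemma block_index_eq:
  fixes p q m :: nat
  assumes "p < m" "q < m" "c div l = c' div l"
  shows "(c mod l) * m + p = (c' mod l) * m + q \<longleftrightarrow> c = c' \<and> p = q"
proof
  assume e: "(c mod l) * m + p = (c' mod l) * m + q"
  have "((c mod l) * m + p) mod m = p" "((c' mod l) * m + q) mod m = q"
    "((c mod l) * m + p) div m = c mod l" "((c' mod l) * m + q) div m = c' mod l" using assms by simp_all
  with e have "p = q" "c mod l = c' mod l" by metis+
  then show "c = c' \<and> p = q" using assms(3) same_block_eq by blast
qed simp

text \<open>The pencil of a realization centred at \<open>Y\<close>, at a point of size \<open>s m l\<close>, in the coordinates of the
  centre \<open>W\<close> of size \<open>s m\<close>.\<close>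

lemma (in unital_algebra) per_jl:
  fixes T :: "'d::finite \<Rightarrow> 'k mat \<Rightarrow> 'k mat"
  assumes l: "l \<ge> 1" and T: "\<And>k i j. T k (unit_mat s i j) \<in> carrier_mat L L'"
  shows "per L L' m l (jl sc s L L' T (m * l) Y X) =
    kap sc (\<Sum>(i, p, q)\<in>Jx s m. kap (*) (coef s T i) * lft (unt 1 p q) * scl (wtx s W Y i p q)) +
    linx s m l W X (\<lambda>(i, p, q). kap (*) (coef s T i) * lft (unt 1 p q))"
proof (rule rcf_eqI)
  fix U V :: "(nat \<times> nat) \<times> nat"
  obtain a p c b q c' where UV: "U = ((a, p), c)" "V = ((b, q), c')" by (metis surj_pair)
  let ?t = "\<lambda>(i, p, q). kap (*) (coef s T i) * lft (unt 1 p q) :: (nat \<times> nat, 'k) rcf"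
  \<comment> \<open>X - I \<otimes> Y is split into W - I \<otimes> Y and X - W, with coordinates
    \<open>wtx\<close> and \<open>xi\<close>; both are collected under one sum before the
    coefficients are applied.\<close>
  let ?R = "\<Sum>j\<in>Jx s m. sc (ent (?t j) (a, p) (b, q)) ((if c = c' then sc (case j of (i, p, q) \<Rightarrow> wtx s W Y i p q) 1 else 0) + ent (xi sc s m l W X j) c c')"
  have e1: "ent (kap sc (\<Sum>(i, p, q)\<in>Jx s m. kap (*) (coef s T i) * lft (unt 1 p q) * scl (wtx s W Y i p q))) U V =
    (\<Sum>j\<in>Jx s m. sc (ent (?t j) (a, p) (b, q)) (if c = c' then sc (case j of (i, p, q) \<Rightarrow> wtx s W Y i p q) 1 else 0))"
    by (auto simp: UV ent_kap ent_sum scale_sum_left scl_commute ent_scl_times case_prod_beta scale_scale mult.commute intro!: sum.cong)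
  have e2: "ent (linx s m l W X ?t) U V = (\<Sum>j\<in>Jx s m. sc (ent (?t j) (a, p) (b, q)) (ent (xi sc s m l W X j) c c'))"
    by (simp add: UV ent_linx)
  have "?R = (\<Sum>i\<in>UNIV \<times> {..<s} \<times> {..<s}. \<Sum>pq\<in>{..<m} \<times> {..<m}. if pq = (p, q) then
      sc (ent (coef s T i) a b) ((if c = c' then sc (wtx s W Y i p q) 1 else 0) + ent (xi sc s m l W X (i, p, q)) c c') else 0)"
    unfolding Jx_def sum.cartesian_product
    by (intro sum.cong refl) (auto simp: fld.ent_kap_lft ent_unt)
  also have "\<dots> = (\<Sum>i\<in>UNIV \<times> {..<s} \<times> {..<s}. if p < m \<and> q < m then
      sc (ent (coef s T i) a b) ((if c = c' then sc (wtx s W Y i p q) 1 else 0) + ent (xi sc s m l W X (i, p, q)) c c') else 0)"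
    by (intro sum.cong refl) (simp add: sum.delta')
  also have "\<dots> = ent (per L L' m l (jl sc s L L' T (m * l) Y X)) U V"
  proof (cases "a < L \<and> b < L' \<and> p < m \<and> q < m \<and> c div l = c' div l")
    case True
    let ?r = "lix L m l ((a, p), c)" and ?t = "lix L' m l ((b, q), c')"
    have rt: "?r < L * (m * l)" "?t < L' * (m * l)" using True l lix_less by auto
    have eqv: "(c mod l) * m + p = (c' mod l) * m + q \<longleftrightarrow> c = c' \<and> p = q"
      by (rule block_index_eq) (use True in auto)
    have "ent (per L L' m l (jl sc s L L' T (m * l) Y X)) U V = (\<Sum>k\<in>UNIV. \<Sum>i<s. \<Sum>j<s.
       sc (T k (unit_mat s i j) $$ (a, b)) (X k $$ (((c mod l) * m + p) * s + i, ((c' mod l) * m + q) * s + j) -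
         (if c = c' \<and> p = q then sc (Y k $$ (i, j)) 1 else 0)))"
      using True rt by (simp add: UV ent_per[OF l] jl_def lix_div_mod eqv)
    also have "\<dots> = (\<Sum>(k, i, j)\<in>UNIV \<times> {..<s} \<times> {..<s}.
       sc (T k (unit_mat s i j) $$ (a, b)) (X k $$ (((c mod l) * m + p) * s + i, ((c' mod l) * m + q) * s + j) -
         (if c = c' \<and> p = q then sc (Y k $$ (i, j)) 1 else 0)))"
      by (simp add: sum.cartesian_product)
    also have "\<dots> = (\<Sum>i\<in>UNIV \<times> {..<s} \<times> {..<s}. if p < m \<and> q < m then
      sc (ent (coef s T i) a b) ((if c = c' then sc (wtx s W Y i p q) 1 else 0) + ent (xi sc s m l W X (i, p, q)) c c') else 0)"
    proof (intro sum.cong refl)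
      fix kij assume "kij \<in> (UNIV :: 'd set) \<times> {..<s} \<times> {..<s}"
      obtain k i j where kij: "kij = (k, i, j)" by (metis surj_pair)
      have "ent (coef s T (k, i, j)) a b = T k (unit_mat s i j) $$ (a, b)"
        using T[of k i j] True by (auto simp: coef_def ent_fr0)
      then show "(case kij of (k, i, j) \<Rightarrow> sc (T k (unit_mat s i j) $$ (a, b)) (X k $$ (((c mod l) * m + p) * s + i, ((c' mod l) * m + q) * s + j) -
         (if c = c' \<and> p = q then sc (Y k $$ (i, j)) 1 else 0))) = (if p < m \<and> q < m then
        sc (ent (coef s T kij) a b) ((if c = c' then sc (wtx s W Y kij p q) 1 else 0) + ent (xi sc s m l W X (kij, p, q)) c c') else 0)"
        using True by (simp add: kij ent_xi[OF l] lix_def wtx_def scale_left_diff_distrib)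
    qed
    finally show ?thesis ..
  next
    case False
    have z: "(if p < m \<and> q < m then sc (ent (coef s T i) a b) ((if c = c' then sc (wtx s W Y i p q) 1 else 0) +
        ent (xi sc s m l W X (i, p, q)) c c') else 0) = 0" for i
    proof (cases "a < L \<and> b < L'")
      case True
      then show ?thesis using False xi_mod[OF l, of sc s m W X "(i, p, q)" c c'] by auto
    next
      case F: False
      obtain k i' j where i: "i = (k, i', j)" by (metis surj_pair)
      have "ent (coef s T i) a b = 0" using F T[of k i' j] by (auto simp: i coef_def ent_fr0)
      then show ?thesis by simp
    qed
    have "\<not> ((a, p) \<in> box L m \<and> (b, q) \<in> box L' m \<and> c div l = c' div l)" using False by auto
    then have "ent (per L L' m l (jl sc s L L' T (m * l) Y X)) U V = 0" by (simp only: UV ent_per[OF l] if_False simp_thms)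
    then show ?thesis unfolding z by simp
  qed
  finally have "?R = ent (per L L' m l (jl sc s L L' T (m * l) Y X)) U V" .
  moreover have "?R = ent (kap sc (\<Sum>(i, p, q)\<in>Jx s m. kap (*) (coef s T i) * lft (unt 1 p q) * scl (wtx s W Y i p q)) + linx s m l W X ?t) U V"
    unfolding ent_plus e1 e2 by (simp add: sum.distrib[symmetric] scale_right_distrib)
  ultimately show "ent (per L L' m l (jl sc s L L' T (m * l) Y X)) U V =
    ent (kap sc (\<Sum>(i, p, q)\<in>Jx s m. kap (*) (coef s T i) * lft (unt 1 p q) * scl (wtx s W Y i p q)) + linx s m l W X ?t) U V"
    by simp
qed

lemma (in unital_algebra) per_jk:
  assumes l: "l \<ge> 1" and M: "M \<in> carrier_mat L L'"
  shows "per L L' m l (jk sc (m * l) M) = kap sc (kap (*) (fr0 M) * lft (idm {..<m}))"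
proof (rule rcf_eqI)
  fix U V :: "(nat \<times> nat) \<times> nat"
  obtain a p c b q c' where UV: "U = ((a, p), c)" "V = ((b, q), c')" by (metis surj_pair)
  show "ent (per L L' m l (jk sc (m * l) M)) U V = ent (kap sc (kap (*) (fr0 M) * lft (idm {..<m}))) U V"
  proof (cases "a < L \<and> b < L' \<and> p < m \<and> q < m \<and> c div l = c' div l")
    case True
    let ?r = "lix L m l ((a, p), c)" and ?t = "lix L' m l ((b, q), c')"
    have rt: "?r < L * (m * l)" "?t < L' * (m * l)" using True l lix_less by auto
    have eqv: "(c mod l) * m + p = (c' mod l) * m + q \<longleftrightarrow> c = c' \<and> p = q"
      by (rule block_index_eq) (use True in auto)
    show ?thesis
      using True M rt
      by (cases "c = c' \<and> p = q") (auto simp: UV ent_per[OF l] jk_def eqv ent_kap fld.ent_kap_lft ent_fr0 ent_idm lix_div_mod)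
  next
    case False
    then have "\<not> ((a, p) \<in> box L m \<and> (b, q) \<in> box L' m \<and> c div l = c' div l)" by auto
    then have 1: "ent (per L L' m l (jk sc (m * l) M)) U V = 0" by (simp only: UV ent_per[OF l] if_False simp_thms)
    have "ent (kap sc (kap (*) (fr0 M) * lft (idm {..<m}))) U V = 0"
      using False M by (auto simp: UV ent_kap fld.ent_kap_lft ent_fr0 ent_idm)
    with 1 show ?thesis by simp
  qed
qed

section \<open>Controllability and observability of realizations\<close>

text \<open>Matrices over the field enter the ring in block 0, so that a space of dimension
  \<open>L\<close> becomes \<open>box L (Suc 0)\<close>.\<close>

definition fz :: "'k::zero mat \<Rightarrow> (nat \<times> nat, 'k) rcf" where
  "fz M = Mk (\<lambda>u v. if snd u = 0 \<and> snd v = 0 \<and> fst u < dim_row M \<and> fst v < dim_col M then M $$ (fst u, fst v) else 0)"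

lemma ent_fz: "ent (fz M) u v =
  (if snd u = 0 \<and> snd v = 0 \<and> fst u < dim_row M \<and> fst v < dim_col M then M $$ (fst u, fst v) else 0)"
  unfolding fz_def
  by (subst ent_Mk)
    (auto intro: finite_subset[of _ "{..<dim_col M} \<times> {0}"] finite_subset[of _ "{..<dim_row M} \<times> {0}"])

lemma fz_eq: "fz M = kap (*) (fr0 M) * lft (unt (1 :: 'k::field) 0 0)"
proof (rule rcf_eqI)
  fix u v show "ent (fz M) u v = ent (kap (*) (fr0 M) * lft (unt (1 :: 'k) 0 0)) u v"
    by (cases u; cases v) (auto simp: ent_fz fld.ent_kap_lft ent_fr0 ent_unt)
qed

lemma fz_times:
  fixes M N :: "'k::field mat"
  assumes "M \<in> carrier_mat a b" "N \<in> carrier_mat b c"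
  shows "fz (M * N) = fz M * fz N"
proof (rule rcf_eqI)
  fix u v :: "nat \<times> nat"
  have "ent (fz M * fz N) u v = (\<Sum>w\<in>{..<b} \<times> {0}. ent (fz M) u w * ent (fz N) w v)"
    using assms by (intro ent_times) (auto simp: ent_fz split: if_splits)
  also have "\<dots> = (\<Sum>k<b. ent (fz M) u (k, 0) * ent (fz N) (k, 0) v)"
    by (rule sum.reindex_cong[of "\<lambda>k. (k, 0)"]) (auto simp: inj_on_def)
  also have "\<dots> = ent (fz (M * N)) u v"
    using assms by (auto simp: ent_fz scalar_prod_def atLeast0LessThan)
  finally show "ent (fz (M * N)) u v = ent (fz M * fz N) u v" ..
qed

lemma fz_one: "fz (1\<^sub>m n) = (idm (box n (Suc 0)) :: (nat \<times> nat, 'k::field) rcf)"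
  by (rule rcf_eqI) (auto simp: ent_fz ent_idm prod_eq_iff)

lemma fz_supp:
  fixes M :: "'k::field mat"
  assumes "M \<in> carrier_mat a b"
  shows "idm (box a (Suc 0)) * fz M = fz M" "fz M * idm (box b (Suc 0)) = fz M"
  using assms by (auto intro!: rcf_eqI simp: ent_idm_times ent_times_idm ent_fz mem_Times_iff)

lemma fz_inject:
  fixes M N :: "'k::field mat"
  assumes "M \<in> carrier_mat a b" "N \<in> carrier_mat a b" "fz M = fz N"
  shows "M = N"
proof (rule eq_matI)
  fix i j assume "i < dim_row N" "j < dim_col N"
  then show "M $$ (i, j) = N $$ (i, j)"
    using assms(1,2) arg_cong[OF assms(3), of "\<lambda>M. ent M (i, 0) (j, 0)"] by (simp add: ent_fz)
qed (use assms in auto)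

definition vm :: "'k vec \<Rightarrow> 'k mat" where "vm v = mat (dim_vec v) 1 (\<lambda>(i, j). v $ i)"

lemma vm_carrier: "v \<in> carrier_vec n \<Longrightarrow> vm v \<in> carrier_mat n 1"
  by (auto simp: vm_def)

lemma vm_mult: "M \<in> carrier_mat a b \<Longrightarrow> v \<in> carrier_vec b \<Longrightarrow> vm (M *\<^sub>v v) = M * vm (v :: 'k::field vec)"
  by (rule eq_matI) (auto simp: vm_def scalar_prod_def)

lemma vm_inject: "v \<in> carrier_vec n \<Longrightarrow> w \<in> carrier_vec n \<Longrightarrow> vm v = vm w \<Longrightarrow> v = w"
proof (rule eq_vecI)
  fix i assume "v \<in> carrier_vec n" "w \<in> carrier_vec n" "vm v = vm w" "i < dim_vec w"
  then have "vm v $$ (i, 0) = vm w $$ (i, 0)" "i < dim_vec v" "i < dim_vec w" by auto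
  then show "v $ i = w $ i" by (simp add: vm_def)
qed auto

abbreviation vf :: "'k::field vec \<Rightarrow> (nat \<times> nat, 'k) rcf" where "vf v \<equiv> fz (vm v)"

lemma vf_mult: "M \<in> carrier_mat a b \<Longrightarrow> v \<in> carrier_vec b \<Longrightarrow> vf (M *\<^sub>v v) = fz M * vf v"
  using fz_times[OF _ vm_carrier] vm_mult by metis

lemma vf_inject: "v \<in> carrier_vec n \<Longrightarrow> w \<in> carrier_vec n \<Longrightarrow> vf v = vf w \<Longrightarrow> v = w"
  using fz_inject[OF vm_carrier vm_carrier] vm_inject by metis

lemma vf_zero [simp]: "vf (0\<^sub>v n) = 0"
  by (rule rcf_eqI) (auto simp: ent_fz vm_def)

lemma vf_add: "v \<in> carrier_vec n \<Longrightarrow> w \<in> carrier_vec n \<Longrightarrow> vf (v + w) = vf v + vf w"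
  by (rule rcf_eqI) (auto simp: ent_fz vm_def)

lemma vf_smult: "vf (c \<cdot>\<^sub>v v) = vf v * scl c"
  by (rule rcf_eqI) (auto simp: scl_commute ent_scl_times ent_fz vm_def)

lemma scl_left_commute:
  fixes M N :: "('i, 'k::field) rcf"
  shows "M * (scl c * N) = scl c * (M * N)"
  by (metis mult.assoc scl_commute)

lemma vf_unit: "i < n \<Longrightarrow> vf (unit_vec n i) = unt 1 (i, 0) o0"
  by (rule rcf_eqI) (auto simp: ent_fz vm_def ent_unt prod_eq_iff)

lemma vf_col: "v \<in> carrier_vec n \<Longrightarrow> vf v * unt 1 o0 o0 = vf v"
  by (rule rcf_eqI) (auto simp: ent_times_unt ent_fz vm_def prod_eq_iff)

lemma fz_expand:
  fixes T :: "'k::field mat \<Rightarrow> 'k mat"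
  assumes T: "linear_mat_map s p q T" and B: "B \<in> carrier_mat s s"
  shows "fz (T B) = (\<Sum>i<s. \<Sum>j<s. fz (T (unit_mat s i j)) * scl (B $$ (i, j)))"
proof (rule rcf_eqI)
  fix u v
  have c: "T B \<in> carrier_mat p q" "\<And>i j. T (unit_mat s i j) \<in> carrier_mat p q"
    using T B by (auto simp: linear_mat_map_def)
  show "ent (fz (T B)) u v = ent (\<Sum>i<s. \<Sum>j<s. fz (T (unit_mat s i j)) * scl (B $$ (i, j))) u v"
    using c(1) carrier_matD[OF c(2)] linear_mat_map_expand[OF T B, of "fst u" "fst v"]
    by (auto simp: ent_sum scl_commute ent_scl_times ent_fz mult.commute)
qed

text \<open>A realization as a system centred at \<open>Y\<close>, with \<open>m = 1\<close>. By
  linearity its mappings are determined by their values at the matrix units, which become the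
  coefficients of the coordinates; \<open>p\<close> and \<open>q\<close> are 0 in this case.\<close>

definition ysys :: "nat \<Rightarrow> ('d, 'k::field) realization \<Rightarrow> ('d, 'k) ksys" where
  "ysys s R = \<lparr>sysD = fz (matD R), sysC = fz (matC R),
     sysA = \<lambda>((k, i, j), p, q). fz (mapA R k (unit_mat s i j)),
     sysB = \<lambda>((k, i, j), p, q). fz (mapB R k (unit_mat s i j))\<rparr>"

locale fm_real =
  fixes s :: nat and R :: "('d::finite, 'k::field) realization"
  assumes R: "fm_realization s R"
begin

abbreviation "L \<equiv> fm_dim R"
abbreviation "J \<equiv> Jx s (Suc 0) :: 'd idx set"
abbreviation "A \<equiv> sysA (ysys s R)"
abbreviation "B \<equiv> sysB (ysys s R)"
abbreviation "C \<equiv> sysC (ysys s R)"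
abbreviation "e \<equiv> idm (box L (Suc 0)) :: (nat \<times> nat, 'k) rcf"

lemma R_carrier:
  "matD R \<in> carrier_mat s s" "matC R \<in> carrier_mat s L"
  "X \<in> carrier_mat s s \<Longrightarrow> mapA R k X \<in> carrier_mat L L" "X \<in> carrier_mat s s \<Longrightarrow> mapB R k X \<in> carrier_mat L s"
  "linear_mat_map s L L (mapA R k)" "linear_mat_map s L s (mapB R k)"
  using R by (auto simp: fm_realization_def linear_mat_map_def)

lemma J_cases: "j \<in> J \<Longrightarrow> \<exists>k i i'. j = ((k, i, i'), 0, 0) \<and> i < s \<and> i' < s"
  by (auto simp: Jx_def)

lemma J_intro: "i < s \<Longrightarrow> i' < s \<Longrightarrow> ((k, i, i'), 0, 0) \<in> J"
  by (auto simp: Jx_def)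

lemma supp_ysys: "supp J (box L (Suc 0)) (ysys s R)"
  unfolding supp_def using fz_supp(2)[OF R_carrier(2)] fz_supp[OF R_carrier(3)[OF unit_mat_carrier]]
    fz_supp(1)[OF R_carrier(4)[OF unit_mat_carrier]]
  by (auto simp: ysys_def split: prod.splits)

lemma A_word_carrier: "w \<in> words s \<Longrightarrow> A_word R w \<in> carrier_mat L L"
  unfolding words_def A_word_def
proof (induct w rule: lists.induct)
  case (Cons x w)
  then show ?case using R_carrier(3) by (cases x) (auto intro!: mult_carrier_mat)
qed simp

lemma A_expand:
  assumes "X \<in> carrier_mat s s"
  shows "fz (mapA R k X) = (\<Sum>i<s. \<Sum>j<s. A ((k, i, j), 0, 0) * scl (X $$ (i, j)))"
  using fz_expand[OF R_carrier(5) assms] by (simp add: ysys_def)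

lemma B_expand:
  assumes "X \<in> carrier_mat s s"
  shows "fz (mapB R k X) = (\<Sum>i<s. \<Sum>j<s. B ((k, i, j), 0, 0) * scl (X $$ (i, j)))"
  using fz_expand[OF R_carrier(6) assms] by (simp add: ysys_def)

definition wd :: "'d idx list \<Rightarrow> ('d \<times> 'k mat) list" where
  "wd w = map (\<lambda>((k, i, j), p, q). (k, unit_mat s i j)) w"

lemma wd_words: "wd w \<in> words s"
  by (induct w) (auto simp: wd_def words_def)

text \<open>The factor \<open>e\<close> is for the empty word, where \<open>wprod\<close> is the
  unit of the whole ring and \<open>A_word\<close> the identity of size \<open>L\<close>.\<close>

lemma fz_A_word: "wprod A w * e = fz (A_word R (wd w))"
proof (induct w)
  case Nil
  show ?case by (simp add: wd_def A_word_def fz_one)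
next
  case (Cons j w)
  obtain k i i' p q where j: "j = ((k, i, i'), p, q)" by (metis surj_pair)
  have "wprod A (j # w) * e = A j * fz (A_word R (wd w))" using Cons by (simp add: mult.assoc)
  also have "\<dots> = fz (mapA R k (unit_mat s i i') * A_word R (wd w))"
    using fz_times[OF R_carrier(3)[OF unit_mat_carrier] A_word_carrier[OF wd_words]] by (simp add: j ysys_def)
  also have "mapA R k (unit_mat s i i') * A_word R (wd w) = A_word R (wd (j # w))"
    by (simp add: wd_def A_word_def j)
  finally show ?case .
qed

lemma eB: "j \<in> J \<Longrightarrow> e * B j = B j" and eA: "j \<in> J \<Longrightarrow> e * A j = A j" "j \<in> J \<Longrightarrow> A j * e = A j" and Ce: "C * e = C"
  using supp_ysys by (auto simp: supp_def)

text \<open>By multilinearity, an annihilator of the words in matrix units annihilates the words in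
  all matrices. The annihilated vectors form a submodule that contains the generators, hence their
  span.\<close>

lemma contr_if_controllable:
  assumes con: "controllable s R" shows "contr J (box L (Suc 0)) (ysys s R)"
  unfolding contr_def
proof (intro allI impI)
  fix Z assume Z: "\<forall>w\<in>lists J. \<forall>j\<in>J. Z * wprod A w * B j = 0"
  \<comment> \<open>\<open>Z\<close> is arbitrary in the induction because the first letter is
    absorbed into it.\<close>
  have kill: "Z * fz (A_word R w * mapB R k X) = 0"
    if w: "w \<in> words s" and X: "X \<in> carrier_mat s s" and Z: "\<forall>w\<in>lists J. \<forall>j\<in>J. Z * wprod A w * B j = 0" for Z w k X
    using w Z unfolding words_def
  proof (induction w arbitrary: Z rule: lists.induct)
    case Nil
    have "Z * B j = 0" if "j \<in> J" for j using bspec[OF bspec[OF Nil lists.Nil] that] by simp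
    then have "Z * fz (mapB R k X) = 0"
      unfolding B_expand[OF X] sum_distrib_left using J_intro by (simp add: mult.assoc[symmetric])
    then show ?case using left_mult_one_mat[OF R_carrier(4)[OF X]] by (simp add: A_word_def)
  next
    case (Cons x w)
    obtain k' X' where x: "x = (k', X')" "X' \<in> carrier_mat s s" using Cons(1) by auto
    have wc: "A_word R w \<in> carrier_mat L L" using A_word_carrier Cons(2) by (simp add: words_def)
    have IH: "Z * A j * fz (A_word R w * mapB R k X) = 0" if j: "j \<in> J" for j
    proof (rule Cons.IH, intro ballI)
      fix w' i assume "w' \<in> lists J" "i \<in> J"
      then have "Z * wprod A (j # w') * B i = 0" using Cons.prems j by (meson lists.Cons)
      then show "Z * A j * wprod A w' * B i = 0" by (simp add: mult.assoc)
    qed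
    have "A_word R (x # w) * mapB R k X = mapA R k' X' * (A_word R w * mapB R k X)"
      using assoc_mult_mat[OF R_carrier(3)[OF x(2)] wc R_carrier(4)[OF X]] by (simp add: A_word_def x)
    then have "fz (A_word R (x # w) * mapB R k X) = fz (mapA R k' X') * fz (A_word R w * mapB R k X)"
      using fz_times[OF R_carrier(3)[OF x(2)] mult_carrier_mat[OF wc R_carrier(4)[OF X]]] by simp
    then have "Z * fz (A_word R (x # w) * mapB R k X) =
        (\<Sum>i<s. \<Sum>j<s. Z * A ((k', i, j), 0, 0) * fz (A_word R w * mapB R k X) * scl (X' $$ (i, j)))"
      unfolding A_expand[OF x(2)] by (simp add: sum_distrib_left sum_distrib_right mult.assoc scl_commute scl_left_commute)
    also have "\<dots> = 0" using IH J_intro by simp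
    finally show ?case .
  qed
  interpret V: vec_space "TYPE('k)" L .
  let ?S = "{A_word R w * mapB R k X *\<^sub>v u | w k X u. w \<in> words s \<and> X \<in> carrier_mat s s \<and> u \<in> carrier_vec s}"
  let ?N = "{v \<in> carrier_vec L. Z * vf v = 0}"
  have "?S \<subseteq> ?N"
  proof
    fix v assume "v \<in> ?S"
    then obtain w k X u where v: "v = A_word R w * mapB R k X *\<^sub>v u" "w \<in> words s" "X \<in> carrier_mat s s" "u \<in> carrier_vec s" by blast
    have c: "A_word R w * mapB R k X \<in> carrier_mat L s" using A_word_carrier[OF v(2)] R_carrier(4)[OF v(3)] by (rule mult_carrier_mat)
    have "Z * vf v = Z * fz (A_word R w * mapB R k X) * vf u" using vf_mult[OF c v(4)] v by (simp add: mult.assoc)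
    then show "v \<in> ?N" using kill[OF v(2,3) Z] v c by simp
  qed
  moreover have "LinearCombinations.submodule class_ring ?N V.V"
    unfolding LinearCombinations.submodule_def
    by (auto simp: V.module_axioms module_vec_simps vf_add distrib_left vf_smult mult.assoc[symmetric])
  ultimately have "V.span ?S \<subseteq> ?N" by (rule V.span_is_subset)
  then have all: "Z * vf v = 0" if "v \<in> carrier_vec L" for v using con that unfolding controllable_def by auto
  show "Z * e = 0"
  proof (rule cols_zero_imp_zero[of _ o0])
    fix t show "col (Z * e) t = 0"
    proof (cases "t \<in> box L (Suc 0)")
      case True
      then obtain j where t: "t = (j, 0)" "j < L" by auto
      have "Z * unt 1 (j, 0) o0 = 0" using all[of "unit_vec L j"] vf_unit[OF t(2), where 'a = 'k] by simp
      then show ?thesis using True t by (simp add: mult.assoc idm_times_unt)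
    next
      case False
      then show ?thesis by (simp add: mult.assoc idm_times_unt)
    qed
  qed
qed

text \<open>A basis \<open>G\<close> is chosen among the reachable columns. Then
  \<open>1 - G * Gp\<close> annihilates them all, so \<open>contr\<close> gives
  \<open>G * Gp * e = e\<close>, and every vector is a combination of generators.\<close>

lemma controllable_if_contr:
  assumes con: "contr J (box L (Suc 0)) (ysys s R)" shows "controllable s R"
proof -
  interpret V: vec_space "TYPE('k)" L .
  let ?S = "{A_word R w * mapB R k X *\<^sub>v u | w k X u. w \<in> words s \<and> X \<in> carrier_mat s s \<and> u \<in> carrier_vec s}"
  have S: "?S \<subseteq> carrier_vec L"
    using A_word_carrier R_carrier(4) by (auto intro!: mult_mat_vec_carrier mult_carrier_mat)
  have sub: "LinearCombinations.submodule class_ring (V.span ?S) V.V" by (rule V.span_is_submodule[OF S])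
  have add: "v + w \<in> V.span ?S" if "v \<in> V.span ?S" "w \<in> V.span ?S" for v w
    using sub that unfolding LinearCombinations.submodule_def by (auto simp: module_vec_simps)
  have sm: "c \<cdot>\<^sub>v v \<in> V.span ?S" if "v \<in> V.span ?S" for c v
    using sub that unfolding LinearCombinations.submodule_def by (auto simp: module_vec_simps class_ring_simps)
  have zero: "0\<^sub>v L \<in> V.span ?S"
    using sub unfolding LinearCombinations.submodule_def by (auto simp: module_vec_simps)
  have cs: "v \<in> carrier_vec L" if "v \<in> V.span ?S" for v using V.span_is_subset2[OF S] that by auto
  obtain G r Gp where g: "G * idm (box r (Suc 0)) = G" "idm (box r (Suc 0)) * Gp = Gp"
    "Gp * G = idm (box r (Suc 0))" "e * G = G" "\<forall>z\<in>gens J (ysys s R). G * Gp * z = z"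
    "\<forall>j<r. col G (j, 0) \<in> gens J (ysys s R)"
    by (rule rank_factor[of "box L (Suc 0)" "gens J (ysys s R)", OF _ conjI[OF gens_supp[OF supp_ysys] gens_col]]) simp
  have "\<forall>w\<in>lists J. \<forall>j\<in>J. (1 - G * Gp) * wprod A w * B j = 0"
  proof (intro ballI)
    fix w j assume "w \<in> lists J" "j \<in> J"
    show "(1 - G * Gp) * wprod A w * B j = 0"
    proof (rule cols_zero_imp_zero[of _ o0])
      fix u
      have "col (wprod A w * B j) u \<in> gens J (ysys s R)" by (rule gens_intros) fact+
      then show "col ((1 - G * Gp) * wprod A w * B j) u = 0" using g(5) by (simp add: left_diff_distrib mult.assoc)
    qed
  qed
  then have "(1 - G * Gp) * e = 0" using con unfolding contr_def by blast
  then have GG: "G * Gp * e = e" by (simp add: left_diff_distrib)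
  have gen: "\<exists>v\<in>V.span ?S. vf v = z" if z: "z \<in> gens J (ysys s R)" for z
  proof -
    obtain w j u where w: "w \<in> lists J" "j \<in> J" "z = col (wprod A w * B j) u"
      using z unfolding gens_def by blast
    obtain k i i' where j: "j = ((k, i, i'), 0, 0)" using J_cases[OF w(2)] by blast
    let ?M = "A_word R (wd w) * mapB R k (unit_mat s i i')"
    have "wprod A w * B j = (wprod A w * e) * B j" using eB[OF w(2)] by (simp add: mult.assoc)
    also have "\<dots> = fz ?M"
      unfolding fz_A_word using fz_times[OF A_word_carrier[OF wd_words] R_carrier(4)[OF unit_mat_carrier]] by (simp add: j ysys_def)
    finally have zM: "z = col (fz ?M) u" using w(3) by simp
    have M: "?M \<in> carrier_mat L s" using A_word_carrier[OF wd_words] R_carrier(4)[OF unit_mat_carrier] by (rule mult_carrier_mat)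
    show ?thesis
    proof (cases "u \<in> box s (Suc 0)")
      case True
      then obtain b where b: "u = (b, 0)" "b < s" by auto
      have "?M *\<^sub>v unit_vec s b \<in> ?S" using wd_words by (auto intro!: exI) 
      then have "?M *\<^sub>v unit_vec s b \<in> V.span ?S" by (rule subsetD[OF V.in_own_span[OF S]])
      moreover have "vf (?M *\<^sub>v unit_vec s b) = z"
        using vf_mult[OF M, of "unit_vec s b"] vf_unit[OF b(2), where 'a = 'k] zM b by simp
      ultimately show ?thesis by blast
    next
      case False
      then have "z = 0" unfolding zM by (rule col_outside[OF fz_supp(2)[OF M]])
      then show ?thesis by (intro bexI[OF _ zero]) simp
    qed
  qed
  have "carrier_vec L \<subseteq> V.span ?S"
  proof
    fix v :: "'k vec" assume v: "v \<in> carrier_vec L"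
    define c where "c j = ent (Gp * vf v) (j, 0) o0" for j
    have "\<exists>x\<in>V.span ?S. vf x = (\<Sum>j<n. col G (j, 0) * scl (c j))" if "n \<le> r" for n
      using that
    proof (induct n)
      case 0
      show ?case by (rule bexI[OF _ zero]) simp
    next
      case (Suc n)
      then obtain x where x: "x \<in> V.span ?S" "vf x = (\<Sum>j<n. col G (j, 0) * scl (c j))" by auto
      have "n < r" using Suc(2) by simp
      then have "col G (n, 0) \<in> gens J (ysys s R)" using g(6) by blast
      from gen[OF this] obtain y where y: "y \<in> V.span ?S" "vf y = col G (n, 0)" by (elim bexE) simp
      have "x + c n \<cdot>\<^sub>v y \<in> V.span ?S" by (rule add[OF x(1) sm[OF y(1)]])
      moreover have "vf (x + c n \<cdot>\<^sub>v y) = (\<Sum>j<Suc n. col G (j, 0) * scl (c j))"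
        using vf_add[OF cs[OF x(1)] smult_carrier_vec[THEN iffD2, OF cs[OF y(1)]]] x(2) y(2) by (simp add: vf_smult)
      ultimately show ?case by (intro bexI)
    qed
    from this[OF le_refl] obtain x where x: "x \<in> V.span ?S" "vf x = (\<Sum>j<r. col G (j, 0) * scl (c j))" by (elim bexE) simp
    have ev: "e * vf v = vf v" by (rule fz_supp(1)[OF vm_carrier[OF v]])
    have "vf v = G * Gp * e * vf v" using GG ev by simp
    also have "\<dots> = G * (Gp * vf v)" using ev by (simp add: mult.assoc)
    also have "Gp * vf v = (\<Sum>j<r. unt 1 (j, 0) o0 * scl (c j))"
    proof (rule rcf_eqI)
      fix a b
      have "Gp * vf v = idm (box r (Suc 0)) * (Gp * vf v) * unt 1 o0 o0"
        using g(2) vf_col[OF v] by (simp add: mult.assoc) (simp add: mult.assoc[symmetric])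
      then have 1: "ent (Gp * vf v) a b = (if a \<in> box r (Suc 0) \<and> b = o0 then ent (Gp * vf v) a b else 0)"
        by (metis (no_types, lifting) ent_idm_times ent_times_unt mult.right_neutral)
      have "ent (\<Sum>j<r. unt 1 (j, 0) o0 * scl (c j)) a b = (\<Sum>j<r. if j = fst a then (if snd a = 0 \<and> b = o0 then c j else 0) else 0)"
        unfolding ent_sum by (intro sum.cong refl) (cases a, auto simp: scl_commute ent_scl_times ent_unt)
      also have "\<dots> = (if a \<in> box r (Suc 0) \<and> b = o0 then ent (Gp * vf v) a b else 0)"
        by (cases a, cases b) (auto simp: c_def)
      finally show "ent (Gp * vf v) a b = ent (\<Sum>j<r. unt 1 (j, 0) o0 * scl (c j)) a b" using 1 by simp
    qed
    finally have "vf v = vf x" using x(2) by (simp add: sum_distrib_left mult.assoc)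
    then have "v = x" using vf_inject[OF v cs[OF x(1)]] by simp
    then show "v \<in> V.span ?S" using x by simp
  qed
  then show ?thesis unfolding controllable_def using V.span_is_subset2[OF S] by auto
qed

lemma obsv_if_observable:
  assumes obs: "observable s R" shows "obsv J (box L (Suc 0)) (ysys s R)"
  unfolding obsv_def
proof (intro allI impI)
  fix Z assume Z: "\<forall>w\<in>lists J. C * wprod A w * Z = 0"
  \<comment> \<open>Stated for every prefix \<open>w'\<close>, since the induction moves the first
    letter of \<open>w\<close> to the end of the prefix.\<close>
  have closed: "\<forall>w'\<in>lists J. C * wprod A w' * (fz (A_word R w) * Z) = 0" if "w \<in> words s" for w
    using that unfolding words_def
  proof (induction w rule: lists.induct)
    case Nil
    have "C * wprod A w * e = C * wprod A w" if "w \<in> lists J" for w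
    proof (cases w rule: rev_cases)
      case (snoc w' j)
      then show ?thesis using that eA by (simp add: mult.assoc)
    qed (simp add: Ce)
    then have "C * wprod A w * (e * Z) = 0" if "w \<in> lists J" for w
      using Z that by (simp add: mult.assoc[symmetric])
    then show ?case by (simp add: A_word_def fz_one)
  next
    case (Cons x w)
    obtain k X where x: "x = (k, X)" "X \<in> carrier_mat s s" using Cons(1) by auto
    have wc: "A_word R w \<in> carrier_mat L L" using A_word_carrier Cons(2) by (simp add: words_def)
    have Aw: "fz (A_word R (x # w)) = fz (mapA R k X) * fz (A_word R w)"
      using fz_times[OF R_carrier(3)[OF x(2)] wc] by (simp add: A_word_def x)
    show ?case
    proof
      fix w' assume w': "w' \<in> lists J"
      have "C * wprod A w' * (A j * (fz (A_word R w) * Z)) = 0" if j: "j \<in> J" for j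
      proof -
        have "w' @ [j] \<in> lists J" using w' j by simp
        then have "C * wprod A (w' @ [j]) * (fz (A_word R w) * Z) = 0" using Cons(3) by blast
        then show ?thesis by (simp add: mult.assoc)
      qed
      then have "(\<Sum>i<s. \<Sum>j<s. C * wprod A w' * (A ((k, i, j), 0, 0) * (fz (A_word R w) * Z)) * scl (X $$ (i, j))) = 0"
        using J_intro by simp
      then show "C * wprod A w' * (fz (A_word R (x # w)) * Z) = 0"
        unfolding Aw A_expand[OF x(2)] by (simp add: sum_distrib_left sum_distrib_right mult.assoc scl_commute scl_left_commute)
    qed
  qed
  have CZ: "C * (fz (A_word R w) * Z) = 0" if "w \<in> words s" for w
    using bspec[OF closed[OF that] lists.Nil] by simp
  show "e * Z = 0"
  proof (rule cols_zero_imp_zero[of _ o0])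
    fix u
    define z where "z = vec L (\<lambda>a. ent Z (a, 0) u)"
    have z: "z \<in> carrier_vec L" by (simp add: z_def)
    have vz: "vf z = col (e * Z) u"
      by (rule rcf_eqI) (auto simp: ent_fz vm_def z_def ent_times_unt ent_idm_times mem_Times_iff prod_eq_iff)
    have "matC R * A_word R w *\<^sub>v z = 0\<^sub>v s" if w: "w \<in> words s" for w
    proof -
      note wc = A_word_carrier[OF w]
      have M: "matC R * A_word R w \<in> carrier_mat s L" by (rule mult_carrier_mat[OF R_carrier(2) wc])
      have "vf (matC R * A_word R w *\<^sub>v z) = C * (fz (A_word R w) * e) * Z * unt 1 u o0"
        using vf_mult[OF M z] fz_times[OF R_carrier(2) wc] by (simp add: vz ysys_def mult.assoc)
      also have "\<dots> = 0" using CZ[OF w] fz_supp(2)[OF wc] by (simp add: mult.assoc)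
      finally show ?thesis using vf_inject[of _ s "0\<^sub>v s"] M z by (metis mult_mat_vec_carrier vf_zero zero_carrier_vec)
    qed
    then have "z = 0\<^sub>v L" using obs z unfolding observable_def by blast
    then show "col (e * Z) u = 0" using vz by simp
  qed
qed

lemma observable_if_obsv:
  assumes obs: "obsv J (box L (Suc 0)) (ysys s R)" shows "observable s R"
  unfolding observable_def
proof (intro ballI impI)
  fix v assume v: "v \<in> carrier_vec L" and z: "\<forall>w\<in>words s. matC R * A_word R w *\<^sub>v v = 0\<^sub>v s"
  have ev: "e * vf v = vf v" by (rule fz_supp(1)[OF vm_carrier[OF v]])
  have "C * wprod A w * vf v = 0" for w
  proof -
    note wc = A_word_carrier[OF wd_words[of w]]
    have M: "matC R * A_word R (wd w) \<in> carrier_mat s L" by (rule mult_carrier_mat[OF R_carrier(2) wc])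
    have "C * wprod A w * vf v = C * (wprod A w * e) * vf v" using ev by (simp add: mult.assoc)
    also have "\<dots> = vf (matC R * A_word R (wd w) *\<^sub>v v)"
      unfolding fz_A_word using vf_mult[OF M v] fz_times[OF R_carrier(2) wc] by (simp add: ysys_def)
    also have "\<dots> = 0" using z wd_words[of w] by simp
    finally show ?thesis .
  qed
  then have "e * vf v = 0" using obs unfolding obsv_def by blast
  then show "v = 0\<^sub>v L" using ev vf_inject[OF v, of "0\<^sub>v L"] by simp
qed

end

section \<open>Realizations in shifted coordinates\<close>

lemma recentring_real:
  fixes R :: "('d::finite, 'k::field) realization"
  assumes R: "fm_realization s R" and m: "m \<ge> 1"
  shows "recentring (coef s (mapA R)) (coef s (mapB R)) (fr0 (matC R)) (Ix s) (fm_dim R) m"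
proof -
  have A: "mapA R k (unit_mat s i j) \<in> carrier_mat (fm_dim R) (fm_dim R)"
    and B: "mapB R k (unit_mat s i j) \<in> carrier_mat (fm_dim R) s" and C: "matC R \<in> carrier_mat s (fm_dim R)" for k i j
    using R by (auto simp: fm_realization_def linear_mat_map_def)
  show ?thesis
  proof
    show "finite (Ix s :: ('d \<times> nat \<times> nat) set)" by (simp add: Ix_def)
    show "m \<ge> 1" by (rule m)
    fix i :: "'d \<times> nat \<times> nat"
    obtain k x y where i: "i = (k, x, y)" by (metis surj_pair)
    show "idm {..<fm_dim R} * coef s (mapA R) i = coef s (mapA R) i" "coef s (mapA R) i * idm {..<fm_dim R} = coef s (mapA R) i"
      "idm {..<fm_dim R} * coef s (mapB R) i = coef s (mapB R) i"
      using A[of k x y] B[of k x y] by (auto intro!: rcf_eqI simp: i coef_def ent_fr0 ent_idm_times ent_times_idm)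
  next
    show "fr0 (matC R) * idm {..<fm_dim R} = fr0 (matC R)"
      using C by (auto intro!: rcf_eqI simp: ent_fr0 ent_times_idm)
  qed
qed


locale real_shift = fm_real s R for s :: nat and R :: "('d::finite, 'k::field) realization" +
  fixes m :: nat and Y W :: "'d \<Rightarrow> 'k mat"
  assumes m: "m \<ge> 1"
begin

sublocale rc: recentring "coef s (mapA R)" "coef s (mapB R)" "fr0 (matC R)" "fr0 (matD R)" "Ix s" "fm_dim R" m
    "wtx s W Y" Q for Q
  by (rule recentring_real[OF R m])

lemma J_Ix: "rc.J = Jx s m"
  unfolding rc.J_def by (simp add: Ix_def Jx_def)

lemma Aw_eq: "rc.Aw = (\<Sum>(i, p, q)\<in>Jx s m. kap (*) (coef s (mapA R) i) * lft (unt 1 p q) * scl (wtx s W Y i p q))"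
  unfolding rc.Aw_def J_Ix by (simp add: rc.a1_def rc.wv_def rc.T_def case_prod_beta)

lemma Bw_eq: "rc.Bw = (\<Sum>(i, p, q)\<in>Jx s m. kap (*) (coef s (mapB R) i) * lft (unt 1 p q) * scl (wtx s W Y i p q))"
  unfolding rc.Bw_def J_Ix by (simp add: rc.b1_def rc.wv_def rc.T_def case_prod_beta)

lemma a1_eq: "rc.a1 = (\<lambda>(i, p, q). kap (*) (coef s (mapA R) i) * lft (unt 1 p q))"
  and b1_eq: "rc.b1 = (\<lambda>(i, p, q). kap (*) (coef s (mapB R) i) * lft (unt 1 p q))"
  unfolding rc.a1_def rc.b1_def rc.T_def by simp_all

end

text \<open>The passage from matrices to the ring. \<open>W\<close> serves as a reference point at
  which the displacement from \<open>Y\<close> is split into a constant and a part linear in the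
  coordinates.\<close>

lemma (in unital_algebra) evJ_iff_unit:
  fixes R :: "('d::finite, 'k) realization" and X :: "'d \<Rightarrow> 'a mat" and Y W :: "'d \<Rightarrow> 'k mat"
  assumes "real_shift s R m" and l: "l \<ge> 1" and v: "v \<in> carrier_mat (s * (m * l)) (s * (m * l))"
  defines "AA \<equiv> kap sc (recentring.Aw (coef s (mapA R)) (Ix s) m (wtx s W Y)) + linx s m l W X (recentring.a1 (coef s (mapA R)))"
    and "BB \<equiv> kap sc (recentring.Bw (coef s (mapB R)) (Ix s) m (wtx s W Y)) + linx s m l W X (recentring.b1 (coef s (mapB R)))"
    and "CC \<equiv> recentring.C1 (fr0 (matC R)) m" and "DD \<equiv> recentring.D1 (fr0 (matD R)) m"
  shows "evJ sc s Y R (m * l) X v \<longleftrightarrow> (\<exists>U. U * (1 - AA) = 1 \<and> (1 - AA) * U = 1 \<and>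
    per s s m l v = kap sc DD + kap sc CC * U * BB)"
proof -
  interpret real_shift s R m Y W by fact
  let ?L = "fm_dim R"
  let ?N = "jl sc s ?L ?L (mapA R) (m * l) Y X" and ?M = "jl sc s ?L s (mapB R) (m * l) Y X"
  let ?jC = "jk sc (m * l) (matC R)" and ?jD = "jk sc (m * l) (matD R)"
  have N: "?N \<in> carrier_mat (?L * (m * l)) (?L * (m * l))" and M: "?M \<in> carrier_mat (?L * (m * l)) (s * (m * l))" by simp_all
  have C: "?jC \<in> carrier_mat (s * (m * l)) (?L * (m * l))" and D: "?jD \<in> carrier_mat (s * (m * l)) (s * (m * l))"
    using jk_carrier[OF R_carrier(2)] jk_carrier[OF R_carrier(1)] by auto
  have pA: "per ?L ?L m l ?N = AA"
    unfolding AA_def Aw_eq a1_eq by (rule per_jl[OF l]) (rule R_carrier(3)[OF unit_mat_carrier])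
  have pB: "per ?L s m l ?M = BB"
    unfolding BB_def Bw_eq b1_eq by (rule per_jl[OF l]) (rule R_carrier(4)[OF unit_mat_carrier])
  have pC: "per s ?L m l ?jC = kap sc CC"
    unfolding CC_def rc.C1_def by (rule per_jk[OF l R_carrier(2)])
  have pD: "per s s m l ?jD = kap sc DD"
    unfolding DD_def rc.D1_def by (rule per_jk[OF l R_carrier(1)])
  let ?e = "kap sc (idm (box ?L m))"
  have Ce: "kap sc CC * ?e = kap sc CC"
    unfolding kap_idm pC[symmetric] by (rule per_supp[OF l])
  have rhs: "per s s m l (?jD + ?jC * Q0 * ?M) = kap sc DD + kap sc CC * (per ?L ?L m l Q0 + (1 - ?e)) * BB"
    if Q0: "Q0 \<in> carrier_mat (?L * (m * l)) (?L * (m * l))" for Q0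
  proof -
    have CQ: "?jC * Q0 \<in> carrier_mat (s * (m * l)) (?L * (m * l))" using C Q0 by (rule mult_carrier_mat)
    have CQM: "?jC * Q0 * ?M \<in> carrier_mat (s * (m * l)) (s * (m * l))" using CQ M by (rule mult_carrier_mat)
    have "kap sc CC * (per ?L ?L m l Q0 + (1 - ?e)) = kap sc CC * per ?L ?L m l Q0"
      using Ce by (simp add: distrib_left right_diff_distrib)
    then show ?thesis
      by (simp add: per_add[OF l CQM] per_mult[OF l CQ M] per_mult[OF l C Q0] pB pC pD)
  qed
  have rhs_c: "?jD + ?jC * Q0 * ?M \<in> carrier_mat (s * (m * l)) (s * (m * l))"
    if Q0: "Q0 \<in> carrier_mat (?L * (m * l)) (?L * (m * l))" for Q0
    using mult_carrier_mat[OF mult_carrier_mat[OF C Q0] M] by (rule add_carrier_mat)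
  show ?thesis
  proof
    assume "evJ sc s Y R (m * l) X v"
    then obtain Q0 where Q0: "Q0 \<in> carrier_mat (?L * (m * l)) (?L * (m * l))"
      "Q0 * (1\<^sub>m (?L * (m * l)) - ?N) = 1\<^sub>m (?L * (m * l))" "(1\<^sub>m (?L * (m * l)) - ?N) * Q0 = 1\<^sub>m (?L * (m * l))"
      "v = ?jD + ?jC * Q0 * ?M"
      unfolding evJ_def Let_def by blast
    let ?U = "per ?L ?L m l Q0 + (1 - ?e)"
    have "?U * (1 - AA) = 1" "(1 - AA) * ?U = 1"
      using per_unit_iff(1)[OF l N Q0(1,2)] per_unit_iff(2)[OF l N Q0(1,3)] unfolding pA by auto
    moreover have "per s s m l v = kap sc DD + kap sc CC * ?U * BB"
      using rhs[OF Q0(1)] Q0(4) by simp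
    ultimately show "\<exists>U. U * (1 - AA) = 1 \<and> (1 - AA) * U = 1 \<and> per s s m l v = kap sc DD + kap sc CC * U * BB" by blast
  next
    assume "\<exists>U. U * (1 - AA) = 1 \<and> (1 - AA) * U = 1 \<and> per s s m l v = kap sc DD + kap sc CC * U * BB"
    then obtain U where U: "U * (1 - AA) = 1" "(1 - AA) * U = 1" "per s s m l v = kap sc DD + kap sc CC * U * BB" by blast
    let ?Q = "unper ?L ?L m l U"
    have Q: "?Q * (1\<^sub>m (?L * (m * l)) - ?N) = 1\<^sub>m (?L * (m * l))" "(1\<^sub>m (?L * (m * l)) - ?N) * ?Q = 1\<^sub>m (?L * (m * l))"
      using per_unit_iff(3)[OF l N, of U] per_unit_iff(4)[OF l N, of U] U(1,2) unfolding pA by auto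
    have "(per ?L ?L m l ?Q + (1 - ?e)) * (1 - AA) = 1"
      using per_unit_iff(1)[OF l N unper_carrier Q(1)] unfolding pA .
    \<comment> \<open>The inverse \<open>U\<close> is recovered from its period, because the
      periodic extension inverts the same pencil.\<close>
    then have "(per ?L ?L m l ?Q + (1 - ?e)) * ((1 - AA) * U) = U" by (simp only: mult.assoc[symmetric]) simp
    then have "per ?L ?L m l ?Q + (1 - ?e) = U" using U(2) by simp
    then have "per s s m l v = per s s m l (?jD + ?jC * ?Q * ?M)"
      using rhs[OF unper_carrier, of U] U(3) by simp
    then have "v = ?jD + ?jC * ?Q * ?M" by (rule per_inject[OF l v rhs_c[OF unper_carrier]])
    then show "evJ sc s Y R (m * l) X v" unfolding evJ_def Let_def using Q unper_carrier by blast
  qed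
qed

lemma (in unital_algebra) evJ_iff_shifted:
  fixes R :: "('d::finite, 'k) realization"
  assumes rs: "real_shift s R m" and l: "l \<ge> 1" and v: "v \<in> carrier_mat (s * (m * l)) (s * (m * l))"
    and Q: "Q * (1 - recentring.Aw (coef s (mapA R)) (Ix s) m (wtx s W Y)) = 1"
      "(1 - recentring.Aw (coef s (mapA R)) (Ix s) m (wtx s W Y)) * Q = 1"
  shows "evJ sc s Y R (m * l) X v \<longleftrightarrow> evx s m l W X (recentring.shifted (coef s (mapA R)) (coef s (mapB R))
    (fr0 (matC R)) (fr0 (matD R)) (Ix s) m (wtx s W Y) Q) (per s s m l v)"
proof -
  interpret real_shift s R m Y W by fact
  interpret pe: pencil_eval "kap sc" "\<lambda>j. lft (xi sc s m l W X j)" "Jx s m" by (rule pencil_eval_lft)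
  show ?thesis
    unfolding evJ_iff_unit[OF rs l v, of Y X W] evx_def rc.shifted_def
    by (intro iffI; (elim exE conjE)?) (simp add: pe.ev_recentre[OF Q], rule pe.ev_recentreD[OF Q])
qed

text \<open>The case W = Y, m = 1 of \<open>evJ_iff_unit\<close>: the centre has coordinates 0
  relative to itself, so the constants \<open>Aw\<close> and \<open>Bw\<close> vanish.\<close>

lemma (in unital_algebra) evJ_iff_ysys:
  fixes R :: "('d::finite, 'k) realization"
  assumes R: "fm_realization s R" and l: "l \<ge> 1" and v: "v \<in> carrier_mat (s * l) (s * l)"
  shows "evJ sc s Y R l X v \<longleftrightarrow> evx s 1 l Y X (ysys s R) (per s s 1 l v)"
proof -
  have rs: "real_shift s R 1" using R by (simp add: real_shift_def real_shift_axioms_def fm_real_def)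
  interpret real_shift s R 1 Y Y by fact
  interpret pe: pencil_eval "kap sc" "\<lambda>j. lft (xi sc s 1 l Y X j)" "Jx s 1" by (rule pencil_eval_lft)
  have w0: "wtx s Y Y i 0 0 = 0" for i by (cases i) (simp add: wtx_def)
  have [simp]: "scl 0 = (0 :: (nat \<times> nat, 'k) rcf)" by (rule rcf_eqI) (simp add: ent_scl)
  have z: "recentring.Aw (coef s (mapA R)) (Ix s) 1 (wtx s Y Y) = 0" "recentring.Bw (coef s (mapB R)) (Ix s) 1 (wtx s Y Y) = 0"
    unfolding Aw_eq Bw_eq by (auto simp: Jx_def w0 intro!: sum.neutral)
  have one: "lft (idm {..<1}) = (lft (unt 1 0 0) :: (nat \<times> nat, 'k) rcf)"
    by (rule arg_cong[where f = lft]) (auto intro!: rcf_eqI simp: ent_idm ent_unt)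
  have A: "linx s 1 l Y X rc.a1 = linx s 1 l Y X (sysA (ysys s R))"
    unfolding a1_eq by (rule pe.lin_cong) (auto simp: ysys_def fz_eq Jx_def coef_def)
  have B: "linx s 1 l Y X rc.b1 = linx s 1 l Y X (sysB (ysys s R))"
    unfolding b1_eq by (rule pe.lin_cong) (auto simp: ysys_def fz_eq Jx_def coef_def)
  have C: "recentring.C1 (fr0 (matC R)) 1 = sysC (ysys s R)" "recentring.D1 (fr0 (matD R)) 1 = sysD (ysys s R)"
    unfolding rc.C1_def rc.D1_def one by (simp_all add: ysys_def fz_eq)
  show ?thesis
    using evJ_iff_unit[OF rs l, of v Y X Y] v
    unfolding evx_def pe.ev_def z C A B pe.K_zero by simp
qed

section \<open>The common realization\<close>

text \<open>Compression to the second index 0. It is multiplicative as soon as one factor comes from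
  \<open>kap\<close>, which is enough to pull an inverse of \<open>kap\<close> of a matrix back to
  the matrix.\<close>

definition slice :: "('i \<times> nat, 'k::{ring,monoid_mult}) rcf \<Rightarrow> ('i, 'k) rcf" where
  "slice V = Mk (\<lambda>u v. ent V (u, 0) (v, 0))"

lemma ent_slice: "ent (slice V) u v = ent V (u, 0) (v, 0)"
proof -
  have "finite ((\<lambda>v. (v, 0::nat)) -` {b. ent V (u, 0) b \<noteq> 0})" "finite ((\<lambda>u. (u, 0::nat)) -` {a. ent V a (v, 0) \<noteq> 0})" for u v
    by (intro finite_vimageI finite_row finite_col; simp add: inj_on_def)+
  then show ?thesis unfolding slice_def by (subst ent_Mk) (simp_all add: vimage_def)
qed

lemma slice_times_kap:
  fixes V :: "('i \<times> nat, 'k::field) rcf"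
  shows "slice (V * kap (*) M) = slice V * M" "slice (kap (*) M * V) = M * slice V"
proof -
  show "slice (V * kap (*) M) = slice V * M"
  proof (rule rcf_eqI)
    fix u v
    have "ent (V * kap (*) M) (u, 0) (v, 0) = (\<Sum>j\<in>{w. ent M w v \<noteq> 0} \<times> {0}. ent V (u, 0) j * ent (kap (*) M) j (v, 0))"
      using finite_col[of M v] by (intro ent_times) (auto simp: fld.ent_kap split: if_splits)
    also have "\<dots> = (\<Sum>w\<in>{w. ent M w v \<noteq> 0}. ent V (u, 0) (w, 0) * ent (kap (*) M) (w, 0) (v, 0))"
      by (rule sum.reindex_cong[of "\<lambda>w. (w, 0)"]) (auto simp: inj_on_def)
    also have "\<dots> = ent (slice V * M) u v"
      by (subst ent_times_col) (simp add: ent_slice fld.ent_kap)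
    finally show "ent (slice (V * kap (*) M)) u v = ent (slice V * M) u v" by (simp add: ent_slice)
  qed
  show "slice (kap (*) M * V) = M * slice V"
  proof (rule rcf_eqI)
    fix u v
    have "ent (kap (*) M * V) (u, 0) (v, 0) = (\<Sum>j\<in>{w. ent M u w \<noteq> 0} \<times> {0}. ent (kap (*) M) (u, 0) j * ent V j (v, 0))"
      using finite_row[of M u] by (intro ent_times) (auto simp: fld.ent_kap split: if_splits)
    also have "\<dots> = (\<Sum>w\<in>{w. ent M u w \<noteq> 0}. ent (kap (*) M) (u, 0) (w, 0) * ent V (w, 0) (v, 0))"
      by (rule sum.reindex_cong[of "\<lambda>w. (w, 0)"]) (auto simp: inj_on_def)
    also have "\<dots> = ent (M * slice V) u v"
      by (subst ent_times_row) (simp add: ent_slice fld.ent_kap)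
    finally show "ent (slice (kap (*) M * V)) u v = ent (M * slice V) u v" by (simp add: ent_slice)
  qed
qed

lemma slice_one: "slice (1 :: ('i \<times> nat, 'k::field) rcf) = 1"
  by (rule rcf_eqI) (simp add: ent_slice ent_one)

text \<open>At \<open>X = W\<close> all coordinates relative to \<open>W\<close> vanish and the
  pencil is \<open>kap\<close> of \<open>1 - Aw\<close>; \<open>slice\<close> turns its inverse into
  one of \<open>1 - Aw\<close>.\<close>

lemma inverse_at_centre:
  fixes R :: "('d::finite, 'k::field) realization"
  assumes rs: "real_shift s R m" and v: "v \<in> carrier_mat (s * m) (s * m)" and ev: "evJ (*) s Y R m W v"
  obtains Q where "Q * (1 - recentring.Aw (coef s (mapA R)) (Ix s) m (wtx s W Y)) = 1"
    "(1 - recentring.Aw (coef s (mapA R)) (Ix s) m (wtx s W Y)) * Q = 1"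
proof -
  interpret real_shift s R m Y W by fact
  let ?P = "1 - rc.Aw"
  have z: "fld.linx s m 1 W W A = 0" for A :: "'d idx \<Rightarrow> (nat \<times> nat, 'k) rcf"
  proof (rule rcf_eqI)
    fix a b :: "(nat \<times> nat) \<times> nat"
    show "ent (fld.linx s m 1 W W A) a b = ent 0 a b"
      by (cases a; cases b) (simp only: fld.ent_linx xi_centre, simp)
  qed
  have "evJ (*) s Y R (m * 1) W v" "v \<in> carrier_mat (s * (m * 1)) (s * (m * 1))" using ev v by simp_all
  from this(1)[unfolded fld.evJ_iff_unit[OF rs le_refl this(2), of Y W W] z]
  obtain U where U: "U * (1 - kap (*) rc.Aw) = 1" "(1 - kap (*) rc.Aw) * U = 1" by auto
  have k: "1 - kap (*) rc.Aw = kap (*) ?P"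
  proof (rule rcf_eqI)
    fix a b :: "(nat \<times> nat) \<times> nat"
    show "ent (1 - kap (*) rc.Aw) a b = ent (kap (*) ?P) a b"
      by (cases a; cases b) (simp add: fld.ent_kap ent_one)
  qed
  have "slice U * ?P = 1" "?P * slice U = 1"
    using arg_cong[OF U(1), of slice] arg_cong[OF U(2), of slice] unfolding k slice_times_kap slice_one by auto
  then show ?thesis by (rule that)
qed

context real_shift
begin

lemma ysys_base: "sysA (ysys s R) j = sysA rc.base (fst j)" "sysB (ysys s R) j = sysB rc.base (fst j)"
  "sysC (ysys s R) = sysC rc.base"
  unfolding rc.base_def rc.T_def by (simp_all add: ysys_def coef_def fz_eq case_prod_beta)

lemma Ix_Jx: "i \<in> Ix s \<Longrightarrow> (i, 0, 0) \<in> Jx s (Suc 0)" "j \<in> Jx s (Suc 0) \<Longrightarrow> fst j \<in> Ix s"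
  by (auto simp: Ix_def Jx_def)

lemma wprod_ysys: "wprod (sysA (ysys s R)) w = wprod (sysA rc.base) (map fst w)"
  by (induct w) (simp_all add: ysys_base(1))

lemma contr_base:
  assumes "contr (Jx s (Suc 0)) S (ysys s R)" shows "contr (Ix s) S rc.base"
  unfolding contr_def
proof (intro allI impI)
  fix Z assume Z: "\<forall>w\<in>lists (Ix s). \<forall>i\<in>Ix s. Z * wprod (sysA rc.base) w * sysB rc.base i = 0"
  have "Z * wprod (sysA (ysys s R)) w * sysB (ysys s R) j = 0" if w: "w \<in> lists (Jx s (Suc 0))" and j: "j \<in> Jx s (Suc 0)" for w j
  proof -
    have "map fst w \<in> lists (Ix s)" using w Ix_Jx(2) by (induct w) auto
    then show ?thesis using Z Ix_Jx(2)[OF j] unfolding wprod_ysys ysys_base by blast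
  qed
  then show "Z * idm S = 0" using assms unfolding contr_def by blast
qed

lemma obsv_base:
  assumes "obsv (Jx s (Suc 0)) S (ysys s R)" shows "obsv (Ix s) S rc.base"
  unfolding obsv_def
proof (intro allI impI)
  fix Z assume Z: "\<forall>w\<in>lists (Ix s). sysC rc.base * wprod (sysA rc.base) w * Z = 0"
  have "sysC (ysys s R) * wprod (sysA (ysys s R)) w * Z = 0" if w: "w \<in> lists (Jx s (Suc 0))" for w
  proof -
    have "map fst w \<in> lists (Ix s)" using w Ix_Jx(2) by (induct w) auto
    then show ?thesis using Z unfolding wprod_ysys ysys_base by blast
  qed
  then show "idm S * Z = 0" using assms unfolding obsv_def by blast
qed

end

section \<open>Periodic matrices of inflated points\<close>

lemma kron_one_blocks:
  fixes X :: "'a::{ring,monoid_mult} mat"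
  assumes X: "X \<in> carrier_mat (s * n) (s * n)" and i: "i < s" "i' < s" and n: "n \<ge> 1" and m: "m \<ge> 1"
    and c: "c div (m * n) = c' div (m * n)"
  shows "kron (1\<^sub>m m) X $$ ((c mod (m * n)) * s + i, (c' mod (m * n)) * s + i') =
    (if c div n = c' div n then X $$ ((c mod n) * s + i, (c' mod n) * s + i') else 0)"
proof -
  have bd: "(c mod (m * n)) * s + i < m * (s * n)" if "i < s" for c i
  proof -
    have "(c mod (m * n)) * s + i < Suc (c mod (m * n)) * s" using that by simp
    also have "\<dots> \<le> (m * n) * s" using m n by (intro mult_le_mono1) (simp add: Suc_leI)
    finally show ?thesis by (simp add: ac_simps)
  qed
  have d: "((c mod (m * n)) * s + i) div (s * n) = (c div n) mod m" if "i < s" for c i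
    using that n by (simp add: div_mult2_eq mult.commute[of m n] mod_mult2_eq)
  have md: "((c mod (m * n)) * s + i) mod (s * n) = (c mod n) * s + i" if "i < s" for c i
  proof -
    have "((c mod (m * n)) * s + i) div s = c mod (m * n)" "((c mod (m * n)) * s + i) mod s = i" using that by simp_all
    then have "((c mod (m * n)) * s + i) mod (s * n) = s * (c mod (m * n) mod n) + i" by (simp only: mod_mult2_eq)
    then show ?thesis by (simp add: mod_mod_cancel mult.commute)
  qed
  have "c div n div m = c' div n div m" using c by (simp add: div_mult2_eq mult.commute[of m n])
  from same_block_eq[OF this] show ?thesis
    using index_kron_one[OF X bd[OF i(1)] bd[OF i(2)], of c c'] i by (simp add: d md)
qed

context unital_algebra
begin

text \<open>I_m \<otimes> X read with period \<open>m n\<close> and \<open>X\<close> read with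
  period \<open>n\<close> describe one periodic matrix.\<close>

lemma xi_kron:
  fixes X :: "'d \<Rightarrow> 'a mat"
  assumes X: "\<And>k. X k \<in> carrier_mat (s * n) (s * n)" and n: "n \<ge> 1" and m: "m \<ge> 1" and j: "j \<in> Jx s 1"
  shows "xi sc s 1 (m * n) Y (\<lambda>k. kron (1\<^sub>m m) (X k)) j = xi sc s 1 n Y X j"
proof (rule rcf_eqI)
  fix c c' :: nat
  have mn: "m * n \<ge> 1" using m n by simp
  obtain k i i' where j: "j = ((k, i, i'), 0, 0)" "i < s" "i' < s" using j by (auto simp: Jx_def)
  have e: "c div (m * n) = c' div (m * n)" if "c div n = c' div n" using that by (simp add: div_mult2_eq mult.commute[of m n])
  show "ent (xi sc s 1 (m * n) Y (\<lambda>k. kron (1\<^sub>m m) (X k)) j) c c' = ent (xi sc s 1 n Y X j) c c'"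
    unfolding j(1) ent_xi[OF mn] ent_xi[OF n] using kron_one_blocks[OF X j(2,3) n m] e by (auto simp: lix_def)
qed

lemma per_kron:
  fixes M :: "'a mat"
  assumes M: "M \<in> carrier_mat (s * n) (s * n)" and n: "n \<ge> 1" and m: "m \<ge> 1"
  shows "per s s 1 (m * n) (kron (1\<^sub>m m) M) = per s s 1 n M"
proof (rule rcf_eqI)
  fix a b :: "(nat \<times> nat) \<times> nat"
  have mn: "m * n \<ge> 1" using m n by simp
  obtain i p c i' p' c' where ab: "a = ((i, p), c)" "b = ((i', p'), c')" by (metis surj_pair)
  have e: "c div (m * n) = c' div (m * n)" if "c div n = c' div n" using that by (simp add: div_mult2_eq mult.commute[of m n])
  show "ent (per s s 1 (m * n) (kron (1\<^sub>m m) M)) a b = ent (per s s 1 n M) a b"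
    unfolding ab ent_per[OF mn] ent_per[OF n] using kron_one_blocks[OF M _ _ n m, of i i' c c'] e by (auto simp: lix_def)
qed

lemma evx_kron:
  fixes X :: "'d::finite \<Rightarrow> 'a mat"
  assumes X: "\<And>k. X k \<in> carrier_mat (s * n) (s * n)" and n: "n \<ge> 1" and m: "m \<ge> 1"
  shows "evx s 1 (m * n) Y (\<lambda>k. kron (1\<^sub>m m) (X k)) \<Sigma> v \<longleftrightarrow> evx s 1 n Y X \<Sigma> v"
proof -
  interpret p1: pencil_eval "kap sc :: (nat \<times> nat, 'k) rcf \<Rightarrow> _" "\<lambda>j. lft (xi sc s 1 (m * n) Y (\<lambda>k. kron (1\<^sub>m m) (X k)) j)" "Jx s 1" by (rule pencil_eval_lft)
  interpret p2: pencil_eval "kap sc :: (nat \<times> nat, 'k) rcf \<Rightarrow> _" "\<lambda>j. lft (xi sc s 1 n Y X j)" "Jx s 1" by (rule pencil_eval_lft)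
  have "p1.lin A = p2.lin A" for A
    unfolding p1.lin_def p2.lin_def using xi_kron[where X = X and m = m, OF X n m] by (intro sum.cong) simp_all
  then show ?thesis unfolding evx_def p1.ev_def p2.ev_def by simp
qed

end

lemma nc_val_mat_closed:
  fixes sc :: "'k::field \<Rightarrow> 'a::{ring,monoid_mult} \<Rightarrow> 'a"
  assumes "X \<in> nc_dom (mat_alg sc n) E" shows "nc_val (mat_alg sc n) E X \<in> carrier_mat n n"
  using nc_val_closed[OF ring_mat_alg _ assms] by simp

lemma nc_dom_mat_carrier:
  assumes "X \<in> nc_dom (mat_alg sc n) E" shows "X k \<in> carrier_mat n n"
  using nc_dom_carrier[OF assms] by simp

text \<open>\<open>matches s Y \<R> S\<close>: the moments of \<open>\<R>\<close> are those of a (not necessarily minimal) system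
  synthesised from the expression \<open>S\<close> at the centre \<open>Y\<close>.\<close>

definition matches :: "nat \<Rightarrow> ('d::finite \<Rightarrow> 'k::field mat) \<Rightarrow> ('d, 'k) realization \<Rightarrow> ('d, 'k) nc_expr \<Rightarrow> bool" where
  "matches s Y R S \<longleftrightarrow> fm_realization s R \<and> contr (Jx s 1) (box (fm_dim R) 1) (ysys s R) \<and>
     obsv (Jx s 1) (box (fm_dim R) 1) (ysys s R) \<and>
     (\<exists>\<Sigma>. sysok s 1 \<Sigma> \<and> moments_eq (Jx s 1) (ysys s R) \<Sigma> \<and>
       fld.models s 1 Y (\<lambda>l. nc_dom (mat_alg (*) (s * (1 * l))) S) (\<lambda>l. nc_val (mat_alg (*) (s * (1 * l))) S) \<Sigma>)"

text \<open>\<open>S\<close> is defined at \<open>Y\<close>, so its values are compared without a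
  change of centre. In particular a point of its domain lies in the domain of the realization, which
  makes it available as a new centre.\<close>

lemma matches_field:
  fixes R :: "('d::finite, 'k::field) realization"
  assumes M: "matches s Y R S" and k: "k \<ge> 1" and X: "X \<in> nc_dom (mat_alg (*) (s * k)) S"
  shows "evJ (*) s Y R k X (nc_val (mat_alg (*) (s * k)) S X)"
proof -
  obtain \<Sigma> where S: "sysok s 1 \<Sigma>" "moments_eq (Jx s 1) (ysys s R) \<Sigma>"
    "fld.models s 1 Y (\<lambda>l. nc_dom (mat_alg (*) (s * (1 * l))) S) (\<lambda>l. nc_val (mat_alg (*) (s * (1 * l))) S) \<Sigma>"
    and R: "fm_realization s R" and con: "contr (Jx s 1) (box (fm_dim R) 1) (ysys s R)"
    and obs: "obsv (Jx s 1) (box (fm_dim R) 1) (ysys s R)" using M unfolding matches_def by blast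
  interpret fm_real s R using R by (simp add: fm_real_def)
  have "fld.evx s 1 k Y X \<Sigma> (per s s 1 k (nc_val (mat_alg (*) (s * k)) S X))"
    using S(3) k X unfolding fld.models_def by simp
  then have "fld.evx s 1 k Y X (ysys s R) (per s s 1 k (nc_val (mat_alg (*) (s * k)) S X))"
    by (rule fld.transfer_point[OF stably_finite_field k S(1) _ S(2) con obs, rotated])
      (use supp_ysys in simp)
  then show ?thesis
    by (subst fld.evJ_iff_ysys[OF R k nc_val_mat_closed[OF X]])
qed

lemma (in unital_algebra) matches_algebra:
  fixes R :: "('d::finite, 'k) realization" and X :: "'d \<Rightarrow> 'a mat"
  assumes sf: "stably_finite TYPE('a)" and s: "s \<ge> 1"
    and M: "matches s Y R S" and nd: "nondegenerate S" "nondegenerate R0" "nondegenerate E"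
    and eqS: "\<And>n X. n \<ge> 1 \<Longrightarrow> X \<in> nc_dom (mat_alg (*) n) R0 \<Longrightarrow> X \<in> nc_dom (mat_alg (*) n) S \<Longrightarrow>
      nc_val (mat_alg (*) n) R0 X = nc_val (mat_alg (*) n) S X"
    and eqE: "\<And>n X. n \<ge> 1 \<Longrightarrow> X \<in> nc_dom (mat_alg (*) n) R0 \<Longrightarrow> X \<in> nc_dom (mat_alg (*) n) E \<Longrightarrow>
      nc_val (mat_alg (*) n) R0 X = nc_val (mat_alg (*) n) E X"
    and k: "k \<ge> 1" and X: "X \<in> nc_dom (mat_alg sc (s * k)) E"
  shows "evJ sc s Y R k X (nc_val (mat_alg sc (s * k)) E X)"
proof -
  \<comment> \<open>The domain of the sum is the intersection; \<open>R0\<close> is present so that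
    \<open>eqS\<close> and \<open>eqE\<close> link the values of \<open>S\<close> and
    \<open>E\<close>.\<close>
  let ?E = "Plus (Plus R0 S) E"
  have R: "fm_realization s R" and con: "contr (Jx s (Suc 0)) (box (fm_dim R) (Suc 0)) (ysys s R)"
    and obs: "obsv (Jx s (Suc 0)) (box (fm_dim R) (Suc 0)) (ysys s R)" using M unfolding matches_def by auto
  have "nondegenerate ?E" by (intro nondegenerate_Plus nd)
  then obtain m W0 where m: "m \<ge> 1" and W0: "W0 \<in> nc_dom (mat_alg (*) m) ?E" unfolding nondegenerate_def by blast
  \<comment> \<open>Inflation to a multiple of \<open>s\<close>, as a realization centred at
    \<open>Y\<close> is evaluated at such sizes.\<close>
  define W where "W = (\<lambda>k. kron (1\<^sub>m s) (W0 k))"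
  have W: "W \<in> nc_dom (mat_alg (*) (s * m)) ?E" unfolding W_def using nc_hom_val[OF fld.nc_hom_kron W0] by blast
  have rs: "real_shift s R m" using R m by (simp add: real_shift_def real_shift_axioms_def fm_real_def)
  interpret real_shift s R m Y W by fact
  have WS: "W \<in> nc_dom (mat_alg (*) (s * m)) S" and WE: "W \<in> nc_dom (mat_alg (*) (s * m)) E" using W by auto
  obtain Q where Q: "Q * (1 - rc.Aw) = 1" "(1 - rc.Aw) * Q = 1"
    by (rule inverse_at_centre[OF rs nc_val_mat_closed[OF WS] matches_field[OF M m WS]])
  interpret ri: recentring_inverse "coef s (mapA R)" "coef s (mapB R)" "fr0 (matC R)" "fr0 (matD R)" "Ix s" "fm_dim R" m
    "wtx s W Y" Q by unfold_locales (fact Q)+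
  obtain \<Sigma> where ok: "sysok s m \<Sigma>"
    and modk: "fld.models s m W (\<lambda>l. nc_dom (mat_alg (*) (s * (m * l))) E) (\<lambda>l. nc_val (mat_alg (*) (s * (m * l))) E) \<Sigma>"
    and moda: "models s m W (\<lambda>l. nc_dom (mat_alg sc (s * (m * l))) E) (\<lambda>l. nc_val (mat_alg sc (s * (m * l))) E) \<Sigma>"
    using synthesis[OF WE] unfolding modelled_def by blast
  \<comment> \<open>Where all three expressions are defined, both systems take the common value of
    \<open>S\<close> and \<open>E\<close>: the first as a translate of the realization, the second
    by synthesis.\<close>
  have mom: "moments_eq (Jx s m) (rc.shifted Q) \<Sigma>"
  proof (rule moments_at[OF s m W])
    fix l and X' :: "'d \<Rightarrow> 'k mat" assume l: "l \<ge> 1" and X': "X' \<in> nc_dom (mat_alg (*) (s * (m * l))) ?E"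
    have ml: "m * l \<ge> 1" "s * (m * l) \<ge> 1" using m l s by simp_all
    have XS: "X' \<in> nc_dom (mat_alg (*) (s * (m * l))) S" and XE: "X' \<in> nc_dom (mat_alg (*) (s * (m * l))) E"
      and X0: "X' \<in> nc_dom (mat_alg (*) (s * (m * l))) R0" using X' by auto
    let ?v = "nc_val (mat_alg (*) (s * (m * l))) S X'"
    have "fld.evx s m l W X' (rc.shifted Q) (per s s m l ?v)"
      using matches_field[OF M ml(1) XS] fld.evJ_iff_shifted[OF rs l nc_val_mat_closed[OF XS] Q] by blast
    moreover have "?v = nc_val (mat_alg (*) (s * (m * l))) E X'"
      using eqS[OF ml(2) X0 XS] eqE[OF ml(2) X0 XE] by simp
    then have "fld.evx s m l W X' \<Sigma> (per s s m l ?v)" using modk l XE unfolding fld.models_def by simp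
    ultimately show "\<exists>v. fld.evx s m l W X' (rc.shifted Q) v \<and> fld.evx s m l W X' \<Sigma> v" by blast
  qed
  \<comment> \<open>A system centred at \<open>W\<close> accepts points of size
    \<open>s m l\<close>; so \<open>X\<close> is inflated by I_m for the comparison, and
    \<open>per_kron\<close> and \<open>evx_kron\<close> undo this at the end.\<close>
  let ?X = "\<lambda>k. kron (1\<^sub>m m) (X k)" and ?v = "nc_val (mat_alg sc (s * k)) E X"
  have size: "m * (s * k) = s * (m * k)" by simp
  have X2: "?X \<in> nc_dom (mat_alg sc (s * (m * k))) E" "nc_val (mat_alg sc (s * (m * k))) E ?X = kron (1\<^sub>m m) ?v"
    using nc_hom_val[OF nc_hom_kron[of "s * k" m] X] unfolding size by auto
  have mk: "m * k \<ge> 1" using m k by simp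
  have v: "?v \<in> carrier_mat (s * k) (s * k)" by (rule nc_val_mat_closed[OF X])
  have v2: "kron (1\<^sub>m m) ?v \<in> carrier_mat (s * (m * k)) (s * (m * k))" using nc_val_mat_closed[OF X2(1)] X2(2) by simp
  have "evx s m k W ?X \<Sigma> (per s s m k (kron (1\<^sub>m m) ?v))" using moda[unfolded models_def, rule_format, OF k X2(1)] X2(2) by simp
  then have "evx s m k W ?X (rc.shifted Q) (per s s m k (kron (1\<^sub>m m) ?v))"
    using transfer_point[OF sf k ok ri.supp_shifted[unfolded J_Ix] mom ri.contr_shifted[unfolded J_Ix, OF contr_base[OF con]]
      ri.obsv_shifted[unfolded J_Ix, OF obsv_base[OF obs]]] by blast
  then have "evJ sc s Y R (m * k) ?X (kron (1\<^sub>m m) ?v)"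
    using evJ_iff_shifted[OF rs k v2 Q] by blast
  then have "evx s 1 (m * k) Y ?X (ysys s R) (per s s 1 (m * k) (kron (1\<^sub>m m) ?v))"
    using evJ_iff_ysys[OF R mk v2] by blast
  then have "evx s 1 k Y X (ysys s R) (per s s 1 k ?v)"
    unfolding per_kron[OF v k m] evx_kron[OF nc_dom_mat_carrier[OF X] k m] .
  then show ?thesis using evJ_iff_ysys[OF R k v] by blast
qed

section \<open>Minimal realizations of a function\<close>

lemma (in unital_algebra) evJ_unique:
  assumes ev: "evJ sc s Y R k X v" "evJ sc s Y R k X v'"
  shows "v = v'"
proof -
  let ?n = "fm_dim R * k" let ?P = "1\<^sub>m ?n - jl sc s (fm_dim R) (fm_dim R) (mapA R) k Y X"
  have P: "?P \<in> carrier_mat ?n ?n" by (rule minus_carrier_mat) simp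
  obtain Q Q' where Q: "Q \<in> carrier_mat ?n ?n" "Q * ?P = 1\<^sub>m ?n" "Q' \<in> carrier_mat ?n ?n" "?P * Q' = 1\<^sub>m ?n"
    and v: "v = jk sc k (matD R) + jk sc k (matC R) * Q * jl sc s (fm_dim R) s (mapB R) k Y X"
    "v' = jk sc k (matD R) + jk sc k (matC R) * Q' * jl sc s (fm_dim R) s (mapB R) k Y X"
    using ev unfolding evJ_def Let_def by blast
  have "Q = Q * (?P * Q')" using Q mult_one_mat by metis
  also have "\<dots> = Q'" using Q one_mat_mult assoc_mult_mat[OF Q(1) P Q(3)] by metis
  finally show ?thesis using v by simp
qed

lemma kron_one_inject:
  fixes M N :: "'a::{ring,monoid_mult} mat"
  assumes s: "s \<ge> 1" and M: "M \<in> carrier_mat n n" and N: "N \<in> carrier_mat n n" and eq: "kron (1\<^sub>m s) M = kron (1\<^sub>m s) N"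
  shows "M = N"
proof (rule eq_matI)
  fix i j assume "i < dim_row N" "j < dim_col N"
  then have ij: "i < n" "j < n" using N by auto
  have "n \<le> s * n" using s by simp
  then have b: "i < s * n" "j < s * n" using ij by linarith+
  show "M $$ (i, j) = N $$ (i, j)"
    using arg_cong[OF eq, of "\<lambda>K. K $$ (i, j)"] ij unfolding index_kron_one[OF M b] index_kron_one[OF N b] by simp
qed (use M N in auto)

lemma (in unital_algebra) tensor_elem_mult: "tensor_elem sc (1\<^sub>m s) a * tensor_elem sc (1\<^sub>m s) b = tensor_elem sc (1\<^sub>m s) (a * b)"
proof (rule eq_matI)
  fix i j assume "i < dim_row (tensor_elem sc (1\<^sub>m s) (a * b))" "j < dim_col (tensor_elem sc (1\<^sub>m s) (a * b))"
  then have ij: "i < s" "j < s" by (auto simp: tensor_elem_def)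
  then have "(tensor_elem sc (1\<^sub>m s) a * tensor_elem sc (1\<^sub>m s) b) $$ (i, j) =
      (\<Sum>k<s. (if i = k then a else 0) * (if k = j then b else 0))"
    by (simp add: tensor_elem_def scalar_prod_def atLeast0LessThan if_distrib[of "\<lambda>c. sc c _"] cong: if_cong)
  also have "\<dots> = (\<Sum>k<s. if k = i then (if k = j then a * b else 0) else 0)" by (intro sum.cong) auto
  also have "\<dots> = tensor_elem sc (1\<^sub>m s) (a * b) $$ (i, j)" using ij by (simp add: tensor_elem_def)
  finally show "(tensor_elem sc (1\<^sub>m s) a * tensor_elem sc (1\<^sub>m s) b) $$ (i, j) = tensor_elem sc (1\<^sub>m s) (a * b) $$ (i, j)" .
qed (auto simp: tensor_elem_def)

lemma (in unital_algebra) nc_hom_tensor: "nc_hom (type_alg sc) (mat_alg sc s) (tensor_elem sc (1\<^sub>m s))"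
  unfolding nc_hom_def Ring.ring_hom_def
  using ring_type_alg ring_mat_alg tensor_elem_mult
  by (auto simp: tensor_elem_def scale_right_distrib scale_left_commute intro!: eq_matI)

lemma (in unital_algebra) tensor_one_inject:
  assumes "s \<ge> 1" "tensor_elem sc (1\<^sub>m s) a = tensor_elem sc (1\<^sub>m s) b" shows "a = b"
  using arg_cong[OF assms(2), of "\<lambda>M. M $$ (0, 0)"] assms(1) by (simp add: tensor_elem_def)

lemma wprod_cong:
  assumes "\<And>i. i \<in> I \<Longrightarrow> A i = B i" "w \<in> lists I" shows "wprod A w = wprod B w"
  using assms(2) by induct (simp_all add: assms(1))

lemma system_cong:
  assumes "sysC \<Sigma> = sysC \<Sigma>'" "sysD \<Sigma> = sysD \<Sigma>'" "\<And>i. i \<in> I \<Longrightarrow> sysA \<Sigma> i = sysA \<Sigma>' i" "\<And>i. i \<in> I \<Longrightarrow> sysB \<Sigma> i = sysB \<Sigma>' i"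
  shows "contr I S \<Sigma> \<longleftrightarrow> contr I S \<Sigma>'" "obsv I S \<Sigma> \<longleftrightarrow> obsv I S \<Sigma>'" "moments_eq I \<Sigma> \<Sigma>'' \<longleftrightarrow> moments_eq I \<Sigma>' \<Sigma>''"
  using wprod_cong[of I "sysA \<Sigma>" "sysA \<Sigma>'", OF assms(3)]
  unfolding contr_def obsv_def moments_eq_def by (simp_all add: assms)

definition fm :: "nat \<Rightarrow> nat \<Rightarrow> (nat \<times> nat, 'k::field) rcf \<Rightarrow> 'k mat" where
  "fm p q M = mat p q (\<lambda>(a, b). ent M (a, 0) (b, 0))"

lemma fm_carrier [simp]: "fm p q M \<in> carrier_mat p q"
  by (simp add: fm_def)

lemma fz_fm:
  assumes "idm (box p (Suc 0)) * M = M" "M * idm (box q (Suc 0)) = M" shows "fz (fm p q M) = M"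
proof (rule rcf_eqI)
  fix u v :: "nat \<times> nat"
  have "ent M u v = ent (idm (box p (Suc 0)) * M * idm (box q (Suc 0))) u v" using assms by simp
  then show "ent (fz (fm p q M)) u v = ent M u v"
    by (cases u; cases v) (auto simp: ent_fz fm_def ent_idm_times ent_times_idm)
qed

text \<open>Arbitrary coefficients at the matrix units extend to linear mappings, so a system with
  the right supports comes from a realization.\<close>

lemma realization_of_system:
  fixes \<Sigma> :: "('d::finite, 'k::field) ksys"
  assumes sup: "supp (Jx s 1) (box L 1) \<Sigma>"
    and io: "idm (box s 1) * sysC \<Sigma> = sysC \<Sigma>" "\<And>j. j \<in> Jx s 1 \<Longrightarrow> sysB \<Sigma> j * idm (box s 1) = sysB \<Sigma> j"
      "idm (box s 1) * sysD \<Sigma> = sysD \<Sigma>" "sysD \<Sigma> * idm (box s 1) = sysD \<Sigma>"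
  obtains R :: "('d, 'k) realization" where "fm_realization s R" "fm_dim R = L"
    "sysC (ysys s R) = sysC \<Sigma>" "sysD (ysys s R) = sysD \<Sigma>"
    "\<And>j. j \<in> Jx s 1 \<Longrightarrow> sysA (ysys s R) j = sysA \<Sigma> j" "\<And>j. j \<in> Jx s 1 \<Longrightarrow> sysB (ysys s R) j = sysB \<Sigma> j"
proof -
  define lm where "lm p q A X = fm p q (\<Sum>i<s. \<Sum>j<s. A (i, j) * scl (X $$ (i, j)))"
    for p q and A :: "nat \<times> nat \<Rightarrow> (nat \<times> nat, 'k) rcf" and X
  have lm_eq: "lm p q A X = mat p q (\<lambda>(a, b). \<Sum>i<s. \<Sum>j<s. X $$ (i, j) * ent (A (i, j)) (a, 0) (b, 0))" for p q A X
    unfolding lm_def fm_def scl_commute ent_sum ent_scl_times ..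
  have lm: "linear_mat_map s p q (lm p q A)" for p q A
    unfolding linear_mat_map_def
  proof (intro conjI ballI allI)
    show "lm p q A X \<in> carrier_mat p q" for X by (simp add: lm_eq)
    fix X :: "'k mat" assume X: "X \<in> carrier_mat s s"
    show "lm p q A (X + X') = lm p q A X + lm p q A X'" if X': "X' \<in> carrier_mat s s" for X'
      using X X' by (intro eq_matI) (simp_all add: lm_eq distrib_right sum.distrib)
    show "lm p q A (c \<cdot>\<^sub>m X) = c \<cdot>\<^sub>m lm p q A X" for c
    proof (rule eq_matI)
      fix a b assume "a < dim_row (c \<cdot>\<^sub>m lm p q A X)" "b < dim_col (c \<cdot>\<^sub>m lm p q A X)"
      then have ab: "a < p" "b < q" by (auto simp: lm_eq)
      have "lm p q A (c \<cdot>\<^sub>m X) $$ (a, b) = (\<Sum>i<s. \<Sum>j<s. (c \<cdot>\<^sub>m X) $$ (i, j) * ent (A (i, j)) (a, 0) (b, 0))"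
        using ab unfolding lm_eq by simp
      also have "\<dots> = (\<Sum>i<s. \<Sum>j<s. c * (X $$ (i, j) * ent (A (i, j)) (a, 0) (b, 0)))"
      proof (intro sum.cong refl)
        fix i j assume "i \<in> {..<s}" "j \<in> {..<s}"
        then have "(c \<cdot>\<^sub>m X) $$ (i, j) = c * X $$ (i, j)" using X by simp
        then show "(c \<cdot>\<^sub>m X) $$ (i, j) * ent (A (i, j)) (a, 0) (b, 0) = c * (X $$ (i, j) * ent (A (i, j)) (a, 0) (b, 0))"
          by (simp only: mult.assoc)
      qed
      also have "\<dots> = c * (\<Sum>i<s. \<Sum>j<s. X $$ (i, j) * ent (A (i, j)) (a, 0) (b, 0))" by (simp only: sum_distrib_left)
      also have "\<dots> = (c \<cdot>\<^sub>m lm p q A X) $$ (a, b)" using ab unfolding lm_eq by simp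
      finally show "lm p q A (c \<cdot>\<^sub>m X) $$ (a, b) = (c \<cdot>\<^sub>m lm p q A X) $$ (a, b)" .
    qed (simp_all add: lm_eq)
  qed
  have lm_unit: "fz (lm p q A (unit_mat s i j)) = A (i, j)"
    if "i < s" "j < s" "idm (box p 1) * A (i, j) = A (i, j)" "A (i, j) * idm (box q 1) = A (i, j)" for p q A i j
  proof -
    have "(\<Sum>i'<s. \<Sum>j'<s. A (i', j') * scl (unit_mat s i j $$ (i', j'))) = (\<Sum>i'<s. \<Sum>j'<s. if j' = j then if i' = i then A (i, j) else 0 else 0)"
      by (intro sum.cong refl) (auto simp: unit_mat_def scl_commute intro!: rcf_eqI simp: ent_scl_times)
    also have "\<dots> = A (i, j)" using that(1,2) by simp
    finally show ?thesis unfolding lm_def using fz_fm[OF that(3,4)[unfolded One_nat_def]] by simp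
  qed
  let ?R = "\<lparr>fm_dim = L, matD = fm s s (sysD \<Sigma>), matC = fm s L (sysC \<Sigma>),
    mapA = \<lambda>k. lm L L (\<lambda>(i, j). sysA \<Sigma> ((k, i, j), 0, 0)), mapB = \<lambda>k. lm L s (\<lambda>(i, j). sysB \<Sigma> ((k, i, j), 0, 0))\<rparr>"
  have "fm_realization s ?R" unfolding fm_realization_def using lm by (simp add: fm_def)
  moreover have "sysC (ysys s ?R) = sysC \<Sigma>" "sysD (ysys s ?R) = sysD \<Sigma>"
    using sup io unfolding supp_def by (simp_all add: ysys_def fz_fm)
  moreover have "sysA (ysys s ?R) j = sysA \<Sigma> j \<and> sysB (ysys s ?R) j = sysB \<Sigma> j" if "j \<in> Jx s 1" for j
  proof -
    obtain k i i' where j: "j = ((k, i, i'), 0, 0)" "i < s" "i' < s" using \<open>j \<in> Jx s 1\<close> by (auto simp: Jx_def)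
    have "idm (box L 1) * sysA \<Sigma> j = sysA \<Sigma> j" "sysA \<Sigma> j * idm (box L 1) = sysA \<Sigma> j" "idm (box L 1) * sysB \<Sigma> j = sysB \<Sigma> j"
      using sup that unfolding supp_def by auto
    then show ?thesis using io(2)[OF that] lm_unit[OF j(2,3)] by (simp add: ysys_def j(1))
  qed
  ultimately show ?thesis by (intro that[of ?R]) auto
qed

text \<open>\<open>agree\<close> is the equivalence as available before transitivity: each
  expression of \<open>F\<close> is compared with the representative \<open>R0\<close>, at points
  where both are defined. \<open>S\<close> is an expression defined at the centre.\<close>

locale nc_function_at =
  fixes F :: "('d::finite, 'k::field) nc_expr set" and s :: nat and Y :: "'d \<Rightarrow> 'k mat" and R0 S :: "('d, 'k) nc_expr"
  assumes s: "s \<ge> 1" and nd0: "nondegenerate R0" and nd: "E \<in> F \<Longrightarrow> nondegenerate E"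
    and agree: "E \<in> F \<Longrightarrow> n \<ge> 1 \<Longrightarrow> X \<in> nc_dom (mat_alg (*) n) R0 \<Longrightarrow> X \<in> nc_dom (mat_alg (*) n) E \<Longrightarrow>
      nc_val (mat_alg (*) n) R0 X = nc_val (mat_alg (*) n) E X"
    and S: "S \<in> F" and Y: "Y \<in> nc_dom (mat_alg (*) s) S"
begin

lemma Y_carrier: "Y k \<in> carrier_mat s s"
  by (rule nc_dom_mat_carrier[OF Y])

definition \<Sigma> :: "('d, 'k) ksys" where
  "\<Sigma> = (SOME \<Sigma>. sysok s 1 \<Sigma> \<and>
     fld.models s 1 Y (\<lambda>l. nc_dom (mat_alg (*) (s * (1 * l))) S) (\<lambda>l. nc_val (mat_alg (*) (s * (1 * l))) S) \<Sigma>)"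

lemma \<Sigma>: "sysok s 1 \<Sigma>"
  "fld.models s 1 Y (\<lambda>l. nc_dom (mat_alg (*) (s * (1 * l))) S) (\<lambda>l. nc_val (mat_alg (*) (s * (1 * l))) S) \<Sigma>"
proof -
  have "Y \<in> nc_dom (mat_alg (*) (s * 1)) S" using Y by simp
  from someI_ex[OF fld.synthesis[OF this, unfolded fld.modelled_def]]
  show "sysok s 1 \<Sigma>"
    "fld.models s 1 Y (\<lambda>l. nc_dom (mat_alg (*) (s * (1 * l))) S) (\<lambda>l. nc_val (mat_alg (*) (s * (1 * l))) S) \<Sigma>"
    unfolding \<Sigma>_def by auto
qed

lemma \<Sigma>_matches:
  assumes "fm_realization s R" "contr (Jx s 1) (box (fm_dim R) 1) (ysys s R)" "obsv (Jx s 1) (box (fm_dim R) 1) (ysys s R)"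
    "moments_eq (Jx s 1) (ysys s R) \<Sigma>"
  shows "matches s Y R S"
  using assms \<Sigma> unfolding matches_def by blast

lemma value_algebra:
  fixes sc :: "'k \<Rightarrow> 'a::{ring,monoid_mult} \<Rightarrow> 'a" and X :: "'d \<Rightarrow> 'a mat"
  assumes "unital_algebra sc" "stably_finite TYPE('a)" "matches s Y R S" "E \<in> F" "k \<ge> 1" "X \<in> nc_dom (mat_alg sc (s * k)) E"
  shows "evJ sc s Y R k X (nc_val (mat_alg sc (s * k)) E X)"
proof -
  interpret unital_algebra sc by fact
  show ?thesis
    by (rule matches_algebra[OF assms(2) s assms(3) nd[OF S] nd0 nd[OF assms(4)] agree[OF S] agree[OF assms(4)] assms(5,6)])
qed

lemma matching_realization_exists:
  obtains R where "matches s Y R S"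
proof -
  obtain T where T: "finite T" "supp (Jx s 1) T \<Sigma>" by (rule sysok_supp[OF \<Sigma>(1)])
  have io: "idm (box s 1) * sysC \<Sigma> = sysC \<Sigma>" "\<And>j. j \<in> Jx s 1 \<Longrightarrow> sysB \<Sigma> j * idm (box s 1) = sysB \<Sigma> j"
      "idm (box s 1) * sysD \<Sigma> = sysD \<Sigma>" "sysD \<Sigma> * idm (box s 1) = sysD \<Sigma>"
    using \<Sigma>(1) unfolding sysok_def by auto
  have fin: "finite (box s 1)" by simp
  obtain L \<Sigma>' where m: "supp (Jx s 1) (box L (Suc 0)) \<Sigma>'" "moments_eq (Jx s 1) \<Sigma>' \<Sigma>"
    "contr (Jx s 1) (box L (Suc 0)) \<Sigma>'" "obsv (Jx s 1) (box L (Suc 0)) \<Sigma>'"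
    "idm (box s 1) * sysC \<Sigma>' = sysC \<Sigma>'" "\<And>j. j \<in> Jx s 1 \<Longrightarrow> sysB \<Sigma>' j * idm (box s 1) = sysB \<Sigma>' j"
    using minimal_system_exists[OF T fin io(1,2)] by blast
  have "sysD \<Sigma>' = sysD \<Sigma>" using m(2) by (simp add: moments_eq_def)
  then have D: "idm (box s 1) * sysD \<Sigma>' = sysD \<Sigma>'" "sysD \<Sigma>' * idm (box s 1) = sysD \<Sigma>'" using io by simp_all
  obtain R :: "('d, 'k) realization" where R: "fm_realization s R" "fm_dim R = L"
    "sysC (ysys s R) = sysC \<Sigma>'" "sysD (ysys s R) = sysD \<Sigma>'"
    "\<And>j. j \<in> Jx s 1 \<Longrightarrow> sysA (ysys s R) j = sysA \<Sigma>' j" "\<And>j. j \<in> Jx s 1 \<Longrightarrow> sysB (ysys s R) j = sysB \<Sigma>' j"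
    using realization_of_system[OF m(1)[folded One_nat_def] m(5,6) D] by blast
  note cong = system_cong[of "ysys s R" \<Sigma>' "Jx s 1", OF R(3-6)]
  have "matches s Y R S"
    by (rule \<Sigma>_matches[OF R(1)]) (use m cong R(2) in simp_all)
  then show ?thesis by (rule that)
qed

lemma fun_val_eqI:
  assumes "E \<in> F" "X \<in> nc_dom A E"
    and "\<And>E'. E' \<in> F \<Longrightarrow> X \<in> nc_dom A E' \<Longrightarrow> nc_val A E' X = nc_val A E X"
  shows "fun_val A F X = nc_val A E X"
  unfolding fun_val_def
proof (rule the_equality)
  show "\<exists>R\<in>F. X \<in> nc_dom A R \<and> nc_val A E X = nc_val A R X" using assms(1,2) by (intro bexI[of _ E]) simp_all
  fix v assume "\<exists>R\<in>F. X \<in> nc_dom A R \<and> v = nc_val A R X"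
  then show "v = nc_val A E X" using assms(3) by (elim bexE conjE) simp
qed

text \<open>Well-definedness at matrices: two expressions of \<open>F\<close> defined at
  \<open>X\<close> give, after inflation by I_s, the value of one and the same realization.\<close>

lemma fun_val_mat:
  assumes n: "n \<ge> 1" and E: "E \<in> F" and X: "X \<in> nc_dom (mat_alg (*) n) E"
  shows "fun_val (mat_alg (*) n) F X = nc_val (mat_alg (*) n) E X"
proof (rule fun_val_eqI[OF E X])
  fix E' assume E': "E' \<in> F" and X': "X \<in> nc_dom (mat_alg (*) n) E'"
  obtain R where R: "matches s Y R S" by (rule matching_realization_exists)
  note h = nc_hom_val[OF fld.nc_hom_kron[of n s] X] and h' = nc_hom_val[OF fld.nc_hom_kron[of n s] X']
  have "evJ (*) s Y R n (\<lambda>k. kron (1\<^sub>m s) (X k)) (kron (1\<^sub>m s) (nc_val (mat_alg (*) n) E X))"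
    "evJ (*) s Y R n (\<lambda>k. kron (1\<^sub>m s) (X k)) (kron (1\<^sub>m s) (nc_val (mat_alg (*) n) E' X))"
    using value_algebra[OF fld.unital_algebra_axioms stably_finite_field R E n, of "\<lambda>k. kron (1\<^sub>m s) (X k)"]
      value_algebra[OF fld.unital_algebra_axioms stably_finite_field R E' n, of "\<lambda>k. kron (1\<^sub>m s) (X k)"] h h' by simp_all
  from fld.evJ_unique[OF this]
  have "kron (1\<^sub>m s) (nc_val (mat_alg (*) n) E X) = kron (1\<^sub>m s) (nc_val (mat_alg (*) n) E' X)" .
  then show "nc_val (mat_alg (*) n) E' X = nc_val (mat_alg (*) n) E X"
    using kron_one_inject[OF s nc_val_mat_closed[OF X] nc_val_mat_closed[OF X']] by simp
qed

lemma value_type: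
  fixes sc :: "'k \<Rightarrow> 'a::{ring,monoid_mult} \<Rightarrow> 'a"
  assumes "unital_algebra sc" "stably_finite TYPE('a)" "matches s Y R S" "E \<in> F" "a \<in> nc_dom (type_alg sc) E"
  shows "evJ sc s Y R 1 (\<lambda>k. tensor_elem sc (1\<^sub>m s) (a k)) (tensor_elem sc (1\<^sub>m s) (nc_val (type_alg sc) E a))"
proof -
  interpret unital_algebra sc by fact
  note h = nc_hom_val[OF nc_hom_tensor[of s] assms(5)]
  show ?thesis using value_algebra[OF assms(1-4) le_refl, of "\<lambda>k. tensor_elem sc (1\<^sub>m s) (a k)"] h by simp
qed

lemma fun_val_type:
  fixes sc :: "'k \<Rightarrow> 'a::{ring,monoid_mult} \<Rightarrow> 'a"
  assumes sc: "unital_algebra sc" "stably_finite TYPE('a)" and E: "E \<in> F" and a: "a \<in> nc_dom (type_alg sc) E"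
  shows "fun_val (type_alg sc) F a = nc_val (type_alg sc) E a"
proof (rule fun_val_eqI[OF E a])
  interpret unital_algebra sc by fact
  fix E' assume E': "E' \<in> F" and a': "a \<in> nc_dom (type_alg sc) E'"
  obtain R where R: "matches s Y R S" by (rule matching_realization_exists)
  from evJ_unique[OF value_type[OF sc R E' a'] value_type[OF sc R E a]]
  show "nc_val (type_alg sc) E' a = nc_val (type_alg sc) E a" by (rule tensor_one_inject[OF s])
qed

lemma realizes_if_matches:
  assumes R: "matches s Y R S" shows "realizes s Y F R"
  unfolding realizes_def
proof (intro allI impI ballI)
  fix m and X :: "'d \<Rightarrow> 'k mat" assume m: "m \<ge> 1" and X: "X \<in> fun_dom (mat_alg (*) (s * m)) F"
  obtain E where E: "E \<in> F" "X \<in> nc_dom (mat_alg (*) (s * m)) E" using X unfolding fun_dom_def by blast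
  have sm: "s * m \<ge> 1" using s m by simp
  have fm: "fm_realization s R" using R by (simp add: matches_def)
  have "evJ (*) s Y R m X (nc_val (mat_alg (*) (s * m)) E X)"
    by (rule value_algebra[OF fld.unital_algebra_axioms stably_finite_field R E(1) m E(2)])
  then show "X \<in> real_dom s Y R m \<and> fun_val (mat_alg (*) (s * m)) F X = real_val s Y R m X"
    unfolding fun_val_mat[OF sm E] evJ_field[OF fm nc_dom_mat_carrier[OF E(2)] Y_carrier] .
qed

text \<open>Moments depend only on values near \<open>Y\<close>, so any realization of the function,
  minimal or not, has the moments of \<open>\<Sigma>\<close>.\<close>

lemma moments_if_realizes:
  assumes fm: "fm_realization s R" and R: "realizes s Y F R"
  shows "moments_eq (Jx s 1) (ysys s R) \<Sigma>"
proof (rule moments_at[OF s le_refl])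
  show "Y \<in> nc_dom (mat_alg (*) (s * 1)) S" using Y by simp
  fix l and X :: "'d \<Rightarrow> 'k mat" assume l: "l \<ge> 1" and X: "X \<in> nc_dom (mat_alg (*) (s * (1 * l))) S"
  then have X: "X \<in> nc_dom (mat_alg (*) (s * l)) S" by simp
  let ?v = "nc_val (mat_alg (*) (s * l)) S X"
  have sl: "s * l \<ge> 1" using s l by simp
  have "X \<in> fun_dom (mat_alg (*) (s * l)) F" using X S unfolding fun_dom_def by blast
  then have "X \<in> real_dom s Y R l \<and> ?v = real_val s Y R l X"
    using R l fun_val_mat[OF sl S X] unfolding realizes_def by simp
  then have "evJ (*) s Y R l X ?v"
    unfolding evJ_field[OF fm nc_dom_mat_carrier[OF X] Y_carrier] .
  then have "fld.evx s 1 l Y X (ysys s R) (per s s 1 l ?v)"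
    unfolding fld.evJ_iff_ysys[OF fm l nc_val_mat_closed[OF X]] .
  moreover have "fld.evx s 1 l Y X \<Sigma> (per s s 1 l ?v)"
    using \<Sigma>(2) l X unfolding fld.models_def by simp
  ultimately show "\<exists>v. fld.evx s 1 l Y X (ysys s R) v \<and> fld.evx s 1 l Y X \<Sigma> v" by blast
qed

lemma matches_if_minimal:
  assumes "minimal_realization s Y F R" shows "matches s Y R S"
proof -
  have fm: "fm_realization s R" and re: "realizes s Y F R" and co: "controllable s R" and ob: "observable s R"
    using assms unfolding minimal_realization_def by auto
  interpret fm_real s R using fm by (simp add: fm_real_def)
  show ?thesis
    using contr_if_controllable[OF co] obsv_if_observable[OF ob] moments_if_realizes[OF fm re]
    by (intro \<Sigma>_matches[OF fm]) simp_all
qed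

lemma moments_eq_realizations:
  assumes "fm_realization s R" "realizes s Y F R" "fm_realization s R'" "realizes s Y F R'"
  shows "moments_eq (Jx s (Suc 0)) (ysys s R) (ysys s R')"
  using moments_if_realizes[OF assms(1,2)] moments_if_realizes[OF assms(3,4)] unfolding moments_eq_def by simp

text \<open>A matching realization is a subquotient of every other realization \<open>R'\<close> of
  the function: its identity factors through a space of dimension \<open>r\<close>, and the identity
  of that space through the state space of \<open>R'\<close>.\<close>

lemma minimal_if_matches:
  assumes match: "matches s Y R S" shows "minimal_realization s Y F R"
proof -
  have fm: "fm_realization s R" and con: "contr (Jx s (Suc 0)) (box (fm_dim R) (Suc 0)) (ysys s R)"
    and obs: "obsv (Jx s (Suc 0)) (box (fm_dim R) (Suc 0)) (ysys s R)" using match unfolding matches_def by auto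
  interpret fm_real s R using fm by (simp add: fm_real_def)
  note re = realizes_if_matches[OF match]
  have "minimal_for s Y F R"
    unfolding minimal_for_def
  proof (intro allI impI)
    fix R' :: "('d, 'k) realization" assume "fm_realization s R' \<and> realizes s Y F R'"
    then have R': "fm_realization s R'" "realizes s Y F R'" by auto
    interpret R': fm_real s R' using R' by (simp add: fm_real_def)
    have fin: "finite (box (fm_dim R) (Suc 0))" "finite (box (fm_dim R') (Suc 0))" by simp_all
    obtain r and G Gp H Hp :: "(nat \<times> nat, 'k) rcf" where g: "Gp * G = idm (box r (Suc 0))" "idm (box (fm_dim R') (Suc 0)) * G = G"
      and h: "H * Hp = idm (box (fm_dim R) (Suc 0))" "idm (box r (Suc 0)) * Hp = Hp"
    proof (rule compare_systems[OF fin supp_ysys R'.supp_ysys moments_eq_realizations[OF fm re R'] con obs])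
      fix r and G Gp H Hp :: "(nat \<times> nat, 'k) rcf"
      assume "Gp * G = idm (box r (Suc 0))" "idm (box (fm_dim R') (Suc 0)) * G = G"
        "H * Hp = idm (box (fm_dim R) (Suc 0))" "idm (box r (Suc 0)) * Hp = Hp"
      then show thesis by (rule that)
    qed
    have finr: "finite (box r (Suc 0))" by simp
    from card_le_of_factor[OF fin(1) finr h] card_le_of_factor[OF finr fin(2) g]
    show "fm_dim R \<le> fm_dim R'" by simp
  qed
  then show ?thesis
    unfolding minimal_realization_def using fm re controllable_if_contr[OF con] observable_if_obsv[OF obs] by blast
qed

end

section \<open>Similarity of minimal realizations\<close>

lemma inverse_pair_fm:
  fixes T T' :: "(nat \<times> nat, 'k::field) rcf"
  assumes e: "e = idm (box L (Suc 0))" and T: "e * T = T" "T * e = T" "e * T' = T'" "T' * e = T'" "T * T' = e" "T' * T = e"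
  shows "fm L L T * fm L L T' = 1\<^sub>m L" "fm L L T' * fm L L T = 1\<^sub>m L"
proof -
  have "fz (fm L L T * fm L L T') = fz (1\<^sub>m L)" "fz (fm L L T' * fm L L T) = fz (1\<^sub>m L)"
    using T unfolding e by (simp_all add: fz_times[where a = L and b = L and c = L] fz_fm fz_one)
  then show "fm L L T * fm L L T' = 1\<^sub>m L" "fm L L T' * fm L L T = 1\<^sub>m L"
    using fz_inject[where a = L and b = L] mult_carrier_mat[OF fm_carrier fm_carrier] by (metis one_carrier_mat)+
qed

lemma similarity_fm:
  fixes R R' :: "('d::finite, 'k::field) realization"
  assumes R: "fm_realization s R" and R': "fm_realization s R'" and dim: "fm_dim R = L" "fm_dim R' = L"
    and e: "e = idm (box L (Suc 0))" and T: "e * T = T" "T * e = T" "e * T' = T'" "T' * e = T'" "T * T' = e" "T' * T = e"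
    and C: "sysC (ysys s R') = sysC (ysys s R) * T'"
    and B: "\<And>j. j \<in> Jx s (Suc 0) \<Longrightarrow> sysB (ysys s R') j = T * sysB (ysys s R) j"
    and A: "\<And>j. j \<in> Jx s (Suc 0) \<Longrightarrow> sysA (ysys s R') j = T * sysA (ysys s R) j * T'"
  shows "similarity s R R' (fm L L T)"
proof -
  interpret r: fm_real s R using R by (simp add: fm_real_def)
  interpret r': fm_real s R' using R' by (simp add: fm_real_def)
  note inv = inverse_pair_fm[OF e T]
  note cr = r.R_carrier[unfolded dim] and cr' = r'.R_carrier[unfolded dim]
  have fT: "fz (fm L L T) = T" "fz (fm L L T') = T'" using fz_fm T unfolding e by auto
  have invT: "inv\<^bsub>(mat_alg (*) L :: ('k, 'k mat) module)\<^esub> (fm L L T) = fm L L T'"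
    by (rule inv_mat_eq[OF fm_carrier fm_carrier inv(2,1)])
  have "fm L L T \<in> Units (mat_alg (*) L :: ('k, 'k mat) module)"
    unfolding Units_mat_iff using inv fm_carrier by blast
  moreover have "matC R' = matC R * fm L L T'"
    by (rule fz_inject[OF cr'(2) mult_carrier_mat[OF cr(2) fm_carrier]])
      (use C in \<open>simp add: fz_times[OF cr(2) fm_carrier] fT ysys_def\<close>)
  moreover have "mapB R' k X = fm L L T * mapB R k X" if X: "X \<in> carrier_mat s s" for k X
  proof (rule fz_inject[OF cr'(4)[OF X] mult_carrier_mat[OF fm_carrier cr(4)[OF X]]])
    have "fz (mapB R' k X) = (\<Sum>i<s. \<Sum>j<s. T * (sysB (ysys s R) ((k, i, j), 0, 0) * scl (X $$ (i, j))))"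
      unfolding r'.B_expand[OF X] using B r.J_intro by (intro sum.cong refl) (simp add: mult.assoc)
    also have "\<dots> = T * fz (mapB R k X)" unfolding r.B_expand[OF X] by (simp only: sum_distrib_left)
    finally show "fz (mapB R' k X) = fz (fm L L T * mapB R k X)" by (simp add: fz_times[OF fm_carrier cr(4)[OF X]] fT)
  qed
  moreover have "mapA R' k X = fm L L T * mapA R k X * fm L L T'" if X: "X \<in> carrier_mat s s" for k X
  proof (rule fz_inject[OF cr'(3)[OF X] mult_carrier_mat[OF mult_carrier_mat[OF fm_carrier cr(3)[OF X]] fm_carrier]])
    have "fz (mapA R' k X) = (\<Sum>i<s. \<Sum>j<s. T * (sysA (ysys s R) ((k, i, j), 0, 0) * scl (X $$ (i, j))) * T')"
      unfolding r'.A_expand[OF X] using A r.J_intro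
      by (intro sum.cong refl) (simp add: mult.assoc scl_commute scl_left_commute)
    also have "\<dots> = T * fz (mapA R k X) * T'" unfolding r.A_expand[OF X] by (simp only: sum_distrib_left sum_distrib_right)
    finally show "fz (mapA R' k X) = fz (fm L L T * mapA R k X * fm L L T')"
      by (simp add: fz_times[OF mult_carrier_mat[OF fm_carrier cr(3)[OF X]] fm_carrier] fz_times[OF fm_carrier cr(3)[OF X]] fT)
  qed
  ultimately show ?thesis unfolding similarity_def dim invT by blast
qed

text \<open>Two similarities agree on the reachable states, which span the state space.\<close>

lemma similarity_unique:
  fixes R R' :: "('d::finite, 'k::field) realization"
  assumes R: "fm_realization s R" and R': "fm_realization s R'" and dim: "fm_dim R' = fm_dim R"
    and con: "contr (Jx s (Suc 0)) (box (fm_dim R) (Suc 0)) (ysys s R)"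
    and sim: "similarity s R R' T1" "similarity s R R' T2"
  shows "T1 = T2"
proof -
  interpret r: fm_real s R using R by (simp add: fm_real_def)
  interpret r': fm_real s R' using R' by (simp add: fm_real_def)
  let ?L = "fm_dim R"
  have int: "fz T * wprod r.A w * r.B j = wprod r'.A w * r'.B j"
    if T: "similarity s R R' T" and w: "w \<in> lists r.J" and j: "j \<in> r.J" for T w j
  proof -
    obtain T' where T': "T' \<in> carrier_mat ?L ?L" "T' * T = 1\<^sub>m ?L" "T * T' = 1\<^sub>m ?L" and Tc: "T \<in> carrier_mat ?L ?L"
      using T unfolding similarity_def Units_mat_iff by blast
    have inv: "inv\<^bsub>(mat_alg (*) ?L :: ('k, 'k mat) module)\<^esub> T = T'" by (rule inv_mat_eq[OF Tc T'])
    have A: "r'.A j * fz T = fz T * r.A j" if j: "j \<in> r.J" for j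
    proof -
      obtain k i i' where j: "j = ((k, i, i'), 0, 0)" using r.J_cases[OF j] by blast
      let ?U = "unit_mat s i i'"
      note Ac = r.R_carrier(3)[OF unit_mat_carrier[of s i i'], of k]
      note Ac' = r'.R_carrier(3)[OF unit_mat_carrier[of s i i'], of k, unfolded dim]
      have "mapA R' k ?U = T * mapA R k ?U * T'" using T unfolding similarity_def inv by simp
      then have "mapA R' k ?U * T = T * mapA R k ?U * (T' * T)"
        using assoc_mult_mat[OF mult_carrier_mat[OF Tc Ac] T'(1) Tc] by simp
      then have "mapA R' k ?U * T = T * mapA R k ?U" using right_mult_one_mat[OF mult_carrier_mat[OF Tc Ac]] T'(2) by simp
      then show ?thesis using fz_times[OF Ac' Tc] fz_times[OF Tc Ac] by (simp add: j ysys_def)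
    qed
    obtain k i i' where jj: "j = ((k, i, i'), 0, 0)" using r.J_cases[OF j] by blast
    have "mapB R' k (unit_mat s i i') = T * mapB R k (unit_mat s i i')" using T unfolding similarity_def by simp
    then have B: "r'.B j = fz T * r.B j"
      using fz_times[OF Tc r.R_carrier(4)[OF unit_mat_carrier]] by (simp add: jj ysys_def)
    have "wprod r'.A w * fz T = fz T * wprod r.A w" by (rule wprod_intertwine[OF A w])
    then show ?thesis unfolding B by (simp add: mult.assoc[symmetric])
  qed
  have T: "T1 \<in> carrier_mat ?L ?L" "T2 \<in> carrier_mat ?L ?L"
    using sim unfolding similarity_def Units_mat_iff by auto
  have "\<forall>w\<in>lists r.J. \<forall>j\<in>r.J. (fz T1 - fz T2) * wprod r.A w * r.B j = 0"
    using int[OF sim(1)] int[OF sim(2)] by (simp add: left_diff_distrib)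
  then have "(fz T1 - fz T2) * idm (box ?L (Suc 0)) = 0" using con unfolding contr_def by blast
  then have "fz T1 = fz T2" using fz_supp(2)[OF T(1)] fz_supp(2)[OF T(2)] by (simp add: left_diff_distrib)
  then show ?thesis by (rule fz_inject[OF T])
qed

context nc_function_at
begin

text \<open>Equality of dimensions forces \<open>r = L\<close>. So the inclusion \<open>G\<close>
  and the projection \<open>H\<close> of the comparison are invertible, and \<open>G * Hp\<close> is
  the similarity.\<close>

lemma minimal_similar:
  assumes min: "minimal_realization s Y F R" and min': "minimal_realization s Y F R'"
  shows "fm_dim R' = fm_dim R \<and> matD R' = matD R \<and> (\<exists>!T. similarity s R R' T)"
proof -
  have fm: "fm_realization s R" and re: "realizes s Y F R" and fm': "fm_realization s R'" and re': "realizes s Y F R'"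
    using min min' unfolding minimal_realization_def by auto
  have dim: "fm_dim R' = fm_dim R"
    using min min' unfolding minimal_realization_def minimal_for_def by (meson antisym)
  interpret r: fm_real s R using fm by (simp add: fm_real_def)
  interpret r': fm_real s R' using fm' by (simp add: fm_real_def)
  have con: "contr (Jx s (Suc 0)) (box (fm_dim R) (Suc 0)) (ysys s R)"
    and obs: "obsv (Jx s (Suc 0)) (box (fm_dim R) (Suc 0)) (ysys s R)"
    using matches_if_minimal[OF min] unfolding matches_def by auto
  note mom = moments_eq_realizations[OF fm re fm' re']
  have "fz (matD R) = fz (matD R')" using mom unfolding moments_eq_def by (simp add: ysys_def)
  then have D: "matD R' = matD R" using fz_inject[OF r.R_carrier(1) r'.R_carrier(1)] by simp
  define L where "L = fm_dim R"
  define e where "e = (idm (box L (Suc 0)) :: (nat \<times> nat, 'k) rcf)"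
  have fin: "finite (box (fm_dim R) (Suc 0))" "finite (box (fm_dim R') (Suc 0))" by simp_all
  have "\<exists>T. similarity s R R' T"
  proof (rule compare_systems[OF fin r.supp_ysys r'.supp_ysys mom con obs])
    fix r and G Gp H Hp :: "(nat \<times> nat, 'k) rcf" and At Bt :: "'d idx \<Rightarrow> (nat \<times> nat, 'k) rcf"
    assume G: "G * idm (box r (Suc 0)) = G" "idm (box r (Suc 0)) * Gp = Gp" "Gp * G = idm (box r (Suc 0))"
        "idm (box (fm_dim R') (Suc 0)) * G = G"
      and A': "\<And>i. i \<in> Jx s (Suc 0) \<Longrightarrow> sysA (ysys s R') i * G = G * At i"
      and B': "\<And>i. i \<in> Jx s (Suc 0) \<Longrightarrow> sysB (ysys s R') i = G * Bt i"
      and eAt: "\<And>i. i \<in> Jx s (Suc 0) \<Longrightarrow> idm (box r (Suc 0)) * At i = At i"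
      and H: "H * idm (box r (Suc 0)) = H" "idm (box (fm_dim R) (Suc 0)) * H = H"
      and A: "\<And>i. i \<in> Jx s (Suc 0) \<Longrightarrow> H * At i = sysA (ysys s R) i * H"
      and B: "\<And>i. i \<in> Jx s (Suc 0) \<Longrightarrow> H * Bt i = sysB (ysys s R) i"
      and C: "sysC (ysys s R) * H = sysC (ysys s R') * G"
      and Hp: "H * Hp = idm (box (fm_dim R) (Suc 0))" "idm (box r (Suc 0)) * Hp = Hp" "Hp * idm (box (fm_dim R) (Suc 0)) = Hp"
    have finr: "finite (box r (Suc 0))" by simp
    have r: "r = L"
      using card_le_of_factor[OF fin(1) finr Hp(1,2)] card_le_of_factor[OF finr fin(2) G(3,4)] dim by (simp add: L_def)
    note G = G[unfolded dim r, folded L_def, folded e_def] and H = H[unfolded r, folded L_def, folded e_def]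
      and Hp = Hp[unfolded r, folded L_def, folded e_def] and eAt = eAt[unfolded r, folded e_def]
    \<comment> \<open>\<open>Gp\<close> may have entries in columns outside the box; cutting them
      off gives a two-sided inverse of \<open>G\<close> in the corner \<open>e\<close>.\<close>
    define Gq where "Gq = Gp * e"
    have ee: "e * e = e" by (simp add: e_def idm_times_idm)
    have Gq: "e * Gq = Gq" "Gq * e = Gq" "Gq * G = e"
      using G by (simp_all add: Gq_def mult.assoc ee) (simp add: mult.assoc[symmetric])
    have finL: "finite (box L (Suc 0))" by simp
    have HpH: "Hp * H = e"
      unfolding e_def by (rule rcf_inverse_commute[OF stably_finite_field finL]) (use H Hp in \<open>simp_all add: e_def\<close>)
    have GGq: "G * Gq = e"
      unfolding e_def by (rule rcf_inverse_commute[OF stably_finite_field finL]) (use G Gq in \<open>simp_all add: e_def\<close>)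
    have c: "x * y = z \<Longrightarrow> x * (y * w) = z * w" for x y z w :: "(nat \<times> nat, 'k) rcf" by (simp add: mult.assoc[symmetric])
    have T: "e * (G * Hp) = G * Hp" "G * Hp * e = G * Hp" "e * (H * Gq) = H * Gq" "H * Gq * e = H * Gq"
      using c[OF G(4)] c[OF H(2)] Hp(3) Gq(2) by (simp_all add: mult.assoc)
    have T1: "G * Hp * (H * Gq) = e" "H * Gq * (G * Hp) = e"
      using c[OF HpH] c[OF Gq(3)] Gq Hp GGq by (simp_all add: mult.assoc)
    have supp': "sysC (ysys s R') * e = sysC (ysys s R')" "\<And>j. j \<in> Jx s (Suc 0) \<Longrightarrow> sysA (ysys s R') j * e = sysA (ysys s R') j"
      using r'.supp_ysys unfolding supp_def dim L_def[symmetric] e_def[symmetric] by auto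
    have "similarity s R R' (fm L L (G * Hp))"
    proof (rule similarity_fm[OF fm fm' _ _ e_def T T1])
      show "fm_dim R = L" "fm_dim R' = L" using dim by (simp_all add: L_def)
      show "sysC (ysys s R') = sysC (ysys s R) * (H * Gq)"
        using c[OF C, of Gq] GGq supp'(1) by (simp add: mult.assoc)
      fix j :: "'d idx" assume j: "j \<in> Jx s (Suc 0)"
      show "sysB (ysys s R') j = G * Hp * sysB (ysys s R) j"
        unfolding B[OF j, symmetric] B'[OF j] using c[OF HpH, of "Bt j"] c[OF G(1), of "Bt j"] by (simp add: mult.assoc)
      have "G * Hp * sysA (ysys s R) j * (H * Gq) = G * (Hp * (H * (At j * Gq)))"
        using c[OF A[OF j, symmetric], of Gq] by (simp add: mult.assoc)
      also have "\<dots> = G * (At j * Gq)" using c[OF HpH] c[OF eAt[OF j]] by simp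
      also have "\<dots> = sysA (ysys s R') j * (G * Gq)" using c[OF A'[OF j], of Gq] by (simp add: mult.assoc)
      also have "\<dots> = sysA (ysys s R') j" using GGq supp'(2)[OF j] by simp
      finally show "sysA (ysys s R') j = G * Hp * sysA (ysys s R) j * (H * Gq)" ..
    qed
    then show ?thesis ..
  qed
  then show ?thesis using similarity_unique[OF fm fm' dim con] dim D by blast
qed

end

lemma nc_rational_function_point:
  fixes F :: "('d::finite, 'k::field) nc_expr set"
  assumes F: "F \<in> nc_rational_functions" and s: "s \<ge> 1" and Y: "Y \<in> fun_dom (mat_alg (*) s) F"
  obtains R0 S where "nc_function_at F s Y R0 S"
proof -
  obtain R0 where R0: "nondegenerate R0" "F = nc_equiv `` {R0}"
    using F unfolding nc_rational_functions_def by (auto elim: quotientE)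
  obtain S where S: "S \<in> F" "Y \<in> nc_dom (mat_alg (*) s) S" using Y unfolding fun_dom_def by blast
  have "nc_function_at F s Y R0 S"
    by unfold_locales (use R0 S s in \<open>auto simp: nc_equiv_def\<close>)
  then show ?thesis by (rule that)
qed

theorem theorem2:
  fixes F :: "('d::finite, 'k::field) nc_expr set"
    and s :: nat
    and Y :: "'d \<Rightarrow> 'k mat"
  assumes F: "F \<in> nc_rational_functions"
    and s: "s \<ge> 1"
    and Y: "Y \<in> fun_dom (mat_alg (*) s) F"
  shows "(\<exists>R. minimal_realization s Y F R) \<and>
    (\<forall>R R'. minimal_realization s Y F R \<and> minimal_realization s Y F R' \<longrightarrow>
       fm_dim R' = fm_dim R \<and> matD R' = matD R \<and> (\<exists>!T. similarity s R R' T)) \<and>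
    (\<forall>R. minimal_realization s Y F R \<longrightarrow>
       (\<forall>n\<ge>1. \<forall>Z \<in> fun_dom (mat_alg (*) n) F.
          (\<lambda>k. kron (1\<^sub>m s) (Z k)) \<in> real_dom s Y R n \<and>
          kron (1\<^sub>m s) (fun_val (mat_alg (*) n) F Z) = real_val s Y R n (\<lambda>k. kron (1\<^sub>m s) (Z k))) \<and>
       (\<forall>sc :: 'k \<Rightarrow> 'a::{ring,monoid_mult} \<Rightarrow> 'a.
          unital_algebra sc \<and> stably_finite TYPE('a) \<longrightarrow>
          (\<forall>a \<in> fun_dom (type_alg sc) F.
             (\<lambda>k. tensor_elem sc (1\<^sub>m s) (a k)) \<in> real_dom_alg sc s Y R \<and>
             tensor_elem sc (1\<^sub>m s) (fun_val (type_alg sc) F a) =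
               real_val_alg sc s Y R (\<lambda>k. tensor_elem sc (1\<^sub>m s) (a k)))))"
proof -
  obtain R0 S where "nc_function_at F s Y R0 S" by (rule nc_rational_function_point[OF F s Y])
  then interpret nc_function_at F s Y R0 S .
  have "\<exists>R. minimal_realization s Y F R"
    using matching_realization_exists minimal_if_matches by blast
  moreover have "(\<lambda>k. kron (1\<^sub>m s) (Z k)) \<in> real_dom s Y R n \<and>
      kron (1\<^sub>m s) (fun_val (mat_alg (*) n) F Z) = real_val s Y R n (\<lambda>k. kron (1\<^sub>m s) (Z k))"
    if R: "minimal_realization s Y F R" and n: "n \<ge> 1" and Z: "Z \<in> fun_dom (mat_alg (*) n) F" for R n Z
  proof -
    obtain E where E: "E \<in> F" "Z \<in> nc_dom (mat_alg (*) n) E" using Z unfolding fun_dom_def by blast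
    have sn: "s * n \<ge> 1" using s n by simp
    note h = nc_hom_val[OF fld.nc_hom_kron[of n s] E(2)]
    \<comment> \<open>Part (ii) is part (i) at the point I_s \<otimes> Z, since evaluation of an
      expression commutes with inflation.\<close>
    have "(\<lambda>k. kron (1\<^sub>m s) (Z k)) \<in> fun_dom (mat_alg (*) (s * n)) F" using h E(1) unfolding fun_dom_def by blast
    moreover have "fun_val (mat_alg (*) (s * n)) F (\<lambda>k. kron (1\<^sub>m s) (Z k)) = kron (1\<^sub>m s) (fun_val (mat_alg (*) n) F Z)"
      unfolding fun_val_mat[OF n E] fun_val_mat[OF sn E(1) conjunct1[OF h]] by (rule conjunct2[OF h])
    ultimately show ?thesis using R n unfolding minimal_realization_def realizes_def by simp
  qed
  moreover have "(\<lambda>k. tensor_elem sc (1\<^sub>m s) (a k)) \<in> real_dom_alg sc s Y R \<and>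
      tensor_elem sc (1\<^sub>m s) (fun_val (type_alg sc) F a) = real_val_alg sc s Y R (\<lambda>k. tensor_elem sc (1\<^sub>m s) (a k))"
    if R: "minimal_realization s Y F R" and sc: "unital_algebra sc" "stably_finite TYPE('a)" and a: "a \<in> fun_dom (type_alg sc) F"
    for R and sc :: "'k \<Rightarrow> 'a \<Rightarrow> 'a" and a
  proof -
    interpret unital_algebra sc by fact
    obtain E where E: "E \<in> F" "a \<in> nc_dom (type_alg sc) E" using a unfolding fun_dom_def by blast
    have fm: "fm_realization s R" using R by (simp add: minimal_realization_def)
    have c: "tensor_elem sc (1\<^sub>m s) (a k) \<in> carrier_mat s s" for k by (simp add: tensor_elem_def)
    show ?thesis
      using value_type[OF sc matches_if_minimal[OF R] E]
      unfolding evJ_algebra[OF fm c Y_carrier] fun_val_type[OF sc E] .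
  qed
  ultimately show ?thesis using minimal_similar by blast
qed

end
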